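(* Let $\mathfrak c=\operatorname{Mas}(\Lambda(0,s),\mathcal D;s\in[1-\varepsilon,1])+\operatorname{Mas}(\Lambda(\lambda,1),\mathcal D;\lambda\in[0,\varepsilon])$ for $0<\varepsilon\ll1$. Then $\mathfrak c$ is calculated as follows. (1) Suppose $\dim\ker(N)=1$, and let $s=s(\lambda)$ be the eigenvalue curve through $(\lambda,s)=(0,1)$. (i) If $0\in\operatorname{Spec}(L_+)\setminus\operatorname{Spec}(L_-)$, then $\mathfrak c=\frac12(s^\sharp(0)-1)$; that is, $\mathfrak c=0$ if $s^\sharp(0)=+1$ and $\mathfrak c=-1$ if $s^\sharp(0)=-1$. (ii) If $0\in\operatorname{Spec}(L_-)\setminus\operatorname{Spec}(L_+)$, then $\mathfrak c=\frac12(1-s^\sharp(0))$; that is, $\mathfrak c=0$ if $s^\sharp(0)=+1$ and $\mathfrak c=+1$ if $s^\sharp(0)=-1$. (2) Suppose $\dim\ker(N)=2$, with $\ker(L_+)=\operatorname{Span}\{u_1\}$ and $\ker(L_-)=\operatorname{Span}\{v_2\}$. If $\langle u_1,v_2\rangle\ne0$, then $\mathfrak c=0$. If $\langle u_1,v_2\rangle=0$ and $$\frac{\langle\widehat v_1,u_1\rangle}{(u_1'(\ell))^2}+\frac{\langle\widehat u_2,v_2\rangle}{(v_2'(\ell))^2}\ne0,$$ where $\widehat u_2,\widehat v_1\in H^2(0,\ell)\cap H^1_0(0,\ell)$ solve $L_+\widehat u_2=v_2$ and $-L_-\widehat v_1=u_1$, then, denoting by $s_{1}(\lambda),s_2(\lambda)$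 the eigenvalue curves passing through $(0,1)$, $$\mathfrak c=\tfrac12\big(s_1^\sharp(0)-s_2^\sharp(0)\big).$$
   Context: Operators. $\ell>0$; $g,h$ are real-valued $C^2$ functions on $[0,\ell]$, taken to be defined and $C^2$ on $[0,\ell']$ for some $\ell'>\ell$ so that $s$ slightly larger than $1$ is allowed. $L_+^s=-\partial_{xx}-s^2g(sx)$, $L_-^s=-\partial_{xx}-s^2h(sx)$, operators in $L^2(0,\ell)$ with domain $H^2(0,\ell)\cap H^1_0(0,\ell)$; $N_s=\begin{pmatrix}0&-L_-^s\\ L_+^s&0\end{pmatrix}$ with domain $(H^2(0,\ell)\cap H^1_0(0,\ell))^2$; $L_\pm=L_\pm^1$, $N=N_1$. $\langle\cdot,\cdot\rangle$ is the $L^2(0,\ell)$ inner product; functions are real-valued. Eigenvalue curves. If $\dim\ker N=1$, there is a $C^2$ function $s(\lambda)$, $|\lambda|\ll1$, with $s(0)=1$, $\dot s(0)=0$, such that for real $(\lambda,s)$ near $(0,1)$ one has $s^2\lambda\in\operatorname{Spec}(N_s)$ iff $s=s(\lambda)$; this is the eigenvalue curve through $(0,1)$. If $\dim\ker N=2$, $\langle u_1,v_2\rangle=0$ and the displayed non-vanishing condition holds (it does not depend on the choice of $\widehat u_2,\widehat v_1$), there are $C^2$ functions $s_1(\lambda),s_2(\lambda)$ with $s_k(\lambda)^2\lambda\in\operatorname{Spec}(N_{s_k(\lambda)})$, $s_k(0)=1$, $\dot s_k(0)=0$, $\ddot s_1(0)=-\frac2\ell\langle\widehat v_1,u_1\rangle/(u_1'(\ell))^2$,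 $\ddot s_2(0)=\frac2\ell\langle\widehat u_2,v_2\rangle/(v_2'(\ell))^2$, whose graphs are the real eigenvalue set near $(0,1)$; moreover eigenfunctions along $s_1$ and $s_2$ can be chosen to converge to $(u_1,0)^\top$ and $(0,v_2)^\top$ respectively as $\lambda\to0$. Define $s^\sharp(0)=\lim_{\lambda\to0^+}\operatorname{sign}(s(\lambda)-1)\in\{\pm1\}$, which exists because $\operatorname{Spec}(N)$ is discrete, and define $s_1^\sharp(0),s_2^\sharp(0)$ analogously. Lagrangian path. For $\mathbf u=(u,v)^\top\in H^2(0,\ell)$ put $\operatorname{Tr}_s\mathbf u=(u(0),v(0),u(\ell),v(\ell),-\frac1su'(0),\frac1sv'(0),\frac1su'(\ell),-\frac1sv'(\ell))^\top\in\mathbb R^8$. Let $\mathcal K_{\lambda,s}$ be the space of all real-valued $\mathbf u\in H^2(0,\ell)$ with $N_s\mathbf u=s^2\lambda\mathbf u$ (no boundary conditions), $\Lambda(\lambda,s)=\operatorname{Tr}_s(\mathcal K_{\lambda,s})$ (a Lagrangian subspace of $\mathbb R^8$), and $\mathcal D=\{0\}\times\mathbb R^4$. Maslov index. On $\mathbb R^{2n}$ let $\omega(x,y)=Jx\cdot y$, $J=\begin{pmatrix}0_n&-I_n\\ I_n&0_n\end{pmatrix}$; $\mathcal L(n)$ is the set of $n$-dimensional subspaces on which $\omega$ vanishes. Fix $\Lambda_0\in\mathcal L(n)$. For a $C^1$ path $\Lambda:[a,b]\to\mathcal L(n)$, a crossing is $t_0$ with $\Lambda(t_0)\cap\Lambda_0\ne\{0\}$.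 Choosing a complement $W$ of $\Lambda(t_0)$, for $t$ near $t_0$, $\Lambda(t)=\{q+R_tq:q\in\Lambda(t_0)\}$ with $R_t:\Lambda(t_0)\to W$ linear, $C^1$ in $t$, $R_{t_0}=0$; the crossing form is $\mathfrak m_{t_0}(q)=\frac d{dt}\omega(q,R_tq)|_{t=t_0}$ on $\Lambda(t_0)\cap\Lambda_0$, and the crossing is regular if this is nondegenerate. With $n_\pm$ the numbers of positive/negative squares and $\operatorname{sign}=n_+-n_-$, for a path with only regular crossings $\operatorname{Mas}(\Lambda(t),\Lambda_0;[a,b])=-n_-(\mathfrak m_a)+\sum_{a<t_0<b}\operatorname{sign}(\mathfrak m_{t_0})+n_+(\mathfrak m_b)$ (endpoint terms are $0$ if not crossings). For an arbitrary continuous path the index is that of any path with only regular crossings homotopic to it with fixed endpoints (well defined). *)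

theory Defs
  imports "HOL-Analysis.Analysis" "HOL-Library.Function_Algebras"
begin

instantiation "fun" :: (type, real_vector) real_vector
begin

definition scaleR_fun :: "real \<Rightarrow> ('a \<Rightarrow> 'b) \<Rightarrow> 'a \<Rightarrow> 'b"
  where "scaleR_fun c f = (\<lambda>x. c *\<^sub>R f x)"

instance
  by standard (auto simp: scaleR_fun_def fun_eq_iff scaleR_add_right scaleR_add_left)

end

definition C2_on :: "(real \<Rightarrow> real) \<Rightarrow> real set \<Rightarrow> bool"
  where "C2_on f S \<longleftrightarrow> (\<exists>f' f''.
    (\<forall>x\<in>S. (f has_real_derivative f' x) (at x within S)) \<and>
    (\<forall>x\<in>S. (f' has_real_derivative f'' x) (at x within S)) \<and>
    continuous_on S f'')"

section \<open>Function spaces on the interval\<close>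

text \<open>
  Elements of \<open>L\<^sup>2(0,l)\<close> are represented by functions, and equality in \<open>L\<^sup>2(0,l)\<close> is
  \<open>eq_ae\<close>. The value type \<^typ>\<open>real\<close> gives \<open>L\<^sup>2(0,l)\<close> and
  \<^typ>\<open>real \<times> real\<close> gives \<open>L\<^sup>2(0,l)\<^sup>2\<close>; likewise for the Sobolev spaces.
\<close>

definition L2 :: "real \<Rightarrow> (real \<Rightarrow> 'b::euclidean_space) set"
  where "L2 l = {f. f \<in> borel_measurable (lebesgue_on {0<..<l}) \<and>
    integrable (lebesgue_on {0<..<l}) (\<lambda>x. (norm (f x))\<^sup>2)}"

definition l2_inner :: "real \<Rightarrow> (real \<Rightarrow> 'b::euclidean_space) \<Rightarrow> (real \<Rightarrow> 'b) \<Rightarrow> real"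
  where "l2_inner l f k = (LINT x|lebesgue_on {0<..<l}. f x \<bullet> k x)"

definition l2_norm :: "real \<Rightarrow> (real \<Rightarrow> 'b::euclidean_space) \<Rightarrow> real"
  where "l2_norm l f = sqrt (l2_inner l f f)"

definition eq_ae :: "real \<Rightarrow> (real \<Rightarrow> 'b::euclidean_space) \<Rightarrow> (real \<Rightarrow> 'b) \<Rightarrow> bool"
  where "eq_ae l f k \<longleftrightarrow> (AE x in lebesgue_on {0<..<l}. f x = k x)"

definition D1 :: "real \<Rightarrow> (real \<Rightarrow> 'b::euclidean_space) \<Rightarrow> real \<Rightarrow> 'b"
  where "D1 l u x = vector_derivative u (at x within {0..l})"

definition has_D2 :: "real \<Rightarrow> (real \<Rightarrow> 'b::euclidean_space) \<Rightarrow> (real \<Rightarrow> 'b) \<Rightarrow> bool"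
  where "has_D2 l u w \<longleftrightarrow> u differentiable_on {0..l} \<and> w \<in> L2 l \<and>
    (\<forall>x\<in>{0..l}. D1 l u x = D1 l u 0 + (LINT y|lebesgue_on {0<..<x}. w y))"

text \<open>
  An element of \<open>H\<^sup>2(0,l)\<close> is its representative that is continuously differentiable on
  \<open>[0,l]\<close> with absolutely continuous derivative and second derivative in \<open>L\<^sup>2\<close>, so that the
  boundary values of \<open>u\<close> and \<open>u'\<close> make sense. Extending it by zero outside \<open>[0,l]\<close> makes
  the representing function unique, so that \<^const>\<open>dim\<close> and \<^const>\<open>span\<close> of sets of such
  functions have their usual meaning.
\<close>

definition H2 :: "real \<Rightarrow> (real \<Rightarrow> 'b::euclidean_space) set"
  where "H2 l = {u. (\<forall>x. x \<notin> {0..l} \<longrightarrow> u x = 0) \<and> (\<exists>w. has_D2 l u w)}"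

definition H2_H10 :: "real \<Rightarrow> (real \<Rightarrow> 'b::euclidean_space) set"
  where "H2_H10 l = {u \<in> H2 l. u 0 = 0 \<and> u l = 0}"

text \<open>The second derivative is determined only almost everywhere.\<close>

definition D2 :: "real \<Rightarrow> (real \<Rightarrow> 'b::euclidean_space) \<Rightarrow> real \<Rightarrow> 'b"
  where "D2 l u = (SOME w. has_D2 l u w)"

section \<open>The operators and their spectra\<close>

text \<open>
  \<open>L_op l g s\<close> is the operator \<open>L\<^sub>+\<^sup>s\<close> and \<open>L_op l h s\<close> is \<open>L\<^sub>-\<^sup>s\<close>. The expressions act
  on all of \<open>H\<^sup>2\<close>; the domain \<open>H2_H10 l\<close> enters in \<open>ker_op\<close> and \<open>Spec\<close>.
\<close>

definition L_op :: "real \<Rightarrow> (real \<Rightarrow> real) \<Rightarrow> real \<Rightarrow> (real \<Rightarrow> real) \<Rightarrow> real \<Rightarrow> real"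
  where "L_op l q s u = (\<lambda>x. - D2 l u x - s\<^sup>2 * q (s * x) * u x)"

definition N_op :: "real \<Rightarrow> (real \<Rightarrow> real) \<Rightarrow> (real \<Rightarrow> real) \<Rightarrow> real
    \<Rightarrow> (real \<Rightarrow> real \<times> real) \<Rightarrow> real \<Rightarrow> real \<times> real"
  where "N_op l g h s U =
    (\<lambda>x. (- L_op l h s (\<lambda>y. snd (U y)) x, L_op l g s (\<lambda>y. fst (U y)) x))"

definition ker_op :: "real \<Rightarrow> ((real \<Rightarrow> 'b::euclidean_space) \<Rightarrow> real \<Rightarrow> 'b) \<Rightarrow> (real \<Rightarrow> 'b) set"
  where "ker_op l A = {u \<in> H2_H10 l. eq_ae l (A u) (\<lambda>x. 0)}"

text \<open>
  The real part of the spectrum: \<open>\<mu>\<close> is in the resolvent set iff \<open>A - \<mu>\<close> maps its domain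
  bijectively onto \<open>L\<^sup>2\<close> with bounded inverse. As \<open>A\<close> has real coefficients, for real \<open>\<mu>\<close>
  this does not depend on whether real- or complex-valued functions are used.
\<close>

definition Spec :: "real \<Rightarrow> ((real \<Rightarrow> 'b::euclidean_space) \<Rightarrow> real \<Rightarrow> 'b) \<Rightarrow> real set"
  where "Spec l A = {\<mu>. \<not> (
    (\<forall>f\<in>L2 l. \<exists>!u. u \<in> H2_H10 l \<and> eq_ae l (\<lambda>x. A u x - \<mu> *\<^sub>R u x) f) \<and>
    (\<exists>C. \<forall>u\<in>H2_H10 l. l2_norm l u \<le> C * l2_norm l (\<lambda>x. A u x - \<mu> *\<^sub>R u x)))}"

section \<open>Eigenvalue curves\<close>

definition curve_germ :: "(real \<Rightarrow> real) \<Rightarrow> bool"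
  where "curve_germ s \<longleftrightarrow> (\<exists>\<delta>>0. C2_on s {-\<delta><..<\<delta>}) \<and> s 0 = 1 \<and> deriv s 0 = 0"

definition eigenvalue_curve ::
    "real \<Rightarrow> (real \<Rightarrow> real) \<Rightarrow> (real \<Rightarrow> real) \<Rightarrow> (real \<Rightarrow> real) \<Rightarrow> bool"
  where "eigenvalue_curve l g h s \<longleftrightarrow> curve_germ s \<and>
    (\<forall>\<^sub>F (\<mu>, \<sigma>) in nhds (0, 1). \<sigma>\<^sup>2 * \<mu> \<in> Spec l (N_op l g h \<sigma>) \<longleftrightarrow> \<sigma> = s \<mu>)"

text \<open>
  The pair of curves when the kernels of \<open>L\<^sub>+\<close> and \<open>L\<^sub>-\<close> are spanned by orthogonal functions
  \<open>u1\<close> and \<open>v2\<close>; \<open>hv1\<close> and \<open>hu2\<close> solve \<open>- L\<^sub>- hv1 = u1\<close> and \<open>L\<^sub>+ hu2 = v2\<close>. The second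
  derivatives at 0 (which are distinct in the nondegenerate case) fix which curve is the first.
\<close>

definition eigenvalue_curve_pair ::
    "real \<Rightarrow> (real \<Rightarrow> real) \<Rightarrow> (real \<Rightarrow> real) \<Rightarrow> (real \<Rightarrow> real) \<Rightarrow> (real \<Rightarrow> real)
      \<Rightarrow> (real \<Rightarrow> real) \<Rightarrow> (real \<Rightarrow> real) \<Rightarrow> (real \<Rightarrow> real) \<Rightarrow> (real \<Rightarrow> real) \<Rightarrow> bool"
  where "eigenvalue_curve_pair l g h u1 v2 hu2 hv1 s1 s2 \<longleftrightarrow>
    curve_germ s1 \<and> curve_germ s2 \<and>
    deriv (deriv s1) 0 = - (2 / l) * (l2_inner l hv1 u1 / (D1 l u1 l)\<^sup>2) \<and>
    deriv (deriv s2) 0 = (2 / l) * (l2_inner l hu2 v2 / (D1 l v2 l)\<^sup>2) \<and>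
    (\<forall>\<^sub>F (\<mu>, \<sigma>) in nhds (0, 1).
      \<sigma>\<^sup>2 * \<mu> \<in> Spec l (N_op l g h \<sigma>) \<longleftrightarrow> \<sigma> = s1 \<mu> \<or> \<sigma> = s2 \<mu>)"

definition s_sharp :: "(real \<Rightarrow> real) \<Rightarrow> real"
  where "s_sharp s = Lim (at_right 0) (\<lambda>\<mu>. sgn (s \<mu> - 1))"

section \<open>The Maslov index\<close>

text \<open>
  \<open>\<real>\<^sup>2\<^sup>n\<close> is written as \<^typ>\<open>(real^'n) \<times> (real^'n)\<close>; \<open>\<omega>(x,y) = J x \<bullet> y\<close> with
  \<open>J (p,q) = (-q, p)\<close>.
\<close>

definition symp :: "(real^'n) \<times> (real^'n) \<Rightarrow> (real^'n) \<times> (real^'n) \<Rightarrow> real"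
  where "symp x y = (- snd x, fst x) \<bullet> y"

definition Lagrangians :: "((real^'n) \<times> (real^'n)) set set"
  where "Lagrangians = {V. subspace V \<and> dim V = CARD('n) \<and> (\<forall>x\<in>V. \<forall>y\<in>V. symp x y = 0)}"

text \<open>
  A subspace is identified with the orthogonal projection onto it; this gives the Lagrangian
  Grassmannian its topology (the gap topology) and its differentiable structure.
\<close>

definition ortho_proj :: "'v::euclidean_space set \<Rightarrow> 'v \<Rightarrow>\<^sub>L 'v"
  where "ortho_proj V = Blinfun (closest_point V)"

definition Lagrangian_topology :: "((real^'n) \<times> (real^'n)) set topology"
  where "Lagrangian_topology = pullback_topology Lagrangians ortho_proj euclidean"

definition C1_path :: "(real \<Rightarrow> ((real^'n) \<times> (real^'n)) set) \<Rightarrow> real \<Rightarrow> real \<Rightarrow> bool"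
  where "C1_path \<Gamma> a b \<longleftrightarrow> (\<forall>t\<in>{a..b}. \<Gamma> t \<in> Lagrangians) \<and>
    (\<exists>P'. (\<forall>t\<in>{a..b}. ((\<lambda>t. ortho_proj (\<Gamma> t)) has_vector_derivative P' t) (at t within {a..b})) \<and>
      continuous_on {a..b} P')"

text \<open>
  \<open>graph_map V W U q\<close> is \<open>R q\<close> for the linear map \<open>R\<close> from \<open>V\<close> to the complement \<open>W\<close> whose
  graph is \<open>U = {q + R q | q \<in> V}\<close>. The crossing form does not depend on the complement; the
  orthogonal one is taken.
\<close>

definition graph_map :: "'v::euclidean_space set \<Rightarrow> 'v set \<Rightarrow> 'v set \<Rightarrow> 'v \<Rightarrow> 'v"
  where "graph_map V W U q = (THE w. w \<in> W \<and> q + w \<in> U)"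

definition crossing_form ::
    "(real \<Rightarrow> ((real^'n) \<times> (real^'n)) set) \<Rightarrow> real \<Rightarrow> real \<Rightarrow> real \<Rightarrow> (real^'n) \<times> (real^'n) \<Rightarrow> real"
  where "crossing_form \<Gamma> a b t0 q = vector_derivative
    (\<lambda>t. symp q (graph_map (\<Gamma> t0) (orthogonal_comp (\<Gamma> t0)) (\<Gamma> t) q)) (at t0 within {a..b})"

definition n_plus :: "'v::euclidean_space set \<Rightarrow> ('v \<Rightarrow> real) \<Rightarrow> nat"
  where "n_plus V m = Max {dim U |U. subspace U \<and> U \<subseteq> V \<and> (\<forall>q\<in>U. q \<noteq> 0 \<longrightarrow> m q > 0)}"

definition n_minus :: "'v::euclidean_space set \<Rightarrow> ('v \<Rightarrow> real) \<Rightarrow> nat"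
  where "n_minus V m = n_plus V (\<lambda>q. - m q)"

text \<open>Nondegeneracy of a quadratic form is stated for its polar bilinear form.\<close>

definition nondegenerate_form :: "'v::euclidean_space set \<Rightarrow> ('v \<Rightarrow> real) \<Rightarrow> bool"
  where "nondegenerate_form V m \<longleftrightarrow>
    (\<forall>p\<in>V. (\<forall>q\<in>V. (m (p + q) - m p - m q) / 2 = 0) \<longrightarrow> p = 0)"

definition crossing :: "(real \<Rightarrow> ((real^'n) \<times> (real^'n)) set) \<Rightarrow> ((real^'n) \<times> (real^'n)) set \<Rightarrow> real \<Rightarrow> bool"
  where "crossing \<Gamma> V0 t \<longleftrightarrow> \<Gamma> t \<inter> V0 \<noteq> {0}"

definition regular_path ::
    "(real \<Rightarrow> ((real^'n) \<times> (real^'n)) set) \<Rightarrow> ((real^'n) \<times> (real^'n)) set \<Rightarrow> real \<Rightarrow> real \<Rightarrow> bool"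
  where "regular_path \<Gamma> V0 a b \<longleftrightarrow> C1_path \<Gamma> a b \<and>
    (\<forall>t\<in>{a..b}. crossing \<Gamma> V0 t \<longrightarrow> nondegenerate_form (\<Gamma> t \<inter> V0) (crossing_form \<Gamma> a b t))"

text \<open>
  Regular crossings are isolated, so the sum is over a finite set. At an endpoint that is not a
  crossing the form lives on \<open>{0}\<close> and contributes 0.
\<close>

definition Mas_regular ::
    "(real \<Rightarrow> ((real^'n) \<times> (real^'n)) set) \<Rightarrow> ((real^'n) \<times> (real^'n)) set \<Rightarrow> real \<Rightarrow> real \<Rightarrow> int"
  where "Mas_regular \<Gamma> V0 a b =
    - int (n_minus (\<Gamma> a \<inter> V0) (crossing_form \<Gamma> a b a))
    + (\<Sum>t\<in>{t\<in>{a<..<b}. crossing \<Gamma> V0 t}.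
        int (n_plus (\<Gamma> t \<inter> V0) (crossing_form \<Gamma> a b t))
        - int (n_minus (\<Gamma> t \<inter> V0) (crossing_form \<Gamma> a b t)))
    + int (n_plus (\<Gamma> b \<inter> V0) (crossing_form \<Gamma> a b b))"

definition Mas ::
    "(real \<Rightarrow> ((real^'n) \<times> (real^'n)) set) \<Rightarrow> ((real^'n) \<times> (real^'n)) set \<Rightarrow> real \<Rightarrow> real \<Rightarrow> int"
  where "Mas \<Lambda> V0 a b = (THE k. \<exists>\<Gamma>. regular_path \<Gamma> V0 a b \<and>
    homotopic_with (\<lambda>\<gamma>. \<gamma> a = \<Lambda> a \<and> \<gamma> b = \<Lambda> b) (top_of_set {a..b}) Lagrangian_topology \<Gamma> \<Lambda> \<and>
    k = Mas_regular \<Gamma> V0 a b)"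

section \<open>The Lagrangian path\<close>

definition Tr :: "real \<Rightarrow> real \<Rightarrow> (real \<Rightarrow> real \<times> real) \<Rightarrow> (real^4) \<times> (real^4)"
  where "Tr l s U = (let u = (\<lambda>x. fst (U x)); v = (\<lambda>x. snd (U x)) in
    (vector [u 0, v 0, u l, v l],
     vector [- (1 / s) * D1 l u 0, (1 / s) * D1 l v 0, (1 / s) * D1 l u l, - (1 / s) * D1 l v l]))"

definition solution_space ::
    "real \<Rightarrow> (real \<Rightarrow> real) \<Rightarrow> (real \<Rightarrow> real) \<Rightarrow> real \<Rightarrow> real \<Rightarrow> (real \<Rightarrow> real \<times> real) set"
  where "solution_space l g h \<mu> s =
    {U \<in> H2 l. eq_ae l (N_op l g h s U) (\<lambda>x. (s\<^sup>2 * \<mu>) *\<^sub>R U x)}"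

definition Lambda ::
    "real \<Rightarrow> (real \<Rightarrow> real) \<Rightarrow> (real \<Rightarrow> real) \<Rightarrow> real \<Rightarrow> real \<Rightarrow> ((real^4) \<times> (real^4)) set"
  where "Lambda l g h \<mu> s = Tr l s ` solution_space l g h \<mu> s"

definition Dirichlet :: "((real^4) \<times> (real^4)) set"
  where "Dirichlet = {0} \<times> UNIV"

definition corner_index :: "real \<Rightarrow> (real \<Rightarrow> real) \<Rightarrow> (real \<Rightarrow> real) \<Rightarrow> real \<Rightarrow> int"
  where "corner_index l g h \<epsilon> =
    Mas (\<lambda>s. Lambda l g h 0 s) Dirichlet (1 - \<epsilon>) 1 + Mas (\<lambda>\<mu>. Lambda l g h \<mu> 1) Dirichlet 0 \<epsilon>"

end

theory Submission
  imports Defs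
begin

text \<open>
  Near the corner \<open>(0, 1)\<close> of the \<open>(\<lambda>, s)\<close>-plane all subspaces \<open>\<Lambda>(\<lambda>, s)\<close> lie in one affine chart of
  the Lagrangian Grassmannian. Choose a slope \<open>\<beta>\<close> such that \<open>\<Lambda>(0, 1)\<close> meets \<open>{(x, \<beta> x)}\<close> only in \<open>0\<close>; then
  the nearby \<open>\<Lambda>\<close> are graphs \<open>{(A y, y + \<beta> A y)}\<close> of symmetric matrices \<open>A\<close>, and \<open>\<Lambda>\<close> crosses the Dirichlet
  subspace exactly when \<open>A\<close> is singular. The quadratic form \<open>slope_form\<close> restricts to \<open>- A y \<bullet> y\<close> on
  such a graph, so its negative index counts the positive eigenvalues of \<open>A\<close>. Inside the chart the
  Maslov index of any continuous path is the drop of this number, \<open>neg_index \<beta>\<close> at the start minus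
  \<open>neg_index \<beta>\<close> at the end (\<open>Maslov_index_in_chart\<close>). Hence \<open>\<cc> = N(0, 1 - \<epsilon>) - N(\<epsilon>, 1)\<close> for the integer
  function \<open>N(\<lambda>, s) = neg_index \<beta> \<Lambda>(\<lambda>, s)\<close>, and the value at the corner itself drops out.

  That the Maslov index is well defined is part of this. Between two slopes \<open>neg_index\<close> changes by the
  negative index of a form that is nondegenerate wherever both slopes are admissible
  (\<open>neg_index_diff\<close>), so the difference is locally constant. This makes it possible to continue
  \<open>- neg_index \<beta>\<close> to an integer function (\<open>index_lift\<close>) over a homotopy, across different charts; such a
  lift is unique up to a constant. Along a path with regular crossings its total increment is the sum
  of signatures in the definition of the index (\<open>regular_path_index_lift\<close>).

  To find \<open>N\<close> near the corner, let \<open>(\<lambda>, s)\<close> run to \<open>(0, 1)\<close> along a curve and rescale: if the Dirichlet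
  values of the solutions that form the kernel at the corner become proportional to a scale \<open>\<tau>\<close>, the change of \<open>N\<close> is the
  negative index of the limiting form on the kernel (\<open>negative_index_near_crossing\<close>). These limits
  come from the expansion of the solutions in powers of \<open>\<lambda>\<close>. With a one-dimensional kernel, straight
  lines \<open>s = 1 \<plusminus> \<lambda>\<close> suffice. With a two-dimensional kernel the first-order coupling of the two kernel
  functions is \<open>\<langle>u\<^sub>1, v\<^sub>2\<rangle>\<close>. If it does not vanish it contributes one positive and one negative square
  on the line \<open>s = 1\<close> itself. If it vanishes, the parabolas \<open>s = 1 + \<rho> \<lambda>\<^sup>2\<close> are the right curves: the
  limiting form is diagonal and changes sign at the two values of \<open>\<rho>\<close> that are half the second
  derivatives of the eigenvalue curves.

  Finally, \<open>N\<close> changes along a vertical segment \<open>\<lambda> = t\<close> only at crossings, crossings are eigenvalues,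
  and for small \<open>t > 0\<close> the only eigenvalues near \<open>s = 1\<close> lie on the given curves. So \<open>N(t, 1)\<close> equals
  the value of \<open>N\<close> in the region between the curves in which the point \<open>(t, 1)\<close> lies, and this region is
  determined by the signs of \<open>s(t) - 1\<close>. The point \<open>(t, 1)\<close> itself is no crossing for small \<open>t > 0\<close>,
  since the Dirichlet determinant is a power series in \<open>\<lambda>\<close> without zeros for large real \<open>\<lambda>\<close>.
\<close>

section \<open>Inertia of quadratic forms\<close>

lemma form_dims_finite:
  fixes V :: "'v::euclidean_space set"
  shows "finite {dim U |U. subspace U \<and> U \<subseteq> V \<and> (\<forall>q\<in>U. q \<noteq> 0 \<longrightarrow> m q > 0)}"
  by (rule finite_subset[of _ "{..DIM('v)}"]) (auto intro: dim_subset_UNIV)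

lemma dim_le_n_plus:
  assumes "subspace U" "U \<subseteq> V" "\<And>q. q \<in> U \<Longrightarrow> q \<noteq> 0 \<Longrightarrow> m q > 0"
  shows "dim U \<le> n_plus V m"
  unfolding n_plus_def using assms by (intro Max_ge form_dims_finite) blast

lemma n_plus_attained:
  assumes "0 \<in> V"
  obtains U where "subspace U" "U \<subseteq> V" "\<And>q. q \<in> U \<Longrightarrow> q \<noteq> 0 \<Longrightarrow> m q > 0"
    "dim U = n_plus V m"
proof -
  have "n_plus V m \<in> {dim U |U. subspace U \<and> U \<subseteq> V \<and> (\<forall>q\<in>U. q \<noteq> 0 \<longrightarrow> m q > 0)}"
    unfolding n_plus_def
    by (intro Max_in form_dims_finite)
       (use assms in \<open>auto intro!: exI[of _ "{0}"] simp: subspace_0\<close>)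
  then show thesis using that by auto
qed

lemma dim_add_le:
  fixes V :: "'v::euclidean_space set"
  assumes "subspace U" "subspace W" "subspace V" "U \<subseteq> V" "W \<subseteq> V" "U \<inter> W \<subseteq> {0}"
  shows "dim U + dim W \<le> dim V"
proof -
  have "dim {x + y |x y. x \<in> U \<and> y \<in> W} + dim (U \<inter> W) = dim U + dim W"
    by (rule dim_sums_Int) (use assms in auto)
  moreover have "dim (U \<inter> W) = 0" using assms(6) by auto
  moreover have "dim {x + y |x y. x \<in> U \<and> y \<in> W} \<le> dim V"
    by (rule dim_subset) (use assms in \<open>auto intro: subspace_add\<close>)
  ultimately show ?thesis by linarith
qed

text \<open>
  A subspace on which the form is positive meets one on which it is nonpositive only in \<open>0\<close>.
\<close>

lemma n_plus_le_codim:
  fixes V :: "'v::euclidean_space set"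
  assumes "subspace V" "subspace W" "W \<subseteq> V" "\<And>q. q \<in> W \<Longrightarrow> m q \<le> 0"
  shows "n_plus V m + dim W \<le> dim V"
proof -
  obtain U where U: "subspace U" "U \<subseteq> V" "\<And>q. q \<in> U \<Longrightarrow> q \<noteq> 0 \<Longrightarrow> m q > 0"
    "dim U = n_plus V m"
    using n_plus_attained[OF subspace_0[OF assms(1)]] by blast
  have "U \<inter> W \<subseteq> {0}" using U(3) assms(4) by fastforce
  then show ?thesis using dim_add_le[of U W V] U assms by auto
qed

lemma n_plus_add_n_minus_le:
  fixes V :: "'v::euclidean_space set"
  assumes "subspace V" "m 0 = 0"
  shows "n_plus V m + n_minus V m \<le> dim V"
proof -
  obtain U where U: "subspace U" "U \<subseteq> V" "\<And>q. q \<in> U \<Longrightarrow> q \<noteq> 0 \<Longrightarrow> - m q > 0"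
    "dim U = n_minus V m"
    unfolding n_minus_def using n_plus_attained[OF subspace_0[OF assms(1)], of "\<lambda>q. - m q"] by blast
  have "m q \<le> 0" if "q \<in> U" for q using U(3)[OF that] assms(2) by (cases "q = 0") auto
  then show ?thesis using n_plus_le_codim[of V U m] U assms by auto
qed

lemma bilinear_double_sum:
  fixes b :: "'v::real_vector \<Rightarrow> 'v \<Rightarrow> real"
  assumes "bilinear b"
  shows "b (\<Sum>i\<in>I. x i *\<^sub>R f i) (\<Sum>j\<in>J. y j *\<^sub>R e j) = (\<Sum>i\<in>I. \<Sum>j\<in>J. x i * y j * b (f i) (e j))"
proof -
  have l: "linear (\<lambda>x. b x y)" and r: "linear (b y)" for y
    using assms by (auto simp: bilinear_def)
  show ?thesis
    by (simp add: linear_sum[OF l] linear_sum[OF r] linear_cmul[OF l] linear_cmul[OF r]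
        bilinear_lmul[OF assms] bilinear_rmul[OF assms] mult_ac sum_distrib_left)
      (rule sum.swap)
qed

lemma bilinear_minus: "bilinear b \<Longrightarrow> bilinear (\<lambda>x y. - b x y :: real)"
  by (auto simp: bilinear_def intro!: linear_compose_neg)

lemma card_le_n_plus:
  fixes b :: "'v::euclidean_space \<Rightarrow> 'v \<Rightarrow> real" and f :: "'i \<Rightarrow> 'v"
  assumes "finite I" "bilinear b" "subspace V" "\<And>i. i \<in> I \<Longrightarrow> f i \<in> V"
    and pos: "\<And>x. \<exists>i\<in>I. x i \<noteq> 0 \<Longrightarrow> b (\<Sum>i\<in>I. x i *\<^sub>R f i) (\<Sum>i\<in>I. x i *\<^sub>R f i) > 0"
  shows "card I \<le> n_plus V (\<lambda>q. b q q)"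
proof -
  have b0: "b 0 0 = 0" using bilinear_lzero[OF assms(2)] .
  have inj: "inj_on f I"
  proof (rule inj_onI, rule ccontr)
    fix i j assume ij: "i \<in> I" "j \<in> I" "f i = f j" "i \<noteq> j"
    define x where "x = (\<lambda>k. if k = i then 1 else if k = j then -1 else (0::real))"
    have "(\<Sum>k\<in>I. x k *\<^sub>R f k) = (\<Sum>k\<in>{i,j}. x k *\<^sub>R f k)"
      by (rule sum.mono_neutral_right) (use ij assms(1) in \<open>auto simp: x_def\<close>)
    also have "\<dots> = 0" using ij by (simp add: x_def)
    finally have "(\<Sum>k\<in>I. x k *\<^sub>R f k) = 0" .
    moreover have "\<exists>k\<in>I. x k \<noteq> 0" using ij by (auto simp: x_def intro!: bexI[of _ i])
    ultimately show False using pos[of x] b0 by simp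
  qed
  have rep: "\<exists>x. q = (\<Sum>i\<in>I. x i *\<^sub>R f i)" if "q \<in> span (f ` I)" for q
  proof -
    obtain u where "q = (\<Sum>a\<in>f ` I. u a *\<^sub>R a)"
      using \<open>q \<in> span (f ` I)\<close> unfolding span_finite[OF finite_imageI[OF assms(1)]] by blast
    then have "q = (\<Sum>i\<in>I. u (f i) *\<^sub>R f i)" by (simp add: sum.reindex[OF inj])
    then show ?thesis by (intro exI[of _ "\<lambda>i. u (f i)"])
  qed
  have ind: "independent (f ` I)"
  proof (rule independent_if_scalars_zero)
    fix u v assume u: "(\<Sum>x\<in>f ` I. u x *\<^sub>R x) = 0" and v: "v \<in> f ` I"
    then have "(\<Sum>i\<in>I. u (f i) *\<^sub>R f i) = 0" by (simp add: sum.reindex[OF inj])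
    then show "u v = 0" using pos[of "u \<circ> f"] b0 v by fastforce
  qed (use assms in auto)
  have "dim (span (f ` I)) = card I"
    using dim_span dim_eq_card_independent[OF ind] card_image[OF inj] by metis
  moreover have "dim (span (f ` I)) \<le> n_plus V (\<lambda>q. b q q)"
  proof (rule dim_le_n_plus)
    show "span (f ` I) \<subseteq> V" using assms by (intro span_minimal) auto
    fix q assume q: "q \<in> span (f ` I)" "q \<noteq> 0"
    then obtain x where x: "q = (\<Sum>i\<in>I. x i *\<^sub>R f i)" using rep by blast
    then have "\<exists>i\<in>I. x i \<noteq> 0" using q by (metis (no_types, lifting) scaleR_zero_left sum.neutral)
    then show "0 < b q q" using pos x by simp
  qed auto
  ultimately show ?thesis by simp
qed

lemma n_plus_orthogonal_basis:
  fixes b :: "'v::euclidean_space \<Rightarrow> 'v \<Rightarrow> real"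
  assumes "bilinear b" "independent B" "span B = V"
    and "\<And>x y. x \<in> B \<Longrightarrow> y \<in> B \<Longrightarrow> x \<noteq> y \<Longrightarrow> b x y = 0"
  shows "n_plus V (\<lambda>q. b q q) = card {e\<in>B. b e e > 0}"
proof -
  have fin: "finite B" using assms(2) by (rule independent_imp_finite)
  have sV: "subspace V" using assms(3) by auto
  have diag: "b (\<Sum>e\<in>S. x e *\<^sub>R e) (\<Sum>e\<in>S. x e *\<^sub>R e) = (\<Sum>e\<in>S. (x e)\<^sup>2 * b e e)"
    if "S \<subseteq> B" for S x
  proof -
    have fS: "finite S" using fin that finite_subset by auto
    have "(\<Sum>j\<in>S. x i * x j * b i j) = (x i)\<^sup>2 * b i i" if "i \<in> S" for i
    proof -
      have "(\<Sum>j\<in>S. x i * x j * b i j) = (\<Sum>j\<in>{i}. x i * x j * b i j)"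
        by (rule sum.mono_neutral_right) (use fS that \<open>S \<subseteq> B\<close> assms(4) in \<open>auto simp: subset_iff\<close>)
      then show ?thesis by (simp add: power2_eq_square)
    qed
    then show ?thesis
      using bilinear_double_sum[OF assms(1), of x "\<lambda>e. e" S x "\<lambda>e. e" S] by simp
  qed
  let ?P = "{e\<in>B. b e e > 0}" and ?N = "{e\<in>B. \<not> b e e > 0}"
  have "card ?P \<le> n_plus V (\<lambda>q. b q q)"
  proof (rule card_le_n_plus[where f = "\<lambda>e. e" and b = b])
    fix x assume "\<exists>i\<in>?P. x i \<noteq> (0::real)"
    then obtain i where i: "i \<in> ?P" "x i \<noteq> 0" by blast
    have "(\<Sum>e\<in>?P. (x e)\<^sup>2 * b e e) > 0"
      by (rule sum_pos2[of _ i]) (use i fin in auto)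
    then show "0 < b (\<Sum>i\<in>?P. x i *\<^sub>R i) (\<Sum>i\<in>?P. x i *\<^sub>R i)" using diag[of ?P] by auto
  qed (use assms fin sV span_superset in auto)
  moreover have "n_plus V (\<lambda>q. b q q) + dim (span ?N) \<le> dim V"
  proof (rule n_plus_le_codim)
    show "span ?N \<subseteq> V" using assms(3) by (metis (no_types, lifting) mem_Collect_eq span_mono subsetI)
    fix q assume "q \<in> span ?N"
    then obtain u where "q = (\<Sum>a\<in>?N. u a *\<^sub>R a)"
      using fin span_finite[of ?N] by fastforce
    then have "b q q = (\<Sum>e\<in>?N. (u e)\<^sup>2 * b e e)" using diag[of ?N u] by simp
    then show "b q q \<le> 0" by (auto intro!: sum_nonpos simp: mult_nonneg_nonpos)
  qed (use sV in auto)
  moreover have "dim (span ?N) = card ?N"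
    using dim_span dim_eq_card_independent independent_mono[OF assms(2)] by (metis (no_types, lifting) mem_Collect_eq subsetI)
  moreover have "dim V = card B" using assms(2,3) by (metis dim_span dim_eq_card_independent)
  moreover have "card B = card ?P + card ?N"
  proof -
    have "card (?P \<union> ?N) = card ?P + card ?N" by (rule card_Un_disjoint) (use fin in auto)
    moreover have "?P \<union> ?N = B" by blast
    ultimately show ?thesis by simp
  qed
  ultimately show ?thesis by linarith
qed

lemma n_minus_orthogonal_basis:
  fixes b :: "'v::euclidean_space \<Rightarrow> 'v \<Rightarrow> real"
  assumes "bilinear b" "independent B" "span B = V"
    and "\<And>x y. x \<in> B \<Longrightarrow> y \<in> B \<Longrightarrow> x \<noteq> y \<Longrightarrow> b x y = 0"
  shows "n_minus V (\<lambda>q. b q q) = card {e\<in>B. b e e < 0}"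
  unfolding n_minus_def
  using n_plus_orthogonal_basis[OF bilinear_minus[OF assms(1)] assms(2,3)] assms(4) by simp

text \<open>
  The spectral theorem for a symmetric form on a subspace: a maximiser of the form on the unit sphere
  is orthogonal, for the form too, to its orthogonal complement, and the dimension goes down by one.
\<close>

lemma form_diagonalization:
  fixes b :: "'v::euclidean_space \<Rightarrow> 'v \<Rightarrow> real"
  assumes b: "bilinear b" and sym: "\<And>x y. x \<in> V \<Longrightarrow> y \<in> V \<Longrightarrow> b x y = b y x" and V: "subspace V"
  obtains B where "B \<subseteq> V" "independent B" "span B = V" "pairwise orthogonal B"
    "\<forall>x\<in>B. norm x = 1" "\<forall>x\<in>B. \<forall>y\<in>B. x \<noteq> y \<longrightarrow> b x y = 0"
proof -
  have "\<exists>B. B \<subseteq> V \<and> span B = V \<and> pairwise orthogonal B \<and> (\<forall>x\<in>B. norm x = 1) \<and>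
      (\<forall>x\<in>B. \<forall>y\<in>B. x \<noteq> y \<longrightarrow> b x y = 0)"
    using sym V
  proof (induction "dim V" arbitrary: V rule: less_induct)
    case less
    show ?case
    proof (cases "V = {0}")
      case True
      then show ?thesis by (intro exI[of _ "{}"]) auto
    next
      case False
      then obtain z where z: "z \<in> V" "z \<noteq> 0" using subspace_0[OF less(3)] by auto
      let ?S = "V \<inter> sphere 0 1"
      have "compact ?S" using closed_subspace[OF less(3)] by (simp add: closed_Int_compact)
      moreover have "(1 / norm z) *\<^sub>R z \<in> ?S" using z less(3) by (simp add: subspace_scale)
      moreover have "continuous_on ?S (\<lambda>x. b x x)"
        using bilinear_continuous_on_compose[OF continuous_on_id continuous_on_id b] by auto
      ultimately obtain e where e: "e \<in> ?S" and mx: "\<And>x. x \<in> ?S \<Longrightarrow> b x x \<le> b e e"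
        using continuous_attains_sup[of ?S "\<lambda>x. b x x"] by blast
      have eV: "e \<in> V" and ne: "norm e = 1" using e by auto
      have ee: "e \<bullet> e = 1" using ne by (simp add: norm_eq_1)
      have quad: "b x x \<le> b e e * (x \<bullet> x)" if "x \<in> V" for x
      proof (cases "x = 0")
        case True
        then show ?thesis using bilinear_lzero[OF b] by simp
      next
        case False
        have "b ((1 / norm x) *\<^sub>R x) ((1 / norm x) *\<^sub>R x) \<le> b e e"
          by (rule mx) (use that False less(3) in \<open>simp add: subspace_scale\<close>)
        then have "b x x / (norm x * norm x) \<le> b e e"
          by (simp add: bilinear_lmul[OF b] bilinear_rmul[OF b] divide_simps)
        then show ?thesis using False
          by (simp add: dot_square_norm power2_eq_square divide_simps split: if_splits)
      qed
      \<comment> \<open>first-order condition at the maximiser\<close>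
      have orth: "b e y = 0" if y: "y \<in> V" "e \<bullet> y = 0" for y
      proof (rule ccontr)
        assume ne0: "b e y \<noteq> 0"
        have ineq: "2 * t * b e y + t\<^sup>2 * b y y \<le> b e e * t\<^sup>2 * (y \<bullet> y)" for t
        proof -
          have "b (e + t *\<^sub>R y) (e + t *\<^sub>R y) \<le> b e e * ((e + t *\<^sub>R y) \<bullet> (e + t *\<^sub>R y))"
            by (rule quad) (use eV y less(3) in \<open>simp add: subspace_add subspace_scale\<close>)
          moreover have "b y e = b e y" using less(2) eV y by auto
          ultimately show ?thesis using y ee
            by (simp add: bilinear_ladd[OF b] bilinear_radd[OF b] bilinear_lmul[OF b] bilinear_rmul[OF b]
                inner_add_left inner_add_right inner_commute algebra_simps power2_eq_square)
        qed
        define c where "c = b e e * (y \<bullet> y) - b y y"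
        have i2: "2 * t * b e y \<le> c * t\<^sup>2" for t using ineq[of t] by (simp add: c_def algebra_simps)
        define s where "s = b e y / (\<bar>c\<bar> + 1)"
        have "2 * s * b e y = 2 * (\<bar>c\<bar> + 1) * s\<^sup>2"
        proof -
          have "b e y = (\<bar>c\<bar> + 1) * s" by (simp add: s_def)
          then show ?thesis by (simp add: power2_eq_square)
        qed
        moreover have "s\<^sup>2 > 0" using ne0 by (auto simp: s_def)
        moreover have "c * s\<^sup>2 \<le> \<bar>c\<bar> * s\<^sup>2" by (intro mult_right_mono) auto
        moreover have "0 \<le> \<bar>c\<bar> * s\<^sup>2" by simp
        moreover have "2 * (\<bar>c\<bar> + 1) * s\<^sup>2 = 2 * (\<bar>c\<bar> * s\<^sup>2) + 2 * s\<^sup>2"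
          by (simp add: distrib_right)
        ultimately show False using i2[of s] by linarith
      qed
      define V' where "V' = {x\<in>V. e \<bullet> x = 0}"
      have sV': "subspace V'" unfolding V'_def using less(3)
        by (auto simp: subspace_def inner_add_right)
      have dec: "x - (e \<bullet> x) *\<^sub>R e \<in> V'" if "x \<in> V" for x
        using that eV less(3) ee by (simp add: V'_def subspace_diff subspace_scale inner_diff_right)
      have "e \<notin> V'" using ee by (simp add: V'_def)
      then have "V' \<subset> V" using eV V'_def by blast
      then have "dim V' < dim V" using dim_psubset[of V' V] sV' less(3) by (simp add: span_eq_iff[THEN iffD2])
      then obtain B where B: "B \<subseteq> V'" "span B = V'" "pairwise orthogonal B" "\<forall>x\<in>B. norm x = 1"
        "\<forall>x\<in>B. \<forall>y\<in>B. x \<noteq> y \<longrightarrow> b x y = 0"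
        using less(1)[of V'] less(2) sV' by (auto simp: V'_def)
      have "span (insert e B) = V"
      proof
        show "span (insert e B) \<subseteq> V" using B(1) eV less(3) by (intro span_minimal) (auto simp: V'_def)
        show "V \<subseteq> span (insert e B)"
        proof
          fix x assume "x \<in> V"
          then have "x - (e \<bullet> x) *\<^sub>R e \<in> span B" using dec B by auto
          then show "x \<in> span (insert e B)" by (auto simp: span_insert)
        qed
      qed
      moreover have "b x e = 0" if "x \<in> V'" for x
        using orth[of x] less(2)[of x e] that eV by (auto simp: V'_def)
      ultimately show ?thesis
        using B ne eV orth by (intro exI[of _ "insert e B"])
          (auto simp: V'_def pairwise_insert orthogonal_def inner_commute subset_iff)
    qed
  qed
  then obtain B where B: "B \<subseteq> V" "span B = V" "pairwise orthogonal B" "\<forall>x\<in>B. norm x = 1"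
    "\<forall>x\<in>B. \<forall>y\<in>B. x \<noteq> y \<longrightarrow> b x y = 0" by blast
  moreover have "independent B" using B by (intro pairwise_orthogonal_independent) auto
  ultimately show thesis using that by blast
qed

text \<open>
  Positivity of a Gram matrix survives perturbation: by \<open>2 x y \<le> x\<^sup>2 + y\<^sup>2\<close>, entrywise errors of size \<open>\<eta>\<close>
  change the form by at most \<open>\<eta>\<close> times the number of vectors.
\<close>

lemma gram_close_pos:
  fixes b :: "'v::euclidean_space \<Rightarrow> 'v \<Rightarrow> real"
  assumes "finite I" "bilinear b" "subspace V" "\<And>i. i \<in> I \<Longrightarrow> f i \<in> V" "\<delta> > 0"
    and "\<And>i j. i \<in> I \<Longrightarrow> j \<in> I \<Longrightarrow> \<bar>b (f i) (f j) - (if i = j then d i else 0)\<bar> \<le> \<eta>"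
    and "\<And>i. i \<in> I \<Longrightarrow> d i \<ge> \<delta>" "\<eta> * card I < \<delta>"
  shows "card I \<le> n_plus V (\<lambda>q. b q q)"
proof (rule card_le_n_plus[where f = f and b = b])
  fix x assume "\<exists>i\<in>I. x i \<noteq> (0::real)"
  then obtain k where k: "k \<in> I" "x k \<noteq> 0" by blast
  let ?S = "\<Sum>i\<in>I. (x i)\<^sup>2"
  have S: "?S > 0" by (rule sum_pos2[of _ k]) (use k assms in auto)
  have t: "x i * x j * b (f i) (f j) \<ge> (if i = j then \<delta> * (x i)\<^sup>2 else 0) - \<eta> * (((x i)\<^sup>2 + (x j)\<^sup>2) / 2)"
    if ij: "i \<in> I" "j \<in> I" for i j
  proof -
    let ?r = "b (f i) (f j) - (if i = j then d i else 0)"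
    have r: "\<bar>?r\<bar> \<le> \<eta>" using assms(6) ij by blast
    have am: "\<bar>x i * x j\<bar> \<le> ((x i)\<^sup>2 + (x j)\<^sup>2) / 2"
      using sum_squares_bound[of "\<bar>x i\<bar>" "\<bar>x j\<bar>"] by (simp add: abs_mult)
    have "\<bar>x i * x j * ?r\<bar> \<le> ((x i)\<^sup>2 + (x j)\<^sup>2) / 2 * \<eta>"
      unfolding abs_mult[of "x i * x j"] using am r by (intro mult_mono) auto
    then have "x i * x j * ?r \<ge> - (\<eta> * (((x i)\<^sup>2 + (x j)\<^sup>2) / 2))"
      by (simp only: abs_le_iff mult.commute[of \<eta>]) linarith
    moreover have "(if i = j then \<delta> * (x i)\<^sup>2 else 0) \<le> x i * x j * (if i = j then d i else 0)"
      using assms(7)[OF ij(1)] mult_right_mono[of \<delta> "d i" "(x i)\<^sup>2"]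
      by (auto simp: power2_eq_square mult_ac)
    moreover have "x i * x j * b (f i) (f j) = x i * x j * (if i = j then d i else 0) + x i * x j * ?r"
      by (simp only: distrib_left[symmetric]) simp
    ultimately show ?thesis by linarith
  qed
  have "b (\<Sum>i\<in>I. x i *\<^sub>R f i) (\<Sum>i\<in>I. x i *\<^sub>R f i) \<ge>
      (\<Sum>i\<in>I. \<Sum>j\<in>I. (if i = j then \<delta> * (x i)\<^sup>2 else 0) - \<eta> * (((x i)\<^sup>2 + (x j)\<^sup>2) / 2))"
    unfolding bilinear_double_sum[OF assms(2)] by (intro sum_mono t)
  also have "(\<Sum>i\<in>I. \<Sum>j\<in>I. (if i = j then \<delta> * (x i)\<^sup>2 else 0) - \<eta> * (((x i)\<^sup>2 + (x j)\<^sup>2) / 2))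
      = \<delta> * ?S - \<eta> * (card I * ?S)"
    using assms(1) by (simp add: sum_subtractf sum.distrib sum_distrib_left[symmetric]
        sum_divide_distrib[symmetric] add_divide_distrib)
  finally have "b (\<Sum>i\<in>I. x i *\<^sub>R f i) (\<Sum>i\<in>I. x i *\<^sub>R f i) \<ge> (\<delta> - \<eta> * card I) * ?S"
    by (simp add: algebra_simps)
  moreover have "(\<delta> - \<eta> * card I) * ?S > 0" using S assms(8) by simp
  ultimately show "b (\<Sum>i\<in>I. x i *\<^sub>R f i) (\<Sum>i\<in>I. x i *\<^sub>R f i) > 0" by linarith
qed (use assms in auto)

lemma eventually_card_le_n_plus:
  fixes b :: "'v::euclidean_space \<Rightarrow> 'v \<Rightarrow> real" and f :: "'t \<Rightarrow> 'i \<Rightarrow> 'v"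
  assumes "finite I" "bilinear b"
    and V: "\<forall>\<^sub>F t in F. subspace (V t) \<and> (\<forall>i\<in>I. f t i \<in> V t)"
    and lim: "\<And>i j. i \<in> I \<Longrightarrow> j \<in> I \<Longrightarrow> ((\<lambda>t. b (f t i) (f t j)) \<longlongrightarrow> (if i = j then d i else 0)) F"
    and d: "\<And>i. i \<in> I \<Longrightarrow> d i > 0"
  shows "\<forall>\<^sub>F t in F. card I \<le> n_plus (V t) (\<lambda>q. b q q)"
proof (cases "I = {}")
  case False
  define \<delta> where "\<delta> = Min (d ` I)"
  have \<delta>: "\<delta> > 0" "\<And>i. i \<in> I \<Longrightarrow> d i \<ge> \<delta>" using assms(1) d False by (auto simp: \<delta>_def)
  define \<eta> where "\<eta> = \<delta> / (card I + 1)"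
  have \<eta>: "\<eta> > 0" "\<eta> * card I < \<delta>" using \<delta> by (auto simp: \<eta>_def divide_simps)
  have "\<forall>\<^sub>F t in F. \<forall>i\<in>I. \<forall>j\<in>I. \<bar>b (f t i) (f t j) - (if i = j then d i else 0)\<bar> \<le> \<eta>"
  proof (intro eventually_ball_finite ballI assms(1))
    fix i j assume "i \<in> I" "j \<in> I"
    from tendstoD[OF lim[OF this] \<eta>(1)]
    show "\<forall>\<^sub>F t in F. \<bar>b (f t i) (f t j) - (if i = j then d i else 0)\<bar> \<le> \<eta>"
      by eventually_elim (simp only: dist_real_def less_imp_le)
  qed
  with V show ?thesis
  proof eventually_elim
    case (elim t)
    show ?case
      by (rule gram_close_pos[where b = b and f = "f t" and d = d and \<delta> = \<delta> and \<eta> = \<eta>]) (use elim assms \<delta> \<eta> in auto)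
  qed
qed simp

text \<open>
  Inertia is stable in a varying space when the Gram matrix of a varying family converges to a
  nondegenerate diagonal one. Both indices are eventually at least those of the limit, and as these
  add up to the dimension, they are equal to them. Only the Gram matrix has to converge, not the vectors:
  this allows the rescaling used below.
\<close>

lemma eventually_inertia:
  fixes b :: "'v::euclidean_space \<Rightarrow> 'v \<Rightarrow> real" and f :: "'t \<Rightarrow> 'i \<Rightarrow> 'v"
  assumes fin: "finite I" and b: "bilinear b" "\<And>x y. b x y = b y x"
    and V: "\<forall>\<^sub>F t in F. subspace (V t) \<and> dim (V t) = card I \<and> (\<forall>i\<in>I. f t i \<in> V t)"
    and lim: "\<And>i j. i \<in> I \<Longrightarrow> j \<in> I \<Longrightarrow> ((\<lambda>t. b (f t i) (f t j)) \<longlongrightarrow> (if i = j then d i else 0)) F"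
    and d: "\<And>i. i \<in> I \<Longrightarrow> d i \<noteq> 0"
  shows "\<forall>\<^sub>F t in F. n_minus (V t) (\<lambda>q. b q q) = card {i\<in>I. d i < 0} \<and>
     (\<forall>q\<in>V t. (\<forall>y\<in>V t. b q y = 0) \<longrightarrow> q = 0)"
proof -
  let ?P = "{i\<in>I. d i > 0}" and ?N = "{i\<in>I. d i < 0}"
  have "\<forall>\<^sub>F t in F. card ?P \<le> n_plus (V t) (\<lambda>q. b q q)"
    by (rule eventually_card_le_n_plus[where b = b and f = f and d = d]) (use fin b lim in \<open>auto intro: eventually_mono[OF V]\<close>)
  moreover have "\<forall>\<^sub>F t in F. card ?N \<le> n_plus (V t) (\<lambda>q. - b q q)"
  proof (rule eventually_card_le_n_plus[where b = "\<lambda>x y. - b x y" and f = f and d = "\<lambda>i. - d i"])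
    fix i j assume "i \<in> ?N" "j \<in> ?N"
    then show "((\<lambda>t. - b (f t i) (f t j)) \<longlongrightarrow> (if i = j then - d i else 0)) F"
      using tendsto_minus[OF lim[of i j]] by (auto split: if_splits)
  qed (use fin bilinear_minus[OF b(1)] in \<open>auto intro: eventually_mono[OF V]\<close>)
  ultimately show ?thesis using V
  proof eventually_elim
    case (elim t)
    have sV: "subspace (V t)" using elim by simp
    have c: "card I = card ?P + card ?N"
    proof -
      have "I = ?P \<union> ?N" using d by fastforce
      then have "card I = card (?P \<union> ?N)" by simp
      also have "\<dots> = card ?P + card ?N" by (rule card_Un_disjoint) (use fin in auto)
      finally show ?thesis .
    qed
    have le: "n_plus (V t) (\<lambda>q. b q q) + n_minus (V t) (\<lambda>q. b q q) \<le> dim (V t)"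
      by (rule n_plus_add_n_minus_le) (use sV bilinear_lzero[OF b(1)] in auto)
    have eq: "n_minus (V t) (\<lambda>q. b q q) = card ?N" "n_plus (V t) (\<lambda>q. b q q) = card ?P"
      using elim le c by (auto simp: n_minus_def)
    obtain U where U: "subspace U" "U \<subseteq> V t" "\<And>q. q \<in> U \<Longrightarrow> q \<noteq> 0 \<Longrightarrow> b q q > 0" "dim U = card ?P"
      using n_plus_attained[OF subspace_0[OF sV], of "\<lambda>q. b q q"] eq by metis
    obtain W where W: "subspace W" "W \<subseteq> V t" "\<And>q. q \<in> W \<Longrightarrow> q \<noteq> 0 \<Longrightarrow> - b q q > 0" "dim W = card ?N"
      using n_plus_attained[OF subspace_0[OF sV], of "\<lambda>q. - b q q"] eq unfolding n_minus_def by metis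
    have UW: "U \<inter> W \<subseteq> {0}" using U(3) W(3) by fastforce
    let ?S = "{x + y |x y. x \<in> U \<and> y \<in> W}"
    have "dim ?S + dim (U \<inter> W) = dim U + dim W" by (rule dim_sums_Int) (use U W in auto)
    moreover have "dim (U \<inter> W) = 0" using UW by auto
    ultimately have "dim ?S = dim (V t)" using U W elim c by simp
    moreover have "?S \<subseteq> V t" using U W sV by (auto intro: subspace_add)
    moreover have "subspace ?S" using subspace_sums U W by auto
    ultimately have S: "?S = V t" using sV by (intro subspace_dim_equal) auto
    have "q = 0" if q: "q \<in> V t" "\<forall>y\<in>V t. b q y = 0" for q
    proof -
      obtain x y where xy: "x \<in> U" "y \<in> W" "q = x + y"
        using q(1) unfolding S[symmetric] by blast
      have "b q x = 0" "b q y = 0" using q xy U W by auto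
      then have "b x x = b y y"
        using xy b(2)[of x y] by (simp add: bilinear_ladd[OF b(1)])
      then have "x = 0 \<and> y = 0" using U(3)[OF xy(1)] W(3)[OF xy(2)] bilinear_lzero[OF b(1)]
        by (metis add.inverse_inverse less_irrefl neg_0_less_iff_less order_less_trans)
      then show ?thesis using xy by simp
    qed
    then show ?case using eq by blast
  qed
qed

section \<open>The index of a Lagrangian subspace in a chart\<close>

text \<open>
  On the graph of a symmetric \<open>A\<close> in the chart of slope \<open>\<beta>\<close> (\<open>sym_graph\<close>) this form is \<open>- A y \<bullet> y\<close>.
  It is written on the ambient space so that no choice of \<open>A\<close> is involved.
\<close>

definition slope_form :: "real \<Rightarrow> (real^'n) \<times> (real^'n) \<Rightarrow> (real^'n) \<times> (real^'n) \<Rightarrow> real"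
  where "slope_form \<beta> z w = \<beta> * (fst z \<bullet> fst w) - (fst z \<bullet> snd w + fst w \<bullet> snd z) / 2"

text \<open>
  In the chart of slope \<open>\<beta>\<close> this form is \<open>y \<bullet> y - (\<gamma> - \<beta>) A y \<bullet> y\<close>; it degenerates exactly when the subspace
  is no longer transverse to slope \<open>\<gamma>\<close>. It measures the change of chart.
\<close>

definition gap_form :: "real \<Rightarrow> real \<Rightarrow> (real^'n) \<times> (real^'n) \<Rightarrow> (real^'n) \<times> (real^'n) \<Rightarrow> real"
  where "gap_form \<beta> \<gamma> z w =
    ((snd z - \<beta> *\<^sub>R fst z) \<bullet> (snd w - \<gamma> *\<^sub>R fst w) + (snd w - \<beta> *\<^sub>R fst w) \<bullet> (snd z - \<gamma> *\<^sub>R fst z)) / 2"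

definition transverse :: "real \<Rightarrow> ((real^'n) \<times> (real^'n)) set \<Rightarrow> bool"
  where "transverse \<beta> V \<longleftrightarrow> (\<forall>x. (x, \<beta> *\<^sub>R x) \<in> V \<longrightarrow> x = 0)"

text \<open>
  The number of positive eigenvalues of \<open>A\<close> if the subspace is the graph of \<open>A\<close> in the chart of slope \<open>\<beta>\<close>.
\<close>

definition neg_index :: "real \<Rightarrow> ((real^'n) \<times> (real^'n)) set \<Rightarrow> nat"
  where "neg_index \<beta> V = n_minus V (\<lambda>z. slope_form \<beta> z z)"

text \<open>
  Every Lagrangian subspace transverse to \<open>{(x, \<beta> x)}\<close> has this form, parametrised by
  \<open>y = snd z - \<beta> fst z\<close>. The slope is kept as a parameter because scalar slopes already give enough
  charts (\<open>transverse_exists\<close>).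
\<close>

definition sym_graph :: "real \<Rightarrow> ((real^'n) \<Rightarrow>\<^sub>L (real^'n)) \<Rightarrow> ((real^'n) \<times> (real^'n)) set"
  where "sym_graph \<beta> A = range (\<lambda>y. (A y, y + \<beta> *\<^sub>R A y))"

definition symmetric_op :: "('v::real_inner \<Rightarrow>\<^sub>L 'v) \<Rightarrow> bool"
  where "symmetric_op A \<longleftrightarrow> (\<forall>x y. A x \<bullet> y = x \<bullet> A y)"

lemma bilinear_slope_form: "bilinear (slope_form \<beta>)"
  by (auto simp: bilinear_def slope_form_def inner_add_left inner_add_right algebra_simps
      add_divide_distrib intro!: linearI)

lemma bilinear_gap_form: "bilinear (gap_form \<beta> \<gamma>)"
  by (auto simp: bilinear_def gap_form_def inner_add_left inner_add_right inner_diff_left inner_diff_right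
      algebra_simps add_divide_distrib diff_divide_distrib intro!: linearI)

lemma slope_form_sym: "slope_form \<beta> z w = slope_form \<beta> w z"
  by (simp add: slope_form_def inner_commute)

lemma gap_form_sym: "gap_form \<beta> \<gamma> z w = gap_form \<beta> \<gamma> w z"
  by (simp add: gap_form_def inner_commute)

lemma symp_eq: "symp z w = fst z \<bullet> snd w - snd z \<bullet> fst w"
  by (cases z, cases w) (simp add: symp_def inner_prod_def inner_diff_left)

lemma LagrangiansD:
  fixes V :: "((real^'n) \<times> (real^'n)) set"
  assumes "V \<in> Lagrangians"
  shows "subspace V" "dim V = CARD('n)"
    "\<And>z w. z \<in> V \<Longrightarrow> w \<in> V \<Longrightarrow> fst z \<bullet> snd w = fst w \<bullet> snd z"
  using assms by (auto simp: Lagrangians_def symp_eq inner_commute)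

lemma linear_graph_param: "linear (\<lambda>y. (blinfun_apply A y, y + \<beta> *\<^sub>R A y))"
  by (auto intro!: linearI simp: blinfun.bilinear_simps algebra_simps)

lemma sym_graph_Lagrangian:
  fixes A :: "(real^'n) \<Rightarrow>\<^sub>L (real^'n)"
  assumes "symmetric_op A"
  shows "sym_graph \<beta> A \<in> Lagrangians" "transverse \<beta> (sym_graph \<beta> A)"
proof -
  let ?\<iota> = "\<lambda>y. (A y, y + \<beta> *\<^sub>R A y)"
  have inj: "inj ?\<iota>" by (auto intro!: injI)
  have "dim (sym_graph \<beta> A) = dim (UNIV :: (real^'n) set)"
    unfolding sym_graph_def by (rule dim_image_eq[OF linear_graph_param]) (use inj in auto)
  moreover have "subspace (sym_graph \<beta> A)"
    unfolding sym_graph_def by (rule linear_subspace_image[OF linear_graph_param subspace_UNIV])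
  moreover have "symp (?\<iota> y) (?\<iota> y') = 0" for y y'
    using assms by (simp add: symp_eq symmetric_op_def inner_add_left inner_add_right)
  ultimately show "sym_graph \<beta> A \<in> Lagrangians"
    by (auto simp: Lagrangians_def sym_graph_def)
  show "transverse \<beta> (sym_graph \<beta> A)"
    by (auto simp: transverse_def sym_graph_def blinfun.zero_right)
qed

lemma Lagrangian_sym_graph:
  fixes V :: "((real^'n) \<times> (real^'n)) set"
  assumes V: "V \<in> Lagrangians" and t: "transverse \<beta> V"
  obtains A where "symmetric_op A" "V = sym_graph \<beta> A"
proof -
  define \<phi> where "\<phi> = (\<lambda>z::(real^'n) \<times> (real^'n). snd z - \<beta> *\<^sub>R fst z)"
  have lin: "linear \<phi>" by (auto intro!: linearI simp: \<phi>_def algebra_simps)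
  note VD = LagrangiansD[OF V]
  have inj: "inj_on \<phi> V"
  proof (subst linear_inj_on_iff_eq_0[OF lin VD(1)], intro ballI impI)
    fix z assume "z \<in> V" "\<phi> z = 0"
    then have "(fst z, \<beta> *\<^sub>R fst z) \<in> V" by (cases z) (auto simp: \<phi>_def)
    then have "fst z = 0" using t by (auto simp: transverse_def)
    then show "z = 0" using \<open>\<phi> z = 0\<close> by (cases z) (auto simp: \<phi>_def zero_prod_def)
  qed
  have "dim (\<phi> ` V) = CARD('n)" using dim_image_eq[OF lin, of V] inj VD by (simp add: span_eq_iff[THEN iffD2])
  then have surj: "\<phi> ` V = UNIV"
    using subspace_dim_equal[of "\<phi> ` V" UNIV] linear_subspace_image[OF lin VD(1)] by simp
  obtain G where G: "range G \<subseteq> V" "linear G" "\<forall>v\<in>V. G (\<phi> v) = v"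
    using linear_exists_left_inverse_on[OF lin VD(1) inj] by auto
  define A where "A = Blinfun (\<lambda>y. fst (G y))"
  have A: "blinfun_apply A = (\<lambda>y. fst (G y))"
    unfolding A_def by (rule bounded_linear_Blinfun_apply)
      (use linear_compose[OF G(2) linear_fst] in \<open>simp add: linear_linear o_def\<close>)
  have PG: "\<phi> (G y) = y" for y
  proof -
    obtain v where "v \<in> V" "y = \<phi> v" using surj by (metis UNIV_I imageE)
    then show ?thesis using G(3) by simp
  qed
  have Geq: "G y = (A y, y + \<beta> *\<^sub>R A y)" for y
    using PG[of y] by (cases "G y") (auto simp: A \<phi>_def algebra_simps)
  have "V = sym_graph \<beta> A"
  proof
    show "V \<subseteq> sym_graph \<beta> A"
    proof
      fix v assume "v \<in> V"
      then have "v = (A (\<phi> v), \<phi> v + \<beta> *\<^sub>R A (\<phi> v))" using G(3) Geq[of "\<phi> v"] by auto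
      then show "v \<in> sym_graph \<beta> A" by (auto simp: sym_graph_def)
    qed
    show "sym_graph \<beta> A \<subseteq> V" using G(1) by (auto simp: sym_graph_def Geq)
  qed
  moreover have "symmetric_op A"
    unfolding symmetric_op_def
  proof (intro allI)
    fix x y
    have "G x \<in> V" "G y \<in> V" using G(1) by auto
    then show "A x \<bullet> y = x \<bullet> A y" using VD(3)[of "G x" "G y"]
      by (simp add: Geq inner_add_right) (simp add: inner_commute)
  qed
  ultimately show thesis using that by blast
qed

text \<open>
  The crossings with the vertical subspace are the degeneracies of the form: both correspond to the
  kernel of \<open>A\<close>.
\<close>

lemma slope_form_kernel:
  fixes V :: "((real^'n) \<times> (real^'n)) set"
  assumes V: "V \<in> Lagrangians" and t: "transverse \<beta> V" and z: "z \<in> V"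
  shows "(\<forall>w\<in>V. slope_form \<beta> z w = 0) \<longleftrightarrow> fst z = 0"
proof
  assume "fst z = 0"
  then show "\<forall>w\<in>V. slope_form \<beta> z w = 0"
    using LagrangiansD(3)[OF V z] by (auto simp: slope_form_def)
next
  assume l: "\<forall>w\<in>V. slope_form \<beta> z w = 0"
  obtain A where A: "symmetric_op A" "V = sym_graph \<beta> A" using Lagrangian_sym_graph[OF V t] .
  then obtain y where y: "z = (A y, y + \<beta> *\<^sub>R A y)" using z by (auto simp: sym_graph_def)
  have "slope_form \<beta> z (A y', y' + \<beta> *\<^sub>R A y') = - (A y \<bullet> y')" for y'
    using A(1) by (simp add: slope_form_def y symmetric_op_def inner_add_right inner_commute field_simps)
  moreover have "slope_form \<beta> z (A y', y' + \<beta> *\<^sub>R A y') = 0" for y'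
    using l A(2) by (auto simp: sym_graph_def)
  ultimately have "A y \<bullet> y' = 0" for y' by simp
  from this[of "A y"] show "fst z = 0" using y by simp
qed

text \<open>
  In an orthonormal eigenbasis of \<open>A\<close>, with eigenvalue \<open>\<alpha>\<close> and \<open>\<delta> = \<gamma> - \<beta> > 0\<close>, the three forms are diagonal with
  entries \<open>- \<alpha>\<close>, \<open>- \<alpha> (1 - \<delta> \<alpha>)\<close> and \<open>1 - \<delta> \<alpha>\<close>. Since \<open>1 - \<delta> \<alpha> < 0\<close> forces \<open>\<alpha> > 0\<close>, the negative entries of
  the first form are those of the second together with those of the third.
\<close>

lemma neg_index_diff:
  fixes V :: "((real^'n) \<times> (real^'n)) set"
  assumes V: "V \<in> Lagrangians" and tb: "transverse \<beta> V" and tg: "transverse \<gamma> V" and "\<beta> < \<gamma>"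
  shows "neg_index \<beta> V = neg_index \<gamma> V + n_minus V (\<lambda>z. gap_form \<beta> \<gamma> z z)"
    "z \<in> V \<Longrightarrow> \<forall>w\<in>V. gap_form \<beta> \<gamma> z w = 0 \<Longrightarrow> z = 0"
proof -
  obtain A where A: "symmetric_op A" "V = sym_graph \<beta> A" using Lagrangian_sym_graph[OF V tb] .
  let ?\<iota> = "\<lambda>y. (A y, y + \<beta> *\<^sub>R A y)"
  have bil: "bilinear (\<lambda>x y. A x \<bullet> y)"
    by (auto simp: bilinear_def blinfun.bilinear_simps inner_add_left inner_add_right intro!: linearI)
  have sy: "A x \<bullet> y = A y \<bullet> x" for x y using A(1) by (simp add: symmetric_op_def inner_commute)
  obtain B where "B \<subseteq> UNIV" and B: "independent B" "span B = (UNIV :: (real^'n) set)" "pairwise orthogonal B"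
    "\<forall>x\<in>B. norm x = 1" "\<forall>x\<in>B. \<forall>y\<in>B. x \<noteq> y \<longrightarrow> A x \<bullet> y = 0"
    by (rule form_diagonalization[OF bil sy subspace_UNIV])
  define \<alpha> where "\<alpha> e = A e \<bullet> e" for e
  have eig: "A e = \<alpha> e *\<^sub>R e" if e: "e \<in> B" for e
  proof -
    have "orthogonal (A e - \<alpha> e *\<^sub>R e) x" if "x \<in> UNIV" for x
    proof (rule orthogonal_to_span)
      show "x \<in> span B" using B by simp
      fix y assume y: "y \<in> B"
      show "orthogonal (A e - \<alpha> e *\<^sub>R e) y"
      proof (cases "y = e")
        case True
        have "e \<bullet> e = 1" using B(4) e by (simp add: norm_eq_1)
        then show ?thesis using True by (simp add: orthogonal_def inner_diff_left \<alpha>_def)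
      next
        case False
        then have "e \<bullet> y = 0" using B(3) e y by (auto simp: pairwise_def orthogonal_def)
        then show ?thesis using False B(5) e y by (simp add: orthogonal_def inner_diff_left)
      qed
    qed
    then have "A e - \<alpha> e *\<^sub>R e = 0" using orthogonal_self by blast
    then show ?thesis by simp
  qed
  define C where "C = ?\<iota> ` B"
  have inj: "inj ?\<iota>" by (auto intro!: injI)
  have "independent C"
    unfolding C_def by (rule linear_independent_injective_image[OF linear_graph_param B(1)])
      (use inj in \<open>auto intro: inj_on_subset\<close>)
  moreover have "span C = V"
    unfolding C_def linear_span_image[OF linear_graph_param] B(2) A(2) sym_graph_def ..
  ultimately have C: "independent C" "span C = V" .
  have ee: "e \<bullet> e' = (if e = e' then 1 else 0)" if "e \<in> B" "e' \<in> B" for e e'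
    using that B(3,4) by (auto simp: pairwise_def orthogonal_def norm_eq_1)
  define \<delta> where "\<delta> = \<gamma> - \<beta>"
  have \<delta>: "\<delta> > 0" "\<gamma> = \<beta> + \<delta>" using \<open>\<beta> < \<gamma>\<close> by (auto simp: \<delta>_def)
  have f1: "slope_form \<beta> (?\<iota> e) (?\<iota> e') = (if e = e' then - \<alpha> e else 0)" if "e \<in> B" "e' \<in> B" for e e'
    using ee[OF that] ee[OF that(2,1)] eig that
    by (simp add: slope_form_def inner_add_right algebra_simps)
  have f2: "slope_form \<gamma> (?\<iota> e) (?\<iota> e') = (if e = e' then - \<alpha> e * (1 - \<delta> * \<alpha> e) else 0)"
    if "e \<in> B" "e' \<in> B" for e e'
    using ee[OF that] ee[OF that(2,1)] eig that \<delta>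
    by (simp add: slope_form_def inner_add_right algebra_simps)
  have f3: "gap_form \<beta> \<gamma> (?\<iota> e) (?\<iota> e') = (if e = e' then 1 - \<delta> * \<alpha> e else 0)"
    if "e \<in> B" "e' \<in> B" for e e'
    using ee[OF that] ee[OF that(2,1)] eig that \<delta>
    by (simp add: gap_form_def inner_add_right inner_diff_right algebra_simps)
  have nz: "1 - \<delta> * \<alpha> e \<noteq> 0" if "e \<in> B" for e
  proof
    assume *: "1 - \<delta> * \<alpha> e = 0"
    have "?\<iota> e \<in> V" using A by (auto simp: sym_graph_def)
    moreover have "?\<iota> e = (A e, \<gamma> *\<^sub>R A e)"
    proof -
      have "e + (\<beta> * \<alpha> e) *\<^sub>R e = (\<delta> * \<alpha> e) *\<^sub>R e + (\<beta> * \<alpha> e) *\<^sub>R e" using * by simp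
      also have "\<dots> = (\<delta> * \<alpha> e + \<beta> * \<alpha> e) *\<^sub>R e" by (simp only: scaleR_left_distrib)
      also have "\<delta> * \<alpha> e + \<beta> * \<alpha> e = \<gamma> * \<alpha> e" by (simp add: \<delta>(2) distrib_right)
      finally show ?thesis by (simp add: eig[OF that])
    qed
    ultimately have "A e = 0" using tg by (auto simp: transverse_def)
    then have "\<alpha> e = 0" by (simp add: \<alpha>_def)
    then show False using * by simp
  qed
  have cnt: "n_minus V (\<lambda>z. b z z) = card {e\<in>B. b (?\<iota> e) (?\<iota> e) < 0}"
    if "bilinear b" "\<And>e e'. e \<in> B \<Longrightarrow> e' \<in> B \<Longrightarrow> e \<noteq> e' \<Longrightarrow> b (?\<iota> e) (?\<iota> e') = 0" for b
  proof -
    have "n_minus V (\<lambda>z. b z z) = card {z\<in>C. b z z < 0}"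
      by (rule n_minus_orthogonal_basis[OF that(1) C]) (use that(2) in \<open>auto simp: C_def\<close>)
    also have "{z\<in>C. b z z < 0} = ?\<iota> ` {e\<in>B. b (?\<iota> e) (?\<iota> e) < 0}" by (auto simp: C_def)
    also have "card \<dots> = card {e\<in>B. b (?\<iota> e) (?\<iota> e) < 0}"
      by (rule card_image) (use inj in \<open>auto intro: inj_on_subset\<close>)
    finally show ?thesis .
  qed
  have finB: "finite B" using B(1) by (rule independent_imp_finite)
  have "neg_index \<beta> V = card {e\<in>B. 0 < \<alpha> e}"
    unfolding neg_index_def by (subst cnt[OF bilinear_slope_form]) (auto simp: f1 intro!: arg_cong[of _ _ card])
  moreover have "neg_index \<gamma> V = card {e\<in>B. 0 < \<alpha> e * (1 - \<delta> * \<alpha> e)}"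
    unfolding neg_index_def by (subst cnt[OF bilinear_slope_form]) (auto simp: f2 intro!: arg_cong[of _ _ card])
  moreover have "n_minus V (\<lambda>z. gap_form \<beta> \<gamma> z z) = card {e\<in>B. 1 - \<delta> * \<alpha> e < 0}"
    by (subst cnt[OF bilinear_gap_form]) (auto simp: f3 intro!: arg_cong[of _ _ card])
  moreover have "card {e\<in>B. 0 < \<alpha> e} =
      card ({e\<in>B. 0 < \<alpha> e * (1 - \<delta> * \<alpha> e)} \<union> {e\<in>B. 1 - \<delta> * \<alpha> e < 0})"
  proof (rule arg_cong[of _ _ card], intro set_eqI iffI)
    fix e assume "e \<in> {e\<in>B. 0 < \<alpha> e}"
    then show "e \<in> {e\<in>B. 0 < \<alpha> e * (1 - \<delta> * \<alpha> e)} \<union> {e\<in>B. 1 - \<delta> * \<alpha> e < 0}"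
      using nz[of e] by (auto simp: zero_less_mult_iff)
  next
    fix e assume e: "e \<in> {e\<in>B. 0 < \<alpha> e * (1 - \<delta> * \<alpha> e)} \<union> {e\<in>B. 1 - \<delta> * \<alpha> e < 0}"
    show "e \<in> {e\<in>B. 0 < \<alpha> e}"
    proof (rule ccontr)
      assume "e \<notin> {e\<in>B. 0 < \<alpha> e}"
      then have "\<alpha> e \<le> 0" using e by auto
      moreover from this have "\<delta> * \<alpha> e \<le> 0" using \<delta> by (simp add: mult_nonneg_nonpos)
      ultimately show False using e by (auto simp: zero_less_mult_iff)
    qed
  qed
  moreover have "card ({e\<in>B. 0 < \<alpha> e * (1 - \<delta> * \<alpha> e)} \<union> {e\<in>B. 1 - \<delta> * \<alpha> e < 0}) =
      card {e\<in>B. 0 < \<alpha> e * (1 - \<delta> * \<alpha> e)} + card {e\<in>B. 1 - \<delta> * \<alpha> e < 0}"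
  proof (rule card_Un_disjoint)
    have "False" if "0 < \<alpha> e * (1 - \<delta> * \<alpha> e)" "1 - \<delta> * \<alpha> e < 0" for e
    proof -
      have "\<alpha> e < 0" using that by (auto simp: zero_less_mult_iff)
      then have "\<delta> * \<alpha> e \<le> 0" using \<delta> by (simp add: mult_nonneg_nonpos)
      then show False using that by simp
    qed
    then show "{e\<in>B. 0 < \<alpha> e * (1 - \<delta> * \<alpha> e)} \<inter> {e\<in>B. 1 - \<delta> * \<alpha> e < 0} = {}" by blast
  qed (use finB in auto)
  ultimately show "neg_index \<beta> V = neg_index \<gamma> V + n_minus V (\<lambda>z. gap_form \<beta> \<gamma> z z)" by simp
  show "z = 0" if z: "z \<in> V" "\<forall>w\<in>V. gap_form \<beta> \<gamma> z w = 0"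
  proof -
    have l: "linear (\<lambda>z. gap_form \<beta> \<gamma> z w)" for w using bilinear_gap_form[of \<beta> \<gamma>] unfolding bilinear_def by blast
    have finC: "finite C" using finB by (simp add: C_def)
    obtain u where "z = (\<Sum>c\<in>C. u c *\<^sub>R c)" using z(1) C(2) span_finite[OF finC] by auto
    then have u: "z = (\<Sum>e\<in>B. u (?\<iota> e) *\<^sub>R ?\<iota> e)"
      using inj by (simp add: C_def sum.reindex[OF inj_on_subset[OF inj]])
    have "u (?\<iota> e) = 0" if e: "e \<in> B" for e
    proof -
      have "gap_form \<beta> \<gamma> z (?\<iota> e) = (\<Sum>e'\<in>B. u (?\<iota> e') * gap_form \<beta> \<gamma> (?\<iota> e') (?\<iota> e))"
        by (subst u) (simp add: linear_sum[OF l] linear_cmul[OF l] del: scaleR_Pair)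
      also have "\<dots> = (\<Sum>e'\<in>B. if e' = e then u (?\<iota> e) * (1 - \<delta> * \<alpha> e) else 0)"
        by (rule sum.cong) (use e f3 in auto)
      also have "\<dots> = u (?\<iota> e) * (1 - \<delta> * \<alpha> e)" using e finB by simp
      finally have "gap_form \<beta> \<gamma> z (?\<iota> e) = u (?\<iota> e) * (1 - \<delta> * \<alpha> e)" .
      moreover have "?\<iota> e \<in> V" using A by (auto simp: sym_graph_def)
      ultimately show ?thesis using z(2) nz[OF e] by auto
    qed
    then show "z = 0" using u by (simp del: scaleR_Pair)
  qed
qed

text \<open>
  If \<open>(x, \<beta> x)\<close> and \<open>(x', \<beta>' x')\<close> lie in a Lagrangian subspace then \<open>x \<bullet> x' = 0\<close> or \<open>\<beta> = \<beta>'\<close>, so only finitely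
  many slopes fail.
\<close>

lemma transverse_exists:
  fixes V :: "((real^'n) \<times> (real^'n)) set"
  assumes V: "V \<in> Lagrangians"
  obtains \<beta> where "transverse \<beta> V"
proof -
  have False if no: "\<And>\<beta>. \<not> transverse \<beta> V"
  proof -
    obtain x where x: "\<And>\<beta>. (x \<beta>, \<beta> *\<^sub>R x \<beta>) \<in> V" "\<And>\<beta>::real. x \<beta> \<noteq> 0"
      using no unfolding transverse_def by metis
    have o: "x \<beta> \<bullet> x \<gamma> = 0" if "\<beta> \<noteq> \<gamma>" for \<beta> \<gamma>
    proof -
      have "\<gamma> * (x \<beta> \<bullet> x \<gamma>) = \<beta> * (x \<beta> \<bullet> x \<gamma>)"
        using LagrangiansD(3)[OF V x(1)[of \<beta>] x(1)[of \<gamma>]] by (simp add: inner_commute)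
      then show ?thesis using that by simp
    qed
    have "inj x"
    proof (rule injI, rule ccontr)
      fix \<beta> \<gamma> assume "x \<beta> = x \<gamma>" "\<beta> \<noteq> \<gamma>"
      then show False using o[of \<beta> \<gamma>] x(2)[of \<gamma>] by simp
    qed
    moreover have "pairwise orthogonal (range x)"
      using o by (auto simp: pairwise_def orthogonal_def) metis
    then have "independent (range x)" by (rule pairwise_orthogonal_independent) (use x in auto)
    then have "finite (range x)" by (rule independent_imp_finite)
    ultimately have "finite (UNIV :: real set)" using finite_imageD by blast
    then show False using infinite_UNIV_char_0 by blast
  qed
  then show thesis using that by blast
qed

text \<open>
  The index close to a crossing subspace \<open>V0\<close>. On the part of \<open>V0\<close> where the form is nondegenerate
  nothing changes. On the kernel \<open>K\<close> the form tends to zero like \<open>\<tau>\<close>; dividing the kernel vectors by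
  \<open>sqrt \<tau>\<close> produces the limits \<open>d\<close> on the diagonal, while the mixed entries still tend to zero like
  \<open>sqrt \<tau>\<close>. The basis \<open>K\<close> of the kernel is required to diagonalise the limiting form.
\<close>

lemma negative_index_near_crossing:
  fixes V0 :: "((real^'n) \<times> (real^'n)) set" and L :: "'t \<Rightarrow> (real^'n) \<times> (real^'n) \<Rightarrow> (real^'n) \<times> (real^'n)"
  assumes V0: "V0 \<in> Lagrangians" "transverse \<beta> V0"
    and V: "\<forall>\<^sub>F t in F. V t \<in> Lagrangians"
    and L: "\<And>z. z \<in> V0 \<Longrightarrow> \<forall>\<^sub>F t in F. L t z \<in> V t"
    and lim: "\<And>z. z \<in> V0 \<Longrightarrow> ((\<lambda>t. L t z) \<longlongrightarrow> z) F"
    and \<tau>: "\<forall>\<^sub>F t in F. \<tau> t > 0" "(\<tau> \<longlongrightarrow> 0) F"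
    and K: "independent K" "span K = {z\<in>V0. fst z = 0}"
    and \<xi>: "\<And>k. k \<in> K \<Longrightarrow> ((\<lambda>t. fst (L t k) /\<^sub>R \<tau> t) \<longlongrightarrow> \<xi> k) F"
    and d: "\<And>k k'. k \<in> K \<Longrightarrow> k' \<in> K \<Longrightarrow> \<xi> k' \<bullet> snd k = (if k = k' then - d k else 0)"
      "\<And>k. k \<in> K \<Longrightarrow> d k \<noteq> 0"
  shows "\<forall>\<^sub>F t in F. neg_index \<beta> (V t) = neg_index \<beta> V0 + card {k\<in>K. d k < 0} \<and>
    (\<forall>z\<in>V t. fst z = 0 \<longrightarrow> z = 0)"
proof -
  note V0D = LagrangiansD[OF V0(1)]
  let ?b = "slope_form \<beta> :: (real^'n) \<times> (real^'n) \<Rightarrow> _"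
  obtain B where B: "B \<subseteq> V0" "independent B" "span B = V0" and "pairwise orthogonal B"
    "\<forall>x\<in>B. norm x = 1"
    and B4': "\<forall>x\<in>B. \<forall>y\<in>B. x \<noteq> y \<longrightarrow> ?b x y = 0"
    by (rule form_diagonalization[OF bilinear_slope_form slope_form_sym V0D(1)])
  have B4: "\<And>x y. x \<in> B \<Longrightarrow> y \<in> B \<Longrightarrow> x \<noteq> y \<Longrightarrow> ?b x y = 0" using B4' by blast
  have finB: "finite B" and finK: "finite K" using B(2) K(1) independent_imp_finite by auto
  define B0 where "B0 = {e\<in>B. ?b e e = 0}"
  have l: "linear (\<lambda>z. ?b z w)" "linear (?b w)" for w
    using bilinear_slope_form[of \<beta>] unfolding bilinear_def by blast+
  have "span B0 = {z\<in>V0. fst z = 0}"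
  proof
    have "B0 \<subseteq> {z\<in>V0. fst z = 0}"
    proof
      fix e assume e: "e \<in> B0"
      then have eB: "e \<in> B" "e \<in> V0" using B by (auto simp: B0_def)
      have "?b e w = 0" if "w \<in> span B" for w
        using that
      proof (rule span_induct)
        show "subspace {w. ?b e w = 0}" by (rule linear_subspace_kernel[OF l(2)])
        fix x assume "x \<in> B" then show "?b e x = 0" using e eB B4[of e x] by (cases "x = e") (auto simp: B0_def)
      qed
      then show "e \<in> {z\<in>V0. fst z = 0}" using slope_form_kernel[OF V0 eB(2)] eB B(3) by auto
    qed
    moreover have "subspace {z\<in>V0. fst z = 0}" using V0D(1) by (auto simp: subspace_def)
    ultimately show "span B0 \<subseteq> {z\<in>V0. fst z = 0}" by (rule span_minimal)
    show "{z\<in>V0. fst z = 0} \<subseteq> span B0"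
    proof
      fix z assume z: "z \<in> {z\<in>V0. fst z = 0}"
      then obtain u where u: "z = (\<Sum>e\<in>B. u e *\<^sub>R e)" using B(3) span_finite[OF finB] by auto
      have "u e = 0" if e: "e \<in> B" "e \<notin> B0" for e
      proof -
        have "?b z e = (\<Sum>e'\<in>B. u e' * ?b e' e)"
          by (subst u) (simp add: linear_sum[OF l(1)] linear_cmul[OF l(1)])
        also have "\<dots> = (\<Sum>e'\<in>B. if e' = e then u e * ?b e e else 0)"
          by (rule sum.cong) (use e B4 in auto)
        also have "\<dots> = u e * ?b e e" using e finB by simp
        finally have "?b z e = u e * ?b e e" .
        moreover have "?b z e = 0" using slope_form_kernel[OF V0, of z] z e B(1) by auto
        ultimately show ?thesis using e by (auto simp: B0_def)
      qed
      then have "z = (\<Sum>e\<in>B0. u e *\<^sub>R e)"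
        unfolding u by (intro sum.mono_neutral_right) (use finB in \<open>auto simp: B0_def\<close>)
      then show "z \<in> span B0" by (auto intro: span_sum span_scale span_base)
    qed
  qed
  moreover have "independent B0" using B(2) independent_mono[of B B0] by (auto simp: B0_def)
  ultimately have cB0: "card B0 = card K" using K by (metis dim_span_eq_card_independent)
  define I where "I = (B - B0) <+> K"
  have finI: "finite I" using finB finK by (simp add: I_def)
  have "card B = CARD('n)" using B(2,3) V0D(2) dim_span_eq_card_independent by metis
  moreover have "card I = card (B - B0) + card K" unfolding I_def using finB finK by (simp add: card_Plus)
  moreover have "card (B - B0) = card B - card B0" "card B0 \<le> card B"
    using finB by (auto simp: B0_def card_Diff_subset card_mono)
  ultimately have cI: "card I = CARD('n)" using cB0 by simp
  \<comment> \<open>the adapted family: a diagonalising basis off the kernel and the rescaled kernel vectors\<close>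
  define f where "f t i = (case i of Inl e \<Rightarrow> L t e | Inr k \<Rightarrow> L t k /\<^sub>R sqrt (\<tau> t))" for t i
  define D where "D i = (case i of Inl e \<Rightarrow> ?b e e | Inr k \<Rightarrow> d k)" for i
  have KV: "k \<in> V0" "fst k = 0" if "k \<in> K" for k using K(2) that span_base[of k K] by auto
  have bt: "((\<lambda>t. ?b (L t z) (L t w)) \<longlongrightarrow> ?b z w) F" if "z \<in> V0" "w \<in> V0" for z w
    unfolding slope_form_def using lim[OF that(1)] lim[OF that(2)] by (auto intro!: tendsto_intros)
  \<comment> \<open>on a Lagrangian subspace one of the two pairings suffices\<close>
  have bL: "\<forall>\<^sub>F t in F. ?b (L t z) (L t w) = fst (L t w) \<bullet> (\<beta> *\<^sub>R fst (L t z) - snd (L t z))"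
    if "z \<in> V0" "w \<in> V0" for z w
    using V L[OF that(1)] L[OF that(2)]
  proof eventually_elim
    case (elim t)
    show ?case using LagrangiansD(3)[OF elim]
      by (simp add: slope_form_def inner_diff_right inner_commute)
  qed
  have "\<forall>\<^sub>F t in F. \<forall>i\<in>I. f t i \<in> V t"
  proof (intro eventually_ball_finite finI ballI)
    fix i assume i: "i \<in> I"
    define z where "z = (case i of Inl e \<Rightarrow> e | Inr k \<Rightarrow> k)"
    have "z \<in> V0" using i B(1) KV by (auto simp: z_def I_def split: sum.split)
    from V L[OF this] show "\<forall>\<^sub>F t in F. f t i \<in> V t"
      by eventually_elim (auto simp: f_def z_def LagrangiansD subspace_scale split: sum.split)
  qed
  with V have VI: "\<forall>\<^sub>F t in F. subspace (V t) \<and> dim (V t) = card I \<and> (\<forall>i\<in>I. f t i \<in> V t)"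
    by eventually_elim (auto simp: LagrangiansD cI)
  have sq: "((\<lambda>t. sqrt (\<tau> t)) \<longlongrightarrow> 0) F" using tendsto_real_sqrt[OF \<tau>(2)] by simp
  have lim_mixed: "((\<lambda>t. ?b (L t e) (L t k /\<^sub>R sqrt (\<tau> t))) \<longlongrightarrow> 0) F" if e: "e \<in> V0" and k: "k \<in> K" for e k
  proof -
    have "((\<lambda>t. sqrt (\<tau> t) * ((fst (L t k) /\<^sub>R \<tau> t) \<bullet> (\<beta> *\<^sub>R fst (L t e) - snd (L t e))))
        \<longlongrightarrow> 0 * (\<xi> k \<bullet> (\<beta> *\<^sub>R fst e - snd e))) F"
      using lim[OF e] \<xi>[OF k] sq by (intro tendsto_intros)
    moreover have "\<forall>\<^sub>F t in F. sqrt (\<tau> t) * ((fst (L t k) /\<^sub>R \<tau> t) \<bullet> (\<beta> *\<^sub>R fst (L t e) - snd (L t e)))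
        = ?b (L t e) (L t k /\<^sub>R sqrt (\<tau> t))"
      using bL[OF e KV(1)[OF k]] \<tau>(1)
    proof eventually_elim
      case (elim t)
      have "sqrt (\<tau> t) * inverse (\<tau> t) = inverse (sqrt (\<tau> t))"
        using elim(2) by (simp add: field_simps)
      then show ?case using elim(1)
        by (simp add: bilinear_rmul[OF bilinear_slope_form] mult.assoc[symmetric])
    qed
    ultimately show ?thesis by (auto intro: Lim_transform_eventually)
  qed
  have lim_kk: "((\<lambda>t. ?b (L t k /\<^sub>R sqrt (\<tau> t)) (L t k' /\<^sub>R sqrt (\<tau> t))) \<longlongrightarrow> - (\<xi> k' \<bullet> snd k)) F"
    if k: "k \<in> K" and k': "k' \<in> K" for k k'
  proof -
    have "((\<lambda>t. (fst (L t k') /\<^sub>R \<tau> t) \<bullet> (\<beta> *\<^sub>R fst (L t k) - snd (L t k)))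
        \<longlongrightarrow> \<xi> k' \<bullet> (\<beta> *\<^sub>R fst k - snd k)) F"
      using lim[OF KV(1)[OF k]] \<xi>[OF k'] by (intro tendsto_intros)
    moreover have "\<forall>\<^sub>F t in F. (fst (L t k') /\<^sub>R \<tau> t) \<bullet> (\<beta> *\<^sub>R fst (L t k) - snd (L t k))
        = ?b (L t k /\<^sub>R sqrt (\<tau> t)) (L t k' /\<^sub>R sqrt (\<tau> t))"
      using bL[OF KV(1)[OF k] KV(1)[OF k']] \<tau>(1)
    proof eventually_elim
      case (elim t)
      have "inverse (sqrt (\<tau> t)) * inverse (sqrt (\<tau> t)) = inverse (\<tau> t)"
        using elim(2) by (simp add: inverse_mult_distrib[symmetric] del: inverse_mult_distrib)
      then show ?case using elim(1)
        by (simp add: bilinear_rmul[OF bilinear_slope_form] bilinear_lmul[OF bilinear_slope_form] mult.assoc[symmetric])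
    qed
    ultimately show ?thesis using KV(2)[OF k] by (auto intro: Lim_transform_eventually)
  qed
  have ev: "\<forall>\<^sub>F t in F. n_minus (V t) (\<lambda>q. ?b q q) = card {i\<in>I. D i < 0} \<and>
     (\<forall>q\<in>V t. (\<forall>y\<in>V t. ?b q y = 0) \<longrightarrow> q = 0)"
  proof (rule eventually_inertia[OF finI bilinear_slope_form slope_form_sym VI])
    fix i j assume i: "i \<in> I" and j: "j \<in> I"
    show "((\<lambda>t. ?b (f t i) (f t j)) \<longlongrightarrow> (if i = j then D i else 0)) F"
    proof (cases i; cases j)
      fix e e' assume "i = Inl e" "j = Inl e'"
      moreover from this i j have "e \<in> B" "e' \<in> B" by (auto simp: I_def)
      ultimately show ?thesis using bt[of e e'] subsetD[OF B(1)] B4[of e e']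
        by (cases "e = e'") (simp_all add: f_def D_def)
    next
      fix e k assume "i = Inl e" "j = Inr k"
      then show ?thesis using i j lim_mixed[of e k] B(1) by (auto simp: f_def D_def I_def)
    next
      fix e k assume "i = Inr k" "j = Inl e"
      moreover from this i j have "e \<in> B" "k \<in> K" by (auto simp: I_def)
      ultimately show ?thesis using lim_mixed[of e k] subsetD[OF B(1)]
        by (simp add: f_def D_def slope_form_sym[of \<beta> "L t k /\<^sub>R sqrt (\<tau> t)" "L t e" for t])
    next
      fix k k' assume "i = Inr k" "j = Inr k'"
      moreover from this i j have "k \<in> K" "k' \<in> K" by (auto simp: I_def)
      ultimately show ?thesis using lim_kk[of k k'] d(1)[of k k']
        by (cases "k = k'") (simp_all add: f_def D_def)
    qed
  next
    fix i assume "i \<in> I" then show "D i \<noteq> 0" using d(2) by (auto simp: I_def D_def B0_def)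
  qed
  have cnt: "card {i\<in>I. D i < 0} = neg_index \<beta> V0 + card {k\<in>K. d k < 0}"
  proof -
    have "{i\<in>I. D i < 0} = {e\<in>B. ?b e e < 0} <+> {k\<in>K. d k < 0}"
      by (auto simp: I_def D_def B0_def)
    then have "card {i\<in>I. D i < 0} = card {e\<in>B. ?b e e < 0} + card {k\<in>K. d k < 0}"
      using finB finK by (simp add: card_Plus)
    then show ?thesis
      using n_minus_orthogonal_basis[OF bilinear_slope_form B(2,3) B4] by (simp add: neg_index_def)
  qed
  from ev V show ?thesis
  proof eventually_elim
    case (elim t)
    have "z = 0" if "z \<in> V t" "fst z = 0" for z
    proof -
      have "?b z y = 0" if "y \<in> V t" for y
        using LagrangiansD(3)[OF elim(2) \<open>z \<in> V t\<close> that] \<open>fst z = 0\<close> by (simp add: slope_form_def)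
      then show ?thesis using elim(1) that by blast
    qed
    then show ?case using elim cnt by (simp add: neg_index_def)
  qed
qed

section \<open>Orthogonal projections onto Lagrangian subspaces\<close>

lemma has_vector_derivative_within_iff:
  "(f has_vector_derivative D) (at x within S) \<longleftrightarrow>
    ((\<lambda>y. (f y - f x) /\<^sub>R (y - x)) \<longlongrightarrow> D) (at x within S)"
proof -
  have "\<forall>\<^sub>F y in at x within S. norm ((1 / norm (y - x)) *\<^sub>R (f y - (f x + (y - x) *\<^sub>R D)))
      = norm ((f y - f x) /\<^sub>R (y - x) - D)"
    unfolding eventually_at_filter
  proof (intro always_eventually allI impI)
    fix y :: real assume "y \<noteq> x"
    then have "(f y - f x) /\<^sub>R (y - x) - D = (f y - (f x + (y - x) *\<^sub>R D)) /\<^sub>R (y - x)"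
    proof -
      have "(f y - (f x + (y - x) *\<^sub>R D)) /\<^sub>R (y - x) = (f y - f x) /\<^sub>R (y - x) - (inverse (y - x) * (y - x)) *\<^sub>R D"
        by (simp only: diff_diff_eq[symmetric] scaleR_diff_right scaleR_scaleR)
      then show ?thesis using \<open>y \<noteq> x\<close> by simp
    qed
    then show "norm ((1 / norm (y - x)) *\<^sub>R (f y - (f x + (y - x) *\<^sub>R D)))
      = norm ((f y - f x) /\<^sub>R (y - x) - D)" by (simp add: divide_inverse)
  qed
  then show ?thesis
    unfolding has_vector_derivative_def has_derivative_within
    by (subst tendsto_norm_zero_iff[symmetric], subst LIM_zero_iff[symmetric], subst tendsto_norm_zero_iff[symmetric])
       (auto intro: bounded_linear_scaleR_left tendsto_cong[THEN iffD1] tendsto_cong[THEN iffD2])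
qed

lemma closest_point_subspace:
  fixes V :: "'v::euclidean_space set"
  assumes V: "subspace V"
  shows "closest_point V x \<in> V" "z \<in> V \<Longrightarrow> (x - closest_point V x) \<bullet> z = 0"
    "y \<in> V \<Longrightarrow> (\<And>z. z \<in> V \<Longrightarrow> (x - y) \<bullet> z = 0) \<Longrightarrow> closest_point V x = y"
proof -
  have cl: "closed V" "convex V" "V \<noteq> {}"
    using V subspace_0[OF V] by (auto simp: closed_subspace subspace_imp_convex)
  show in_V: "closest_point V x \<in> V" using closest_point_in_set cl by blast
  show orth: "(x - closest_point V x) \<bullet> z = 0" if z: "z \<in> V" for z
  proof -
    have "(x - closest_point V x) \<bullet> ((closest_point V x + z) - closest_point V x) \<le> 0"
      using cl in_V z V by (intro closest_point_dot) (auto intro: subspace_add)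
    moreover have "(x - closest_point V x) \<bullet> ((closest_point V x - z) - closest_point V x) \<le> 0"
      using cl in_V z V by (intro closest_point_dot) (auto intro: subspace_diff)
    ultimately show ?thesis by simp
  qed
  show "closest_point V x = y" if y: "y \<in> V" "\<And>z. z \<in> V \<Longrightarrow> (x - y) \<bullet> z = 0"
  proof -
    let ?d = "closest_point V x - y"
    have "?d \<in> V" using in_V y V by (auto intro: subspace_diff)
    then have "(x - y) \<bullet> ?d = 0" "(x - closest_point V x) \<bullet> ?d = 0" using orth y(2) by auto
    then have "?d \<bullet> ?d = 0" by (simp add: inner_diff_left)
    then show ?thesis by simp
  qed
qed

lemma ortho_proj_apply:
  fixes V :: "'v::euclidean_space set"
  assumes V: "subspace V"
  shows "blinfun_apply (ortho_proj V) = closest_point V"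
  unfolding ortho_proj_def
proof (rule bounded_linear_Blinfun_apply)
  note cp = closest_point_subspace[OF V]
  have "linear (closest_point V)"
  proof (rule linearI)
    fix x y
    show "closest_point V (x + y) = closest_point V x + closest_point V y"
    proof (rule cp(3))
      show "closest_point V x + closest_point V y \<in> V" using cp(1) V by (auto intro: subspace_add)
      fix z assume "z \<in> V"
      then show "(x + y - (closest_point V x + closest_point V y)) \<bullet> z = 0"
        using cp(2)[of z x] cp(2)[of z y] by (simp add: inner_diff_left inner_add_left)
    qed
  next
    fix r x
    show "closest_point V (r *\<^sub>R x) = r *\<^sub>R closest_point V x"
    proof (rule cp(3))
      show "r *\<^sub>R closest_point V x \<in> V" using cp(1) V by (auto intro: subspace_scale)
      fix z assume "z \<in> V"
      then show "(r *\<^sub>R x - r *\<^sub>R closest_point V x) \<bullet> z = 0"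
        using cp(2)[of z x] by (simp add: inner_diff_left)
    qed
  qed
  then show "bounded_linear (closest_point V)" by (simp add: linear_linear)
qed

lemma ortho_proj_subspace:
  fixes V :: "'v::euclidean_space set"
  assumes V: "subspace V"
  shows "ortho_proj V x \<in> V" "z \<in> V \<Longrightarrow> (x - ortho_proj V x) \<bullet> z = 0"
    "z \<in> V \<Longrightarrow> ortho_proj V z = z"
    "y \<in> V \<Longrightarrow> (\<And>z. z \<in> V \<Longrightarrow> (x - y) \<bullet> z = 0) \<Longrightarrow> ortho_proj V x = y"
  using closest_point_subspace[OF V] by (auto simp: ortho_proj_apply[OF V])

text \<open>
  Convergence of the subspaces in the gap topology suffices: projecting a diagonalising basis of \<open>V0\<close>
  onto the nearby subspaces gives families with convergent Gram matrix.
\<close>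

lemma nondegenerate_inertia_stable:
  fixes V0 :: "((real^'n) \<times> (real^'n)) set" and b :: "(real^'n) \<times> (real^'n) \<Rightarrow> (real^'n) \<times> (real^'n) \<Rightarrow> real"
  assumes V0: "V0 \<in> Lagrangians" and V: "\<forall>\<^sub>F t in F. V t \<in> Lagrangians"
    and P: "((\<lambda>t. ortho_proj (V t)) \<longlongrightarrow> ortho_proj V0) F"
    and b: "bilinear b" "\<And>x y. b x y = b y x"
    and nd: "\<And>z. z \<in> V0 \<Longrightarrow> \<forall>w\<in>V0. b z w = 0 \<Longrightarrow> z = 0"
  shows "\<forall>\<^sub>F t in F. n_minus (V t) (\<lambda>z. b z z) = n_minus V0 (\<lambda>z. b z z) \<and>
    (\<forall>z\<in>V t. (\<forall>w\<in>V t. b z w = 0) \<longrightarrow> z = 0)"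
proof -
  note V0D = LagrangiansD[OF V0]
  obtain B where B: "B \<subseteq> V0" "independent B" "span B = V0" and "pairwise orthogonal B"
    and B1: "\<forall>x\<in>B. norm x = 1" and B2: "\<forall>x\<in>B. \<forall>y\<in>B. x \<noteq> y \<longrightarrow> b x y = 0"
    by (rule form_diagonalization[OF b V0D(1)])
  have finB: "finite B" using B(2) by (rule independent_imp_finite)
  have cB: "card B = CARD('n)" using B(2,3) V0D(2) dim_span_eq_card_independent by metis
  have lim: "((\<lambda>t. ortho_proj (V t) z) \<longlongrightarrow> z) F" if "z \<in> V0" for z
    using blinfun.tendsto[OF P tendsto_const[of z]] ortho_proj_subspace(3)[OF V0D(1) that] by simp
  have bt: "((\<lambda>t. b (ortho_proj (V t) z) (ortho_proj (V t) w)) \<longlongrightarrow> b z w) F"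
    if "z \<in> V0" "w \<in> V0" for z w
    using bounded_bilinear.tendsto[OF bilinear_conv_bounded_bilinear[THEN iffD1, OF b(1)] lim[OF that(1)] lim[OF that(2)]] .
  have "\<forall>\<^sub>F t in F. n_minus (V t) (\<lambda>q. b q q) = card {i\<in>B. b i i < 0} \<and>
     (\<forall>q\<in>V t. (\<forall>y\<in>V t. b q y = 0) \<longrightarrow> q = 0)"
  proof (rule eventually_inertia[where f = "\<lambda>t e. ortho_proj (V t) e"])
    show "\<forall>\<^sub>F t in F. subspace (V t) \<and> dim (V t) = card B \<and> (\<forall>i\<in>B. ortho_proj (V t) i \<in> V t)"
      using V by eventually_elim (auto simp: LagrangiansD cB ortho_proj_subspace)
    fix i j assume "i \<in> B" "j \<in> B"
    then show "((\<lambda>t. b (ortho_proj (V t) i) (ortho_proj (V t) j)) \<longlongrightarrow> (if i = j then b i i else 0)) F"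
      using bt[of i j] B(1) B2 by (cases "i = j") auto
  next
    fix i assume i: "i \<in> B"
    have l: "linear (b i)" using b(1) unfolding bilinear_def by blast
    show "b i i \<noteq> 0"
    proof
      assume "b i i = 0"
      have z: "b i w = 0" if "w \<in> span B" for w
        using that
      proof (rule span_induct)
        show "subspace {w. b i w = 0}" by (rule linear_subspace_kernel[OF l])
        fix x assume "x \<in> B" then show "b i x = 0" using i B2 \<open>b i i = 0\<close> by (cases "x = i") auto
      qed
      have "i = 0" by (rule nd[OF subsetD[OF B(1) i]]) (use z B(3) in simp)
      then show False using B1 i by auto
    qed
  qed (use finB b in auto)
  then show ?thesis
    using n_minus_orthogonal_basis[OF b(1) B(2,3)] B2 by simp
qed

lemma eventually_transverse:
  fixes V0 :: "((real^'n) \<times> (real^'n)) set"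
  assumes V0: "V0 \<in> Lagrangians" and V: "\<forall>\<^sub>F t in F. V t \<in> Lagrangians"
    and P: "((\<lambda>t. ortho_proj (V t)) \<longlongrightarrow> ortho_proj V0) F" and t: "transverse \<beta> V0"
  shows "\<forall>\<^sub>F t in F. transverse \<beta> (V t)"
proof -
  have "\<forall>\<^sub>F t in F. n_minus (V t) (\<lambda>z. gap_form \<beta> \<beta> z z) = n_minus V0 (\<lambda>z. gap_form \<beta> \<beta> z z) \<and>
    (\<forall>z\<in>V t. (\<forall>w\<in>V t. gap_form \<beta> \<beta> z w = 0) \<longrightarrow> z = 0)"
  proof (rule nondegenerate_inertia_stable[OF V0 V P bilinear_gap_form gap_form_sym])
    fix z assume z: "z \<in> V0" "\<forall>w\<in>V0. gap_form \<beta> \<beta> z w = 0"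
    then have "gap_form \<beta> \<beta> z z = 0" by blast
    then have s: "snd z = \<beta> *\<^sub>R fst z" by (simp add: gap_form_def)
    then have "(fst z, \<beta> *\<^sub>R fst z) \<in> V0" using z(1) by (metis prod.collapse)
    then have "fst z = 0" using t by (simp add: transverse_def)
    then show "z = 0" using s by (simp add: prod_eq_iff)
  qed
  then show ?thesis
  proof eventually_elim
    case (elim t)
    show ?case unfolding transverse_def
    proof (intro allI impI)
      fix x assume x: "(x, \<beta> *\<^sub>R x) \<in> V t"
      have "gap_form \<beta> \<beta> (x, \<beta> *\<^sub>R x) w = 0" for w by (simp add: gap_form_def)
      then have "(x, \<beta> *\<^sub>R x) = 0" using elim x by blast
      then show "x = 0" by (simp add: prod_eq_iff)
    qed
  qed
qed

text \<open>
  Both terms jump at crossings, but the difference does not see them: it is the negative index of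
  \<open>gap_form\<close>, which is nondegenerate as long as both slopes are admissible.
\<close>

lemma neg_index_diff_locally_const:
  fixes V0 :: "((real^'n) \<times> (real^'n)) set"
  assumes V0: "V0 \<in> Lagrangians" and V: "\<forall>\<^sub>F t in F. V t \<in> Lagrangians"
    and P: "((\<lambda>t. ortho_proj (V t)) \<longlongrightarrow> ortho_proj V0) F"
    and t: "transverse \<beta> V0" "transverse \<gamma> V0"
  shows "\<forall>\<^sub>F t in F. int (neg_index \<beta> (V t)) - int (neg_index \<gamma> (V t)) =
      int (neg_index \<beta> V0) - int (neg_index \<gamma> V0)"
proof -
  have *: "\<forall>\<^sub>F t in F. int (neg_index \<beta> (V t)) - int (neg_index \<gamma> (V t)) =
      int (neg_index \<beta> V0) - int (neg_index \<gamma> V0)"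
    if t: "transverse \<beta> V0" "transverse \<gamma> V0" and "\<beta> < \<gamma>" for \<beta> \<gamma>
  proof -
    have "\<forall>\<^sub>F t in F. n_minus (V t) (\<lambda>z. gap_form \<beta> \<gamma> z z) = n_minus V0 (\<lambda>z. gap_form \<beta> \<gamma> z z) \<and>
      (\<forall>z\<in>V t. (\<forall>w\<in>V t. gap_form \<beta> \<gamma> z w = 0) \<longrightarrow> z = 0)"
      by (rule nondegenerate_inertia_stable[OF V0 V P bilinear_gap_form gap_form_sym])
         (rule neg_index_diff(2)[OF V0 t \<open>\<beta> < \<gamma>\<close>])
    with V eventually_transverse[OF V0 V P t(1)] eventually_transverse[OF V0 V P t(2)]
    show ?thesis
  proof eventually_elim
    case (elim t)
    then show ?case using neg_index_diff(1)[OF V0 t \<open>\<beta> < \<gamma>\<close>] neg_index_diff(1)[OF elim(1-3) \<open>\<beta> < \<gamma>\<close>] elim(4)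
      by simp
  qed
  qed
  show ?thesis
  proof (cases "\<beta> = \<gamma>")
    case False
    then consider "\<beta> < \<gamma>" | "\<gamma> < \<beta>" by linarith
    then show ?thesis
    proof cases
      case 1 then show ?thesis using *[OF t] by blast
    next
      case 2 show ?thesis by (rule eventually_mono[OF *[OF t(2,1) 2]]) simp
    qed
  qed simp
qed

section \<open>Integer lifts of the index along families of Lagrangian subspaces\<close>

text \<open>
  An integer function that compensates the local changes of \<open>neg_index \<beta>\<close>, for every slope admissible at
  the point. Within one chart \<open>- neg_index \<beta>\<close> is such a function (\<open>index_lift_chart\<close>); lifts play the role
  of the universal cover of the Lagrangian Grassmannian, with the increment of a lift in place of the
  Maslov index.
\<close>

definition index_lift :: "('p::topological_space \<Rightarrow> ((real^'n) \<times> (real^'n)) set) \<Rightarrow> 'p set \<Rightarrow> ('p \<Rightarrow> int) \<Rightarrow> bool"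
  where "index_lift H T m \<longleftrightarrow> (\<forall>p\<in>T. \<forall>\<beta>. transverse \<beta> (H p) \<longrightarrow>
    (\<forall>\<^sub>F q in at p within T. m q + int (neg_index \<beta> (H q)) = m p + int (neg_index \<beta> (H p))))"

lemma index_lift_unique:
  fixes H :: "'p::topological_space \<Rightarrow> ((real^'n) \<times> (real^'n)) set"
  assumes "index_lift H T m" "index_lift H T m'" "connected T" "\<And>p. p \<in> T \<Longrightarrow> H p \<in> Lagrangians"
    "p \<in> T" "q \<in> T"
  shows "m p - m' p = m q - m' q"
proof (rule connected_local_const[OF assms(3,5,6)], intro ballI)
  fix a assume a: "a \<in> T"
  obtain \<beta> where \<beta>: "transverse \<beta> (H a)" using transverse_exists[OF assms(4)[OF a]] .
  have "\<forall>\<^sub>F q in at a within T. m q + int (neg_index \<beta> (H q)) = m a + int (neg_index \<beta> (H a))"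
    "\<forall>\<^sub>F q in at a within T. m' q + int (neg_index \<beta> (H q)) = m' a + int (neg_index \<beta> (H a))"
    using assms(1,2) a \<beta> by (auto simp: index_lift_def)
  then show "\<forall>\<^sub>F b in at a within T. m a - m' a = m b - m' b" by eventually_elim linarith
qed

lemma index_lift_subset:
  assumes "index_lift H T m" "T' \<subseteq> T"
  shows "index_lift H T' m"
  unfolding index_lift_def
proof (intro ballI allI impI)
  fix p \<beta> assume "p \<in> T'" "transverse \<beta> (H p)"
  then have "\<forall>\<^sub>F q in at p within T. m q + int (neg_index \<beta> (H q)) = m p + int (neg_index \<beta> (H p))"
    using assms by (auto simp: index_lift_def)
  then show "\<forall>\<^sub>F q in at p within T'. m q + int (neg_index \<beta> (H q)) = m p + int (neg_index \<beta> (H p))"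
    using at_le[OF assms(2)] filter_leD by blast
qed

lemma index_lift_shift: "index_lift H T m \<Longrightarrow> index_lift H T (\<lambda>p. m p + c)"
  by (simp add: index_lift_def algebra_simps)

lemma index_lift_cong:
  assumes "index_lift H T m" "\<And>p. p \<in> T \<Longrightarrow> m p = m' p"
  shows "index_lift H T m'"
  unfolding index_lift_def
proof (intro ballI allI impI)
  fix p \<beta> assume p: "p \<in> T" "transverse \<beta> (H p)"
  then have "\<forall>\<^sub>F q in at p within T. m q + int (neg_index \<beta> (H q)) = m p + int (neg_index \<beta> (H p))"
    using assms by (auto simp: index_lift_def)
  then show "\<forall>\<^sub>F q in at p within T. m' q + int (neg_index \<beta> (H q)) = m' p + int (neg_index \<beta> (H p))"
    unfolding eventually_at_filter by eventually_elim (use assms(2) p in auto)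
qed

text \<open>
  On the connected intersection the two lifts differ by a constant, which is subtracted. Closedness makes
  the neighbourhood condition at a point of one piece insensitive to the other piece.
\<close>

lemma index_lift_glue:
  fixes H :: "'p::topological_space \<Rightarrow> ((real^'n) \<times> (real^'n)) set"
  assumes l: "index_lift H T1 m1" "index_lift H T2 m2" and cl: "closed T1" "closed T2"
    and con: "connected (T1 \<inter> T2)" "T1 \<inter> T2 \<noteq> {}"
    and Lag: "\<And>p. p \<in> T1 \<union> T2 \<Longrightarrow> H p \<in> Lagrangians"
  obtains m where "index_lift H (T1 \<union> T2) m"
proof -
  obtain x0 where x0: "x0 \<in> T1" "x0 \<in> T2" using con by blast
  define c where "c = m1 x0 - m2 x0"
  define m where "m p = (if p \<in> T1 then m1 p else m2 p + c)" for p
  have diff: "m1 p - m2 p = c" if "p \<in> T1 \<inter> T2" for p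
    unfolding c_def
    by (rule index_lift_unique[where H = H and T = "T1 \<inter> T2"])
       (use l Lag x0 that con in \<open>auto intro: index_lift_subset\<close>)
  have m2: "m p = m2 p + c" if "p \<in> T2" for p 
  proof (cases "p \<in> T1")
    case True
    then show ?thesis using diff[of p] that by (simp add: m_def algebra_simps)
  qed (simp add: m_def)
  have L1: "index_lift H T1 m" by (rule index_lift_cong[OF l(1)]) (simp add: m_def)
  have L2: "index_lift H T2 m" by (rule index_lift_cong[OF index_lift_shift[OF l(2), of c]]) (simp add: m2)
  have out: "eventually P (at p within T)" if "closed T" "p \<notin> T" for P p and T :: "'p set"
    unfolding eventually_at_topological using that by (intro exI[of _ "- T"]) auto
  have "index_lift H (T1 \<union> T2) m"
    unfolding index_lift_def at_within_union eventually_sup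
  proof (intro ballI allI impI conjI)
    fix p \<beta> assume p: "p \<in> T1 \<union> T2" "transverse \<beta> (H p)"
    show "\<forall>\<^sub>F q in at p within T1. m q + int (neg_index \<beta> (H q)) = m p + int (neg_index \<beta> (H p))"
      using out[OF cl(1), of p] L1 p by (cases "p \<in> T1") (auto simp: index_lift_def)
    show "\<forall>\<^sub>F q in at p within T2. m q + int (neg_index \<beta> (H q)) = m p + int (neg_index \<beta> (H p))"
      using out[OF cl(2), of p] L2 p by (cases "p \<in> T2") (auto simp: index_lift_def)
  qed
  then show thesis by (rule that)
qed

lemma index_lift_chart:
  fixes H :: "'p::topological_space \<Rightarrow> ((real^'n) \<times> (real^'n)) set"
  assumes "\<And>p. p \<in> T \<Longrightarrow> H p \<in> Lagrangians" "\<And>p. p \<in> T \<Longrightarrow> transverse \<beta> (H p)"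
    and "continuous_on T (\<lambda>p. ortho_proj (H p))"
  shows "index_lift H T (\<lambda>p. - int (neg_index \<beta> (H p)))"
  unfolding index_lift_def
proof (intro ballI allI impI)
  fix p \<gamma> assume p: "p \<in> T" "transverse \<gamma> (H p)"
  have "\<forall>\<^sub>F q in at p within T. H q \<in> Lagrangians"
    unfolding eventually_at_filter by (intro always_eventually) (use assms(1) in auto)
  from neg_index_diff_locally_const[OF assms(1)[OF p(1)] this _ assms(2)[OF p(1)] p(2)]
  have "\<forall>\<^sub>F q in at p within T. int (neg_index \<beta> (H q)) - int (neg_index \<gamma> (H q)) =
      int (neg_index \<beta> (H p)) - int (neg_index \<gamma> (H p))"
    using assms(3) p(1) by (auto simp: continuous_on_def)
  then show "\<forall>\<^sub>F q in at p within T. - int (neg_index \<beta> (H q)) + int (neg_index \<gamma> (H q)) =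
      - int (neg_index \<beta> (H p)) + int (neg_index \<gamma> (H p))"
    by eventually_elim linarith
qed

text \<open>
  Small cells lie in one chart. Two applications of bisection glue them, first to thin strips and then
  to the whole rectangle; the overlaps are segments, hence connected.
\<close>

lemma index_lift_square:
  fixes H :: "real \<times> real \<Rightarrow> ((real^'n) \<times> (real^'n)) set"
  assumes ab: "a \<le> b" "c \<le> d" and Lag: "\<And>p. p \<in> {a..b} \<times> {c..d} \<Longrightarrow> H p \<in> Lagrangians"
    and cont: "continuous_on ({a..b} \<times> {c..d}) (\<lambda>p. ortho_proj (H p))"
  obtains m where "index_lift H ({a..b} \<times> {c..d}) m"
proof -
  let ?S = "{a..b} \<times> {c..d}"
  define J where "J r e = {max a (r - e)..min b (r + e)}" for r e
  have cell: "\<exists>e>0. \<forall>s1 s2. c \<le> s1 \<longrightarrow> s1 \<le> s \<longrightarrow> s \<le> s2 \<longrightarrow> s2 \<le> d \<longrightarrow> s2 - s1 < e \<longrightarrow>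
      (\<exists>m. index_lift H (J r e \<times> {s1..s2}) m)"
    if rs: "r \<in> {a..b}" "s \<in> {c..d}" for r s
  proof -
    have p: "(r, s) \<in> ?S" using rs by auto
    obtain \<beta> where \<beta>: "transverse \<beta> (H (r, s))" using transverse_exists[OF Lag[OF p]] .
    have "\<forall>\<^sub>F q in at (r, s) within ?S. H q \<in> Lagrangians"
      unfolding eventually_at_filter by (intro always_eventually) (use Lag in auto)
    from eventually_transverse[OF Lag[OF p] this _ \<beta>]
    have "\<forall>\<^sub>F q in at (r, s) within ?S. transverse \<beta> (H q)"
      using cont p by (auto simp: continuous_on_def)
    then obtain \<delta> where \<delta>: "\<delta> > 0" "\<And>q. q \<in> ?S \<Longrightarrow> q \<noteq> (r, s) \<Longrightarrow> dist q (r, s) < \<delta> \<Longrightarrow> transverse \<beta> (H q)"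
      unfolding eventually_at by auto
    then have tr: "transverse \<beta> (H q)" if "q \<in> ?S" "dist q (r, s) < \<delta>" for q
      using that \<beta> by (cases "q = (r, s)") auto
    show ?thesis
    proof (intro exI[of _ "\<delta> / 3"] conjI allI impI)
      fix s1 s2 assume s: "c \<le> s1" "s1 \<le> s" "s \<le> s2" "s2 \<le> d" "s2 - s1 < \<delta> / 3"
      have sub: "J r (\<delta>/3) \<times> {s1..s2} \<subseteq> ?S" using s by (auto simp: J_def)
      have "transverse \<beta> (H q)" if q: "q \<in> J r (\<delta>/3) \<times> {s1..s2}" for q
      proof (rule tr)
        show "q \<in> ?S" using q sub by blast
        have "dist q (r, s) \<le> \<bar>fst q - r\<bar> + \<bar>snd q - s\<bar>"
          using sqrt_sum_squares_le_sum_abs by (auto simp: dist_prod_def dist_real_def)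
        also have "\<dots> < \<delta>" using q s \<delta>(1) by (auto simp: J_def abs_if)
        finally show "dist q (r, s) < \<delta>" .
      qed
      then have "index_lift H (J r (\<delta>/3) \<times> {s1..s2}) (\<lambda>p. - int (neg_index \<beta> (H p)))"
        by (intro index_lift_chart) (use sub Lag cont continuous_on_subset in blast)+
      then show "\<exists>m. index_lift H (J r (\<delta>/3) \<times> {s1..s2}) m" by blast
    qed (use \<delta> in auto)
  qed
  have strip: "\<exists>e>0. \<exists>m. index_lift H (J r e \<times> {c..d}) m" if r: "r \<in> {a..b}" for r
  proof -
    define Q where "Q s1 s2 \<longleftrightarrow> (c \<le> s1 \<longrightarrow> s2 \<le> d \<longrightarrow> (\<exists>e>0. \<exists>m. index_lift H (J r e \<times> {s1..s2}) m))" for s1 s2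
    have "Q c d" using \<open>c \<le> d\<close>
    proof (induction rule: Bolzano)
      case (trans s1 s2 s3)
      show ?case unfolding Q_def
      proof (intro impI)
        assume c: "c \<le> s1" "s3 \<le> d"
        obtain e1 m1 where 1: "e1 > 0" "index_lift H (J r e1 \<times> {s1..s2}) m1" using trans c by (auto simp: Q_def)
        obtain e2 m2 where 2: "e2 > 0" "index_lift H (J r e2 \<times> {s2..s3}) m2" using trans c by (auto simp: Q_def)
        define e where "e = min e1 e2"
        have e: "e > 0" "J r e \<subseteq> J r e1" "J r e \<subseteq> J r e2" using 1 2 by (auto simp: e_def J_def)
        have i: "(J r e \<times> {s1..s2}) \<inter> (J r e \<times> {s2..s3}) = J r e \<times> {s2}" using trans by auto
        have u: "(J r e \<times> {s1..s2}) \<union> (J r e \<times> {s2..s3}) = J r e \<times> {s1..s3}" using trans by auto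
        have rJ: "r \<in> J r e" using r e by (auto simp: J_def)
        have "\<exists>m. index_lift H ((J r e \<times> {s1..s2}) \<union> (J r e \<times> {s2..s3})) m"
        proof (rule index_lift_glue)
          show "index_lift H (J r e \<times> {s1..s2}) m1" by (rule index_lift_subset[OF 1(2)]) (use e in auto)
          show "index_lift H (J r e \<times> {s2..s3}) m2" by (rule index_lift_subset[OF 2(2)]) (use e in auto)
          show "closed (J r e \<times> {s1..s2})" "closed (J r e \<times> {s2..s3})"
            by (auto simp: J_def intro: closed_Times)
          show "connected (J r e \<times> {s1..s2} \<inter> J r e \<times> {s2..s3})"
            unfolding i by (auto simp: J_def intro!: connected_Times)
          show "J r e \<times> {s1..s2} \<inter> J r e \<times> {s2..s3} \<noteq> {}" unfolding i using rJ by auto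
          show "H p \<in> Lagrangians" if "p \<in> J r e \<times> {s1..s2} \<union> J r e \<times> {s2..s3}" for p
            using that c trans by (intro Lag) (auto simp: J_def)
        qed blast
        then show "\<exists>e>0. \<exists>m. index_lift H (J r e \<times> {s1..s3}) m" unfolding u using e by blast
      qed
    next
      case (local s)
      then have "s \<in> {c..d}" by simp
      from cell[OF r this] obtain e where e: "e > 0" "\<forall>s1 s2. c \<le> s1 \<longrightarrow> s1 \<le> s \<longrightarrow> s \<le> s2 \<longrightarrow> s2 \<le> d \<longrightarrow> s2 - s1 < e \<longrightarrow>
          (\<exists>m. index_lift H (J r e \<times> {s1..s2}) m)" by (elim exE conjE)
      show ?case
      proof (intro exI[of _ e] conjI allI impI)
        fix s1 s2 assume s: "s1 \<le> s \<and> s \<le> s2 \<and> s2 - s1 < e"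
        show "Q s1 s2" unfolding Q_def
        proof (intro impI)
          assume "c \<le> s1" "s2 \<le> d"
          then have "\<exists>m. index_lift H (J r e \<times> {s1..s2}) m" using e(2) s by simp
          then show "\<exists>e>0. \<exists>m. index_lift H (J r e \<times> {s1..s2}) m" using e(1) by blast
        qed
      qed (rule e(1))
    qed
    then show ?thesis by (simp add: Q_def)
  qed
  define P where "P r1 r2 \<longleftrightarrow> (a \<le> r1 \<longrightarrow> r2 \<le> b \<longrightarrow> (\<exists>m. index_lift H ({r1..r2} \<times> {c..d}) m))" for r1 r2
  have "P a b" using \<open>a \<le> b\<close>
  proof (induction rule: Bolzano)
    case (trans r1 r2 r3)
    show ?case unfolding P_def
    proof (intro impI)
      assume c: "a \<le> r1" "r3 \<le> b"
      obtain m1 m2 where 1: "index_lift H ({r1..r2} \<times> {c..d}) m1" and 2: "index_lift H ({r2..r3} \<times> {c..d}) m2"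
        using trans c by (auto simp: P_def)
      have i: "({r1..r2} \<times> {c..d}) \<inter> ({r2..r3} \<times> {c..d}) = {r2} \<times> {c..d}" using trans by auto
      have u: "({r1..r2} \<times> {c..d}) \<union> ({r2..r3} \<times> {c..d}) = {r1..r3} \<times> {c..d}" using trans by auto
      show "\<exists>m. index_lift H ({r1..r3} \<times> {c..d}) m"
      proof (rule index_lift_glue[OF 1 2])
        show "connected ({r1..r2} \<times> {c..d} \<inter> {r2..r3} \<times> {c..d})"
          unfolding i by (auto intro!: connected_Times)
        show "{r1..r2} \<times> {c..d} \<inter> {r2..r3} \<times> {c..d} \<noteq> {}" unfolding i using ab by auto
        show "H p \<in> Lagrangians" if "p \<in> {r1..r2} \<times> {c..d} \<union> {r2..r3} \<times> {c..d}" for p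
          using that c trans by (intro Lag) auto
      qed (auto simp: u intro: closed_Times)
    qed
  next
    case (local r)
    then obtain e m where e: "e > 0" "index_lift H (J r e \<times> {c..d}) m" using strip[of r] by auto
    show ?case
    proof (intro exI[of _ e] conjI allI impI)
      fix r1 r2 assume r: "r1 \<le> r \<and> r \<le> r2 \<and> r2 - r1 < e"
      show "P r1 r2" unfolding P_def
      proof (intro impI)
        assume "a \<le> r1" "r2 \<le> b"
        then have "{r1..r2} \<times> {c..d} \<subseteq> J r e \<times> {c..d}" using r by (auto simp: J_def)
        then show "\<exists>m. index_lift H ({r1..r2} \<times> {c..d}) m"
            by (intro exI[of _ m] index_lift_subset[OF e(2)])
      qed
    qed (use e in auto)
  qed
  then show thesis using that by (auto simp: P_def)
qed

lemma index_lift_compose: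
  fixes H :: "'p::topological_space \<Rightarrow> ((real^'n) \<times> (real^'n)) set" and \<phi> :: "'q::topological_space \<Rightarrow> 'p"
  assumes "index_lift H T m" "\<phi> ` T' \<subseteq> T" "continuous_on T' \<phi>" "inj \<phi>"
  shows "index_lift (\<lambda>x. H (\<phi> x)) T' (\<lambda>x. m (\<phi> x))"
  unfolding index_lift_def
proof (intro ballI allI impI)
  fix x \<beta> assume x: "x \<in> T'" "transverse \<beta> (H (\<phi> x))"
  have "filterlim \<phi> (at (\<phi> x) within T) (at x within T')"
    unfolding filterlim_at
  proof
    show "(\<phi> \<longlongrightarrow> \<phi> x) (at x within T')" using assms(3) x(1) by (auto simp: continuous_on_def)
    show "\<forall>\<^sub>F y in at x within T'. \<phi> y \<in> T \<and> \<phi> y \<noteq> \<phi> x"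
      unfolding eventually_at_filter by (intro always_eventually) (use assms(2,4) in \<open>auto dest: injD\<close>)
  qed
  moreover have "\<forall>\<^sub>F q in at (\<phi> x) within T. m q + int (neg_index \<beta> (H q)) = m (\<phi> x) + int (neg_index \<beta> (H (\<phi> x)))"
    using assms(1,2) x by (auto simp: index_lift_def)
  ultimately show "\<forall>\<^sub>F y in at x within T'. m (\<phi> y) + int (neg_index \<beta> (H (\<phi> y))) = m (\<phi> x) + int (neg_index \<beta> (H (\<phi> x)))"
    using filterlim_iff by blast
qed

text \<open>
  Lift the whole homotopy. On the two vertical sides the subspace is constant, so the lift is constant
  there, and the increments along the two horizontal sides agree.
\<close>

lemma index_lift_homotopy_invariant:
  fixes h :: "real \<times> real \<Rightarrow> ((real^'n) \<times> (real^'n)) set"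
  assumes "a \<le> b" and Lag: "\<And>p. p \<in> {0..1} \<times> {a..b} \<Longrightarrow> h p \<in> Lagrangians"
    and cont: "continuous_on ({0..1} \<times> {a..b}) (\<lambda>p. ortho_proj (h p))"
    and ends: "\<And>r. r \<in> {0..1} \<Longrightarrow> h (r, a) = h (0, a)" "\<And>r. r \<in> {0..1} \<Longrightarrow> h (r, b) = h (0, b)"
    and lifts: "index_lift (\<lambda>t. h (0, t)) {a..b} m0" "index_lift (\<lambda>t. h (1, t)) {a..b} m1"
  shows "m0 b - m0 a = m1 b - m1 a"
proof -
  obtain m where m: "index_lift h ({0..1} \<times> {a..b}) m"
    using index_lift_square[of 0 1 a b h] Lag cont \<open>a \<le> b\<close> by auto
  have row: "m (r, b) - m' b = m (r, a) - m' a" if "r \<in> {0..1}" "index_lift (\<lambda>t. h (r, t)) {a..b} m'" for r m'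
    by (rule index_lift_unique[OF index_lift_compose[OF m, of "\<lambda>t. (r, t)"] that(2)])
       (use that Lag \<open>a \<le> b\<close> in \<open>auto intro!: continuous_intros injI\<close>)
  have col: "m (0, t) = m (1, t)" if t: "t \<in> {a..b}" and eq: "\<And>r. r \<in> {0..1} \<Longrightarrow> h (r, t) = h (0, t)" for t
  proof -
    have "index_lift (\<lambda>r. h (r, t)) {0..1} (\<lambda>r. m (r, t))"
      by (rule index_lift_compose[OF m]) (use t in \<open>auto intro!: continuous_intros injI\<close>)
    moreover have "index_lift (\<lambda>r. h (r, t)) {0..1} (\<lambda>r. 0)"
      unfolding index_lift_def eventually_at_filter
    proof (intro ballI allI impI always_eventually)
      fix r q :: real and \<beta> assume r: "r \<in> {0..1}" "q \<in> {0..1}"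
      have "h (q, t) = h (r, t)" using eq[OF r(1)] eq[OF r(2)] by metis
      then show "0 + int (neg_index \<beta> (h (q, t))) = 0 + int (neg_index \<beta> (h (r, t)))" by simp
    qed
    ultimately have "m (0, t) - 0 = m (1, t) - 0"
      by (rule index_lift_unique) (use Lag t in auto)
    then show ?thesis by simp
  qed
  show ?thesis
  proof -
    have "m (0, a) = m (1, a)" by (rule col[OF _ ends(1)]) (use \<open>a \<le> b\<close> in auto)
    moreover have "m (0, b) = m (1, b)" by (rule col[OF _ ends(2)]) (use \<open>a \<le> b\<close> in auto)
    moreover have "m (0, b) - m0 b = m (0, a) - m0 a" "m (1, b) - m1 b = m (1, a) - m1 a"
      using row[OF _ lifts(1)] row[OF _ lifts(2)] by auto
    ultimately show ?thesis by linarith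
  qed
qed

section \<open>Crossings with the vertical subspace\<close>

lemma n_plus_cong:
  assumes "\<And>q. q \<in> V \<Longrightarrow> m q = m' q"
  shows "n_plus V m = n_plus V m'"
  unfolding n_plus_def using assms by (intro arg_cong[of _ _ Max] Collect_cong) (metis subsetD)

lemma n_minus_cong:
  assumes "\<And>q. q \<in> V \<Longrightarrow> m q = m' q"
  shows "n_minus V m = n_minus V m'"
  unfolding n_minus_def using assms by (intro n_plus_cong) auto

lemma n_plus_zero [simp]: "n_plus {0::'v::euclidean_space} m = 0"
proof -
  have "{dim U |U. subspace U \<and> U \<subseteq> {0::'v} \<and> (\<forall>q\<in>U. q \<noteq> 0 \<longrightarrow> m q > 0)} = {0}"
  proof (intro set_eqI iffI)
    fix k assume "k \<in> {dim U |U. subspace U \<and> U \<subseteq> {0::'v} \<and> (\<forall>q\<in>U. q \<noteq> 0 \<longrightarrow> m q > 0)}"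
    then obtain U :: "'v set" where "k = dim U" "U \<subseteq> {0}" by blast
    then show "k \<in> {0}" by auto
  next
    fix k :: nat assume "k \<in> {0}"
    then show "k \<in> {dim U |U. subspace U \<and> U \<subseteq> {0::'v} \<and> (\<forall>q\<in>U. q \<noteq> 0 \<longrightarrow> m q > 0)}"
      by (intro CollectI exI[of _ "{0}"]) auto
  qed
  then show ?thesis by (simp add: n_plus_def)
qed

lemma n_minus_zero [simp]: "n_minus {0::'v::euclidean_space} m = 0"
  by (simp add: n_minus_def)

definition vertical :: "((real^'n) \<times> (real^'n)) set"
  where "vertical = {0} \<times> UNIV"

lemma Int_vertical: "V \<inter> vertical = {z\<in>V. fst z = 0}"
  by (auto simp: vertical_def)

lemma crossing_vertical:
  assumes "\<Gamma> t \<in> Lagrangians"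
  shows "crossing \<Gamma> vertical t \<longleftrightarrow> \<not> (\<forall>z\<in>\<Gamma> t. fst z = 0 \<longrightarrow> z = 0)"
  using subspace_0[OF LagrangiansD(1)[OF assms]] unfolding crossing_def Int_vertical by auto

text \<open>
  The crossing form in terms of the derivative of the projections. If \<open>w(t)\<close> denotes the graph map
  at \<open>q\<close> then \<open>w(t) = (P(t) - P(t\<^sub>0)) (q + w(t))\<close>, so \<open>w'(t\<^sub>0) = P'(t\<^sub>0) q\<close>.
\<close>

lemma crossing_form_eq:
  fixes \<Gamma> :: "real \<Rightarrow> ((real^'n) \<times> (real^'n)) set"
  assumes Lag: "\<And>t. t \<in> {a..b} \<Longrightarrow> \<Gamma> t \<in> Lagrangians" and t0: "t0 \<in> {a..b}" and "a < b"
    and P': "((\<lambda>t. ortho_proj (\<Gamma> t)) has_vector_derivative P') (at t0 within {a..b})"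
    and q: "q \<in> \<Gamma> t0" "fst q = 0"
  shows "crossing_form \<Gamma> a b t0 q = - (fst (P' q) \<bullet> snd q)"
proof -
  let ?F = "at t0 within {a..b}"
  let ?V0 = "\<Gamma> t0"
  define P where "P t = ortho_proj (\<Gamma> t)" for t
  define w where "w t = graph_map ?V0 (orthogonal_comp ?V0) (\<Gamma> t) q" for t
  note V0 = LagrangiansD[OF Lag[OF t0]]
  have sub: "subspace (\<Gamma> t)" if "t \<in> {a..b}" for t using LagrangiansD Lag that by blast
  have nt: "?F \<noteq> bot" using t0 \<open>a < b\<close> by (simp add: trivial_limit_within islimpt_Icc)
  have Pc: "((\<lambda>t. P t) \<longlongrightarrow> P t0) ?F"
    using has_vector_derivative_continuous[OF P'] by (simp add: continuous_within P_def)
  then have ev: "\<forall>\<^sub>F t in ?F. norm (P t - P t0) < 1/2"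
    using tendstoD[of P "P t0" ?F "1/2"] by (simp add: dist_norm)
  have graph: "norm (w t) \<le> 2 * norm (P t - P t0) * norm q \<and> w t = (P t - P t0) (q + w t)"
    if t: "t \<in> {a..b}" and nrm: "norm (P t - P t0) < 1/2" for t
  proof -
    let ?D = "P t - P t0"
    have Dle: "norm (?D x) \<le> 1/2 * norm x" for x
      using norm_blinfun[of ?D x] nrm by (smt (verit) mult_right_mono norm_ge_zero)
    have oc: "x \<in> orthogonal_comp ?V0 \<longleftrightarrow> P t0 x = 0" for x
    proof
      assume "x \<in> orthogonal_comp ?V0"
      then show "P t0 x = 0" unfolding P_def
        by (intro ortho_proj_subspace(4)[OF V0(1)]) (auto simp: orthogonal_comp_def orthogonal_def inner_commute subspace_0[OF V0(1)])
    next
      assume "P t0 x = 0"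
      then show "x \<in> orthogonal_comp ?V0"
        using ortho_proj_subspace(2)[OF V0(1), of _ x] by (auto simp: orthogonal_comp_def orthogonal_def P_def inner_commute)
    qed
    have inj: "inj_on (P t0) (\<Gamma> t)"
    proof (subst linear_inj_on_iff_eq_0[OF _ sub[OF t]])
      show "linear (P t0)" by (simp add: blinfun.bounded_linear_right bounded_linear.linear)
      show "\<forall>x\<in>\<Gamma> t. P t0 x = 0 \<longrightarrow> x = 0"
      proof (intro ballI impI)
        fix x assume x: "x \<in> \<Gamma> t" "P t0 x = 0"
        then have "?D x = x" using ortho_proj_subspace(3)[OF sub[OF t]] by (simp add: P_def blinfun.diff_left)
        then show "x = 0" using Dle[of x] by simp
      qed
    qed
    have "P t0 ` \<Gamma> t = ?V0"
    proof (rule subspace_dim_equal)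
      show "subspace (P t0 ` \<Gamma> t)" by (rule linear_subspace_image) (auto simp: sub[OF t] blinfun.bounded_linear_right bounded_linear.linear)
      show "P t0 ` \<Gamma> t \<subseteq> ?V0" using ortho_proj_subspace(1)[OF V0(1)] by (auto simp: P_def)
      have "dim (P t0 ` \<Gamma> t) = dim (\<Gamma> t)"
        by (rule dim_image_eq) (use inj sub[OF t] in \<open>auto simp: span_eq_iff[THEN iffD2] blinfun.bounded_linear_right bounded_linear.linear\<close>)
      then show "dim ?V0 \<le> dim (P t0 ` \<Gamma> t)" using LagrangiansD(2)[OF Lag[OF t]] V0(2) by simp
    qed (use V0 in auto)
    then obtain z where z: "z \<in> \<Gamma> t" "P t0 z = q" using q(1) by (metis imageE)
    have Pq: "P t0 q = q" using ortho_proj_subspace(3)[OF V0(1) q(1)] by (simp add: P_def)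
    have ex: "z - q \<in> orthogonal_comp ?V0 \<and> q + (z - q) \<in> \<Gamma> t"
      using z Pq by (simp add: oc blinfun.diff_right)
    have uniq: "x = z - q" if "x \<in> orthogonal_comp ?V0 \<and> q + x \<in> \<Gamma> t" for x
    proof -
      have "q + x \<in> \<Gamma> t" "P t0 (q + x) = P t0 z" using that z Pq by (auto simp: oc blinfun.add_right)
      then have "q + x = z" using inj z(1) by (auto dest: inj_onD)
      then show ?thesis by (simp add: algebra_simps)
    qed
    have weq: "w t = z - q" unfolding w_def graph_map_def using ex uniq by (intro the_equality)
    have w1: "w t = ?D (q + w t)"
      using z(2) ortho_proj_subspace(3)[OF sub[OF t] z(1)] by (simp add: weq P_def blinfun.diff_left)
    have "norm (w t) \<le> norm (?D q) + norm (?D (w t))"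
      by (subst w1) (simp add: blinfun.add_right norm_triangle_ineq)
    also have "\<dots> \<le> norm ?D * norm q + 1/2 * norm (w t)" using norm_blinfun[of ?D q] Dle[of "w t"] by linarith
    finally have "norm (w t) \<le> 2 * norm ?D * norm q" by linarith
    then show ?thesis using w1 by blast
  qed
  have w0: "w t0 = 0" using graph[OF t0] by simp
  have in_ab: "\<forall>\<^sub>F t in ?F. t \<in> {a..b}" unfolding eventually_at_filter by simp
  have "((\<lambda>t. 2 * norm (P t - P t0) * norm q) \<longlongrightarrow> 2 * norm (P t0 - P t0) * norm q) ?F"
    by (intro tendsto_intros Pc)
  then have bd: "((\<lambda>t. 2 * norm (P t - P t0) * norm q) \<longlongrightarrow> 0) ?F" by simp
  have "\<forall>\<^sub>F t in ?F. norm (w t) \<le> 2 * norm (P t - P t0) * norm q"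
    using ev in_ab by eventually_elim (use graph in blast)
  then have wlim: "(w \<longlongrightarrow> 0) ?F" using bd by (rule Lim_null_comparison)
  have "((\<lambda>t. ((P t - P t0) /\<^sub>R (t - t0)) (q + w t)) \<longlongrightarrow> P' (q + 0)) ?F"
    using P' wlim unfolding has_vector_derivative_within_iff P_def[symmetric]
    by (intro blinfun.tendsto tendsto_intros)
  moreover have "\<forall>\<^sub>F t in ?F. ((P t - P t0) /\<^sub>R (t - t0)) (q + w t) = (w t - w t0) /\<^sub>R (t - t0)"
    using ev in_ab
  proof eventually_elim
    case (elim t)
    then have "(P t - P t0) (q + w t) = w t" using graph[OF elim(2,1)] by simp
    then show ?case by (simp add: w0 blinfun.scaleR_left)
  qed
  ultimately have "((\<lambda>t. (w t - w t0) /\<^sub>R (t - t0)) \<longlongrightarrow> P' (q + 0)) ?F"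
    by (rule Lim_transform_eventually)
  then have "(w has_vector_derivative P' q) ?F" by (simp add: has_vector_derivative_within_iff)
  then have "((\<lambda>t. symp q (w t)) has_vector_derivative symp q (P' q)) ?F"
    unfolding symp_def by (intro bounded_linear.has_vector_derivative[OF bounded_linear_inner_right])
  then have "crossing_form \<Gamma> a b t0 q = symp q (P' q)"
    unfolding crossing_form_def w_def by (rule vector_derivative_within[OF nt])
  then show ?thesis using q(2) by (simp add: symp_eq inner_commute)
qed

text \<open>
  One-sided version of the change of index at a regular crossing, for both sides at once: \<open>c\<close> is positive
  on the right and negative on the left, and \<open>(t - t0) / c\<close> is the positive scale \<open>\<tau>\<close>.
\<close>

lemma one_sided_index_jump:
  fixes \<Gamma> :: "real \<Rightarrow> ((real^'n) \<times> (real^'n)) set" and c :: real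
  assumes Lag: "\<And>t. t \<in> S \<Longrightarrow> \<Gamma> t \<in> Lagrangians" "\<Gamma> t0 \<in> Lagrangians" and tr: "transverse \<beta> (\<Gamma> t0)"
    and P': "((\<lambda>t. ortho_proj (\<Gamma> t)) has_vector_derivative P') (at t0 within S)"
    and c: "c \<noteq> 0" "\<And>t. t \<in> S \<Longrightarrow> t \<noteq> t0 \<Longrightarrow> c * (t - t0) > 0"
    and form: "\<And>q. q \<in> \<Gamma> t0 \<inter> vertical \<Longrightarrow> m q = - (fst (P' q) \<bullet> snd q)"
    and nd: "nondegenerate_form (\<Gamma> t0 \<inter> vertical) m"
  shows "\<forall>\<^sub>F t in at t0 within S.
    neg_index \<beta> (\<Gamma> t) = neg_index \<beta> (\<Gamma> t0) + n_minus (\<Gamma> t0 \<inter> vertical) (\<lambda>q. c * m q) \<and>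
    (\<forall>z\<in>\<Gamma> t. fst z = 0 \<longrightarrow> z = 0)"
proof (cases "at t0 within S = bot")
  case False
  let ?F = "at t0 within S" and ?V0 = "\<Gamma> t0" and ?K = "\<Gamma> t0 \<inter> vertical"
  note V0 = LagrangiansD[OF Lag(2)]
  define L where "L t = ortho_proj (\<Gamma> t)" for t
  have inS: "\<forall>\<^sub>F t in ?F. t \<in> S \<and> t \<noteq> t0" unfolding eventually_at_filter by simp
  have VL: "\<forall>\<^sub>F t in ?F. \<Gamma> t \<in> Lagrangians" using inS by eventually_elim (use Lag in auto)
  have Lin: "\<forall>\<^sub>F t in ?F. L t z \<in> \<Gamma> t" for z
    using VL by eventually_elim (auto simp: L_def LagrangiansD ortho_proj_subspace)
  have Lc: "((\<lambda>t. L t) \<longlongrightarrow> L t0) ?F"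
    using has_vector_derivative_continuous[OF P'] by (simp add: continuous_within L_def)
  have L0: "((\<lambda>t. L t z) \<longlongrightarrow> z) ?F" if "z \<in> ?V0" for z
    using blinfun.tendsto[OF Lc tendsto_const[of z]] ortho_proj_subspace(3)[OF V0(1) that] by (simp add: L_def)
  have dq: "((\<lambda>t. (L t z - L t0 z) /\<^sub>R (t - t0)) \<longlongrightarrow> P' z) ?F" for z
    using blinfun.tendsto[OF P'[unfolded has_vector_derivative_within_iff] tendsto_const[of z]]
    by (simp add: L_def blinfun.scaleR_left blinfun.diff_left)
  have id0: "L t0 z = z" if "z \<in> ?V0" for z using ortho_proj_subspace(3)[OF V0(1) that] by (simp add: L_def)
  have fdq: "((\<lambda>t. fst (L t k) /\<^sub>R (t - t0)) \<longlongrightarrow> fst (P' k)) ?F" if "k \<in> ?K" for k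
    using tendsto_fst[OF dq[of k]] id0[of k] that by (simp add: vertical_def mem_Times_iff)
  have subK: "subspace ?K" unfolding Int_vertical using V0(1) by (auto simp: subspace_def)
  define b :: "(real^'n) \<times> (real^'n) \<Rightarrow> (real^'n) \<times> (real^'n) \<Rightarrow> real"
    where "b p q = c * (fst (P' p) \<bullet> snd q)" for p q
  \<comment> \<open>differentiate the Lagrangian identity along the projections\<close>
  have bsym: "b p q = b q p" if pq: "p \<in> ?K" "q \<in> ?K" for p q
  proof -
    have l1: "((\<lambda>t. (fst (L t p) /\<^sub>R (t - t0)) \<bullet> snd (L t q)) \<longlongrightarrow> fst (P' p) \<bullet> snd q) ?F"
      using tendsto_inner[OF fdq[OF pq(1)] tendsto_snd[OF L0[of q]]] pq by blast
    have l2: "((\<lambda>t. (fst (L t q) /\<^sub>R (t - t0)) \<bullet> snd (L t p)) \<longlongrightarrow> fst (P' q) \<bullet> snd p) ?F"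
      using tendsto_inner[OF fdq[OF pq(2)] tendsto_snd[OF L0[of p]]] pq by blast
    have "\<forall>\<^sub>F t in ?F. (fst (L t p) /\<^sub>R (t - t0)) \<bullet> snd (L t q) = (fst (L t q) /\<^sub>R (t - t0)) \<bullet> snd (L t p)"
      using VL Lin[of p] Lin[of q] by eventually_elim (simp add: LagrangiansD(3))
    from tendsto_unique[OF False Lim_transform_eventually[OF l1 this] l2]
    have "fst (P' p) \<bullet> snd q = fst (P' q) \<bullet> snd p" .
    then show ?thesis by (simp add: b_def)
  qed
  have bil: "bilinear b"
    unfolding bilinear_def
    by (intro conjI allI linearI) (simp_all add: b_def blinfun.bilinear_simps inner_add_left inner_add_right distrib_left)
  obtain K where K: "K \<subseteq> ?K" "independent K" "span K = ?K" and "pairwise orthogonal K"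
    and K1: "\<forall>x\<in>K. norm x = 1" and K2: "\<forall>x\<in>K. \<forall>y\<in>K. x \<noteq> y \<longrightarrow> b x y = 0"
    by (rule form_diagonalization[OF bil bsym subK])
  have bm: "b q q = - (c * m q)" if "q \<in> ?K" for q using form[OF that] by (simp add: b_def)
  have bnz: "b k k \<noteq> 0" if k: "k \<in> K" for k
  proof
    assume bk: "b k k = 0"
    have l: "linear (b k)" using bil unfolding bilinear_def by blast
    have z: "b k q = 0" if "q \<in> span K" for q
      using that
    proof (rule span_induct)
      show "subspace {w. b k w = 0}" by (rule linear_subspace_kernel[OF l])
      fix x assume "x \<in> K" then show "b k x = 0" using k K2 bk by (cases "x = k") auto
    qed
    have "(m (k + q) - m k - m q) / 2 = 0" if q: "q \<in> ?K" for q
    proof -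
      have kK: "k \<in> ?K" using k K by auto
      have "- (c * m (k + q)) = b (k + q) (k + q)" using bm[of "k + q"] subspace_add[OF subK kK q] by simp
      also have "\<dots> = b k k + b k q + b q k + b q q" by (simp add: bilinear_ladd[OF bil] bilinear_radd[OF bil])
      also have "\<dots> = - (c * m q)" using bk z[of q] q K(3) bsym[OF kK q] bm[OF q] by simp
      finally have "m (k + q) = m q" using c(1) by simp
      moreover have "m k = 0" using bk bm[OF kK] c(1) by simp
      ultimately show ?thesis by simp
    qed
    then have "k = 0" using nd k K(1) unfolding nondegenerate_form_def by blast
    then show False using K1 k by auto
  qed
  have "\<forall>\<^sub>F t in ?F. neg_index \<beta> (\<Gamma> t) = neg_index \<beta> ?V0 + card {k\<in>K. - b k k < 0} \<and>
    (\<forall>z\<in>\<Gamma> t. fst z = 0 \<longrightarrow> z = 0)"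
  proof (rule negative_index_near_crossing[OF Lag(2) tr VL Lin L0])
    show "\<forall>\<^sub>F t in ?F. 0 < (t - t0) / c"
    proof (rule eventually_mono[OF inS])
      fix t assume "t \<in> S \<and> t \<noteq> t0"
      then have "c * (t - t0) > 0" using c(2) by blast
      then show "0 < (t - t0) / c" using zero_less_mult_iff zero_less_divide_iff by (metis mult.commute)
    qed
    have "((\<lambda>t. (t - t0) / c) \<longlongrightarrow> (t0 - t0) / c) ?F" by (intro tendsto_intros c(1))
    then show "((\<lambda>t. (t - t0) / c) \<longlongrightarrow> 0) ?F" by simp
    show "span K = {z \<in> ?V0. fst z = 0}" using K(3) by (simp add: Int_vertical)
    show "((\<lambda>t. fst (L t k) /\<^sub>R ((t - t0) / c)) \<longlongrightarrow> c *\<^sub>R fst (P' k)) ?F" if "k \<in> K" for k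
      using tendsto_scaleR[OF tendsto_const[of c] fdq[of k]] that K(1) by (auto simp: divide_inverse mult.commute)
    show "(c *\<^sub>R fst (P' k')) \<bullet> snd k = (if k = k' then - (- b k k) else 0)" if "k \<in> K" "k' \<in> K" for k k'
      using K2 that by (auto simp: b_def)
    show "- b k k \<noteq> 0" if "k \<in> K" for k using bnz[OF that] by simp
  qed (use K(2) in auto)
  moreover have "card {k\<in>K. - b k k < 0} = n_minus ?K (\<lambda>q. c * m q)"
  proof -
    have "n_minus ?K (\<lambda>q. c * m q) = n_minus ?K (\<lambda>q. - b q q)"
      by (rule n_minus_cong) (simp add: bm)
    also have "\<dots> = card {k\<in>K. - b k k < 0}"
      using n_minus_orthogonal_basis[OF bilinear_minus[OF bil] K(2,3)] K2 by simp
    finally show ?thesis by simp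
  qed
  ultimately show ?thesis by simp
qed simp

text \<open>
  Regular crossings are isolated, so there are finitely many. Just after a crossing \<open>neg_index\<close> exceeds
  its value at the crossing by the number of negative squares, just before it by the number of positive
  squares; the lift falls short by the same amounts. At the endpoints only one side contributes.
\<close>

lemma regular_path_index_lift:
  fixes \<Gamma> :: "real \<Rightarrow> ((real^'n) \<times> (real^'n)) set"
  assumes reg: "regular_path \<Gamma> vertical a b" and "a < b"
  obtains m where "index_lift \<Gamma> {a..b} m" "m b - m a = Mas_regular \<Gamma> vertical a b"
proof -
  have Lag: "\<And>t. t \<in> {a..b} \<Longrightarrow> \<Gamma> t \<in> Lagrangians"
    using reg by (auto simp: regular_path_def C1_path_def)
  obtain P' where "\<forall>t\<in>{a..b}. ((\<lambda>t. ortho_proj (\<Gamma> t)) has_vector_derivative P' t) (at t within {a..b})"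
    using reg unfolding regular_path_def C1_path_def by blast
  then have P': "\<And>t. t \<in> {a..b} \<Longrightarrow> ((\<lambda>t. ortho_proj (\<Gamma> t)) has_vector_derivative P' t) (at t within {a..b})"
    by blast
  define cf where "cf = crossing_form \<Gamma> a b"
  have cfe: "cf t q = - (fst (P' t q) \<bullet> snd q)" if "t \<in> {a..b}" "q \<in> \<Gamma> t \<inter> vertical" for t q
    using crossing_form_eq[OF Lag that(1) \<open>a < b\<close> P'[OF that(1)], of q] that(2) by (auto simp: cf_def vertical_def)
  have nd: "nondegenerate_form (\<Gamma> t \<inter> vertical) (cf t)" if "t \<in> {a..b}" for t
  proof (cases "crossing \<Gamma> vertical t")
    case True then show ?thesis using reg that by (simp add: regular_path_def cf_def)
  next
    case False
    then show ?thesis by (simp add: crossing_def nondegenerate_form_def)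
  qed
  define jp where "jp t = int (n_plus (\<Gamma> t \<inter> vertical) (cf t))" for t
  define jm where "jm t = int (n_minus (\<Gamma> t \<inter> vertical) (cf t))" for t
  have j0: "jp t = 0 \<and> jm t = 0" if "\<not> crossing \<Gamma> vertical t" for t
    using that by (simp add: crossing_def jp_def jm_def)
  have right: "\<forall>\<^sub>F t in at t0 within {t0<..b}. int (neg_index \<beta> (\<Gamma> t)) = int (neg_index \<beta> (\<Gamma> t0)) + jm t0 \<and> \<not> crossing \<Gamma> vertical t"
    if t0: "t0 \<in> {a..b}" and tr: "transverse \<beta> (\<Gamma> t0)" for t0 \<beta>
  proof -
    have sub: "{t0<..b} \<subseteq> {a..b}" using t0 by auto
    have "\<forall>\<^sub>F t in at t0 within {t0<..b}.
      neg_index \<beta> (\<Gamma> t) = neg_index \<beta> (\<Gamma> t0) + n_minus (\<Gamma> t0 \<inter> vertical) (\<lambda>q. 1 * cf t0 q) \<and>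
      (\<forall>z\<in>\<Gamma> t. fst z = 0 \<longrightarrow> z = 0)"
      by (rule one_sided_index_jump[where P' = "P' t0"])
         (use t0 sub Lag tr cfe nd has_vector_derivative_within_subset[OF P'[OF t0] sub] in auto)
    moreover have "\<forall>\<^sub>F t in at t0 within {t0<..b}. t \<in> {a..b}"
      unfolding eventually_at_filter by (intro always_eventually) (use sub in auto)
    ultimately show ?thesis
      by eventually_elim (use crossing_vertical Lag in \<open>auto simp: jm_def\<close>)
  qed
  have left: "\<forall>\<^sub>F t in at t0 within {a..<t0}. int (neg_index \<beta> (\<Gamma> t)) = int (neg_index \<beta> (\<Gamma> t0)) + jp t0 \<and> \<not> crossing \<Gamma> vertical t"
    if t0: "t0 \<in> {a..b}" and tr: "transverse \<beta> (\<Gamma> t0)" for t0 \<beta>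
  proof -
    have sub: "{a..<t0} \<subseteq> {a..b}" using t0 by auto
    have "\<forall>\<^sub>F t in at t0 within {a..<t0}.
      neg_index \<beta> (\<Gamma> t) = neg_index \<beta> (\<Gamma> t0) + n_minus (\<Gamma> t0 \<inter> vertical) (\<lambda>q. (-1) * cf t0 q) \<and>
      (\<forall>z\<in>\<Gamma> t. fst z = 0 \<longrightarrow> z = 0)"
      by (rule one_sided_index_jump[where P' = "P' t0"])
         (use t0 sub Lag tr cfe nd has_vector_derivative_within_subset[OF P'[OF t0] sub] in auto)
    moreover have "\<forall>\<^sub>F t in at t0 within {a..<t0}. t \<in> {a..b}"
      unfolding eventually_at_filter by (intro always_eventually) (use sub in auto)
    ultimately show ?thesis
      by eventually_elim (use crossing_vertical Lag in \<open>auto simp: jp_def n_minus_def\<close>)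
  qed
  have split: "at t0 within {a..b} = sup (at t0 within {a..<t0}) (at t0 within {t0<..b})" if "t0 \<in> {a..b}" for t0
  proof -
    have "{a..b} - {t0} = {a..<t0} \<union> {t0<..b}" using that by auto
    moreover have "at t0 within {a..b} = at t0 within ({a..b} - {t0})"
      unfolding at_within_def by simp
    ultimately show ?thesis by (simp only: at_within_union)
  qed
  define C where "C = {t\<in>{a..b}. crossing \<Gamma> vertical t}"
  have isol: "\<forall>\<^sub>F t in at t0 within {a..b}. t \<notin> C" if t0: "t0 \<in> {a..b}" for t0
  proof -
    obtain \<beta> where tr: "transverse \<beta> (\<Gamma> t0)" using transverse_exists[OF Lag[OF t0]] .
    show ?thesis
      unfolding split[OF t0] eventually_sup
    proof
      show "\<forall>\<^sub>F t in at t0 within {a..<t0}. t \<notin> C"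
        using left[OF t0 tr] by eventually_elim (simp add: C_def)
      show "\<forall>\<^sub>F t in at t0 within {t0<..b}. t \<notin> C"
        using right[OF t0 tr] by eventually_elim (simp add: C_def)
    qed
  qed
  have "finite ({a..b} \<inter> C)"
  proof (rule finite_not_islimpt_in_compact)
    fix t0 assume t0: "t0 \<in> {a..b}"
    from isol[OF t0] have "\<forall>\<^sub>F t in at t0. t \<notin> C"
      unfolding eventually_at_filter by eventually_elim (auto simp: C_def)
    then show "\<not> t0 islimpt C" by (simp add: islimpt_iff_eventually)
  qed simp
  moreover have "{a..b} \<inter> C = C" by (auto simp: C_def)
  ultimately have finC: "finite C" by simp
  define I where "I t = (\<Sum>s\<in>{s\<in>C. a < s \<and> s < t}. jp s - jm s)" for t
  \<comment> \<open>at a crossing the positive squares are already counted and the negative ones are not yet\<close>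
  define m where "m t = (if t = a then 0 else - jm a + I t + jp t)" for t
  have "index_lift \<Gamma> {a..b} m"
    unfolding index_lift_def
  proof (intro ballI allI impI)
    fix t0 \<beta> assume t0: "t0 \<in> {a..b}" and tr: "transverse \<beta> (\<Gamma> t0)"
    obtain \<delta> where \<delta>: "\<delta> > 0" and nc': "\<forall>t\<in>{a..b}. t \<noteq> t0 \<and> dist t t0 < \<delta> \<longrightarrow> t \<notin> C"
      using isol[OF t0] unfolding eventually_at by blast
    have nc: "t \<notin> C" if "t \<in> {a..b}" "t \<noteq> t0" "dist t t0 < \<delta>" for t using nc' that by blast
    have near: "\<forall>\<^sub>F t in at t0 within {a..b}. dist t t0 < \<delta> \<and> t \<in> {a..b}"
      unfolding eventually_at using \<delta> by blast
    have nl: "\<forall>\<^sub>F t in at t0 within {a..<t0}. (dist t t0 < \<delta> \<and> t \<in> {a..b}) \<and> t < t0"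
      and nr: "\<forall>\<^sub>F t in at t0 within {t0<..b}. (dist t t0 < \<delta> \<and> t \<in> {a..b}) \<and> t > t0"
      using near unfolding split[OF t0] eventually_sup eventually_at_filter
      by (auto elim: eventually_mono)
    show "\<forall>\<^sub>F t in at t0 within {a..b}. m t + int (neg_index \<beta> (\<Gamma> t)) = m t0 + int (neg_index \<beta> (\<Gamma> t0))"
      unfolding split[OF t0] eventually_sup
    proof
      show "\<forall>\<^sub>F t in at t0 within {a..<t0}. m t + int (neg_index \<beta> (\<Gamma> t)) = m t0 + int (neg_index \<beta> (\<Gamma> t0))"
        using left[OF t0 tr] nl
      proof eventually_elim
        case (elim t)
        have "{s\<in>C. a < s \<and> s < t0} = {s\<in>C. a < s \<and> s < t}"
        proof (intro Collect_cong iffI)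
          fix s assume s: "s \<in> C \<and> a < s \<and> s < t0"
          then have "\<not> t \<le> s" using nc[of s] elim by (auto simp: C_def dist_real_def)
          then show "s \<in> C \<and> a < s \<and> s < t" using s by auto
        qed (use elim in auto)
        then have "I t0 = I t" by (simp add: I_def)
        moreover have "jp t = 0" "jm t = 0" using j0[of t] elim by auto
        moreover have "I a = 0" by (auto simp: I_def intro: sum.neutral)
        ultimately show ?case using elim t0 by (auto simp: m_def)
      qed
    next
      show "\<forall>\<^sub>F t in at t0 within {t0<..b}. m t + int (neg_index \<beta> (\<Gamma> t)) = m t0 + int (neg_index \<beta> (\<Gamma> t0))"
        using right[OF t0 tr] nr
      proof eventually_elim
        case (elim t)
        have jt: "jp t = 0" "jm t = 0" using j0[of t] elim by auto
        have Iext: "I t = I t0 + (if a < t0 then jp t0 - jm t0 else 0)"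
        proof -
          have e: "{s\<in>C. a < s \<and> s < t} = {s\<in>C. a < s \<and> s < t0} \<union> (if a < t0 \<and> t0 \<in> C then {t0} else {})"
          proof (intro set_eqI iffI)
            fix s assume s: "s \<in> {s\<in>C. a < s \<and> s < t}"
            then have "\<not> t0 < s" using nc[of s] elim by (auto simp: C_def dist_real_def)
            then consider "s < t0" | "s = t0" by linarith
            then show "s \<in> {s\<in>C. a < s \<and> s < t0} \<union> (if a < t0 \<and> t0 \<in> C then {t0} else {})"
              using s by cases auto
          qed (use elim in \<open>auto split: if_splits\<close>)
          have "jp t0 = 0 \<and> jm t0 = 0" if "t0 \<notin> C" using j0[of t0] that t0 by (auto simp: C_def)
          then show ?thesis unfolding I_def e using finC by (auto simp: sum.insert_if)
        qed
        have "I a = 0" by (auto simp: I_def intro: sum.neutral)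
        then show ?case using elim t0 jt Iext by (auto simp: m_def)
      qed
    qed
  qed
  moreover have "m b - m a = Mas_regular \<Gamma> vertical a b"
  proof -
    have "{s\<in>C. a < s \<and> s < b} = {t\<in>{a<..<b}. crossing \<Gamma> vertical t}" by (auto simp: C_def)
    then show ?thesis using \<open>a < b\<close> by (simp add: m_def Mas_regular_def I_def jp_def jm_def cf_def)
  qed
  ultimately show thesis by (rule that)
qed

section \<open>Smooth dependence of the projection\<close>

definition C1_curve :: "(real \<Rightarrow> 'v::real_normed_vector) \<Rightarrow> real set \<Rightarrow> bool"
  where "C1_curve f S \<longleftrightarrow> (\<exists>f'. (\<forall>t\<in>S. (f has_vector_derivative f' t) (at t within S)) \<and> continuous_on S f')"

lemma C1_curveI:
  "(\<And>t. t \<in> S \<Longrightarrow> (f has_vector_derivative f' t) (at t within S)) \<Longrightarrow> continuous_on S f' \<Longrightarrow> C1_curve f S"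
  by (auto simp: C1_curve_def)

lemma C1_curve_continuous: "C1_curve f S \<Longrightarrow> continuous_on S f"
  unfolding C1_curve_def continuous_on_eq_continuous_within using has_vector_derivative_continuous by blast

lemma C1_curve_const: "C1_curve (\<lambda>t. c) S"
  by (rule C1_curveI[where f' = "\<lambda>t. 0"]) auto

lemma C1_curve_add:
  assumes "C1_curve f S" "C1_curve g S"
  shows "C1_curve (\<lambda>t. f t + g t) S"
proof -
  obtain f' g' where "\<forall>t\<in>S. (f has_vector_derivative f' t) (at t within S)" "continuous_on S f'"
    "\<forall>t\<in>S. (g has_vector_derivative g' t) (at t within S)" "continuous_on S g'"
    using assms unfolding C1_curve_def by blast
  then show ?thesis
    by (intro C1_curveI[where f' = "\<lambda>t. f' t + g' t"] has_vector_derivative_add continuous_on_add) auto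
qed

lemma C1_curve_bilinear:
  assumes b: "bounded_bilinear b" and "C1_curve f S" "C1_curve g S"
  shows "C1_curve (\<lambda>t. b (f t) (g t)) S"
proof -
  obtain f' g' where f: "\<forall>t\<in>S. (f has_vector_derivative f' t) (at t within S)" "continuous_on S f'"
    and g: "\<forall>t\<in>S. (g has_vector_derivative g' t) (at t within S)" "continuous_on S g'"
    using assms unfolding C1_curve_def by blast
  show ?thesis
  proof (rule C1_curveI)
    show "((\<lambda>t. b (f t) (g t)) has_vector_derivative b (f t) (g' t) + b (f' t) (g t)) (at t within S)"
      if "t \<in> S" for t
      using bounded_bilinear.has_vector_derivative[OF b] f g that by blast
    show "continuous_on S (\<lambda>t. b (f t) (g' t) + b (f' t) (g t))"
      using f(2) g(2) C1_curve_continuous[OF assms(2)] C1_curve_continuous[OF assms(3)]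
      by (intro continuous_on_add bounded_bilinear.continuous_on[OF b])
  qed
qed

lemmas C1_curve_compose = C1_curve_bilinear[OF bounded_bilinear_blinfun_compose]

text \<open>
  The identity \<open>H - H\<^sub>0 = - H (G - G\<^sub>0) H\<^sub>0\<close> gives first boundedness of \<open>H\<close> and then convergence.
\<close>

lemma inverse_operator_tendsto:
  fixes G H :: "'t \<Rightarrow> 'v::real_normed_vector \<Rightarrow>\<^sub>L 'v"
  assumes G: "(G \<longlongrightarrow> G0) F" and inv: "\<And>t. G t o\<^sub>L H t = id_blinfun" "\<And>t. H t o\<^sub>L G t = id_blinfun"
    and inv0: "G0 o\<^sub>L H0 = id_blinfun" "H0 o\<^sub>L G0 = id_blinfun"
  shows "(H \<longlongrightarrow> H0) F"
    "\<And>t. H t - H0 = - (H t o\<^sub>L (G t - G0) o\<^sub>L H0)"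
proof -
  show id: "H t - H0 = - (H t o\<^sub>L (G t - G0) o\<^sub>L H0)" for t
  proof -
    have "H t (G t x) = x" "G0 (H0 x) = x" for x
      using arg_cong[OF inv(2)[of t], of "\<lambda>T. blinfun_apply T x"] arg_cong[OF inv0(1), of "\<lambda>T. blinfun_apply T x"]
      by simp_all
    then show ?thesis by (intro blinfun_eqI) (simp add: blinfun.bilinear_simps)
  qed
  have bound: "norm (H t - H0) \<le> 2 * norm H0 * norm H0 * norm (G t - G0)"
    if "norm (G t - G0) * norm H0 \<le> 1/2" for t
  proof -
    have le: "norm (H t - H0) \<le> norm (H t) * norm (G t - G0) * norm H0"
      unfolding id norm_minus_cancel
      by (rule order_trans[OF norm_blinfun_compose mult_right_mono[OF norm_blinfun_compose norm_ge_zero]])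
    also have "\<dots> = norm (H t) * (norm (G t - G0) * norm H0)" by simp
    also have "\<dots> \<le> norm (H t) * (1/2)" using that by (intro mult_left_mono) auto
    finally have "norm (H t - H0) \<le> norm (H t) / 2" by simp
    then have "norm (H t) \<le> 2 * norm H0" using norm_triangle_ineq2[of "H t" H0] by linarith
    then have "norm (H t) * norm (G t - G0) * norm H0 \<le> 2 * norm H0 * norm (G t - G0) * norm H0"
      by (intro mult_right_mono) auto
    then show ?thesis using le by (simp add: mult_ac)
  qed
  have G0: "((\<lambda>t. norm (G t - G0)) \<longlongrightarrow> 0) F" using G by (simp add: tendsto_norm_zero_iff LIM_zero_iff)
  have "((\<lambda>t. norm (G t - G0) * norm H0) \<longlongrightarrow> 0) F" by (rule tendsto_mult_left_zero[OF G0])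
  then have "\<forall>\<^sub>F t in F. norm (G t - G0) * norm H0 < 1/2" by (rule order_tendstoD) simp
  then have "\<forall>\<^sub>F t in F. norm (H t - H0) \<le> 2 * norm H0 * norm H0 * norm (G t - G0)"
    by eventually_elim (rule bound, simp)
  moreover have "((\<lambda>t. 2 * norm H0 * norm H0 * norm (G t - G0)) \<longlongrightarrow> 0) F"
    by (rule tendsto_mult_right_zero[OF G0])
  ultimately have "((\<lambda>t. H t - H0) \<longlongrightarrow> 0) F" by (rule Lim_null_comparison)
  then show "(H \<longlongrightarrow> H0) F" by (simp add: LIM_zero_iff)
qed

lemma C1_curve_inverse:
  fixes G H :: "real \<Rightarrow> 'v::real_normed_vector \<Rightarrow>\<^sub>L 'v"
  assumes G: "C1_curve G S" and inv: "\<And>t. G t o\<^sub>L H t = id_blinfun" "\<And>t. H t o\<^sub>L G t = id_blinfun"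
  shows "C1_curve H S"
proof -
  obtain G' where G': "\<forall>t\<in>S. (G has_vector_derivative G' t) (at t within S)" "continuous_on S G'"
    using G unfolding C1_curve_def by blast
  have Hc: "(H \<longlongrightarrow> H t) (at t within S)" if "t \<in> S" for t
    by (rule inverse_operator_tendsto(1)[where G = G and ?G0.0 = "G t"])
       (use C1_curve_continuous[OF G] that inv in \<open>auto simp: continuous_on_def\<close>)
  then have Hcont: "continuous_on S H" by (simp add: continuous_on_def)
  show ?thesis
  proof (rule C1_curveI)
    fix t assume t: "t \<in> S"
    have "((\<lambda>s. - (H s o\<^sub>L ((G s - G t) /\<^sub>R (s - t)) o\<^sub>L H t)) \<longlongrightarrow> - (H t o\<^sub>L G' t o\<^sub>L H t)) (at t within S)"
      using G' t unfolding has_vector_derivative_within_iff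
      by (intro tendsto_minus bounded_bilinear.tendsto[OF bounded_bilinear_blinfun_compose] Hc tendsto_const) auto
    moreover have "- (H s o\<^sub>L ((G s - G t) /\<^sub>R (s - t)) o\<^sub>L H t) = (H s - H t) /\<^sub>R (s - t)" for s
      unfolding inverse_operator_tendsto(2)[of G "G t" "at t" H "H t" s, OF _ inv inv]
      by (subst inverse_operator_tendsto(2)[where G = G and ?G0.0 = "G t" and F = bot and H = H]) (auto simp: inv
          bounded_bilinear.scaleR_left[OF bounded_bilinear_blinfun_compose]
          bounded_bilinear.scaleR_right[OF bounded_bilinear_blinfun_compose])
    ultimately show "(H has_vector_derivative - (H t o\<^sub>L G' t o\<^sub>L H t)) (at t within S)"
      by (simp add: has_vector_derivative_within_iff)
  next
    show "continuous_on S (\<lambda>t. - (H t o\<^sub>L G' t o\<^sub>L H t))"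
      by (intro continuous_on_minus bounded_bilinear.continuous_on[OF bounded_bilinear_blinfun_compose] Hcont G'(2))
  qed
qed

definition inl_blinfun :: "'a::real_normed_vector \<Rightarrow>\<^sub>L ('a \<times> 'b::real_normed_vector)"
  where "inl_blinfun = Blinfun (\<lambda>x. (x, 0))"

definition inr_blinfun :: "'b::real_normed_vector \<Rightarrow>\<^sub>L ('a::real_normed_vector \<times> 'b)"
  where "inr_blinfun = Blinfun (\<lambda>x. (0, x))"

lemma inl_blinfun_apply [simp]: "blinfun_apply inl_blinfun x = (x, 0)"
  unfolding inl_blinfun_def
  by (subst bounded_linear_Blinfun_apply) (auto intro: bounded_linear_Pair bounded_linear_ident bounded_linear_zero)

lemma inr_blinfun_apply [simp]: "blinfun_apply inr_blinfun x = (0, x)"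
  unfolding inr_blinfun_def
  by (subst bounded_linear_Blinfun_apply) (auto intro: bounded_linear_Pair bounded_linear_ident bounded_linear_zero)

definition graph_blinfun :: "real \<Rightarrow> ((real^'n) \<Rightarrow>\<^sub>L (real^'n)) \<Rightarrow> (real^'n) \<Rightarrow>\<^sub>L ((real^'n) \<times> (real^'n))"
  where "graph_blinfun \<beta> A = (inl_blinfun o\<^sub>L A) + (inr_blinfun o\<^sub>L (id_blinfun + ((\<beta> *\<^sub>R id_blinfun) o\<^sub>L A)))"

text \<open>
  The adjoint of \<open>graph_blinfun \<beta> A\<close> for symmetric \<open>A\<close> (\<open>graph_adjoint_inner\<close>).
\<close>

definition graph_adjoint :: "real \<Rightarrow> ((real^'n) \<Rightarrow>\<^sub>L (real^'n)) \<Rightarrow> ((real^'n) \<times> (real^'n)) \<Rightarrow>\<^sub>L (real^'n)"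
  where "graph_adjoint \<beta> A = (A o\<^sub>L fst_blinfun) + ((id_blinfun + ((\<beta> *\<^sub>R id_blinfun) o\<^sub>L A)) o\<^sub>L snd_blinfun)"

lemma graph_blinfun_apply: "graph_blinfun \<beta> A y = (A y, y + \<beta> *\<^sub>R A y)"
  by (simp add: graph_blinfun_def blinfun.bilinear_simps)

lemma graph_adjoint_apply: "graph_adjoint \<beta> A z = A (fst z) + snd z + \<beta> *\<^sub>R A (snd z)"
  by (simp add: graph_adjoint_def blinfun.bilinear_simps)

lemma graph_adjoint_inner: "symmetric_op A \<Longrightarrow> z \<bullet> graph_blinfun \<beta> A y = graph_adjoint \<beta> A z \<bullet> y"
  by (cases z) (simp add: graph_blinfun_apply graph_adjoint_apply symmetric_op_def inner_add_left inner_add_right)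

text \<open>
  With \<open>Z = graph_blinfun \<beta> A\<close> and its adjoint \<open>Z\<^sup>*\<close>, this is \<open>(Z\<^sup>* Z)\<^sup>-\<^sup>1\<close>; the projection onto the range of \<open>Z\<close> is
  \<open>Z (Z\<^sup>* Z)\<^sup>-\<^sup>1 Z\<^sup>*\<close>, which is a smooth function of \<open>A\<close>.
\<close>

definition graph_gram_inverse :: "real \<Rightarrow> ((real^'n) \<Rightarrow>\<^sub>L (real^'n)) \<Rightarrow> (real^'n) \<Rightarrow>\<^sub>L (real^'n)"
  where "graph_gram_inverse \<beta> A = (SOME H. (graph_adjoint \<beta> A o\<^sub>L graph_blinfun \<beta> A) o\<^sub>L H = id_blinfun \<and>
    H o\<^sub>L (graph_adjoint \<beta> A o\<^sub>L graph_blinfun \<beta> A) = id_blinfun)"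

lemma graph_gram_inverse:
  fixes A :: "(real^'n) \<Rightarrow>\<^sub>L (real^'n)"
  assumes "symmetric_op A"
  shows "(graph_adjoint \<beta> A o\<^sub>L graph_blinfun \<beta> A) o\<^sub>L graph_gram_inverse \<beta> A = id_blinfun \<and>
    graph_gram_inverse \<beta> A o\<^sub>L (graph_adjoint \<beta> A o\<^sub>L graph_blinfun \<beta> A) = id_blinfun"
  unfolding graph_gram_inverse_def
proof (rule someI_ex)
  let ?G = "graph_adjoint \<beta> A o\<^sub>L graph_blinfun \<beta> A"
  have lin: "linear (blinfun_apply ?G)" by (simp add: blinfun.bounded_linear_right bounded_linear.linear)
  have "inj (blinfun_apply ?G)"
    unfolding linear_injective_0[OF lin]
  proof (intro allI impI)
    fix y assume "?G y = 0"
    then have "graph_blinfun \<beta> A y \<bullet> graph_blinfun \<beta> A y = 0"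
      unfolding graph_adjoint_inner[OF assms] by simp
    then have "graph_blinfun \<beta> A y = 0" by (rule inner_eq_zero_iff[THEN iffD1])
    then have "A y = 0" "y + \<beta> *\<^sub>R A y = 0" by (auto simp: graph_blinfun_apply prod_eq_iff)
    then show "y = 0" by simp
  qed
  then obtain H where H: "linear H" "\<And>x. H (?G x) = x" "\<And>x. ?G (H x) = x"
    using linear_injective_isomorphism[OF lin] by blast
  have "blinfun_apply (Blinfun H) = H" using H(1) by (simp add: bounded_linear_Blinfun_apply linear_linear)
  then show "\<exists>H. ?G o\<^sub>L H = id_blinfun \<and> H o\<^sub>L ?G = id_blinfun"
    using H(2,3) by (intro exI[of _ "Blinfun H"]) (auto intro!: blinfun_eqI)
qed

lemma ortho_proj_sym_graph:
  fixes A :: "(real^'n) \<Rightarrow>\<^sub>L (real^'n)"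
  assumes A: "symmetric_op A"
  shows "ortho_proj (sym_graph \<beta> A) = graph_blinfun \<beta> A o\<^sub>L (graph_gram_inverse \<beta> A o\<^sub>L graph_adjoint \<beta> A)"
proof (rule blinfun_eqI)
  fix z :: "(real^'n) \<times> (real^'n)"
  have sub: "subspace (sym_graph \<beta> A)" using LagrangiansD(1) sym_graph_Lagrangian(1)[OF A] by blast
  let ?y = "graph_gram_inverse \<beta> A (graph_adjoint \<beta> A z)"
  have "((graph_adjoint \<beta> A o\<^sub>L graph_blinfun \<beta> A) o\<^sub>L graph_gram_inverse \<beta> A) (graph_adjoint \<beta> A z) = graph_adjoint \<beta> A z"
    using graph_gram_inverse[OF A] by simp
  then have G: "graph_adjoint \<beta> A (graph_blinfun \<beta> A ?y) = graph_adjoint \<beta> A z" by simp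
  have "ortho_proj (sym_graph \<beta> A) z = graph_blinfun \<beta> A ?y"
  proof (rule ortho_proj_subspace(4)[OF sub])
    show "graph_blinfun \<beta> A ?y \<in> sym_graph \<beta> A" by (simp add: sym_graph_def graph_blinfun_apply)
    fix w assume "w \<in> sym_graph \<beta> A"
    then obtain y where w: "w = graph_blinfun \<beta> A y" by (auto simp: sym_graph_def graph_blinfun_apply)
    show "(z - graph_blinfun \<beta> A ?y) \<bullet> w = 0"
      unfolding w graph_adjoint_inner[OF A] using G by (simp add: blinfun.diff_right)
  qed
  then show "ortho_proj (sym_graph \<beta> A) z = (graph_blinfun \<beta> A o\<^sub>L (graph_gram_inverse \<beta> A o\<^sub>L graph_adjoint \<beta> A)) z"
    by simp
qed

lemma C1_curve_ortho_proj_sym_graph: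
  fixes A :: "real \<Rightarrow> (real^'n) \<Rightarrow>\<^sub>L (real^'n)"
  assumes sym: "\<And>t. symmetric_op (A t)" and A: "C1_curve A S"
  shows "C1_curve (\<lambda>t. ortho_proj (sym_graph \<beta> (A t))) S"
proof -
  have Z: "C1_curve (\<lambda>t. graph_blinfun \<beta> (A t)) S" "C1_curve (\<lambda>t. graph_adjoint \<beta> (A t)) S"
    unfolding graph_blinfun_def graph_adjoint_def
    by (intro C1_curve_add C1_curve_compose C1_curve_const A)+
  have "C1_curve (\<lambda>t. graph_gram_inverse \<beta> (A t)) S"
    by (rule C1_curve_inverse[OF C1_curve_compose[OF Z(2,1)]]) (use graph_gram_inverse[OF sym] in blast)+
  then show ?thesis unfolding ortho_proj_sym_graph[OF sym] by (intro C1_curve_compose Z)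
qed

lemma continuous_on_ortho_proj_sym_graph:
  fixes A :: "'t::topological_space \<Rightarrow> (real^'n) \<Rightarrow>\<^sub>L (real^'n)"
  assumes sym: "\<And>t. t \<in> S \<Longrightarrow> symmetric_op (A t)" and A: "continuous_on S A"
  shows "continuous_on S (\<lambda>t. ortho_proj (sym_graph \<beta> (A t)))"
proof -
  \<comment> \<open>outside S the operator is replaced by 0, so that the Gram operators are all invertible\<close>
  define A' where "A' t = (if t \<in> S then A t else 0)" for t
  have sym': "symmetric_op (A' t)" for t using sym by (auto simp: A'_def symmetric_op_def)
  have A': "continuous_on S A'" by (rule continuous_on_eq[OF A]) (simp add: A'_def)
  note cc = bounded_bilinear.continuous_on[OF bounded_bilinear_blinfun_compose]
  have Z: "continuous_on S (\<lambda>t. graph_blinfun \<beta> (A' t))" "continuous_on S (\<lambda>t. graph_adjoint \<beta> (A' t))"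
    unfolding graph_blinfun_def graph_adjoint_def
    by (intro continuous_on_add cc continuous_on_const A')+
  have H: "continuous_on S (\<lambda>t. graph_gram_inverse \<beta> (A' t))"
    unfolding continuous_on_def
  proof
    fix t assume t: "t \<in> S"
    show "((\<lambda>t. graph_gram_inverse \<beta> (A' t)) \<longlongrightarrow> graph_gram_inverse \<beta> (A' t)) (at t within S)"
      by (rule inverse_operator_tendsto(1)[where G = "\<lambda>t. graph_adjoint \<beta> (A' t) o\<^sub>L graph_blinfun \<beta> (A' t)"])
         (use cc[OF Z(2,1)] t graph_gram_inverse[OF sym'] in \<open>auto simp: continuous_on_def\<close>)
  qed
  have "continuous_on S (\<lambda>t. ortho_proj (sym_graph \<beta> (A' t)))"
    unfolding ortho_proj_sym_graph[OF sym'] by (intro cc Z H)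
  then show ?thesis by (rule continuous_on_eq) (simp add: A'_def)
qed

section \<open>The Maslov index of a path inside one chart\<close>

lemma symmetric_op_add: "symmetric_op A \<Longrightarrow> symmetric_op B \<Longrightarrow> symmetric_op (A + B)"
  by (simp add: symmetric_op_def blinfun.bilinear_simps inner_add_left inner_add_right)

lemma symmetric_op_scaleR: "symmetric_op A \<Longrightarrow> symmetric_op (c *\<^sub>R A)"
  by (simp add: symmetric_op_def blinfun.bilinear_simps)

lemma symmetric_op_id: "symmetric_op id_blinfun"
  by (simp add: symmetric_op_def)

text \<open>
  This is what makes the definite description in \<open>Mas\<close> well defined.
\<close>

lemma homotopic_paths_same_Maslov:
  fixes \<Gamma>0 :: "real \<Rightarrow> ((real^'n) \<times> (real^'n)) set"
  assumes reg: "regular_path \<Gamma>0 vertical a b" "regular_path \<Gamma>1 vertical a b" and "a < b"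
    and hom: "homotopic_with (\<lambda>\<gamma>. \<gamma> a = x \<and> \<gamma> b = y) (top_of_set {a..b}) Lagrangian_topology \<Gamma>0 \<Gamma>1"
  shows "Mas_regular \<Gamma>0 vertical a b = Mas_regular \<Gamma>1 vertical a b"
proof -
  obtain h where h: "continuous_map (prod_topology (top_of_set {0..1::real}) (top_of_set {a..b})) Lagrangian_topology h"
    and h0: "\<And>t. h (0, t) = \<Gamma>0 t" and h1: "\<And>t. h (1, t) = \<Gamma>1 t"
    and ends: "\<And>r. r \<in> {0..1} \<Longrightarrow> h (r, a) = x \<and> h (r, b) = y"
    using hom unfolding homotopic_with_def by auto
  let ?S = "{0..1::real} \<times> {a..b}"
  have top: "prod_topology (top_of_set {0..1::real}) (top_of_set {a..b}) = top_of_set ?S"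
    by (simp add: subtopology_Times)
  have "continuous_map Lagrangian_topology euclidean (ortho_proj :: _ \<Rightarrow> ((real^'n) \<times> (real^'n)) \<Rightarrow>\<^sub>L _)"
    unfolding Lagrangian_topology_def using continuous_map_pullback[OF continuous_map_id] by simp
  from continuous_map_compose[OF h this]
  have "continuous_map (top_of_set ?S) euclidean (ortho_proj \<circ> h)" unfolding top .
  then have cont: "continuous_on ?S (\<lambda>p. ortho_proj (h p))" by (simp add: o_def)
  have Lag: "h p \<in> Lagrangians" if "p \<in> ?S" for p
    using continuous_map_image_subset_topspace[OF h] that unfolding top Lagrangian_topology_def topspace_pullback_topology by auto
  obtain m0 where m0: "index_lift \<Gamma>0 {a..b} m0" "m0 b - m0 a = Mas_regular \<Gamma>0 vertical a b"
    using regular_path_index_lift[OF reg(1) \<open>a < b\<close>] .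
  obtain m1 where m1: "index_lift \<Gamma>1 {a..b} m1" "m1 b - m1 a = Mas_regular \<Gamma>1 vertical a b"
    using regular_path_index_lift[OF reg(2) \<open>a < b\<close>] .
  have "m0 b - m0 a = m1 b - m1 a"
  proof (rule index_lift_homotopy_invariant[OF _ Lag cont])
    show "index_lift (\<lambda>t. h (0, t)) {a..b} m0" "index_lift (\<lambda>t. h (1, t)) {a..b} m1"
      unfolding h0 h1 using m0(1) m1(1) by simp_all
    show "h (r, a) = h (0, a)" "h (r, b) = h (0, b)" if "r \<in> {0..1}" for r
      using ends[OF that] ends[of 0] by simp_all
  qed (use \<open>a < b\<close> in auto)
  then show ?thesis using m0(2) m1(2) by simp
qed

text \<open>
  The path from \<open>A0\<close> to \<open>A1\<close> bent by a large multiple of the identity. For \<open>\<tau>\<close> in \<open>[1/4, 3/4]\<close> the bump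
  dominates and there is no kernel; near the two ends its derivative dominates, so every crossing is
  definite.
\<close>

lemma quadratic_op_path:
  fixes A0 A1 :: "(real^'n) \<Rightarrow>\<^sub>L (real^'n)" and \<tau> c :: real and y
  defines "D \<equiv> A1 - A0"
  assumes c: "c > 8 * (norm A0 + norm A1) " and \<tau>: "0 \<le> \<tau>" "\<tau> \<le> 1" and y: "y \<noteq> 0"
    and ker: "(A0 + \<tau> *\<^sub>R D + (c * \<tau> * (1 - \<tau>)) *\<^sub>R id_blinfun) y = 0"
  shows "\<tau> < 1/4 \<and> (\<forall>w. w \<noteq> 0 \<longrightarrow> (D w + (c * (1 - 2 * \<tau>)) *\<^sub>R w) \<bullet> w > 0) \<or>
    \<tau> > 3/4 \<and> (\<forall>w. w \<noteq> 0 \<longrightarrow> (D w + (c * (1 - 2 * \<tau>)) *\<^sub>R w) \<bullet> w < 0)"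
proof -
  let ?N = "norm A0 + norm A1"
  have ip: "\<bar>(B w) \<bullet> w\<bar> \<le> norm B * (norm w)\<^sup>2" for B :: "(real^'n) \<Rightarrow>\<^sub>L (real^'n)" and w
  proof -
    have "\<bar>B w \<bullet> w\<bar> \<le> norm (B w) * norm w" by (rule Cauchy_Schwarz_ineq2)
    also have "\<dots> \<le> norm B * norm w * norm w" using norm_blinfun by (intro mult_right_mono) auto
    finally show ?thesis by (simp add: power2_eq_square mult_ac)
  qed
  have nD: "norm D \<le> ?N" unfolding D_def using norm_triangle_ineq4[of A1 A0] by simp
  define N where "N = ?N"
  have cN: "8 * N < c" and N0: "0 \<le> N" using c by (simp_all add: N_def)
  have c0: "c > 0" using cN N0 by simp
  \<comment> \<open>\<open>3/16\<close> is the minimum of \<open>\<tau> (1 - \<tau>)\<close> on \<open>[1/4, 3/4]\<close>, and \<open>1/2\<close> bounds \<open>\<bar>1 - 2 \<tau>\<bar>\<close> from below off it\<close>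
  have cN2: "N < c * (3/16)" "N < c * (1/2)" "c * (- 1/2) < - N" using cN N0 by auto
  have mid: "\<not> (1/4 \<le> \<tau> \<and> \<tau> \<le> 3/4)"
  proof
    assume m: "1/4 \<le> \<tau> \<and> \<tau> \<le> 3/4"
    have "(3/16::real) \<le> \<tau> * (1 - \<tau>)"
    proof -
      have "0 \<le> (\<tau> - 1/4) * (3/4 - \<tau>)" using m by simp
      moreover have "(\<tau> - 1/4) * (3/4 - \<tau>) = \<tau> * (1 - \<tau>) - 3/16" by (simp add: field_simps)
      ultimately show ?thesis by linarith
    qed
    then have "c * (3/16) \<le> c * (\<tau> * (1 - \<tau>))" using c0 by (intro mult_left_mono) auto
    moreover have "?N < c * (3/16)" using cN2(1) by (simp add: N_def)
    ultimately have big: "c * \<tau> * (1 - \<tau>) > ?N"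
      unfolding mult.assoc by (rule order_less_le_trans[rotated])
    have "A0 y + \<tau> *\<^sub>R D y = (1 - \<tau>) *\<^sub>R A0 y + \<tau> *\<^sub>R A1 y"
      by (simp add: D_def blinfun.diff_left algebra_simps)
    then have "(c * \<tau> * (1 - \<tau>)) *\<^sub>R y = - ((1 - \<tau>) *\<^sub>R A0 y + \<tau> *\<^sub>R A1 y)"
      using ker by (simp add: blinfun.bilinear_simps add_eq_0_iff2)
    then have "c * \<tau> * (1 - \<tau>) * norm y = norm ((1 - \<tau>) *\<^sub>R A0 y + \<tau> *\<^sub>R A1 y)"
    proof -
      have "0 \<le> c * \<tau> * (1 - \<tau>)" using \<tau> c0 by simp
      then have "c * \<tau> * (1 - \<tau>) * norm y = norm ((c * \<tau> * (1 - \<tau>)) *\<^sub>R y)"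
        by (simp only: norm_scaleR abs_of_nonneg)
      then show ?thesis
        unfolding \<open>(c * \<tau> * (1 - \<tau>)) *\<^sub>R y = _\<close> norm_minus_cancel .
    qed
    also have "\<dots> \<le> (1 - \<tau>) * norm (A0 y) + \<tau> * norm (A1 y)"
      using \<tau> by (intro norm_triangle_le) auto
    also have "\<dots> \<le> 1 * (norm A0 * norm y) + 1 * (norm A1 * norm y)"
      using \<tau> norm_blinfun[of A0 y] norm_blinfun[of A1 y] by (intro add_mono mult_mono) auto
    finally have "c * \<tau> * (1 - \<tau>) * norm y \<le> ?N * norm y" by (simp add: distrib_right)
    then show False using big y by simp
  qed
  have dw: "(D w + r *\<^sub>R w) \<bullet> w \<ge> (r - ?N) * (norm w)\<^sup>2 \<and> (D w + r *\<^sub>R w) \<bullet> w \<le> (r + ?N) * (norm w)\<^sup>2" for r w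
  proof -
    have "\<bar>D w \<bullet> w\<bar> \<le> ?N * (norm w)\<^sup>2"
      using ip[of D w] mult_right_mono[OF nD, of "(norm w)\<^sup>2"] by simp
    then show ?thesis by (simp add: inner_add_left power2_norm_eq_inner abs_le_iff left_diff_distrib distrib_right) 
  qed
  show ?thesis
  proof (cases "\<tau> < 1/4")
    case True
    have "?N < c * (1/2)" using cN2(2) by (simp add: N_def)
    also have "c * (1/2) \<le> c * (1 - 2 * \<tau>)" using c0 True by (intro mult_left_mono) auto
    finally have "c * (1 - 2 * \<tau>) - ?N > 0" by simp
    then have "(D w + (c * (1 - 2 * \<tau>)) *\<^sub>R w) \<bullet> w > 0" if "w \<noteq> 0" for w
      using dw[where w = w and r = "c * (1 - 2 * \<tau>)"] that
      by (smt (verit) mult_pos_pos zero_less_norm_iff zero_less_power)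
    then show ?thesis using True by blast
  next
    case False
    then have t: "\<tau> > 3/4" using mid by linarith
    have "c * (1 - 2 * \<tau>) \<le> c * (- 1/2)" using c0 t by (intro mult_left_mono) auto
    also have "c * (- 1/2) < - ?N" using cN2(3) by (simp add: N_def)
    finally have "c * (1 - 2 * \<tau>) + ?N < 0" by simp
    then have "(D w + (c * (1 - 2 * \<tau>)) *\<^sub>R w) \<bullet> w < 0" if "w \<noteq> 0" for w
      using dw[where w = w and r = "c * (1 - 2 * \<tau>)"] that
      by (smt (verit) mult_neg_pos zero_less_norm_iff zero_less_power)
    then show ?thesis using t by blast
  qed
qed

text \<open>
  An explicit path takes the place of a general position argument.
\<close>

lemma chart_regular_path:
  fixes A0 A1 :: "(real^'n) \<Rightarrow>\<^sub>L (real^'n)"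
  assumes sym: "symmetric_op A0" "symmetric_op A1" and "a < b"
  obtains B where "\<And>t. symmetric_op (B t)" "continuous_on {a..b} B" "B a = A0" "B b = A1"
    "regular_path (\<lambda>t. sym_graph \<beta> (B t)) vertical a b"
proof -
  define c where "c = 8 * (norm A0 + norm A1) + 1"
  define D where "D = A1 - A0"
  define \<tau> where "\<tau> t = (t - a) / (b - a)" for t
  define B where "B t = A0 + \<tau> t *\<^sub>R D + (c * \<tau> t * (1 - \<tau> t)) *\<^sub>R id_blinfun" for t
  define B' where "B' t = (1 / (b - a)) *\<^sub>R D + (c * (1 - 2 * \<tau> t) / (b - a)) *\<^sub>R (id_blinfun :: (real^'n) \<Rightarrow>\<^sub>L (real^'n))" for t
  have symD: "symmetric_op D"
    using sym by (simp add: D_def symmetric_op_def blinfun.diff_left inner_diff_left inner_diff_right)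
  have symB: "symmetric_op (B t)" for t
    unfolding B_def by (intro symmetric_op_add symmetric_op_scaleR symmetric_op_id sym symD)
  have dB: "(B has_vector_derivative B' t) (at t within S)" for t S
  proof -
    have d: "(\<tau> has_vector_derivative 1 / (b - a)) (at t within S)"
      unfolding \<tau>_def has_real_derivative_iff_has_vector_derivative[symmetric]
      using \<open>a < b\<close> by (auto intro!: derivative_eq_intros)
    have d2: "((\<lambda>t. c * \<tau> t * (1 - \<tau> t)) has_vector_derivative c * (1 - 2 * \<tau> t) / (b - a)) (at t within S)"
      using d unfolding has_real_derivative_iff_has_vector_derivative[symmetric]
      by (auto intro!: derivative_eq_intros simp: algebra_simps add_divide_distrib diff_divide_distrib)
    show ?thesis
      unfolding B_def B'_def
      using has_vector_derivative_add[OF has_vector_derivative_add[OF has_vector_derivative_const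
          has_vector_derivative_scaleR[OF d[folded has_real_derivative_iff_has_vector_derivative] has_vector_derivative_const]]
          has_vector_derivative_scaleR[OF d2[folded has_real_derivative_iff_has_vector_derivative] has_vector_derivative_const]]
      by simp
  qed
  have cB': "continuous_on {a..b} B'"
    unfolding B'_def \<tau>_def using \<open>a < b\<close> by (auto intro!: continuous_intros)
  have C1B: "C1_curve B {a..b}" by (rule C1_curveI[OF dB cB'])
  let ?\<Gamma> = "\<lambda>t. sym_graph \<beta> (B t)"
  have Lag: "?\<Gamma> t \<in> Lagrangians" for t by (rule sym_graph_Lagrangian(1)[OF symB])
  obtain P' where P': "\<And>t. t \<in> {a..b} \<Longrightarrow> ((\<lambda>t. ortho_proj (?\<Gamma> t)) has_vector_derivative P' t) (at t within {a..b})"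
    "continuous_on {a..b} P'"
    using C1_curve_ortho_proj_sym_graph[OF symB C1B, of \<beta>] unfolding C1_curve_def by blast
  have cf: "crossing_form ?\<Gamma> a b t (0, y) = - (y \<bullet> B' t y)" if t: "t \<in> {a..b}" and y: "B t y = 0" for t y
  proof -
    let ?q = "(0, y) :: (real^'n) \<times> (real^'n)"
    define z where "z s = graph_blinfun \<beta> (B s) y" for s
    have zt: "z t = ?q" using y by (simp add: z_def graph_blinfun_apply)
    have q: "?q \<in> ?\<Gamma> t" using y by (auto simp: sym_graph_def intro!: image_eqI[of _ _ y])
    have sub: "subspace (?\<Gamma> s)" for s using LagrangiansD(1)[OF Lag] .
    have dBy: "((\<lambda>s. B s y) has_vector_derivative B' t y) (at t within {a..b})"
      by (rule bounded_linear.has_vector_derivative[OF blinfun.bounded_linear_left dB])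
    have dz: "(z has_vector_derivative (B' t y, \<beta> *\<^sub>R B' t y)) (at t within {a..b})"
      unfolding z_def graph_blinfun_apply
      using dBy by (auto intro!: has_vector_derivative_Pair derivative_eq_intros)
    have "((\<lambda>s. ortho_proj (?\<Gamma> s) (z s)) has_vector_derivative
        ortho_proj (?\<Gamma> t) (B' t y, \<beta> *\<^sub>R B' t y) + P' t (z t)) (at t within {a..b})"
      by (rule bounded_bilinear.has_vector_derivative[OF bounded_bilinear_blinfun_apply P'(1)[OF t] dz])
    moreover have "ortho_proj (?\<Gamma> s) (z s) = z s" for s
      by (rule ortho_proj_subspace(3)[OF sub]) (auto simp: z_def graph_blinfun_apply sym_graph_def)
    ultimately have "(z has_vector_derivative
        ortho_proj (?\<Gamma> t) (B' t y, \<beta> *\<^sub>R B' t y) + P' t ?q) (at t within {a..b})" by (simp add: zt)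
    moreover have "at t within {a..b} \<noteq> bot" using t \<open>a < b\<close> by (simp add: trivial_limit_within islimpt_Icc)
    ultimately have eq: "(B' t y, \<beta> *\<^sub>R B' t y) = ortho_proj (?\<Gamma> t) (B' t y, \<beta> *\<^sub>R B' t y) + P' t ?q"
      using dz vector_derivative_unique_within by blast
    let ?w = "ortho_proj (?\<Gamma> t) (B' t y, \<beta> *\<^sub>R B' t y)"
    have "?w \<in> ?\<Gamma> t" by (rule ortho_proj_subspace(1)[OF sub])
    from LagrangiansD(3)[OF Lag this q] have "fst ?w \<bullet> y = 0" by simp
    moreover have "fst (P' t ?q) = B' t y - fst ?w" using arg_cong[OF eq, of fst] by (simp add: algebra_simps)
    ultimately have "fst (P' t ?q) \<bullet> y = B' t y \<bullet> y" by (simp add: inner_diff_left)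
    moreover have "crossing_form ?\<Gamma> a b t ?q = - (fst (P' t ?q) \<bullet> snd ?q)"
      by (rule crossing_form_eq[OF Lag t \<open>a < b\<close> P'(1)[OF t] q]) simp
    ultimately show ?thesis by (simp add: inner_commute)
  qed
  have "regular_path ?\<Gamma> vertical a b"
    unfolding regular_path_def C1_path_def
  proof (intro conjI ballI impI)
    show "\<exists>P'. (\<forall>t\<in>{a..b}. ((\<lambda>t. ortho_proj (?\<Gamma> t)) has_vector_derivative P' t) (at t within {a..b})) \<and> continuous_on {a..b} P'"
      using P' by blast
    fix t assume t: "t \<in> {a..b}"
    show "?\<Gamma> t \<in> Lagrangians" by (rule Lag)
    let ?m = "crossing_form ?\<Gamma> a b t"
    have el: "\<exists>y. q = (0, y) \<and> B t y = 0" if "q \<in> ?\<Gamma> t \<inter> vertical" for q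
      using that by (auto simp: sym_graph_def vertical_def)
    show "nondegenerate_form (?\<Gamma> t \<inter> vertical) ?m"
      unfolding nondegenerate_form_def
    proof (intro ballI impI)
      fix p assume p: "p \<in> ?\<Gamma> t \<inter> vertical" and all: "\<forall>q\<in>?\<Gamma> t \<inter> vertical. (?m (p + q) - ?m p - ?m q) / 2 = 0"
      obtain y where y: "p = (0, y)" "B t y = 0" using el[OF p] by blast
      have "(?m (p + p) - ?m p - ?m p) / 2 = 0" using all p by blast
      moreover have "?m (p + p) = - ((2 *\<^sub>R y) \<bullet> B' t (2 *\<^sub>R y))"
      proof -
        have pp: "p + p = (0, 2 *\<^sub>R y)" by (simp add: y scaleR_2)
        show ?thesis unfolding pp by (rule cf[OF t]) (simp add: y blinfun.scaleR_right)
      qed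
      moreover have "?m p = - (y \<bullet> B' t y)" unfolding y(1) by (rule cf[OF t y(2)])
      ultimately have m0: "y \<bullet> B' t y = 0" by (simp add: blinfun.scaleR_right)
      have "y = 0"
      proof (rule ccontr)
        assume "y \<noteq> 0"
        have \<tau>: "0 \<le> \<tau> t" "\<tau> t \<le> 1" using t \<open>a < b\<close> by (auto simp: \<tau>_def)
        have "(b - a) *\<^sub>R B' t y = D y + (c * (1 - 2 * \<tau> t)) *\<^sub>R y"
          using \<open>a < b\<close> by (simp add: B'_def blinfun.bilinear_simps scaleR_add_right)
        then have "(D y + (c * (1 - 2 * \<tau> t)) *\<^sub>R y) \<bullet> y = 0"
          using m0 by (metis inner_commute inner_scaleR_left mult_zero_right)
        then show False
          using quadratic_op_path[of A0 A1 c "\<tau> t" y] \<tau> \<open>y \<noteq> 0\<close> y(2) unfolding B_def D_def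
          by (auto simp: c_def)
      qed
      then show "p = 0" using y by (simp add: zero_prod_def)
    qed
  qed
  moreover have "B a = A0" "B b = A1" using \<open>a < b\<close> by (simp_all add: B_def \<tau>_def D_def)
  ultimately show thesis using symB C1_curve_continuous[OF C1B] by (intro that) auto
qed

text \<open>
  The chart is convex in \<open>A\<close>, so the path is homotopic with fixed ends to any regular path in the
  chart with the same ends, and there the increment of the lift \<open>- neg_index \<beta>\<close> can be read off.
\<close>

theorem Maslov_index_in_chart:
  fixes A :: "real \<Rightarrow> (real^'n) \<Rightarrow>\<^sub>L (real^'n)"
  assumes sym: "\<And>t. t \<in> {a..b} \<Longrightarrow> symmetric_op (A t)" and cont: "continuous_on {a..b} A" and "a < b"
    and \<Lambda>: "\<And>t. t \<in> {a..b} \<Longrightarrow> \<Lambda> t = sym_graph \<beta> (A t)"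
  shows "Mas \<Lambda> vertical a b = int (neg_index \<beta> (\<Lambda> a)) - int (neg_index \<beta> (\<Lambda> b))"
proof -
  obtain B where symB: "\<And>t. symmetric_op (B t)" and cB: "continuous_on {a..b} B" and Bab: "B a = A a" "B b = A b"
    and reg: "regular_path (\<lambda>t. sym_graph \<beta> (B t)) vertical a b"
    using chart_regular_path[of "A a" "A b" a b \<beta>] sym \<open>a < b\<close> by auto
  let ?\<Gamma> = "\<lambda>t. sym_graph \<beta> (B t)"
  let ?hom = "\<lambda>\<Gamma>. homotopic_with (\<lambda>\<gamma>. \<gamma> a = \<Lambda> a \<and> \<gamma> b = \<Lambda> b) (top_of_set {a..b}) Lagrangian_topology \<Gamma> \<Lambda>"
  define h where "h p = sym_graph \<beta> ((1 - fst p) *\<^sub>R B (snd p) + fst p *\<^sub>R A (snd p))" for p :: "real \<times> real"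
  have hom: "?hom ?\<Gamma>"
  proof (subst homotopic_with)
    show "((h a = \<Lambda> a \<and> h b = \<Lambda> b) \<longleftrightarrow> (k a = \<Lambda> a \<and> k b = \<Lambda> b))"
      if "\<And>x. x \<in> topspace (top_of_set {a..b}) \<Longrightarrow> h x = k x" for h k :: "real \<Rightarrow> ((real^'n) \<times> (real^'n)) set"
      using that[of a] that[of b] \<open>a < b\<close> by simp
    show "\<exists>h. continuous_map (prod_topology (top_of_set {0..1::real}) (top_of_set {a..b})) Lagrangian_topology h \<and>
        (\<forall>x\<in>topspace (top_of_set {a..b}). h (0, x) = ?\<Gamma> x) \<and>
        (\<forall>x\<in>topspace (top_of_set {a..b}). h (1, x) = \<Lambda> x) \<and>
        (\<forall>t\<in>{0..1}. h (t, a) = \<Lambda> a \<and> h (t, b) = \<Lambda> b)"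
    proof (intro exI[of _ h] conjI)
      let ?S = "{0..1::real} \<times> {a..b}"
      have top: "prod_topology (top_of_set {0..1::real}) (top_of_set {a..b}) = top_of_set ?S"
        by (simp add: subtopology_Times)
      have s: "symmetric_op ((1 - fst p) *\<^sub>R B (snd p) + fst p *\<^sub>R A (snd p))" if "p \<in> ?S" for p
        using that by (intro symmetric_op_add symmetric_op_scaleR symB sym) auto
      have "continuous_on ?S (\<lambda>p. ortho_proj (h p))"
        unfolding h_def
      proof (rule continuous_on_ortho_proj_sym_graph[OF s])
        have "continuous_on ?S (\<lambda>p. B (snd p))" "continuous_on ?S (\<lambda>p. A (snd p))"
          using continuous_on_compose2[OF cB continuous_on_snd[OF continuous_on_id], of ?S]
            continuous_on_compose2[OF cont continuous_on_snd[OF continuous_on_id], of ?S] by auto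
        then show "continuous_on ?S (\<lambda>p. (1 - fst p) *\<^sub>R B (snd p) + fst p *\<^sub>R A (snd p))"
          by (intro continuous_intros)
      qed
      then show "continuous_map (prod_topology (top_of_set {0..1::real}) (top_of_set {a..b})) Lagrangian_topology h"
        unfolding top Lagrangian_topology_def
        by (intro continuous_map_pullback') (auto simp: o_def h_def intro!: sym_graph_Lagrangian(1) symmetric_op_add symmetric_op_scaleR symB sym)
      show "\<forall>x\<in>topspace (top_of_set {a..b}). h (0, x) = ?\<Gamma> x" by (simp add: h_def)
      show "\<forall>x\<in>topspace (top_of_set {a..b}). h (1, x) = \<Lambda> x" using \<Lambda> by (simp add: h_def)
      show "\<forall>t\<in>{0..1}. h (t, a) = \<Lambda> a \<and> h (t, b) = \<Lambda> b"
        using \<Lambda>[of a] \<Lambda>[of b] \<open>a < b\<close> Bab by (simp add: h_def scaleR_left_distrib[symmetric])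
    qed
  qed
  have val: "Mas_regular ?\<Gamma> vertical a b = int (neg_index \<beta> (\<Lambda> a)) - int (neg_index \<beta> (\<Lambda> b))"
  proof -
    obtain m where m: "index_lift ?\<Gamma> {a..b} m" "m b - m a = Mas_regular ?\<Gamma> vertical a b"
      using regular_path_index_lift[OF reg \<open>a < b\<close>] .
    have "index_lift ?\<Gamma> {a..b} (\<lambda>t. - int (neg_index \<beta> (?\<Gamma> t)))"
      using sym_graph_Lagrangian[OF symB] continuous_on_ortho_proj_sym_graph[OF symB cB]
      by (intro index_lift_chart) auto
    from index_lift_unique[OF m(1) this, of a b] sym_graph_Lagrangian[OF symB] \<open>a < b\<close> m(2)
    show ?thesis using \<Lambda>[of a] \<Lambda>[of b] Bab by auto
  qed
  show ?thesis
    unfolding Mas_def val[symmetric]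
  proof (rule the_equality)
    show "\<exists>\<Gamma>. regular_path \<Gamma> vertical a b \<and> ?hom \<Gamma> \<and> Mas_regular ?\<Gamma> vertical a b = Mas_regular \<Gamma> vertical a b"
      using reg hom by blast
    fix k assume "\<exists>\<Gamma>. regular_path \<Gamma> vertical a b \<and> ?hom \<Gamma> \<and> k = Mas_regular \<Gamma> vertical a b"
    then obtain \<Gamma> where G: "regular_path \<Gamma> vertical a b" "?hom \<Gamma>" "k = Mas_regular \<Gamma> vertical a b" by blast
    have "homotopic_with (\<lambda>\<gamma>. \<gamma> a = \<Lambda> a \<and> \<gamma> b = \<Lambda> b) (top_of_set {a..b}) Lagrangian_topology \<Gamma> ?\<Gamma>"
      by (rule homotopic_with_trans[OF G(2) homotopic_with_symD[OF hom]])
    from homotopic_paths_same_Maslov[OF G(1) reg \<open>a < b\<close> this] G(3)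
    show "k = Mas_regular ?\<Gamma> vertical a b" by simp
  qed
qed

section \<open>Linear differential equations with a parameter\<close>

lemma has_vector_derivative_imp_continuous_on:
  assumes "\<And>x. (F has_vector_derivative f x) (at x)"
  shows "continuous_on S F"
  by (intro continuous_at_imp_continuous_on ballI has_vector_derivative_continuous[OF assms])

lemma antiderivative_exists:
  fixes f :: "real \<Rightarrow> 'a::euclidean_space"
  assumes "continuous_on UNIV f"
  shows "\<exists>F. F 0 = 0 \<and> (\<forall>x. (F has_vector_derivative f x) (at x))"
proof -
  obtain F where F: "\<And>x. (F has_vector_derivative f x) (at x)"
    using einterval_antiderivative[of "-\<infinity>" \<infinity> f] assms by (auto simp: continuous_on_eq_continuous_at)
  show ?thesis
    by (rule exI[of _ "\<lambda>x. F x - F 0"]) (auto intro!: derivative_eq_intros F)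
qed

lemma antiderivative_power_bound:
  fixes F :: "real \<Rightarrow> 'a::real_normed_vector"
  assumes F: "\<And>x. (F has_vector_derivative f x) (at x)" and F0: "F 0 = 0"
    and bnd: "\<And>x. \<bar>x\<bar> \<le> R \<Longrightarrow> norm (f x) \<le> K * \<bar>x\<bar> ^ n" and y: "\<bar>y\<bar> \<le> R"
  shows "norm (F y) \<le> K * \<bar>y\<bar> ^ Suc n / Suc n"
proof -
  have pos: "norm (G t) \<le> K * t ^ Suc n / Suc n"
    if G: "\<And>x. (G has_vector_derivative g x) (at x)" and "G 0 = 0"
      and b: "\<And>x. 0 < x \<Longrightarrow> x < t \<Longrightarrow> norm (g x) \<le> K * x ^ n" and "0 \<le> t" for G :: "real \<Rightarrow> 'a" and g t
  proof (cases "t = 0")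
    case False
    have d: "((\<lambda>x. K * x ^ Suc n / Suc n) has_vector_derivative K * x ^ n) (at x)" for x :: real
      unfolding has_real_derivative_iff_has_vector_derivative[symmetric]
      by (rule derivative_eq_intros refl | simp)+
    have "norm (G t - G 0) \<le> K * t ^ Suc n / Suc n - K * 0 ^ Suc n / Suc n"
    proof (rule differentiable_bound_general[of 0 t G "\<lambda>x. K * x ^ Suc n / Suc n" g "\<lambda>x. K * x ^ n"])
      show "continuous_on {0..t} G"
        by (rule has_vector_derivative_imp_continuous_on[OF G])
      show "continuous_on {0..t} (\<lambda>x. K * x ^ Suc n / Suc n)"
        by (intro continuous_intros) simp
    qed (use False that d in auto)
    then show ?thesis using that(2) by simp
  qed (use that in simp)
  show ?thesis
  proof (cases "0 \<le> y")
    case True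
    have "norm (f x) \<le> K * x ^ n" if "0 < x" "x < y" for x using bnd[of x] that y by simp
    then have "norm (F y) \<le> K * y ^ Suc n / Suc n" by (rule pos[OF F F0 _ True])
    then show ?thesis using True by simp
  next
    case False
    have dn: "((\<lambda>x. F (- x)) has_vector_derivative - f (- x)) (at x)" for x
    proof -
      have "(uminus has_vector_derivative -1) (at x)" by (auto intro!: derivative_eq_intros)
      from vector_diff_chain_at[OF this F] show ?thesis by (simp add: o_def)
    qed
    have "norm (F (- (- y))) \<le> K * (- y) ^ Suc n / Suc n"
    proof (rule pos[OF dn])
      fix x assume "0 < x" "x < - y"
      then show "norm (- f (- x)) \<le> K * x ^ n" using bnd[of "- x"] y by simp
    qed (use F0 False in auto)
    then show ?thesis using False by simp
  qed
qed

text \<open>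
  The Picard coefficients of \<open>X' = z C(y) X\<close>, \<open>X(0) = c\<close>: iterated integrals of \<open>C\<close>.
\<close>

definition ode_coeffs :: "(real \<Rightarrow> 'a::euclidean_space \<Rightarrow>\<^sub>L 'a) \<Rightarrow> 'a \<Rightarrow> (nat \<Rightarrow> real \<Rightarrow> 'a) \<Rightarrow> bool"
  where "ode_coeffs C c X \<longleftrightarrow> (\<forall>y. X 0 y = c) \<and> (\<forall>n. X (Suc n) 0 = 0) \<and>
    (\<forall>n y. (X (Suc n) has_vector_derivative C y (X n y)) (at y))"

lemma ode_coeffs_exist:
  fixes C :: "real \<Rightarrow> 'a::euclidean_space \<Rightarrow>\<^sub>L 'a"
  assumes C: "continuous_on UNIV C"
  obtains X where "ode_coeffs C c X"
proof -
  define AD where "AD f = (SOME F. F 0 = 0 \<and> (\<forall>x. (F has_vector_derivative f x) (at x)))" for f :: "real \<Rightarrow> 'a"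
  have AD: "AD f 0 = 0 \<and> (\<forall>x. (AD f has_vector_derivative f x) (at x))" if "continuous_on UNIV f" for f
    unfolding AD_def by (rule someI_ex[OF antiderivative_exists[OF that]])
  define X where "X n = rec_nat (\<lambda>y. c) (\<lambda>n f. AD (\<lambda>y. C y (f y))) n" for n
  have X: "X 0 = (\<lambda>y. c)" "\<And>n. X (Suc n) = AD (\<lambda>y. C y (X n y))" by (simp_all add: X_def)
  have cont: "continuous_on UNIV (X n)" for n
  proof (induction n)
    case (Suc n)
    then have "continuous_on UNIV (\<lambda>y. C y (X n y))" using C by (intro blinfun.continuous_on)
    from AD[OF this] show ?case unfolding X
      by (intro has_vector_derivative_imp_continuous_on[of _ "\<lambda>y. C y (X n y)"]) simp
  qed (simp add: X)
  have "AD (\<lambda>y. C y (X n y)) 0 = 0 \<and> (\<forall>x. (AD (\<lambda>y. C y (X n y)) has_vector_derivative C x (X n x)) (at x))" for n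
    by (rule AD) (use C cont in \<open>intro blinfun.continuous_on\<close>)
  then have "ode_coeffs C c X" by (simp add: ode_coeffs_def X)
  then show thesis by (rule that)
qed

text \<open>
  The simplex estimate for iterated integrals; the factorial makes the series in \<open>z\<close> converge everywhere.
\<close>

lemma ode_coeffs_bound:
  fixes C :: "real \<Rightarrow> 'a::euclidean_space \<Rightarrow>\<^sub>L 'a"
  assumes C: "continuous_on UNIV C" and X: "ode_coeffs C c X"
  obtains M where "M \<ge> 0" "\<And>n y. \<bar>y\<bar> \<le> R \<Longrightarrow> norm (X n y) \<le> norm c * (M ^ n / fact n)"
    "\<And>y. \<bar>y\<bar> \<le> R \<Longrightarrow> norm (C y) \<le> M"
proof -
  have "compact (C ` {-R..R})" using C by (intro compact_continuous_image) (auto intro: continuous_on_subset)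
  then have "bounded (C ` {-R..R})" by (rule compact_imp_bounded)
  then obtain M0 where M0': "M0 > 0" "\<forall>x\<in>C ` {-R..R}. norm x \<le> M0"
    unfolding bounded_pos by blast
  then have M0: "\<And>y. y \<in> {-R..R} \<Longrightarrow> norm (C y) \<le> M0" "M0 > 0" by auto
  have est: "norm (X n y) \<le> norm c * (M0 ^ n / fact n) * \<bar>y\<bar> ^ n" if y: "\<bar>y\<bar> \<le> R" for n y
    using y
  proof (induction n arbitrary: y)
    case 0
    then show ?case using X by (simp add: ode_coeffs_def)
  next
    case (Suc n)
    have "norm (X (Suc n) y) \<le> (norm c * (M0 ^ Suc n / fact n)) * \<bar>y\<bar> ^ Suc n / Suc n"
    proof (rule antiderivative_power_bound)
      show "(X (Suc n) has_vector_derivative C x (X n x)) (at x)" for x using X by (simp add: ode_coeffs_def)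
      show "X (Suc n) 0 = 0" using X by (simp add: ode_coeffs_def)
      fix x assume x: "\<bar>x\<bar> \<le> R"
      have "norm (C x (X n x)) \<le> norm (C x) * norm (X n x)" by (rule norm_blinfun)
      also have "\<dots> \<le> M0 * (norm c * (M0 ^ n / fact n) * \<bar>x\<bar> ^ n)"
        using M0(1)[of x] M0(2) Suc.IH[OF x] x by (intro mult_mono) (auto simp: abs_le_iff)
      finally show "norm (C x (X n x)) \<le> norm c * (M0 ^ Suc n / fact n) * \<bar>x\<bar> ^ n" by (simp add: mult_ac)
    qed (use Suc in auto)
    then show ?case by (simp add: mult_ac)
  qed
  define M where "M = max M0 (M0 * \<bar>R\<bar>)"
  show thesis
  proof (rule that[of M])
    show "M \<ge> 0" using M0 by (simp add: M_def)
    show "norm (C y) \<le> M" if "\<bar>y\<bar> \<le> R" for y using M0(1)[of y] that by (auto simp: M_def le_max_iff_disj abs_le_iff)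
    fix n y assume y: "\<bar>y\<bar> \<le> R"
    have "M0 ^ n * \<bar>y\<bar> ^ n \<le> M ^ n"
      unfolding power_mult_distrib[symmetric]
    proof (rule power_mono)
      have "M0 * \<bar>y\<bar> \<le> M0 * \<bar>R\<bar>" using y M0 by (intro mult_left_mono) auto
      then show "M0 * \<bar>y\<bar> \<le> M" by (simp add: M_def)
    qed (use M0 in auto)
    then have "norm c * ((M0 ^ n * \<bar>y\<bar> ^ n) / fact n) \<le> norm c * (M ^ n / fact n)"
      by (intro mult_left_mono divide_right_mono) auto
    then show "norm (X n y) \<le> norm c * (M ^ n / fact n)" using est[OF y, of n] by (simp add: mult_ac)
  qed
qed

definition ode_sum :: "(nat \<Rightarrow> real \<Rightarrow> 'a::euclidean_space) \<Rightarrow> real \<Rightarrow> real \<Rightarrow> 'a"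
  where "ode_sum X z y = (\<Sum>n. z ^ n *\<^sub>R X n y)"

lemma exp_like_summable: "summable (\<lambda>n. K * (r ^ n / fact n :: real))"
  using summable_mult[OF summable_exp[of r], of K] by (simp add: field_simps)

lemma ode_term_bound:
  assumes "\<bar>z\<bar> \<le> \<rho>" "M \<ge> 0" "norm x \<le> K * (M ^ n / fact n)" "K \<ge> 0"
  shows "norm (z ^ n *\<^sub>R x) \<le> K * ((\<rho> * M) ^ n / fact n)"
proof -
  have "norm (z ^ n *\<^sub>R x) = \<bar>z\<bar> ^ n * norm x" by (simp add: power_abs)
  also have "\<dots> \<le> \<rho> ^ n * (K * (M ^ n / fact n))" using assms by (intro mult_mono power_mono) auto
  finally show ?thesis by (simp add: power_mult_distrib mult_ac)
qed

lemma ode_sum_summable: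
  assumes C: "continuous_on UNIV C" and X: "ode_coeffs C c X"
  shows "summable (\<lambda>n. norm (z ^ n *\<^sub>R X n y))"
proof -
  obtain M where M: "M \<ge> 0" "\<And>n y'. \<bar>y'\<bar> \<le> \<bar>y\<bar> \<Longrightarrow> norm (X n y') \<le> norm c * (M ^ n / fact n)"
    using ode_coeffs_bound[OF C X] by metis
  show ?thesis
    by (rule summable_comparison_test'[OF exp_like_summable[of "norm c" "\<bar>z\<bar> * M"], of 0])
       (use ode_term_bound[of z "\<bar>z\<bar>" M _ "norm c"] M in auto)
qed

lemma ode_sum_has_derivative:
  assumes C: "continuous_on UNIV C" and X: "ode_coeffs C c X"
  shows "(ode_sum X z has_vector_derivative z *\<^sub>R C y (ode_sum X z y)) (at y)"
proof -
  define R where "R = \<bar>y\<bar> + 1"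
  let ?S = "ball (0::real) R"
  obtain M where M: "M \<ge> 0" "\<And>n y'. \<bar>y'\<bar> \<le> R \<Longrightarrow> norm (X n y') \<le> norm c * (M ^ n / fact n)"
    "\<And>y'. \<bar>y'\<bar> \<le> R \<Longrightarrow> norm (C y') \<le> M"
    using ode_coeffs_bound[OF C X] by metis
  have sm: "summable (\<lambda>n. z ^ n *\<^sub>R X n y')" for y' by (rule summable_norm_cancel[OF ode_sum_summable[OF C X]])
  have X0: "X 0 y' = c" "(X (Suc n) has_vector_derivative C y' (X n y')) (at y')" for n y'
    using X by (auto simp: ode_coeffs_def)
  define D where "D n y' = (case n of 0 \<Rightarrow> 0 | Suc m \<Rightarrow> z ^ n *\<^sub>R C y' (X m y'))" for n y'
  have dX: "((\<lambda>y. z ^ n *\<^sub>R X n y) has_vector_derivative D n y') (at y' within ?S)" for n y'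
  proof (cases n)
    case 0
    then show ?thesis by (simp add: D_def X0)
  next
    case (Suc m)
    have "((\<lambda>y. z ^ n *\<^sub>R X n y) has_vector_derivative z ^ n *\<^sub>R C y' (X m y')) (at y')"
      unfolding Suc by (rule bounded_linear.has_vector_derivative[OF bounded_linear_scaleR_right X0(2)])
    then show ?thesis using Suc by (auto simp: D_def intro: has_vector_derivative_at_within)
  qed
  have part: "(\<Sum>i<Suc n. D i y') = z *\<^sub>R C y' (\<Sum>i<n. z ^ i *\<^sub>R X i y')" for n y'
    by (subst sum.lessThan_Suc_shift)
       (simp add: D_def blinfun.sum_right blinfun.scaleR_right scaleR_sum_right mult.commute)
  have ul: "uniform_limit ?S (\<lambda>n y'. \<Sum>i<n. z ^ i *\<^sub>R X i y') (\<lambda>y'. ode_sum X z y') sequentially"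
    unfolding ode_sum_def
  proof (rule Weierstrass_m_test)
    show "norm (z ^ n *\<^sub>R X n y') \<le> norm c * ((\<bar>z\<bar> * M) ^ n / fact n)" if "y' \<in> ?S" for n y'
      using that by (intro ode_term_bound M) auto
  qed (rule exp_like_summable)
  have "\<exists>g. \<forall>x\<in>?S. (\<lambda>n. z ^ n *\<^sub>R X n x) sums g x \<and> (g has_derivative (\<lambda>h. h *\<^sub>R (z *\<^sub>R C x (ode_sum X z x)))) (at x within ?S)"
  proof (rule has_derivative_series)
    show "((\<lambda>y. z ^ n *\<^sub>R X n y) has_derivative (\<lambda>h. h *\<^sub>R D n x)) (at x within ?S)" for n x
      using dX[of n x] by (simp add: has_vector_derivative_def)
    show "(\<lambda>n. z ^ n *\<^sub>R X n 0) sums (\<Sum>n. z ^ n *\<^sub>R X n 0)" using sm by (rule summable_sums)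
    show "0 \<in> ?S" by (simp add: R_def)
    fix e :: real assume e: "e > 0"
    define K where "K = \<bar>z\<bar> * M + 1"
    have K: "K > 0" using M(1) by (simp add: K_def add_nonneg_pos)
    have "\<forall>\<^sub>F n in sequentially. \<forall>x\<in>?S. dist (\<Sum>i<n. z ^ i *\<^sub>R X i x) (ode_sum X z x) < e / K"
      using ul e K by (simp add: uniform_limit_iff)
    then obtain N where N: "\<And>n x. n \<ge> N \<Longrightarrow> x \<in> ?S \<Longrightarrow> dist (\<Sum>i<n. z ^ i *\<^sub>R X i x) (ode_sum X z x) < e / K"
      unfolding eventually_sequentially by blast
    show "\<forall>\<^sub>F n in sequentially. \<forall>x\<in>?S. \<forall>h. norm ((\<Sum>i<n. h *\<^sub>R D i x) - h *\<^sub>R (z *\<^sub>R C x (ode_sum X z x))) \<le> e * norm h"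
      unfolding eventually_sequentially
    proof (intro exI[of _ "Suc N"] allI impI ballI)
      fix n x and h :: real assume n: "Suc N \<le> n" and x: "x \<in> ?S"
      then obtain k where k: "n = Suc k" "N \<le> k" by (cases n) auto
      let ?d = "(\<Sum>i<k. z ^ i *\<^sub>R X i x) - ode_sum X z x"
      have "(\<Sum>i<n. h *\<^sub>R D i x) - h *\<^sub>R (z *\<^sub>R C x (ode_sum X z x)) = h *\<^sub>R (z *\<^sub>R C x ?d)"
        unfolding k scaleR_sum_right[symmetric] part by (simp add: blinfun.diff_right scaleR_diff_right)
      then have "norm ((\<Sum>i<n. h *\<^sub>R D i x) - h *\<^sub>R (z *\<^sub>R C x (ode_sum X z x))) = \<bar>h\<bar> * (\<bar>z\<bar> * norm (C x ?d))"
        by (simp add: abs_mult)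
      also have "\<dots> \<le> \<bar>h\<bar> * (\<bar>z\<bar> * (M * (e / K)))"
      proof (intro mult_left_mono)
        have "norm (C x ?d) \<le> norm (C x) * norm ?d" by (rule norm_blinfun)
        also have "\<dots> \<le> M * (e / K)"
          using M(1) M(3)[of x] N[OF k(2) x] x by (intro mult_mono) (auto simp: dist_norm)
        finally show "norm (C x ?d) \<le> M * (e / K)" .
      qed auto
      also have "\<dots> = \<bar>h\<bar> * (e * ((\<bar>z\<bar> * M) / K))" by simp
      also have "\<dots> \<le> \<bar>h\<bar> * (e * 1)"
        using e K by (intro mult_left_mono) (auto simp: K_def)
      finally show "norm ((\<Sum>i<n. h *\<^sub>R D i x) - h *\<^sub>R (z *\<^sub>R C x (ode_sum X z x))) \<le> e * norm h"
        by (simp add: mult.commute)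
    qed
  qed simp
  then obtain g where g': "\<forall>x\<in>?S. (\<lambda>n. z ^ n *\<^sub>R X n x) sums g x \<and>
    (g has_derivative (\<lambda>h. h *\<^sub>R (z *\<^sub>R C x (ode_sum X z x)))) (at x within ?S)" by (elim exE)
  have g: "(\<lambda>n. z ^ n *\<^sub>R X n x) sums g x"
    "(g has_derivative (\<lambda>h. h *\<^sub>R (z *\<^sub>R C x (ode_sum X z x)))) (at x within ?S)" if "x \<in> ?S" for x
    using bspec[OF g' that] by simp_all
  have y: "y \<in> ?S" by (simp add: R_def)
  have geq: "g x = ode_sum X z x" if "x \<in> ?S" for x using g(1)[OF that] by (simp add: ode_sum_def sums_unique)
  have "(g has_vector_derivative z *\<^sub>R C y (ode_sum X z y)) (at y)"
    using g(2)[OF y] y at_within_open[OF y] by (simp add: has_vector_derivative_def)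
  then show ?thesis
    by (rule has_vector_derivative_transform_within_open[OF _ open_ball y geq])
qed

lemma ode_sum_zero: "ode_coeffs C c X \<Longrightarrow> ode_sum X z 0 = c"
proof -
  assume X: "ode_coeffs C c X"
  have "ode_sum X z 0 = (\<Sum>n. if n = 0 then c else 0)"
    unfolding ode_sum_def
  proof (rule suminf_cong)
    fix n show "z ^ n *\<^sub>R X n 0 = (if n = 0 then c else 0)"
      using X by (cases n) (auto simp: ode_coeffs_def)
  qed
  then show ?thesis using suminf_finite[of "{0::nat}" "\<lambda>n. if n = 0 then c else 0"] by simp
qed

lemma ode_sum_continuous:
  assumes C: "continuous_on UNIV C" and X: "ode_coeffs C c X"
  shows "continuous_on UNIV (\<lambda>p. ode_sum X (fst p) (snd p))"
proof -
  have Xc: "continuous_on UNIV (X n)" for n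
  proof (cases n)
    case 0
    have "X 0 = (\<lambda>y. c)" using X by (auto simp: ode_coeffs_def)
    then show ?thesis using 0 by simp
  next
    case (Suc m)
    then show ?thesis using X unfolding ode_coeffs_def
      by (intro has_vector_derivative_imp_continuous_on[of _ "\<lambda>y. C y (X m y)"]) simp
  qed
  have "isCont (\<lambda>p. ode_sum X (fst p) (snd p)) p" for p :: "real \<times> real"
  proof -
    define R where "R = norm p + 1"
    let ?S = "ball (0::real \<times> real) R"
    obtain M where M: "M \<ge> 0" "\<And>n y'. \<bar>y'\<bar> \<le> R \<Longrightarrow> norm (X n y') \<le> norm c * (M ^ n / fact n)"
      using ode_coeffs_bound[OF C X] by metis
    have "uniform_limit ?S (\<lambda>n q. \<Sum>i<n. fst q ^ i *\<^sub>R X i (snd q)) (\<lambda>q. \<Sum>i. fst q ^ i *\<^sub>R X i (snd q)) sequentially"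
    proof (rule Weierstrass_m_test)
      fix n and q :: "real \<times> real" assume "q \<in> ?S"
      then have q: "\<bar>fst q\<bar> \<le> R" "\<bar>snd q\<bar> \<le> R"
        using norm_fst_le[of "fst q" "snd q"] norm_snd_le[of "snd q" "fst q"] by auto
      then show "norm (fst q ^ n *\<^sub>R X n (snd q)) \<le> norm c * ((R * M) ^ n / fact n)"
        using M by (intro ode_term_bound) auto
    qed (rule exp_like_summable)
    then have "continuous_on ?S (\<lambda>q. \<Sum>i. fst q ^ i *\<^sub>R X i (snd q))"
    proof (rule uniform_limit_theorem[rotated])
      show "\<forall>\<^sub>F n in sequentially. continuous_on ?S (\<lambda>q. \<Sum>i<n. fst q ^ i *\<^sub>R X i (snd q))"
        by (intro always_eventually allI continuous_intros continuous_on_compose2[OF Xc]) auto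
    qed simp
    moreover have "p \<in> ?S" by (simp add: R_def)
    ultimately show ?thesis by (simp add: ode_sum_def continuous_on_eq_continuous_at)
  qed
  then show ?thesis by (simp add: continuous_at_imp_continuous_on)
qed

text \<open>
  The error of the truncated series is uniform on bounded sets, so the expansion may be used along
  curves in the \<open>(z, y)\<close>-plane.
\<close>

lemma ode_sum_remainder:
  assumes C: "continuous_on UNIV C" and X: "ode_coeffs C c X"
  obtains K where "K \<ge> 0" "\<forall>z y. \<bar>z\<bar> \<le> 1 \<longrightarrow> \<bar>y\<bar> \<le> R \<longrightarrow>
    norm (ode_sum X z y - (\<Sum>n<k. z ^ n *\<^sub>R X n y)) \<le> K * \<bar>z\<bar> ^ k"
proof -
  obtain M where M: "M \<ge> 0" "\<And>n y'. \<bar>y'\<bar> \<le> R \<Longrightarrow> norm (X n y') \<le> norm c * (M ^ n / fact n)"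
    using ode_coeffs_bound[OF C X] by metis
  define B where "B n = norm c * (M ^ n / fact n)" for n
  have sB: "summable B" unfolding B_def by (rule exp_like_summable)
  have B0: "B n \<ge> 0" for n using M(1) by (simp add: B_def)
  define K where "K = (\<Sum>n. B (n + k))"
  have sBk: "summable (\<lambda>n. B (n + k))" using summable_ignore_initial_segment[OF sB] .
  show thesis
  proof (rule that[of K]; (intro allI impI)?)
    show "K \<ge> 0" unfolding K_def by (rule suminf_nonneg[OF sBk]) (rule B0)
    fix z y :: real assume z: "\<bar>z\<bar> \<le> 1" and y: "\<bar>y\<bar> \<le> R"
    have sm: "summable (\<lambda>n. z ^ n *\<^sub>R X n y)" by (rule summable_norm_cancel[OF ode_sum_summable[OF C X]])
    have le: "norm (z ^ (n + k) *\<^sub>R X (n + k) y) \<le> \<bar>z\<bar> ^ k * B (n + k)" for n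
    proof -
      have "norm (z ^ (n + k) *\<^sub>R X (n + k) y) = \<bar>z\<bar> ^ n * (\<bar>z\<bar> ^ k * norm (X (n + k) y))"
        by (simp add: power_abs power_add abs_mult mult_ac)
      also have "\<dots> \<le> 1 * (\<bar>z\<bar> ^ k * B (n + k))"
        using z M(2)[OF y] B0 unfolding B_def by (intro mult_mono power_le_one) auto
      finally show ?thesis by simp
    qed
    have "ode_sum X z y - (\<Sum>n<k. z ^ n *\<^sub>R X n y) = (\<Sum>n. z ^ (n + k) *\<^sub>R X (n + k) y)"
      unfolding ode_sum_def using suminf_minus_initial_segment[OF sm, of k] by simp
    also have "norm \<dots> \<le> (\<Sum>n. \<bar>z\<bar> ^ k * B (n + k))"
      by (rule norm_suminf_le[OF le summable_mult[OF sBk]])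
    also have "\<dots> = \<bar>z\<bar> ^ k * K" unfolding K_def by (rule suminf_mult[OF sBk])
    also have "\<dots> = K * \<bar>z\<bar> ^ k" by (rule mult.commute)
    finally show "norm (ode_sum X z y - (\<Sum>n<k. z ^ n *\<^sub>R X n y)) \<le> K * \<bar>z\<bar> ^ k" .
  qed
qed

section \<open>Fundamental solutions of a scalar equation\<close>

lemma scalar_solution_exists:
  fixes q :: "real \<Rightarrow> real"
  assumes q: "continuous_on UNIV q"
  shows "\<exists>w w'. w 0 = a \<and> w' 0 = b \<and> (\<forall>y. (w has_real_derivative w' y) (at y)) \<and>
    (\<forall>y. (w' has_real_derivative - q y * w y) (at y))"
proof -
  define C where "C y = Blinfun (\<lambda>p::real \<times> real. (snd p, - q y * fst p))" for y
  have bl: "bounded_linear (\<lambda>p::real \<times> real. (snd p, - q y * fst p))" for y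
    by (intro bounded_linear_Pair bounded_linear_snd bounded_linear_compose[OF bounded_linear_mult_right bounded_linear_fst])
  have C: "C y p = (snd p, - q y * fst p)" for y p
    unfolding C_def by (subst bounded_linear_Blinfun_apply[OF bl]) simp
  have "continuous (at y) C" for y
  proof (rule continuous_blinfun_componentwiseI1)
    fix i :: "real \<times> real"
    have "continuous (at y) q" using q by (simp add: continuous_on_eq_continuous_at)
    then show "continuous (at y) (\<lambda>y. C y i)" unfolding C by (intro continuous_intros)
  qed
  then have Cc: "continuous_on UNIV C" by (simp add: continuous_at_imp_continuous_on)
  obtain X where X: "ode_coeffs C (a, b) X" using ode_coeffs_exist[OF Cc] .
  let ?w = "ode_sum X 1"
  have d: "(?w has_vector_derivative (snd (?w y), - q y * fst (?w y))) (at y)" for y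
    using ode_sum_has_derivative[OF Cc X, of 1 y] by (simp add: C)
  have "((\<lambda>y. fst (?w y)) has_vector_derivative snd (?w y)) (at y)"
    "((\<lambda>y. snd (?w y)) has_vector_derivative - q y * fst (?w y)) (at y)" for y
    using bounded_linear.has_vector_derivative[OF bounded_linear_fst d[of y]]
      bounded_linear.has_vector_derivative[OF bounded_linear_snd d[of y]] by simp_all
  then show ?thesis
    by (intro exI[of _ "\<lambda>y. fst (?w y)"] exI[of _ "\<lambda>y. snd (?w y)"])
       (simp add: ode_sum_zero[OF X] has_real_derivative_iff_has_vector_derivative)
qed

definition fundamental :: "(real \<Rightarrow> real) \<Rightarrow> real \<Rightarrow> real \<Rightarrow> (real \<Rightarrow> real) \<times> (real \<Rightarrow> real)"
  where "fundamental q a b = (SOME (w, w'). w 0 = a \<and> w' 0 = b \<and> (\<forall>y. (w has_real_derivative w' y) (at y)) \<and>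
    (\<forall>y. (w' has_real_derivative - q y * w y) (at y)))"

lemma fundamental:
  assumes "continuous_on UNIV q"
  shows "fst (fundamental q a b) 0 = a" "snd (fundamental q a b) 0 = b"
    "(fst (fundamental q a b) has_real_derivative snd (fundamental q a b) y) (at y)"
    "(snd (fundamental q a b) has_real_derivative - q y * fst (fundamental q a b) y) (at y)"
proof -
  have "case fundamental q a b of (w, w') \<Rightarrow> w 0 = a \<and> w' 0 = b \<and> (\<forall>y. (w has_real_derivative w' y) (at y)) \<and>
    (\<forall>y. (w' has_real_derivative - q y * w y) (at y))"
    unfolding fundamental_def by (rule someI_ex) (use scalar_solution_exists[OF assms, of a b] in auto)
  then show "fst (fundamental q a b) 0 = a" "snd (fundamental q a b) 0 = b"
    "(fst (fundamental q a b) has_real_derivative snd (fundamental q a b) y) (at y)"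
    "(snd (fundamental q a b) has_real_derivative - q y * fst (fundamental q a b) y) (at y)"
    by (auto split: prod.splits)
qed

section \<open>The eigenvalue equation as a power series in the spectral parameter\<close>

text \<open>
  The pair \<open>((u(0), u'(0)), (v(0), v'(0)))\<close>.
\<close>

type_synonym cauchy_data = "(real \<times> real) \<times> (real \<times> real)"

locale hamiltonian_pencil =
  fixes g h :: "real \<Rightarrow> real"
  assumes g_cont: "continuous_on UNIV g" and h_cont: "continuous_on UNIV h"
begin

text \<open>
  The analogues of cosine and sine for \<open>w'' = - g w\<close> and \<open>w'' = - h w\<close>, with their derivatives. The Dirichlet
  problem on \<open>[0, l]\<close> for \<open>L\<^sub>+\<close> has a kernel iff \<open>sg l = 0\<close>, and for \<open>L\<^sub>-\<close> iff \<open>sh l = 0\<close>.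
\<close>

definition "cg = fst (fundamental g 1 0)"
definition "cg' = snd (fundamental g 1 0)"
definition "sg = fst (fundamental g 0 1)"
definition "sg' = snd (fundamental g 0 1)"
definition "ch = fst (fundamental h 1 0)"
definition "ch' = snd (fundamental h 1 0)"
definition "sh = fst (fundamental h 0 1)"
definition "sh' = snd (fundamental h 0 1)"

lemma fund_init [simp]: "cg 0 = 1" "cg' 0 = 0" "sg 0 = 0" "sg' 0 = 1" "ch 0 = 1" "ch' 0 = 0" "sh 0 = 0" "sh' 0 = 1"
  using fundamental(1,2)[OF g_cont] fundamental(1,2)[OF h_cont]
  by (simp_all add: cg_def cg'_def sg_def sg'_def ch_def ch'_def sh_def sh'_def)

lemma fund_deriv:
  "(cg has_real_derivative cg' y) (at y)" "(cg' has_real_derivative - g y * cg y) (at y)"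
  "(sg has_real_derivative sg' y) (at y)" "(sg' has_real_derivative - g y * sg y) (at y)"
  "(ch has_real_derivative ch' y) (at y)" "(ch' has_real_derivative - h y * ch y) (at y)"
  "(sh has_real_derivative sh' y) (at y)" "(sh' has_real_derivative - h y * sh y) (at y)"
  using fundamental(3,4)[OF g_cont] fundamental(3,4)[OF h_cont]
  by (simp_all add: cg_def cg'_def sg_def sg'_def ch_def ch'_def sh_def sh'_def)

lemma fund_cont [continuous_intros]:
  "continuous_on S cg" "continuous_on S cg'" "continuous_on S sg" "continuous_on S sg'"
  "continuous_on S ch" "continuous_on S ch'" "continuous_on S sh" "continuous_on S sh'"
  by (rule continuous_at_imp_continuous_on, intro ballI DERIV_isCont, rule fund_deriv)+

lemma wronskian: "cg y * sg' y - cg' y * sg y = 1" "ch y * sh' y - ch' y * sh y = 1"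
proof -
  have "((\<lambda>y. cg y * sg' y - cg' y * sg y) has_real_derivative 0) (at y)" for y
    by (rule derivative_eq_intros fund_deriv refl | simp)+
  from DERIV_isconst_all[of "\<lambda>y. cg y * sg' y - cg' y * sg y" y 0] this
  show "cg y * sg' y - cg' y * sg y = 1" by simp
  have "((\<lambda>y. ch y * sh' y - ch' y * sh y) has_real_derivative 0) (at y)" for y
    by (rule derivative_eq_intros fund_deriv refl | simp)+
  from DERIV_isconst_all[of "\<lambda>y. ch y * sh' y - ch' y * sh y" y 0] this
  show "ch y * sh' y - ch' y * sh y = 1" by simp
qed

text \<open>
  The solution of the uncoupled equations with Cauchy data \<open>p\<close>, evaluated at \<open>y\<close>; similarly \<open>vc\<close>.
\<close>

definition uc :: "cauchy_data \<Rightarrow> real \<Rightarrow> real" where "uc p y = fst (fst p) * cg y + snd (fst p) * sg y"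
definition uc' :: "cauchy_data \<Rightarrow> real \<Rightarrow> real" where "uc' p y = fst (fst p) * cg' y + snd (fst p) * sg' y"
definition vc :: "cauchy_data \<Rightarrow> real \<Rightarrow> real" where "vc p y = fst (snd p) * ch y + snd (snd p) * sh y"
definition vc' :: "cauchy_data \<Rightarrow> real \<Rightarrow> real" where "vc' p y = fst (snd p) * ch' y + snd (snd p) * sh' y"

text \<open>
  Variation of constants: if the Cauchy data move by \<open>p' = \<mu> coupling y p\<close> then \<open>uc\<close> and \<open>vc\<close> solve
  \<open>u'' = - g u - \<mu> v\<close>, \<open>v'' = - h v + \<mu> u\<close>. In this form the equation is linear in \<open>\<mu>\<close> without constant term, so
  the Picard series is the expansion in powers of \<open>\<mu>\<close>.
\<close>

definition coupling :: "real \<Rightarrow> cauchy_data \<Rightarrow>\<^sub>L cauchy_data"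
  where "coupling y = Blinfun (\<lambda>p. ((sg y * vc p y, - cg y * vc p y), (- sh y * uc p y, ch y * uc p y)))"

lemma coupling_apply: "coupling y p = ((sg y * vc p y, - cg y * vc p y), (- sh y * uc p y, ch y * uc p y))"
proof -
  have u: "bounded_linear (\<lambda>p. uc p y)" and v: "bounded_linear (\<lambda>p. vc p y)"
    unfolding uc_def vc_def
    by (intro bounded_linear_add bounded_linear_compose[OF bounded_linear_mult_left]
        bounded_linear_compose[OF bounded_linear_fst] bounded_linear_compose[OF bounded_linear_snd]
        bounded_linear_fst bounded_linear_snd)+
  have "bounded_linear (\<lambda>p. ((sg y * vc p y, - cg y * vc p y), (- sh y * uc p y, ch y * uc p y)))"
    by (intro bounded_linear_Pair bounded_linear_compose[OF bounded_linear_mult_right] u v)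
  then show ?thesis unfolding coupling_def by (subst bounded_linear_Blinfun_apply) auto
qed

lemma coupling_cont: "continuous_on UNIV coupling"
proof -
  have "continuous (at y) coupling" for y
  proof (rule continuous_blinfun_componentwiseI1)
    fix i :: cauchy_data
    have "continuous_on UNIV (\<lambda>y. coupling y i)"
      unfolding coupling_apply uc_def vc_def by (intro continuous_intros)
    then show "continuous (at y) (\<lambda>y. coupling y i)" by (simp add: continuous_on_eq_continuous_at)
  qed
  then show ?thesis by (simp add: continuous_at_imp_continuous_on)
qed

lemma variation_of_constants:
  fixes P :: "real \<Rightarrow> cauchy_data"
  assumes P: "(P has_vector_derivative ((- sg y * F, cg y * F), (- sh y * G, ch y * G))) (at y)"
  shows "((\<lambda>y. uc (P y) y) has_real_derivative uc' (P y) y) (at y)"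
    "((\<lambda>y. uc' (P y) y) has_real_derivative - g y * uc (P y) y + F) (at y)"
    "((\<lambda>y. vc (P y) y) has_real_derivative vc' (P y) y) (at y)"
    "((\<lambda>y. vc' (P y) y) has_real_derivative - h y * vc (P y) y + G) (at y)"
proof -
  note bl = bounded_linear.has_vector_derivative
  have 1: "((\<lambda>y. fst (P y)) has_vector_derivative (- sg y * F, cg y * F)) (at y)"
    using bl[OF bounded_linear_fst P] by simp
  have 2: "((\<lambda>y. snd (P y)) has_vector_derivative (- sh y * G, ch y * G)) (at y)"
    using bl[OF bounded_linear_snd P] by simp
  have c: "((\<lambda>y. fst (fst (P y))) has_real_derivative - sg y * F) (at y)"
    "((\<lambda>y. snd (fst (P y))) has_real_derivative cg y * F) (at y)"
    "((\<lambda>y. fst (snd (P y))) has_real_derivative - sh y * G) (at y)"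
    "((\<lambda>y. snd (snd (P y))) has_real_derivative ch y * G) (at y)"
    using bl[OF bounded_linear_fst 1] bl[OF bounded_linear_snd 1] bl[OF bounded_linear_fst 2] bl[OF bounded_linear_snd 2]
    by (simp_all add: has_real_derivative_iff_has_vector_derivative)
  show "((\<lambda>y. uc (P y) y) has_real_derivative uc' (P y) y) (at y)"
    unfolding uc_def uc'_def by (rule derivative_eq_intros c fund_deriv refl | simp)+
  show "((\<lambda>y. vc (P y) y) has_real_derivative vc' (P y) y) (at y)"
    unfolding vc_def vc'_def by (rule derivative_eq_intros c fund_deriv refl | simp)+
  have "((\<lambda>y. uc' (P y) y) has_real_derivative
      (- sg y * F * cg' y + - g y * cg y * fst (fst (P y))) + (cg y * F * sg' y + - g y * sg y * snd (fst (P y)))) (at y)"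
    unfolding uc'_def
    using DERIV_add[OF DERIV_mult[OF c(1) fund_deriv(2)[of y]] DERIV_mult[OF c(2) fund_deriv(4)[of y]]] .
  moreover have "(- sg y * F * cg' y + - g y * cg y * fst (fst (P y))) + (cg y * F * sg' y + - g y * sg y * snd (fst (P y)))
      = - g y * uc (P y) y + F * (cg y * sg' y - cg' y * sg y)" by (simp add: uc_def algebra_simps)
  ultimately show "((\<lambda>y. uc' (P y) y) has_real_derivative - g y * uc (P y) y + F) (at y)" by (simp add: wronskian)
  have "((\<lambda>y. vc' (P y) y) has_real_derivative
      (- sh y * G * ch' y + - h y * ch y * fst (snd (P y))) + (ch y * G * sh' y + - h y * sh y * snd (snd (P y)))) (at y)"
    unfolding vc'_def
    using DERIV_add[OF DERIV_mult[OF c(3) fund_deriv(6)[of y]] DERIV_mult[OF c(4) fund_deriv(8)[of y]]] .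
  moreover have "(- sh y * G * ch' y + - h y * ch y * fst (snd (P y))) + (ch y * G * sh' y + - h y * sh y * snd (snd (P y)))
      = - h y * vc (P y) y + G * (ch y * sh' y - ch' y * sh y)" by (simp add: vc_def algebra_simps)
  ultimately show "((\<lambda>y. vc' (P y) y) has_real_derivative - h y * vc (P y) y + G) (at y)" by (simp add: wronskian)
qed

definition cf :: "cauchy_data \<Rightarrow> nat \<Rightarrow> real \<Rightarrow> cauchy_data"
  where "cf c = (SOME X. ode_coeffs coupling c X)"

lemma cf: "ode_coeffs coupling c (cf c)"
  unfolding cf_def using ode_coeffs_exist[OF coupling_cont] by (metis someI_ex)

lemma cf_simps [simp]: "cf c 0 y = c" "cf c (Suc n) 0 = 0"
  using cf[of c] by (simp_all add: ode_coeffs_def)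

lemma cf_deriv: "(cf c (Suc n) has_vector_derivative
    ((- sg y * (- vc (cf c n y) y), cg y * (- vc (cf c n y) y)), (- sh y * uc (cf c n y) y, ch y * uc (cf c n y) y))) (at y)"
  using cf[of c] by (simp add: ode_coeffs_def coupling_apply)

definition state :: "cauchy_data \<Rightarrow> real \<Rightarrow> real \<Rightarrow> cauchy_data"
  where "state c \<mu> y = ode_sum (cf c) \<mu> y"

definition usol where "usol c \<mu> y = uc (state c \<mu> y) y"
definition usol' where "usol' c \<mu> y = uc' (state c \<mu> y) y"
definition vsol where "vsol c \<mu> y = vc (state c \<mu> y) y"
definition vsol' where "vsol' c \<mu> y = vc' (state c \<mu> y) y"

lemma state_deriv: "(state c \<mu> has_vector_derivative
    ((- sg y * (- \<mu> * vsol c \<mu> y), cg y * (- \<mu> * vsol c \<mu> y)), (- sh y * (\<mu> * usol c \<mu> y), ch y * (\<mu> * usol c \<mu> y)))) (at y)"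
  using ode_sum_has_derivative[OF coupling_cont cf, of c \<mu> y]
  by (simp add: state_def[abs_def] coupling_apply usol_def vsol_def mult_ac)

lemma sol_deriv:
  "(usol c \<mu> has_real_derivative usol' c \<mu> y) (at y)"
  "(usol' c \<mu> has_real_derivative - g y * usol c \<mu> y - \<mu> * vsol c \<mu> y) (at y)"
  "(vsol c \<mu> has_real_derivative vsol' c \<mu> y) (at y)"
  "(vsol' c \<mu> has_real_derivative - h y * vsol c \<mu> y + \<mu> * usol c \<mu> y) (at y)"
  using variation_of_constants[OF state_deriv]
  by (simp_all add: usol_def[abs_def] usol'_def[abs_def] vsol_def[abs_def] vsol'_def[abs_def])

lemma sol_init [simp]:
  "usol c \<mu> 0 = fst (fst c)" "usol' c \<mu> 0 = snd (fst c)" "vsol c \<mu> 0 = fst (snd c)" "vsol' c \<mu> 0 = snd (snd c)"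
  by (simp_all add: usol_def usol'_def vsol_def vsol'_def state_def ode_sum_zero[OF cf] uc_def uc'_def vc_def vc'_def)

lemma sol_cont:
  "continuous_on UNIV (\<lambda>p. usol c (fst p) (snd p))" "continuous_on UNIV (\<lambda>p. usol' c (fst p) (snd p))"
  "continuous_on UNIV (\<lambda>p. vsol c (fst p) (snd p))" "continuous_on UNIV (\<lambda>p. vsol' c (fst p) (snd p))"
proof -
  have s: "continuous_on UNIV (\<lambda>p. state c (fst p) (snd p))"
    unfolding state_def by (rule ode_sum_continuous[OF coupling_cont cf])
  have k: "continuous_on UNIV (\<lambda>p::real \<times> real. f (snd p))" if "continuous_on UNIV f" for f :: "real \<Rightarrow> real"
    by (rule continuous_on_compose2[OF that continuous_on_snd[OF continuous_on_id]]) simp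
  show "continuous_on UNIV (\<lambda>p. usol c (fst p) (snd p))" "continuous_on UNIV (\<lambda>p. usol' c (fst p) (snd p))"
    "continuous_on UNIV (\<lambda>p. vsol c (fst p) (snd p))" "continuous_on UNIV (\<lambda>p. vsol' c (fst p) (snd p))"
    unfolding usol_def usol'_def vsol_def vsol'_def uc_def uc'_def vc_def vc'_def
    by (intro continuous_on_add continuous_on_mult continuous_on_fst continuous_on_snd s k fund_cont)+
qed

lemma state_zero: "state c 0 y = c"
  unfolding state_def ode_sum_def
proof -
  have "(\<Sum>n. 0 ^ n *\<^sub>R cf c n y) = (\<Sum>n\<in>{0}. 0 ^ n *\<^sub>R cf c n y)"
    by (rule suminf_finite) auto
  then show "(\<Sum>n. 0 ^ n *\<^sub>R cf c n y) = c" by simp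
qed

definition eu :: cauchy_data where "eu = ((0, 1), (0, 0))"
definition ev :: cauchy_data where "ev = ((0, 0), (0, 1))"

lemma sol_zero:
  "usol c 0 y = uc c y" "usol' c 0 y = uc' c y" "vsol c 0 y = vc c y" "vsol' c 0 y = vc' c y"
  by (simp_all add: usol_def usol'_def vsol_def vsol'_def state_zero)

lemma uc_norm: "\<bar>uc p y\<bar> \<le> (\<bar>cg y\<bar> + \<bar>sg y\<bar>) * norm p" "\<bar>vc p y\<bar> \<le> (\<bar>ch y\<bar> + \<bar>sh y\<bar>) * norm p"
proof -
  have n: "\<bar>fst (fst p)\<bar> \<le> norm p" "\<bar>snd (fst p)\<bar> \<le> norm p" "\<bar>fst (snd p)\<bar> \<le> norm p" "\<bar>snd (snd p)\<bar> \<le> norm p"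
  proof -
    have "norm (fst p) \<le> norm p" "norm (snd p) \<le> norm p"
      using norm_fst_le[of "fst p" "snd p"] norm_snd_le[of "snd p" "fst p"] by simp_all
    moreover have "\<bar>fst q\<bar> \<le> norm q" "\<bar>snd q\<bar> \<le> norm q" for q :: "real \<times> real"
      using norm_fst_le[of "fst q" "snd q"] norm_snd_le[of "snd q" "fst q"] by simp_all
    ultimately show "\<bar>fst (fst p)\<bar> \<le> norm p" "\<bar>snd (fst p)\<bar> \<le> norm p" "\<bar>fst (snd p)\<bar> \<le> norm p" "\<bar>snd (snd p)\<bar> \<le> norm p"
      using order_trans by blast+
  qed
  have "\<bar>uc p y\<bar> \<le> \<bar>fst (fst p)\<bar> * \<bar>cg y\<bar> + \<bar>snd (fst p)\<bar> * \<bar>sg y\<bar>"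
    unfolding uc_def abs_mult[symmetric] by (rule abs_triangle_ineq)
  also have "\<dots> \<le> norm p * \<bar>cg y\<bar> + norm p * \<bar>sg y\<bar>" using n by (intro add_mono mult_right_mono) auto
  finally show "\<bar>uc p y\<bar> \<le> (\<bar>cg y\<bar> + \<bar>sg y\<bar>) * norm p" by (simp add: algebra_simps)
  have "\<bar>vc p y\<bar> \<le> \<bar>fst (snd p)\<bar> * \<bar>ch y\<bar> + \<bar>snd (snd p)\<bar> * \<bar>sh y\<bar>"
    unfolding vc_def abs_mult[symmetric] by (rule abs_triangle_ineq)
  also have "\<dots> \<le> norm p * \<bar>ch y\<bar> + norm p * \<bar>sh y\<bar>" using n by (intro add_mono mult_right_mono) auto
  finally show "\<bar>vc p y\<bar> \<le> (\<bar>ch y\<bar> + \<bar>sh y\<bar>) * norm p" by (simp add: algebra_simps)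
qed

text \<open>
  The coefficients of \<open>\<mu> ^ n\<close> in the solution with Cauchy data \<open>c\<close>; each is driven by the previous one of
  the other component (\<open>un_deriv\<close>).
\<close>

definition un where "un c n y = uc (cf c n y) y"
definition un' where "un' c n y = uc' (cf c n y) y"
definition vn where "vn c n y = vc (cf c n y) y"
definition vn' where "vn' c n y = vc' (cf c n y) y"

lemma un_deriv:
  "(un c (Suc n) has_real_derivative un' c (Suc n) y) (at y)"
  "(un' c (Suc n) has_real_derivative - g y * un c (Suc n) y - vn c n y) (at y)"
  "(vn c (Suc n) has_real_derivative vn' c (Suc n) y) (at y)"
  "(vn' c (Suc n) has_real_derivative - h y * vn c (Suc n) y + un c n y) (at y)"
  using variation_of_constants[OF cf_deriv]
  by (simp_all add: un_def[abs_def] un'_def[abs_def] vn_def[abs_def] vn'_def[abs_def])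

lemma un_init: "un c (Suc n) 0 = 0" "un' c (Suc n) 0 = 0" "vn c (Suc n) 0 = 0" "vn' c (Suc n) 0 = 0"
  by (simp_all add: un_def un'_def vn_def vn'_def uc_def uc'_def vc_def vc'_def)

lemma u_zero: "un eu 0 = sg" "vn eu 0 = (\<lambda>y. 0)" "un ev 0 = (\<lambda>y. 0)" "vn ev 0 = sh"
  by (auto simp: fun_eq_iff un_def vn_def uc_def vc_def eu_def ev_def)

lemma un_vanish:
  assumes "\<And>y. vn c n y = 0" shows "un c (Suc n) y = 0"
proof -
  have "((\<lambda>y. fst (cf c (Suc n) y)) has_vector_derivative 0) (at y)" for y
    using bounded_linear.has_vector_derivative[OF bounded_linear_fst cf_deriv[of c n y]] assms
    by (simp add: vn_def zero_prod_def)
  then have "fst (cf c (Suc n) y) = fst (cf c (Suc n) 0)"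
    using has_vector_derivative_zero_constant[of UNIV "\<lambda>y. fst (cf c (Suc n) y)"] by (metis UNIV_I convex_UNIV)
  then show ?thesis by (simp add: un_def uc_def)
qed

lemma vn_vanish:
  assumes "\<And>y. un c n y = 0" shows "vn c (Suc n) y = 0"
proof -
  have "((\<lambda>y. snd (cf c (Suc n) y)) has_vector_derivative 0) (at y)" for y
    using bounded_linear.has_vector_derivative[OF bounded_linear_snd cf_deriv[of c n y]] assms
    by (simp add: un_def zero_prod_def)
  then have "snd (cf c (Suc n) y) = snd (cf c (Suc n) 0)"
    using has_vector_derivative_zero_constant[of UNIV "\<lambda>y. snd (cf c (Suc n) y)"] by (metis UNIV_I convex_UNIV)
  then show ?thesis by (simp add: vn_def vc_def)
qed

text \<open>
  Replacing \<open>\<mu>\<close> by \<open>- \<mu>\<close> and \<open>v\<close> by \<open>- v\<close> preserves the equation, so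
  with Cauchy data in \<open>u\<close> alone \<open>u\<close> is even and \<open>v\<close> odd in \<open>\<mu>\<close>, and conversely.
\<close>

lemma parity:
  "un eu 1 y = 0" "vn eu 2 y = 0" "vn ev 1 y = 0" "un ev 2 y = 0"
proof -
  show 1: "un eu 1 y = 0" for y using un_vanish[of eu 0] by (simp add: u_zero)
  show 2: "vn ev 1 y = 0" for y using vn_vanish[of ev 0] by (simp add: u_zero)
  show "vn eu 2 y = 0" using vn_vanish[of eu 1] 1 by (simp add: numeral_2_eq_2)
  show "un ev 2 y = 0" using un_vanish[of ev 1] 2 by (simp add: numeral_2_eq_2)
qed

lemma sol_remainder:
  obtains K where "K \<ge> 0"
    "\<forall>\<mu> y. \<bar>\<mu>\<bar> \<le> 1 \<longrightarrow> \<bar>y\<bar> \<le> R \<longrightarrow> \<bar>usol c \<mu> y - (\<Sum>n<k. \<mu> ^ n * un c n y)\<bar> \<le> K * \<bar>\<mu>\<bar> ^ k"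
    "\<forall>\<mu> y. \<bar>\<mu>\<bar> \<le> 1 \<longrightarrow> \<bar>y\<bar> \<le> R \<longrightarrow> \<bar>vsol c \<mu> y - (\<Sum>n<k. \<mu> ^ n * vn c n y)\<bar> \<le> K * \<bar>\<mu>\<bar> ^ k"
proof -
  obtain K0 where K0: "K0 \<ge> 0" "\<forall>z y. \<bar>z\<bar> \<le> 1 \<longrightarrow> \<bar>y\<bar> \<le> R \<longrightarrow>
    norm (ode_sum (cf c) z y - (\<Sum>n<k. z ^ n *\<^sub>R cf c n y)) \<le> K0 * \<bar>z\<bar> ^ k"
    by (rule ode_sum_remainder[OF coupling_cont cf])
  have "compact ((\<lambda>y. \<bar>cg y\<bar> + \<bar>sg y\<bar> + (\<bar>ch y\<bar> + \<bar>sh y\<bar>)) ` {-R..R})"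
    by (intro compact_continuous_image continuous_intros) simp
  then have "bounded ((\<lambda>y. \<bar>cg y\<bar> + \<bar>sg y\<bar> + (\<bar>ch y\<bar> + \<bar>sh y\<bar>)) ` {-R..R})" by (rule compact_imp_bounded)
  then obtain B where B0: "B > 0" and B': "\<forall>x\<in>(\<lambda>y. \<bar>cg y\<bar> + \<bar>sg y\<bar> + (\<bar>ch y\<bar> + \<bar>sh y\<bar>)) ` {-R..R}. norm x \<le> B"
    unfolding bounded_pos by blast
  have B: "\<bar>cg y\<bar> + \<bar>sg y\<bar> \<le> B" "\<bar>ch y\<bar> + \<bar>sh y\<bar> \<le> B" if "\<bar>y\<bar> \<le> R" for y
  proof -
    have "y \<in> {-R..R}" using that by auto
    then have "norm (\<bar>cg y\<bar> + \<bar>sg y\<bar> + (\<bar>ch y\<bar> + \<bar>sh y\<bar>)) \<le> B" using B' by blast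
    then show "\<bar>cg y\<bar> + \<bar>sg y\<bar> \<le> B" "\<bar>ch y\<bar> + \<bar>sh y\<bar> \<le> B" by simp_all
  qed
  have lin: "linear (\<lambda>p. uc p y)" "linear (\<lambda>p. vc p y)" for y
    by (auto intro!: linearI simp: uc_def vc_def algebra_simps)
  show thesis
  proof (rule that[of "B * K0"]; (intro allI impI)?)
    show "B * K0 \<ge> 0" using B0 K0(1) by simp
    fix \<mu> y :: real assume m: "\<bar>\<mu>\<bar> \<le> 1" and y: "\<bar>y\<bar> \<le> R"
    let ?d = "state c \<mu> y - (\<Sum>n<k. \<mu> ^ n *\<^sub>R cf c n y)"
    have d: "norm ?d \<le> K0 * \<bar>\<mu>\<bar> ^ k" using K0(2) m y by (simp add: state_def)
    have "usol c \<mu> y - (\<Sum>n<k. \<mu> ^ n * un c n y) = uc ?d y"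
      by (simp add: usol_def un_def linear_diff[OF lin(1)] linear_sum[OF lin(1)] linear_cmul[OF lin(1)])
    moreover have "\<bar>uc ?d y\<bar> \<le> B * (K0 * \<bar>\<mu>\<bar> ^ k)"
      by (rule order_trans[OF uc_norm(1) mult_mono]) (use B(1)[OF y] d B0 in auto)
    ultimately show "\<bar>usol c \<mu> y - (\<Sum>n<k. \<mu> ^ n * un c n y)\<bar> \<le> B * K0 * \<bar>\<mu>\<bar> ^ k" by simp
    have "vsol c \<mu> y - (\<Sum>n<k. \<mu> ^ n * vn c n y) = vc ?d y"
      by (simp add: vsol_def vn_def linear_diff[OF lin(2)] linear_sum[OF lin(2)] linear_cmul[OF lin(2)])
    moreover have "\<bar>vc ?d y\<bar> \<le> B * (K0 * \<bar>\<mu>\<bar> ^ k)"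
      by (rule order_trans[OF uc_norm(2) mult_mono]) (use B(2)[OF y] d B0 in auto)
    ultimately show "\<bar>vsol c \<mu> y - (\<Sum>n<k. \<mu> ^ n * vn c n y)\<bar> \<le> B * K0 * \<bar>\<mu>\<bar> ^ k" by simp
  qed
qed

lemma sol_sums:
  "summable (\<lambda>n. norm (un c n y * \<mu> ^ n))" "(\<Sum>n. un c n y * \<mu> ^ n) = usol c \<mu> y"
  "summable (\<lambda>n. norm (vn c n y * \<mu> ^ n))" "(\<Sum>n. vn c n y * \<mu> ^ n) = vsol c \<mu> y"
proof -
  have s: "summable (\<lambda>n. norm (\<mu> ^ n *\<^sub>R cf c n y))" by (rule ode_sum_summable[OF coupling_cont cf])
  have u: "bounded_linear (\<lambda>p. uc p y)" and v: "bounded_linear (\<lambda>p. vc p y)"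
    unfolding linear_conv_bounded_linear[symmetric]
    by (auto intro!: linearI simp: uc_def vc_def algebra_simps)
  have eu: "un c n y * \<mu> ^ n = uc (\<mu> ^ n *\<^sub>R cf c n y) y" and ev: "vn c n y * \<mu> ^ n = vc (\<mu> ^ n *\<^sub>R cf c n y) y" for n
    by (simp_all add: un_def vn_def uc_def vc_def algebra_simps)
  show "summable (\<lambda>n. norm (un c n y * \<mu> ^ n))"
    by (rule summable_comparison_test'[OF summable_mult[OF s, of "\<bar>cg y\<bar> + \<bar>sg y\<bar>"], of 0])
       (simp only: eu real_norm_def abs_idempotent uc_norm(1))
  show "summable (\<lambda>n. norm (vn c n y * \<mu> ^ n))"
    by (rule summable_comparison_test'[OF summable_mult[OF s, of "\<bar>ch y\<bar> + \<bar>sh y\<bar>"], of 0])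
       (simp only: ev real_norm_def abs_idempotent uc_norm(2))
  show "(\<Sum>n. un c n y * \<mu> ^ n) = usol c \<mu> y" "(\<Sum>n. vn c n y * \<mu> ^ n) = vsol c \<mu> y"
    unfolding eu ev usol_def vsol_def state_def ode_sum_def
    using bounded_linear.suminf[OF u summable_norm_cancel[OF s]] bounded_linear.suminf[OF v summable_norm_cancel[OF s]]
    by simp_all
qed

end

section \<open>Weak and classical second derivatives\<close>

lemma AE_lebesgue_on_subset:
  fixes S T :: "real set"
  assumes "AE x in lebesgue_on S. P x" "T \<subseteq> S" "S \<in> sets lebesgue" "T \<in> sets lebesgue"
  shows "AE x in lebesgue_on T. P x"
proof -
  have "AE x in lebesgue. x \<in> S \<longrightarrow> P x" using assms(1,3) by (subst (asm) AE_restrict_space_iff) auto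
  then have "AE x in lebesgue. x \<in> T \<longrightarrow> P x" by (rule AE_mp) (use assms(2) in auto)
  then show ?thesis using assms(4) by (subst AE_restrict_space_iff) auto
qed

lemma continuous_integrable_open:
  fixes f :: "real \<Rightarrow> 'b::euclidean_space"
  assumes "continuous_on {a..b} f"
  shows "integrable (lebesgue_on {a<..<b}) f" "(LINT y|lebesgue_on {a<..<b}. f y) = integral {a..b} f"
proof -
  have "f absolutely_integrable_on {a..b}" by (rule absolutely_integrable_continuous_real[OF assms])
  then have "f absolutely_integrable_on {a<..<b}" by (rule set_integrable_subset) auto
  then show i: "integrable (lebesgue_on {a<..<b}) f" by (simp add: integrable_restrict_space set_integrable_def)
  show "(LINT y|lebesgue_on {a<..<b}. f y) = integral {a..b} f"
    by (simp add: lebesgue_integral_eq_integral[OF i] integral_open_interval_real)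
qed

lemma continuous_in_L2:
  fixes f :: "real \<Rightarrow> 'b::euclidean_space"
  assumes "continuous_on {0..l} f"
  shows "f \<in> L2 l"
proof -
  have "continuous_on {0<..<l} f" using assms by (rule continuous_on_subset) auto
  then have "f \<in> borel_measurable (lebesgue_on {0<..<l})"
    by (rule continuous_imp_measurable_on_sets_lebesgue) simp
  moreover have "continuous_on {0..l} (\<lambda>x. (norm (f x))\<^sup>2)" by (intro continuous_intros assms)
  ultimately show ?thesis unfolding L2_def using continuous_integrable_open(1) by blast
qed

lemma L2_integrable:
  fixes w :: "real \<Rightarrow> 'b::euclidean_space"
  assumes "w \<in> L2 l"
  shows "integrable (lebesgue_on {0<..<l}) w"
proof (rule Bochner_Integration.integrable_bound)
  show "integrable (lebesgue_on {0<..<l}) (\<lambda>x. 1 + (norm (w x))\<^sup>2)"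
    using assms continuous_integrable_open(1)[of 0 l "\<lambda>x. 1::real"] by (auto simp: L2_def)
  show "w \<in> borel_measurable (lebesgue_on {0<..<l})" using assms by (simp add: L2_def)
  have "norm (w x) \<le> 1 + (norm (w x))\<^sup>2" for x
    using sum_squares_bound[of "norm (w x)" 1] by (simp add: power2_eq_square) 
      (smt (verit) mult_nonneg_nonneg norm_ge_zero)
  then show "AE x in lebesgue_on {0<..<l}. norm (w x) \<le> norm (1 + (norm (w x))\<^sup>2)"
    by (intro AE_I2) (simp add: order_trans[OF _ abs_ge_self])
qed

lemma has_D2_derivative:
  fixes u :: "real \<Rightarrow> 'b::euclidean_space"
  assumes "has_D2 l u w" "x \<in> {0..l}"
  shows "(u has_vector_derivative D1 l u x) (at x within {0..l})"
  using assms unfolding has_D2_def D1_def differentiable_on_def vector_derivative_works[symmetric] by blast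

lemma has_vector_derivative_within_continuous_on:
  assumes "\<And>x. x \<in> S \<Longrightarrow> (f has_vector_derivative f' x) (at x within S)"
  shows "continuous_on S f"
  unfolding continuous_on_eq_continuous_within
  by (intro ballI has_vector_derivative_continuous[OF assms])

lemma has_D2_classical:
  fixes u :: "real \<Rightarrow> 'b::euclidean_space"
  assumes w: "has_D2 l u w" and f: "continuous_on {0..l} f" and ae: "eq_ae l w f" and x: "x \<in> {0..l}"
  shows "(D1 l u has_vector_derivative f x) (at x within {0..l})"
proof -
  have D: "D1 l u y = D1 l u 0 + integral {0..y} f" if y: "y \<in> {0..l}" for y
  proof -
    have sub: "{0<..<y} \<subseteq> {0<..<l}" using y by auto
    have cf: "continuous_on {0..y} f" using f y by (auto intro: continuous_on_subset)
    have "w \<in> borel_measurable (lebesgue_on {0<..<y})"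
    proof (rule measurable_restrict_mono[OF _ sub])
      show "w \<in> borel_measurable (lebesgue_on {0<..<l})" using w by (simp add: has_D2_def L2_def)
    qed
    moreover have "f \<in> borel_measurable (lebesgue_on {0<..<y})"
      using continuous_integrable_open(1)[OF cf] by (rule borel_measurable_integrable)
    moreover have "AE x in lebesgue_on {0<..<y}. w x = f x"
      by (rule AE_lebesgue_on_subset[OF ae[unfolded eq_ae_def] sub]) auto
    ultimately have "(LINT y|lebesgue_on {0<..<y}. w y) = (LINT y|lebesgue_on {0<..<y}. f y)"
      by (rule integral_cong_AE)
    moreover have "D1 l u y = D1 l u 0 + (LINT y|lebesgue_on {0<..<y}. w y)"
      using w y unfolding has_D2_def by blast
    ultimately show ?thesis using continuous_integrable_open(2)[OF cf] by simp
  qed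
  have "((\<lambda>y. D1 l u 0 + integral {0..y} f) has_vector_derivative f x) (at x within {0..l})"
    using integral_has_vector_derivative[OF f x] by (auto intro!: derivative_eq_intros)
  then show ?thesis by (rule has_vector_derivative_transform[OF x, rotated]) (rule D)
qed

lemma D1_eq:
  assumes "0 < l" "x \<in> {0..l}" "(u has_vector_derivative u1) (at x within {0..l})"
  shows "D1 l u x = u1"
  unfolding D1_def
  by (rule vector_derivative_within[OF _ assms(3)]) (use assms in \<open>simp add: trivial_limit_within islimpt_Icc\<close>)

lemma classical_has_D2:
  fixes u :: "real \<Rightarrow> 'b::euclidean_space"
  assumes "0 < l" and u: "\<And>x. x \<in> {0..l} \<Longrightarrow> (u has_vector_derivative u1 x) (at x within {0..l})"
    "\<And>x. x \<in> {0..l} \<Longrightarrow> (u1 has_vector_derivative f x) (at x within {0..l})"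
    and f: "continuous_on {0..l} f"
  shows "has_D2 l u f" "\<And>x. x \<in> {0..l} \<Longrightarrow> D1 l u x = u1 x"
proof -
  show D: "D1 l u x = u1 x" if "x \<in> {0..l}" for x by (rule D1_eq[OF \<open>0 < l\<close> that u(1)[OF that]])
  show "has_D2 l u f"
    unfolding has_D2_def
  proof (intro conjI ballI)
    show "u differentiable_on {0..l}"
      unfolding differentiable_on_def using u(1) differentiableI_vector by blast
    show "f \<in> L2 l" by (rule continuous_in_L2[OF f])
    fix x assume x: "x \<in> {0..l}"
    have cf: "continuous_on {0..x} f" using f x by (auto intro: continuous_on_subset)
    have "(f has_integral (u1 x - u1 0)) {0..x}"
    proof (rule fundamental_theorem_of_calculus)
      fix y assume "y \<in> {0..x}"
      then show "(u1 has_vector_derivative f y) (at y within {0..x})"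
        using x by (intro has_vector_derivative_within_subset[OF u(2)]) auto
    qed (use x in simp)
    then have "integral {0..x} f = u1 x - u1 0" by (rule integral_unique)
    then show "D1 l u x = D1 l u 0 + (LINT y|lebesgue_on {0<..<x}. f y)"
      using continuous_integrable_open(2)[OF cf] D[OF x] D[of 0] \<open>0 < l\<close> by simp
  qed
qed

text \<open>
  The primitives of the two candidates agree, and by Lebesgue differentiation so do the integrands almost
  everywhere.
\<close>

lemma has_D2_unique:
  fixes u :: "real \<Rightarrow> 'b::euclidean_space"
  assumes w: "has_D2 l u w" and f: "has_D2 l u f"
  shows "eq_ae l w f"
proof -
  define d where "d x = (if x \<in> {0<..<l} then w x - f x else 0)" for x
  have iw: "integrable (lebesgue_on {0<..<l}) w" and jf: "integrable (lebesgue_on {0<..<l}) f"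
    using w f L2_integrable unfolding has_D2_def by blast+
  then have "integrable (lebesgue_on {0<..<l}) (\<lambda>x. w x - f x)" by (rule Bochner_Integration.integrable_diff)
  then have "(\<lambda>x. w x - f x) absolutely_integrable_on {0<..<l}"
    by (simp add: integrable_restrict_space set_integrable_def)
  then have "d absolutely_integrable_on UNIV"
    unfolding d_def by (subst absolutely_integrable_restrict_UNIV) 
  then have dint: "d integrable_on UNIV" "d absolutely_integrable_on UNIV"
    using set_lebesgue_integral_eq_integral(1) by blast+
  have dbox: "d integrable_on cbox a b" for a b :: real
    using integrable_on_subcbox[OF dint(1)] by simp
  have zero: "integral {0..x} d = 0" if x: "x \<in> {0..l}" for x
  proof -
    have sub: "{0<..<x} \<subseteq> {0<..<l}" using x by auto
    have i: "integrable (lebesgue_on {0<..<x}) k" if "integrable (lebesgue_on {0<..<l}) k" for k :: "real \<Rightarrow> 'b"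
    proof -
      have "k absolutely_integrable_on {0<..<l}" using that by (simp add: integrable_restrict_space set_integrable_def)
      then have "k absolutely_integrable_on {0<..<x}" by (rule set_integrable_subset) (use sub in auto)
      then show ?thesis by (simp add: integrable_restrict_space set_integrable_def)
    qed
    have "(LINT y|lebesgue_on {0<..<x}. w y) = (LINT y|lebesgue_on {0<..<x}. f y)"
    proof -
      have "D1 l u x = D1 l u 0 + (LINT y|lebesgue_on {0<..<x}. w y)"
        "D1 l u x = D1 l u 0 + (LINT y|lebesgue_on {0<..<x}. f y)"
        using w f x unfolding has_D2_def by blast+
      then show ?thesis by simp
    qed
    then have "integral {0<..<x} w = integral {0<..<x} f"
      by (simp add: lebesgue_integral_eq_integral[OF i[OF iw]] lebesgue_integral_eq_integral[OF i[OF jf]])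
    moreover have "w integrable_on {0<..<x}" "f integrable_on {0<..<x}"
      using integrable_on_lebesgue_on[OF i[OF iw]] integrable_on_lebesgue_on[OF i[OF jf]] by auto
    ultimately have "integral {0<..<x} (\<lambda>y. w y - f y) = 0" by (simp add: integral_diff)
    moreover have "integral {0<..<x} d = integral {0<..<x} (\<lambda>y. w y - f y)"
      by (rule integral_cong) (use sub in \<open>auto simp: d_def\<close>)
    ultimately show ?thesis by (simp add: integral_open_interval_real)
  qed
  obtain N where N: "negligible N" and dN: "\<And>x e. x \<notin> N \<Longrightarrow> 0 < e \<Longrightarrow>
      \<exists>r>0. \<forall>h. 0 < h \<and> h < r \<longrightarrow> norm (integral (cbox x (x + h *\<^sub>R One)) d /\<^sub>R h ^ DIM(real) - d x) < e"
    by (rule integrable_ccontinuous_explicit[OF dbox]) blast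
  have "d x = 0" if x: "x \<in> {0<..<l}" "x \<notin> N" for x
  proof (rule ccontr)
    assume "d x \<noteq> 0"
    then obtain r where r: "r > 0" "\<forall>h. 0 < h \<and> h < r \<longrightarrow> norm (integral (cbox x (x + h *\<^sub>R One)) d /\<^sub>R h ^ DIM(real) - d x) < norm (d x)"
      using dN[OF x(2), of "norm (d x)"] by auto
    define k where "k = min (r / 2) (l - x)"
    have k: "0 < k" "k < r" "x + k \<le> l" using r x by (auto simp: k_def)
    have "integral {0..x} d + integral {x..x + k} d = integral {0..x + k} d"
      using dbox[of 0 "x + k"] x k by (intro Henstock_Kurzweil_Integration.integral_combine) auto
    then have "integral {x..x + k} d = 0" using zero[of x] zero[of "x + k"] x k by simp
    then have "norm (d x) < norm (d x)" using r(2)[rule_format, of k] k by simp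
    then show False by simp
  qed
  then have "\<forall>x. x \<notin> N \<longrightarrow> (x \<in> {0<..<l} \<longrightarrow> w x = f x)" by (auto simp: d_def)
  moreover have "N \<in> null_sets lebesgue" using N by (simp add: negligible_iff_null_sets)
  ultimately have "AE x in lebesgue. x \<in> {0<..<l} \<longrightarrow> w x = f x"
    by (intro AE_I'[of N]) auto
  then show ?thesis unfolding eq_ae_def by (subst AE_restrict_space_iff) auto
qed

lemma D2_has_D2: "has_D2 l u w \<Longrightarrow> has_D2 l u (D2 l u)"
  unfolding D2_def using someI[of "has_D2 l u" w] by simp

lemma eq_ae_mono:
  assumes "eq_ae l a b" "\<And>x. x \<in> {0<..<l} \<Longrightarrow> a x = b x \<Longrightarrow> c x = d x"
  shows "eq_ae l c d"
proof -
  have "AE x in lebesgue_on {0<..<l}. x \<in> {0<..<l}" using AE_space[of "lebesgue_on {0<..<l}"] by simp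
  then show ?thesis using assms(1) unfolding eq_ae_def
    by eventually_elim (rule assms(2))
qed

text \<open>
  Since the coefficients are continuous, every weak solution is a classical one on the closed interval
  (\<open>classical_iff\<close>); from here on only classical derivatives occur.
\<close>

definition classical :: "real \<Rightarrow> (real \<Rightarrow> real) \<Rightarrow> (real \<Rightarrow> real) \<Rightarrow> bool"
  where "classical l u f \<longleftrightarrow> (\<forall>x\<in>{0..l}. (u has_real_derivative D1 l u x) (at x within {0..l})) \<and>
    (\<forall>x\<in>{0..l}. (D1 l u has_real_derivative f x) (at x within {0..l}))"

lemma classical_iff:
  assumes "0 < l" and f: "continuous_on {0..l} f"
  shows "(\<exists>w. has_D2 l u w) \<and> eq_ae l (D2 l u) f \<longleftrightarrow> classical l u f"
proof
  assume "(\<exists>w. has_D2 l u w) \<and> eq_ae l (D2 l u) f"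
  then have "has_D2 l u (D2 l u)" "eq_ae l (D2 l u) f" using D2_has_D2 by auto
  then show "classical l u f"
    unfolding classical_def has_real_derivative_iff_has_vector_derivative
    using has_D2_derivative has_D2_classical[OF _ f] by blast
next
  assume c: "classical l u f"
  have "has_D2 l u f"
    by (rule classical_has_D2(1)[OF \<open>0 < l\<close> _ _ f])
       (use c in \<open>auto simp: classical_def has_real_derivative_iff_has_vector_derivative\<close>)
  then show "(\<exists>w. has_D2 l u w) \<and> eq_ae l (D2 l u) f"
    using has_D2_unique D2_has_D2 by blast
qed

lemma classicalI:
  assumes "0 < l" "\<And>x. x \<in> {0..l} \<Longrightarrow> (u has_real_derivative u1 x) (at x within {0..l})"
    "\<And>x. x \<in> {0..l} \<Longrightarrow> (u1 has_real_derivative f x) (at x within {0..l})"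
  shows "classical l u f" "\<And>x. x \<in> {0..l} \<Longrightarrow> D1 l u x = u1 x"
proof -
  show D: "D1 l u x = u1 x" if "x \<in> {0..l}" for x
    using D1_eq[OF assms(1) that] assms(2)[OF that] by (simp add: has_real_derivative_iff_has_vector_derivative)
  show "classical l u f"
    unfolding classical_def
  proof (intro conjI ballI)
    fix x assume x: "x \<in> {0..l}"
    show "(u has_real_derivative D1 l u x) (at x within {0..l})" using assms(2)[OF x] D[OF x] by simp
    show "(D1 l u has_real_derivative f x) (at x within {0..l})"
      by (rule has_field_derivative_transform_within[OF assms(3)[OF x] zero_less_one x]) (simp add: D)
  qed
qed

lemma has_D2_components:
  fixes U :: "real \<Rightarrow> real \<times> real"
  assumes w: "has_D2 l U w" and "0 < l"
  shows "has_D2 l (\<lambda>x. fst (U x)) (\<lambda>x. fst (w x))" "has_D2 l (\<lambda>x. snd (U x)) (\<lambda>x. snd (w x))"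
    "\<And>x. x \<in> {0..l} \<Longrightarrow> D1 l U x = (D1 l (\<lambda>x. fst (U x)) x, D1 l (\<lambda>x. snd (U x)) x)"
proof -
  have comp: "has_D2 l (\<lambda>x. p (U x)) (\<lambda>x. p (w x)) \<and> (\<forall>x\<in>{0..l}. D1 l (\<lambda>x. p (U x)) x = p (D1 l U x))"
    if p: "bounded_linear p" and pn: "\<And>z. norm (p z) \<le> norm z" for p :: "real \<times> real \<Rightarrow> real"
  proof -
    have dp: "((\<lambda>x. p (U x)) has_vector_derivative p (D1 l U x)) (at x within {0..l})" if "x \<in> {0..l}" for x
      by (rule bounded_linear.has_vector_derivative[OF p has_D2_derivative[OF w that]])
    have D: "D1 l (\<lambda>x. p (U x)) x = p (D1 l U x)" if "x \<in> {0..l}" for x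
      by (rule D1_eq[OF \<open>0 < l\<close> that dp[OF that]])
    have wL: "w \<in> L2 l" using w by (simp add: has_D2_def)
    have "has_D2 l (\<lambda>x. p (U x)) (\<lambda>x. p (w x))"
      unfolding has_D2_def
    proof (intro conjI ballI)
      show "(\<lambda>x. p (U x)) differentiable_on {0..l}"
        unfolding differentiable_on_def using dp differentiableI_vector by blast
      have m: "(\<lambda>x. p (w x)) \<in> borel_measurable (lebesgue_on {0<..<l})"
        using wL borel_measurable_continuous_onI[OF linear_continuous_on[OF p]] unfolding L2_def
        by (auto intro: measurable_compose)
      have "integrable (lebesgue_on {0<..<l}) (\<lambda>x. (norm (p (w x)))\<^sup>2)"
      proof (rule Bochner_Integration.integrable_bound)
        show "integrable (lebesgue_on {0<..<l}) (\<lambda>x. (norm (w x))\<^sup>2)" using wL by (simp add: L2_def)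
        show "AE x in lebesgue_on {0<..<l}. norm ((norm (p (w x)))\<^sup>2) \<le> norm ((norm (w x))\<^sup>2)"
          using power_mono[OF pn norm_ge_zero, of _ 2] by (intro AE_I2) simp
      qed (use m in measurable)
      then show "(\<lambda>x. p (w x)) \<in> L2 l" using m by (simp add: L2_def)
      fix x assume x: "x \<in> {0..l}"
      have "w absolutely_integrable_on {0<..<l}"
        using L2_integrable[OF wL] by (simp add: integrable_restrict_space set_integrable_def)
      then have "w absolutely_integrable_on {0<..<x}" by (rule set_integrable_subset) (use x in auto)
      then have i: "integrable (lebesgue_on {0<..<x}) w" by (simp add: integrable_restrict_space set_integrable_def)
      have "D1 l U x = D1 l U 0 + (LINT y|lebesgue_on {0<..<x}. w y)" using w x unfolding has_D2_def by blast
      then have "p (D1 l U x) = p (D1 l U 0 + (LINT y|lebesgue_on {0<..<x}. w y))" by (rule arg_cong)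
      then have "p (D1 l U x) = p (D1 l U 0) + (LINT y|lebesgue_on {0<..<x}. p (w y))"
        by (simp add: bounded_linear.linear[OF p] linear_add integral_bounded_linear[OF p i])
      then show "D1 l (\<lambda>x. p (U x)) x = D1 l (\<lambda>x. p (U x)) 0 + (LINT y|lebesgue_on {0<..<x}. p (w y))"
        using D[OF x] D[of 0] \<open>0 < l\<close> by simp
    qed
    then show ?thesis using D by blast
  qed
  have fst: "norm (fst z) \<le> norm z" and snd: "norm (snd z) \<le> norm z" for z :: "real \<times> real"
    using norm_fst_le[of "fst z" "snd z"] norm_snd_le[of "snd z" "fst z"] by simp_all
  show "has_D2 l (\<lambda>x. fst (U x)) (\<lambda>x. fst (w x))" "has_D2 l (\<lambda>x. snd (U x)) (\<lambda>x. snd (w x))"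
    "\<And>x. x \<in> {0..l} \<Longrightarrow> D1 l U x = (D1 l (\<lambda>x. fst (U x)) x, D1 l (\<lambda>x. snd (U x)) x)"
    using comp[OF bounded_linear_fst fst] comp[OF bounded_linear_snd snd] by (auto simp: prod_eq_iff)
qed

lemma solution_space_iff:
  assumes "0 < l" and g: "continuous_on {0..l} (\<lambda>x. g (s * x))" and h: "continuous_on {0..l} (\<lambda>x. h (s * x))"
  shows "U \<in> solution_space l g h \<mu> s \<longleftrightarrow> (\<forall>x. x \<notin> {0..l} \<longrightarrow> U x = 0) \<and>
    classical l (\<lambda>x. fst (U x)) (\<lambda>x. - s\<^sup>2 * g (s * x) * fst (U x) - s\<^sup>2 * \<mu> * snd (U x)) \<and>
    classical l (\<lambda>x. snd (U x)) (\<lambda>x. - s\<^sup>2 * h (s * x) * snd (U x) + s\<^sup>2 * \<mu> * fst (U x))"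
proof -
  let ?u = "\<lambda>x. fst (U x)" and ?v = "\<lambda>x. snd (U x)"
  let ?F = "\<lambda>x. - s\<^sup>2 * g (s * x) * fst (U x) - s\<^sup>2 * \<mu> * snd (U x)"
  let ?G = "\<lambda>x. - s\<^sup>2 * h (s * x) * snd (U x) + s\<^sup>2 * \<mu> * fst (U x)"
  have eq: "eq_ae l (N_op l g h s U) (\<lambda>x. (s\<^sup>2 * \<mu>) *\<^sub>R U x) \<longleftrightarrow> eq_ae l (D2 l ?u) ?F \<and> eq_ae l (D2 l ?v) ?G"
    unfolding eq_ae_def AE_conj_iff[symmetric]
    by (rule arg_cong2[where f = eventually])
       (auto simp: N_op_def L_op_def prod_eq_iff fun_eq_iff algebra_simps)
  have cont: "continuous_on {0..l} ?F \<and> continuous_on {0..l} ?G"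
    if "\<And>x. x \<in> {0..l} \<Longrightarrow> (?u has_vector_derivative D1 l ?u x) (at x within {0..l})"
      "\<And>x. x \<in> {0..l} \<Longrightarrow> (?v has_vector_derivative D1 l ?v x) (at x within {0..l})"
  proof -
    have "continuous_on {0..l} ?u" "continuous_on {0..l} ?v"
      by (rule has_vector_derivative_within_continuous_on, erule that)+
    then show ?thesis using g h
      by (intro conjI continuous_on_add continuous_on_diff continuous_on_mult continuous_on_const)
  qed
  show ?thesis
  proof
    assume U: "U \<in> solution_space l g h \<mu> s"
    then obtain w where w: "has_D2 l U w" by (auto simp: solution_space_def H2_def)
    note c = has_D2_components[OF w \<open>0 < l\<close>]
    have FG: "continuous_on {0..l} ?F" "continuous_on {0..l} ?G"
      using cont has_D2_derivative[OF c(1)] has_D2_derivative[OF c(2)] by blast+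
    have "eq_ae l (D2 l ?u) ?F" "eq_ae l (D2 l ?v) ?G" using U eq by (auto simp: solution_space_def)
    then have "classical l ?u ?F" "classical l ?v ?G"
      using classical_iff[OF \<open>0 < l\<close> FG(1), of ?u] classical_iff[OF \<open>0 < l\<close> FG(2), of ?v] c(1,2) by blast+
    then show "(\<forall>x. x \<notin> {0..l} \<longrightarrow> U x = 0) \<and> classical l ?u ?F \<and> classical l ?v ?G"
      using U by (auto simp: solution_space_def H2_def)
  next
    assume R: "(\<forall>x. x \<notin> {0..l} \<longrightarrow> U x = 0) \<and> classical l ?u ?F \<and> classical l ?v ?G"
    then have d: "\<And>x. x \<in> {0..l} \<Longrightarrow> (?u has_vector_derivative D1 l ?u x) (at x within {0..l})"
      "\<And>x. x \<in> {0..l} \<Longrightarrow> (?v has_vector_derivative D1 l ?v x) (at x within {0..l})"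
      "\<And>x. x \<in> {0..l} \<Longrightarrow> (D1 l ?u has_vector_derivative ?F x) (at x within {0..l})"
      "\<And>x. x \<in> {0..l} \<Longrightarrow> (D1 l ?v has_vector_derivative ?G x) (at x within {0..l})"
      by (auto simp: classical_def has_real_derivative_iff_has_vector_derivative)
    have FG: "continuous_on {0..l} ?F" "continuous_on {0..l} ?G" using cont d(1,2) by blast+
    have "eq_ae l (D2 l ?u) ?F" "eq_ae l (D2 l ?v) ?G"
      using classical_iff[OF \<open>0 < l\<close> FG(1), of ?u] classical_iff[OF \<open>0 < l\<close> FG(2), of ?v] R by blast+
    then have e: "eq_ae l (N_op l g h s U) (\<lambda>x. (s\<^sup>2 * \<mu>) *\<^sub>R U x)" using eq by blast
    have "has_D2 l U (\<lambda>x. (?F x, ?G x))"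
    proof (rule classical_has_D2(1)[OF \<open>0 < l\<close>, where ?u1.0 = "\<lambda>x. (D1 l ?u x, D1 l ?v x)"])
      fix x assume x: "x \<in> {0..l}"
      show "(U has_vector_derivative (D1 l ?u x, D1 l ?v x)) (at x within {0..l})"
        using has_vector_derivative_Pair[OF d(1)[OF x] d(2)[OF x]] by simp
      show "((\<lambda>x. (D1 l ?u x, D1 l ?v x)) has_vector_derivative (?F x, ?G x)) (at x within {0..l})"
        by (rule has_vector_derivative_Pair[OF d(3)[OF x] d(4)[OF x]])
    qed (use FG in \<open>intro continuous_on_Pair\<close>)
    then show "U \<in> solution_space l g h \<mu> s" using e R by (auto simp: solution_space_def H2_def)
  qed
qed

lemma scalar_H2_iff:
  assumes "0 < l" and q: "continuous_on {0..l} q" and k: "continuous_on {0..l} k"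
  shows "u \<in> H2_H10 l \<and> eq_ae l (L_op l q 1 u) k \<longleftrightarrow>
    (\<forall>x. x \<notin> {0..l} \<longrightarrow> u x = 0) \<and> u 0 = 0 \<and> u l = 0 \<and> classical l u (\<lambda>x. - q x * u x - k x)"
proof -
  let ?F = "\<lambda>x. - q x * u x - k x"
  have eq: "eq_ae l (L_op l q 1 u) k \<longleftrightarrow> eq_ae l (D2 l u) ?F"
    unfolding eq_ae_def by (rule arg_cong2[where f = eventually]) (auto simp: L_op_def fun_eq_iff algebra_simps)
  have cont: "continuous_on {0..l} ?F"
    if "\<And>x. x \<in> {0..l} \<Longrightarrow> (u has_vector_derivative D1 l u x) (at x within {0..l})"
  proof -
    have "continuous_on {0..l} u"
      by (rule has_vector_derivative_within_continuous_on, erule that)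
    then show ?thesis using q k by (intro continuous_intros)
  qed
  show ?thesis
  proof
    assume L: "u \<in> H2_H10 l \<and> eq_ae l (L_op l q 1 u) k"
    then obtain w where w: "has_D2 l u w" by (auto simp: H2_H10_def H2_def)
    have "classical l u ?F"
      using classical_iff[OF \<open>0 < l\<close> cont[OF has_D2_derivative[OF w]]] w L eq by blast
    then show "(\<forall>x. x \<notin> {0..l} \<longrightarrow> u x = 0) \<and> u 0 = 0 \<and> u l = 0 \<and> classical l u ?F"
      using L by (auto simp: H2_H10_def H2_def)
  next
    assume R: "(\<forall>x. x \<notin> {0..l} \<longrightarrow> u x = 0) \<and> u 0 = 0 \<and> u l = 0 \<and> classical l u ?F"
    then have "\<And>x. x \<in> {0..l} \<Longrightarrow> (u has_vector_derivative D1 l u x) (at x within {0..l})"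
      by (auto simp: classical_def has_real_derivative_iff_has_vector_derivative)
    from classical_iff[OF \<open>0 < l\<close> cont[OF this], of u] R
    show "u \<in> H2_H10 l \<and> eq_ae l (L_op l q 1 u) k" using eq by (auto simp: H2_H10_def H2_def)
  qed
qed

lemma l2_inner_FTC:
  fixes u v :: "real \<Rightarrow> real"
  assumes "0 < l" "continuous_on {0..l} (\<lambda>x. u x * v x)"
    and "\<And>x. x \<in> {0..l} \<Longrightarrow> (F has_real_derivative u x * v x) (at x within {0..l})"
  shows "l2_inner l u v = F l - F 0"
proof -
  have "((\<lambda>x. u x * v x) has_integral (F l - F 0)) {0..l}"
    by (rule fundamental_theorem_of_calculus) (use assms in \<open>auto simp: has_real_derivative_iff_has_vector_derivative\<close>)
  then show ?thesis
    unfolding l2_inner_def using continuous_integrable_open(2)[OF assms(2)] by (simp add: integral_unique)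
qed

text \<open>
  The resolvent equation is uniquely solvable, in particular with right-hand side zero.
\<close>

lemma not_in_Spec_ker_trivial:
  assumes "\<mu> \<notin> Spec l A" "u \<in> H2_H10 l" "eq_ae l (\<lambda>x. A u x - \<mu> *\<^sub>R u x) (\<lambda>x. 0)"
    "v \<in> H2_H10 l" "eq_ae l (\<lambda>x. A v x - \<mu> *\<^sub>R v x) (\<lambda>x. 0)"
  shows "u = v"
proof -
  have "(\<lambda>x. 0) \<in> L2 l" by (rule continuous_in_L2) simp
  then have "\<exists>!u. u \<in> H2_H10 l \<and> eq_ae l (\<lambda>x. A u x - \<mu> *\<^sub>R u x) (\<lambda>x. 0)"
    using assms(1) unfolding Spec_def by blast
  then show ?thesis using assms(2-5) by blast
qed

section \<open>Uniqueness for the linear system\<close>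

text \<open>
  Gronwall: the squared norm \<open>E\<close> of the Cauchy data satisfies \<open>E' \<le> K E\<close>.
\<close>

lemma linear_system_unique:
  fixes u u1 v v1 p q :: "real \<Rightarrow> real" and m L :: real
  assumes d: "\<And>x. x \<in> {0..L} \<Longrightarrow> (u has_real_derivative u1 x) (at x within {0..L})"
    "\<And>x. x \<in> {0..L} \<Longrightarrow> (u1 has_real_derivative - p x * u x - m * v x) (at x within {0..L})"
    "\<And>x. x \<in> {0..L} \<Longrightarrow> (v has_real_derivative v1 x) (at x within {0..L})"
    "\<And>x. x \<in> {0..L} \<Longrightarrow> (v1 has_real_derivative - q x * v x + m * u x) (at x within {0..L})"
    and pq: "continuous_on {0..L} p" "continuous_on {0..L} q"
    and z: "u 0 = 0" "u1 0 = 0" "v 0 = 0" "v1 0 = 0" and x: "x \<in> {0..L}"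
  shows "u x = 0 \<and> u1 x = 0 \<and> v x = 0 \<and> v1 x = 0"
proof -
  have bnd: "\<exists>B. \<forall>x\<in>{0..L}. \<bar>f x\<bar> \<le> B" if "continuous_on {0..L} f" for f :: "real \<Rightarrow> real"
  proof -
    have "bounded (f ` {0..L})" using compact_continuous_image[OF that] by (simp add: compact_imp_bounded)
    then show ?thesis by (auto simp: bounded_iff)
  qed
  obtain P Q where P: "\<forall>x\<in>{0..L}. \<bar>p x\<bar> \<le> P" and Q: "\<forall>x\<in>{0..L}. \<bar>q x\<bar> \<le> Q" using bnd pq by metis
  define E where "E x = (u x)\<^sup>2 + (u1 x)\<^sup>2 + (v x)\<^sup>2 + (v1 x)\<^sup>2" for x
  define E' where "E' x = 2 * (u x * u1 x) + 2 * (u1 x * (- p x * u x - m * v x)) + 2 * (v x * v1 x)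
    + 2 * (v1 x * (- q x * v x + m * u x))" for x
  define K where "K = 2 + P + Q + 2 * \<bar>m\<bar>"
  define G where "G x = E x * exp (- K * x)" for x
  have E0: "E x \<ge> 0" for x by (simp add: E_def)
  have dE: "(E has_real_derivative E' x) (at x within {0..L})" if "x \<in> {0..L}" for x
    unfolding E_def[abs_def]
    by (rule DERIV_cong, (rule derivative_intros d that)+) (simp add: E'_def mult_ac)
  have am: "2 * (a * c * b) \<le> B * (a\<^sup>2 + b\<^sup>2)" if "\<bar>c\<bar> \<le> B" for a b c B :: real
  proof -
    have "2 * (a * c * b) \<le> \<bar>c\<bar> * (2 * \<bar>a\<bar> * \<bar>b\<bar>)"
      using abs_ge_self[of "2 * (a * c * b)"] by (simp add: abs_mult mult_ac)
    also have "\<dots> \<le> B * (a\<^sup>2 + b\<^sup>2)"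
      using sum_squares_bound[of "\<bar>a\<bar>" "\<bar>b\<bar>"] that by (intro mult_mono) auto
    finally show ?thesis .
  qed
  have E'K: "E' x \<le> K * E x" if x: "x \<in> {0..L}" for x
  proof -
    have Pp: "\<bar>- p x\<bar> \<le> P" "\<bar>- q x\<bar> \<le> Q" and PQ0: "0 \<le> P" "0 \<le> Q" using P Q x by (auto intro: order_trans[OF abs_ge_zero])
    have "E' x = 2 * (u x * 1 * u1 x) + 2 * (u1 x * (- p x) * u x) + 2 * (u1 x * (- m) * v x) + 2 * (v x * 1 * v1 x)
      + 2 * (v1 x * (- q x) * v x) + 2 * (v1 x * m * u x)" by (simp add: E'_def algebra_simps)
    also have "\<dots> \<le> 1 * ((u x)\<^sup>2 + (u1 x)\<^sup>2) + P * ((u1 x)\<^sup>2 + (u x)\<^sup>2) + \<bar>m\<bar> * ((u1 x)\<^sup>2 + (v x)\<^sup>2) + 1 * ((v x)\<^sup>2 + (v1 x)\<^sup>2)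
      + Q * ((v1 x)\<^sup>2 + (v x)\<^sup>2) + \<bar>m\<bar> * ((v1 x)\<^sup>2 + (u x)\<^sup>2)"
      using Pp by (intro add_mono am) auto
    also have "\<dots> \<le> 1 * E x + P * E x + \<bar>m\<bar> * E x + 1 * E x + Q * E x + \<bar>m\<bar> * E x"
      using PQ0 by (intro add_mono mult_left_mono) (auto simp: E_def)
    also have "\<dots> = K * E x" by (simp add: K_def algebra_simps)
    finally show ?thesis .
  qed
  have dG: "(G has_real_derivative (E' y - K * E y) * exp (- K * y)) (at y within {0..L})" if yL: "y \<in> {0..L}" for y
  proof -
    have "((\<lambda>x. exp (- K * x)) has_real_derivative exp (- K * y) * (- K)) (at y within {0..L})"
      by (auto intro!: derivative_eq_intros)
    from DERIV_mult[OF dE[OF yL] this]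
    have "(G has_real_derivative E' y * exp (- K * y) + exp (- K * y) * (- K) * E y) (at y within {0..L})"
      by (simp add: G_def[abs_def])
    then show ?thesis by (rule DERIV_cong) (simp add: algebra_simps)
  qed
  have "G x \<le> G 0"
  proof (rule DERIV_nonpos_imp_decreasing_open[of 0 x G])
    show "0 \<le> x" using x by simp
    show "continuous_on {0..x} G"
      unfolding continuous_on_eq_continuous_within
    proof
      fix y assume y: "y \<in> {0..x}"
      then have "continuous (at y within {0..L}) G" using dG[of y] x by (intro DERIV_continuous) auto
      then show "continuous (at y within {0..x}) G" by (rule continuous_within_subset) (use x in auto)
    qed
    fix y assume y: "0 < y" "y < x"
    then have yL: "y \<in> {0..L}" "at y within {0..L} = at y" using x by (auto simp: at_within_Icc_at)
    have "(E' y - K * E y) * exp (- K * y) \<le> 0" using E'K[OF yL(1)] by (intro mult_nonpos_nonneg) auto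
    then show "\<exists>D. (G has_real_derivative D) (at y) \<and> D \<le> 0" using dG[OF yL(1)] yL(2) by auto
  qed
  moreover have "G 0 = 0" using z by (simp add: G_def E_def)
  ultimately have "E x * exp (- K * x) \<le> 0" by (simp add: G_def)
  then have "E x \<le> 0" by (simp add: mult_le_0_iff)
  then show ?thesis
    unfolding E_def by (smt (verit) zero_le_power2 power2_eq_iff_nonneg zero_eq_power2)
qed

section \<open>The zero eigenvalue is isolated\<close>

context hamiltonian_pencil
begin

text \<open>
  For a solution with Dirichlet values at both ends, \<open>W = u v' - u' v\<close> vanishes at both ends, while
  \<open>W' = \<mu> (u\<^sup>2 + v\<^sup>2) + (g - h) u v\<close> is nonnegative once \<open>\<mu>\<close> exceeds the supremum of \<open>\<bar>g - h\<bar>\<close>. So \<open>W\<close> is zero, and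
  then so are \<open>u\<close> and \<open>v\<close>.
\<close>

lemma no_large_real_eigenvalue:
  assumes "0 < l"
  obtains K where "\<And>\<mu> a b. \<mu> > K \<Longrightarrow> a * usol eu \<mu> l + b * usol ev \<mu> l = 0 \<Longrightarrow>
    a * vsol eu \<mu> l + b * vsol ev \<mu> l = 0 \<Longrightarrow> a = 0 \<and> b = 0"
proof -
  have "compact ((\<lambda>y. g y - h y) ` {0..l})"
    using g_cont h_cont by (intro compact_continuous_image continuous_on_diff) (auto intro: continuous_on_subset)
  then have "bounded ((\<lambda>y. g y - h y) ` {0..l})" by (rule compact_imp_bounded)
  then obtain K where K: "\<forall>y\<in>{0..l}. \<bar>g y - h y\<bar> \<le> K" by (auto simp: bounded_iff)
  moreover have "0 \<in> {0..l}" using \<open>0 < l\<close> by simp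
  ultimately have "\<bar>g 0 - h 0\<bar> \<le> K" by blast
  then have K0: "K \<ge> 0" by simp
  show thesis
  proof (rule that[of K])
    fix \<mu> a b assume m: "\<mu> > K" and bc: "a * usol eu \<mu> l + b * usol ev \<mu> l = 0" "a * vsol eu \<mu> l + b * vsol ev \<mu> l = 0"
    define u where "u y = a * usol eu \<mu> y + b * usol ev \<mu> y" for y
    define u1 where "u1 y = a * usol' eu \<mu> y + b * usol' ev \<mu> y" for y
    define v where "v y = a * vsol eu \<mu> y + b * vsol ev \<mu> y" for y
    define v1 where "v1 y = a * vsol' eu \<mu> y + b * vsol' ev \<mu> y" for y
    have du: "(u has_real_derivative u1 y) (at y)" "(v has_real_derivative v1 y) (at y)"
      "(u1 has_real_derivative - g y * u y - \<mu> * v y) (at y)" "(v1 has_real_derivative - h y * v y + \<mu> * u y) (at y)" for y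
      unfolding u_def[abs_def] u1_def[abs_def] v_def[abs_def] v1_def[abs_def]
      by (rule DERIV_cong, (rule derivative_intros sol_deriv)+, simp add: algebra_simps)+
    define W where "W y = u y * v1 y - u1 y * v y" for y
    have dW: "(W has_real_derivative \<mu> * ((u y)\<^sup>2 + (v y)\<^sup>2) + (g y - h y) * (u y * v y)) (at y)" for y
      unfolding W_def[abs_def]
      by (rule DERIV_cong, (rule derivative_intros du)+) (simp add: algebra_simps power2_eq_square)
    have pos: "(\<mu> - K) * ((u y)\<^sup>2 + (v y)\<^sup>2) \<le> \<mu> * ((u y)\<^sup>2 + (v y)\<^sup>2) + (g y - h y) * (u y * v y)" if y: "y \<in> {0..l}" for y
    proof -
      have "\<bar>(g y - h y) * (u y * v y)\<bar> \<le> K * ((u y)\<^sup>2 + (v y)\<^sup>2)"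
        unfolding abs_mult[of "g y - h y"]
      proof (rule mult_mono)
        show "\<bar>g y - h y\<bar> \<le> K" using K y by blast
        have "2 * (\<bar>u y\<bar> * \<bar>v y\<bar>) \<le> (u y)\<^sup>2 + (v y)\<^sup>2" using sum_squares_bound[of "\<bar>u y\<bar>" "\<bar>v y\<bar>"] by simp
        then show "\<bar>u y * v y\<bar> \<le> (u y)\<^sup>2 + (v y)\<^sup>2" unfolding abs_mult
          using mult_nonneg_nonneg[OF abs_ge_zero[of "u y"] abs_ge_zero[of "v y"]] by linarith
      qed (use K0 in auto)
      then show ?thesis by (simp add: left_diff_distrib abs_le_iff)
    qed
    have init: "u 0 = 0" "v 0 = 0" "u1 0 = a" "v1 0 = b" by (simp_all add: u_def v_def u1_def v1_def eu_def ev_def)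
    have W0: "W 0 = 0" "W l = 0" using bc init by (simp_all add: W_def u_def v_def)
    have mono: "W y \<le> W z" if "0 \<le> y" "y \<le> z" "z \<le> l" for y z
    proof (rule DERIV_nonneg_imp_nondecreasing[of y z W, OF that(2)])
      fix x assume x: "y \<le> x" "x \<le> z"
      have "0 \<le> (\<mu> - K) * ((u x)\<^sup>2 + (v x)\<^sup>2)" using m by simp
      also have "\<dots> \<le> \<mu> * ((u x)\<^sup>2 + (v x)\<^sup>2) + (g x - h x) * (u x * v x)" using x that by (intro pos) auto
      finally show "\<exists>D. (W has_real_derivative D) (at x) \<and> D \<ge> 0" using dW by blast
    qed
    have Wz: "W y = 0" if "0 \<le> y" "y \<le> l" for y using mono[of 0 y] mono[of y l] W0 that by simp
    have uv: "u y = 0 \<and> v y = 0" if y: "y \<in> {0<..<l}" for y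
    proof -
      have "(W has_real_derivative 0) (at y)"
        by (rule has_field_derivative_transform_within_open[of "\<lambda>_. 0" _ _ "{0<..<l}"]) (use y Wz in auto)
      then have "\<mu> * ((u y)\<^sup>2 + (v y)\<^sup>2) + (g y - h y) * (u y * v y) = 0" using DERIV_unique[OF dW] by blast
      then have "(\<mu> - K) * ((u y)\<^sup>2 + (v y)\<^sup>2) \<le> 0" using pos[of y] y by simp
      then have "(u y)\<^sup>2 + (v y)\<^sup>2 \<le> 0" using m by (simp add: mult_le_0_iff)
      then show ?thesis using sum_power2_le_zero_iff by blast
    qed
    have "u1 y = 0 \<and> v1 y = 0" if y: "y \<in> {0<..<l}" for y
    proof -
      have "(u has_real_derivative 0) (at y)"
        by (rule has_field_derivative_transform_within_open[of "\<lambda>_. 0" _ _ "{0<..<l}"]) (use y uv in auto)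
      moreover have "(v has_real_derivative 0) (at y)"
        by (rule has_field_derivative_transform_within_open[of "\<lambda>_. 0" _ _ "{0<..<l}"]) (use y uv in auto)
      ultimately show ?thesis using DERIV_unique du by blast
    qed
    then have "\<And>y. y \<in> {0<..<l} \<Longrightarrow> u1 y = 0" "\<And>y. y \<in> {0<..<l} \<Longrightarrow> v1 y = 0" by auto
    moreover have "continuous_on (closure {0<..<l}) u1" "continuous_on (closure {0<..<l}) v1"
      by (intro continuous_at_imp_continuous_on ballI DERIV_isCont[OF du(3)] DERIV_isCont[OF du(4)])+
    moreover have "0 \<in> closure {0<..<l}" using \<open>0 < l\<close> by simp
    ultimately have "u1 0 = 0" "v1 0 = 0"
      using continuous_constant_on_closure[of "{0<..<l}" u1 0 0] continuous_constant_on_closure[of "{0<..<l}" v1 0 0] by blast+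
    then show "a = 0 \<and> b = 0" using init by simp
  qed
qed

definition dirichlet_det :: "real \<Rightarrow> real \<Rightarrow> real"
  where "dirichlet_det \<mu> y = usol eu \<mu> y * vsol ev \<mu> y - usol ev \<mu> y * vsol eu \<mu> y"

lemma dirichlet_det_kernel:
  assumes "a * usol eu \<mu> y + b * usol ev \<mu> y = 0" "a * vsol eu \<mu> y + b * vsol ev \<mu> y = 0" "(a, b) \<noteq> (0, 0)"
  shows "dirichlet_det \<mu> y = 0"
proof -
  have "a * dirichlet_det \<mu> y = (a * usol eu \<mu> y + b * usol ev \<mu> y) * vsol ev \<mu> y - usol ev \<mu> y * (a * vsol eu \<mu> y + b * vsol ev \<mu> y)"
    "b * dirichlet_det \<mu> y = usol eu \<mu> y * (a * vsol eu \<mu> y + b * vsol ev \<mu> y) - vsol eu \<mu> y * (a * usol eu \<mu> y + b * usol ev \<mu> y)"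
    by (simp_all add: dirichlet_det_def algebra_simps)
  then show ?thesis using assms by auto
qed

text \<open>
  The determinant is a power series in \<open>\<mu>\<close> that is nonzero for large real \<open>\<mu>\<close>, so it has a first
  nonvanishing coefficient.
\<close>

lemma dirichlet_det_isolated:
  assumes "0 < l"
  shows "\<forall>\<^sub>F \<mu> in at_right 0. dirichlet_det \<mu> l \<noteq> 0"
proof -
  define d where "d n = (\<Sum>i\<le>n. un eu i l * vn ev (n - i) l) - (\<Sum>i\<le>n. un ev i l * vn eu (n - i) l)" for n
  have sums: "(\<lambda>n. d n * \<mu> ^ n) sums dirichlet_det \<mu> l" for \<mu>
  proof -
    have "(\<lambda>k. \<Sum>i\<le>k. (un e i l * \<mu> ^ i) * (vn f (k - i) l * \<mu> ^ (k - i))) sums (usol e \<mu> l * vsol f \<mu> l)" for e f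
      using Cauchy_product_sums[OF sol_sums(1)[of e l \<mu>] sol_sums(3)[of f l \<mu>]] by (simp add: sol_sums)
    moreover have "(\<Sum>i\<le>k. (un e i l * \<mu> ^ i) * (vn f (k - i) l * \<mu> ^ (k - i))) = (\<Sum>i\<le>k. un e i l * vn f (k - i) l) * \<mu> ^ k" for e f k
      unfolding sum_distrib_right by (rule sum.cong) (auto simp: power_add[symmetric])
    ultimately have "(\<lambda>k. (\<Sum>i\<le>k. un e i l * vn f (k - i) l) * \<mu> ^ k) sums (usol e \<mu> l * vsol f \<mu> l)" for e f by simp
    from sums_diff[OF this[of eu ev] this[of ev eu]] show ?thesis
      by (simp add: d_def dirichlet_det_def left_diff_distrib)
  qed
  have "\<exists>n. d n \<noteq> 0"
  proof (rule ccontr)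
    assume "\<nexists>n. d n \<noteq> 0"
    then have det0: "dirichlet_det \<mu> l = 0" for \<mu> using sums[of \<mu>] sums_unique2[OF sums_zero] by simp
    obtain K where K: "\<And>\<mu> a b. \<mu> > K \<Longrightarrow> a * usol eu \<mu> l + b * usol ev \<mu> l = 0 \<Longrightarrow>
      a * vsol eu \<mu> l + b * vsol ev \<mu> l = 0 \<Longrightarrow> a = 0 \<and> b = 0"
      using no_large_real_eigenvalue[OF \<open>0 < l\<close>] by metis
    define \<mu> where "\<mu> = K + 1"
    have m: "\<mu> > K" by (simp add: \<mu>_def)
    have det: "usol eu \<mu> l * vsol ev \<mu> l = usol ev \<mu> l * vsol eu \<mu> l" using det0[of \<mu>] by (simp add: dirichlet_det_def)
    have "vsol ev \<mu> l = 0 \<and> - vsol eu \<mu> l = 0" by (rule K[OF m]) (use det in \<open>simp_all add: mult_ac\<close>)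
    moreover have "usol ev \<mu> l = 0 \<and> - usol eu \<mu> l = 0" by (rule K[OF m]) (use det in \<open>simp_all add: mult_ac\<close>)
    ultimately have "(1::real) = 0 \<and> (0::real) = 0" by (intro K[OF m]) auto
    then show False by simp
  qed
  then obtain k where k: "d k \<noteq> 0" "\<And>i. i < k \<Longrightarrow> d i = 0" using exists_least_iff[of "\<lambda>n. d n \<noteq> 0"] by auto
  define e where "e x = (\<Sum>n. d (n + k) * x ^ n)" for x
  have fact: "dirichlet_det x l = x ^ k * e x" for x
  proof -
    have s: "summable (\<lambda>n. d n * x ^ n)" using sums by (rule sums_summable)
    have "dirichlet_det x l = (\<Sum>n. d n * x ^ n)" using sums by (rule sums_unique)
    also have "\<dots> = (\<Sum>n. d (n + k) * x ^ (n + k)) + (\<Sum>i<k. d i * x ^ i)"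
      by (rule suminf_split_initial_segment[OF s])
    also have "(\<Sum>i<k. d i * x ^ i) = 0" using k(2) by simp
    finally have 1: "dirichlet_det x l = (\<Sum>n. x ^ k * (d (n + k) * x ^ n))" by (simp add: power_add mult_ac)
    show ?thesis
    proof (cases "x = 0")
      case True
      have "(\<Sum>n. d n * 0 ^ n) = d 0" using powser_zero[of d] by simp
      moreover have "e 0 = d k" unfolding e_def using powser_zero[of "\<lambda>n. d (n + k)"] by simp
      ultimately show ?thesis using True sums_unique[OF sums[of 0]] k(2)[of 0] by (cases k) auto
    next
      case False
      have "summable (\<lambda>n. d (n + k) * x ^ (n + k))" using summable_ignore_initial_segment[OF s] .
      then have "summable (\<lambda>n. inverse (x ^ k) * (d (n + k) * x ^ (n + k)))" by (rule summable_mult)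
      then have "summable (\<lambda>n. d (n + k) * x ^ n)" using False by (simp add: power_add field_simps)
      then show ?thesis unfolding 1 e_def by (rule suminf_mult)
    qed
  qed
  have "isCont e 0"
    unfolding e_def[abs_def]
  proof (rule isCont_powser)
    have "summable (\<lambda>n. d (n + k) * 1 ^ (n + k))"
      using summable_ignore_initial_segment[OF sums_summable[OF sums[of 1]]] .
    then show "summable (\<lambda>n. d (n + k) * 1 ^ n)" by simp
  qed simp
  moreover have "e 0 \<noteq> 0" using powser_zero[of "\<lambda>n. d (n + k)"] k by (simp add: e_def)
  ultimately have "\<forall>\<^sub>F x in at 0. e x \<noteq> 0" unfolding isCont_def by (rule tendsto_imp_eventually_ne)
  then have "\<forall>\<^sub>F x in at_right 0. e x \<noteq> 0"
    using at_le[of "{0<..}" UNIV "0::real"] filter_leD by blast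
  moreover have "\<forall>\<^sub>F x in at_right (0::real). x > 0" by (simp add: eventually_at_right_less)
  ultimately show ?thesis by eventually_elim (simp add: fact)
qed

end

section \<open>Charts from frames\<close>

definition vec4 :: "real \<Rightarrow> real \<Rightarrow> real \<Rightarrow> real \<Rightarrow> real^4"
  where "vec4 a b c d = vector [a, b, c, d]"

lemma vec4_nth [simp]: "vec4 a b c d $ 1 = a" "vec4 a b c d $ 2 = b" "vec4 a b c d $ 3 = c" "vec4 a b c d $ 4 = d"
  unfolding vec4_def vector_def by simp_all

lemma vec4_eq_iff: "(x :: real^4) = y \<longleftrightarrow> x $ 1 = y $ 1 \<and> x $ 2 = y $ 2 \<and> x $ 3 = y $ 3 \<and> x $ 4 = y $ 4"
  by (simp add: vec_eq_iff forall_4)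

lemma inner_vec4: "(x :: real^4) \<bullet> y = x $ 1 * y $ 1 + x $ 2 * y $ 2 + x $ 3 * y $ 3 + x $ 4 * y $ 4"
  by (simp add: inner_vec_def sum_4)

lemma tendsto_vec4:
  assumes "(a \<longlongrightarrow> a') F" "(b \<longlongrightarrow> b') F" "(c \<longlongrightarrow> c') F" "(d \<longlongrightarrow> d') F"
  shows "((\<lambda>t. vec4 (a t) (b t) (c t) (d t)) \<longlongrightarrow> vec4 a' b' c' d') F"
proof (rule vec_tendstoI)
  fix i :: 4
  show "((\<lambda>t. vec4 (a t) (b t) (c t) (d t) $ i) \<longlongrightarrow> vec4 a' b' c' d' $ i) F"
    using exhaust_4[of i] assms by auto
qed

lemma continuous_vec4:
  assumes "continuous_on S a" "continuous_on S b" "continuous_on S c" "continuous_on S d"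
  shows "continuous_on S (\<lambda>t. vec4 (a t) (b t) (c t) (d t))"
  using assms unfolding continuous_on_def by (auto intro: tendsto_vec4)

lemma frame_transverse_inj:
  fixes Z :: "(real^'n) \<Rightarrow>\<^sub>L ((real^'n) \<times> (real^'n))"
  assumes "inj (blinfun_apply Z)"
  shows "transverse \<beta> (range Z) \<longleftrightarrow> inj (\<lambda>k. snd (Z k) - \<beta> *\<^sub>R fst (Z k))"
proof -
  have lin: "linear (\<lambda>k. snd (Z k) - \<beta> *\<^sub>R fst (Z k))"
    by (auto intro!: linearI simp: blinfun.bilinear_simps algebra_simps)
  have lz: "linear (blinfun_apply Z)" by (simp add: blinfun.bounded_linear_right bounded_linear.linear)
  show ?thesis
    unfolding linear_injective_0[OF lin]
  proof
    assume t: "transverse \<beta> (range Z)"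
    show "\<forall>k. snd (Z k) - \<beta> *\<^sub>R fst (Z k) = 0 \<longrightarrow> k = 0"
    proof (intro allI impI)
      fix k assume k: "snd (Z k) - \<beta> *\<^sub>R fst (Z k) = 0"
      then have "Z k = (fst (Z k), \<beta> *\<^sub>R fst (Z k))" by (simp add: prod_eq_iff)
      then have "(fst (Z k), \<beta> *\<^sub>R fst (Z k)) \<in> range Z" by (metis rangeI)
      then have "fst (Z k) = 0" using t by (simp add: transverse_def)
      then have "Z k = 0" using k by (simp add: prod_eq_iff)
      then show "k = 0" using assms linear_injective_0[OF lz] by blast
    qed
  next
    assume i: "\<forall>k. snd (Z k) - \<beta> *\<^sub>R fst (Z k) = 0 \<longrightarrow> k = 0"
    show "transverse \<beta> (range Z)"
      unfolding transverse_def
    proof (intro allI impI)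
      fix x assume "(x, \<beta> *\<^sub>R x) \<in> range Z"
      then obtain k where k: "Z k = (x, \<beta> *\<^sub>R x)" by (metis imageE)
      then have "k = 0" using i by simp
      then show "x = 0" using k by (simp add: zero_prod_def)
    qed
  qed
qed

text \<open>
  With \<open>Y = snd Z - \<beta> fst Z\<close>, which is invertible by transversality, \<open>A = fst Z Y\<^sup>-\<^sup>1\<close>.
\<close>

lemma chart_of_frame:
  fixes Z :: "'t::topological_space \<Rightarrow> (real^'n) \<Rightarrow>\<^sub>L ((real^'n) \<times> (real^'n))"
  assumes cont: "continuous_on S Z" and inj: "\<And>t. t \<in> S \<Longrightarrow> inj (blinfun_apply (Z t))"
    and Lag: "\<And>t. t \<in> S \<Longrightarrow> range (Z t) \<in> Lagrangians"
    and tr: "\<And>t. t \<in> S \<Longrightarrow> transverse \<beta> (range (Z t))"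
  obtains A where "continuous_on S A" "\<forall>t\<in>S. symmetric_op (A t) \<and> range (Z t) = sym_graph \<beta> (A t)"
proof -
  define Y where "Y t = (if t \<in> S then (snd_blinfun o\<^sub>L Z t) - \<beta> *\<^sub>R (fst_blinfun o\<^sub>L Z t) else id_blinfun)" for t
  have Yapp: "Y t k = snd (Z t k) - \<beta> *\<^sub>R fst (Z t k)" if "t \<in> S" for t k
    using that by (simp add: Y_def blinfun.bilinear_simps)
  have Yc: "continuous_on S Y"
  proof (rule continuous_on_eq)
    show "continuous_on S (\<lambda>t. (snd_blinfun o\<^sub>L Z t) - \<beta> *\<^sub>R (fst_blinfun o\<^sub>L Z t))"
      by (intro continuous_on_diff continuous_on_scaleR continuous_on_const cont
          bounded_bilinear.continuous_on[OF bounded_bilinear_blinfun_compose])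
  qed (simp add: Y_def)
  have "\<exists>H. Y t o\<^sub>L H = id_blinfun \<and> H o\<^sub>L Y t = id_blinfun" for t
  proof (cases "t \<in> S")
    case True
    have lin: "linear (blinfun_apply (Y t))" by (simp add: blinfun.bounded_linear_right bounded_linear.linear)
    have "inj (blinfun_apply (Y t))"
      using tr[OF True] unfolding frame_transverse_inj[OF inj[OF True]] Yapp[OF True, symmetric] by simp
    then obtain H where H: "linear H" "\<And>x. H (Y t x) = x" "\<And>x. Y t (H x) = x"
      using linear_injective_isomorphism[OF lin] by blast
    have "blinfun_apply (Blinfun H) = H" using H(1) by (simp add: bounded_linear_Blinfun_apply linear_linear)
    then show ?thesis using H(2,3) by (intro exI[of _ "Blinfun H"]) (auto intro!: blinfun_eqI)
  qed (auto simp: Y_def intro!: exI[of _ id_blinfun] blinfun_eqI)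
  then obtain H where H: "\<And>t. Y t o\<^sub>L H t = id_blinfun" "\<And>t. H t o\<^sub>L Y t = id_blinfun" by metis
  have Hc: "continuous_on S H"
    unfolding continuous_on_def
  proof
    fix t assume "t \<in> S"
    then show "(H \<longlongrightarrow> H t) (at t within S)"
      using Yc by (intro inverse_operator_tendsto(1)[where G = Y, OF _ H H]) (auto simp: continuous_on_def)
  qed
  have YH: "Y t (H t y) = y" "H t (Y t y) = y" for t y
    using arg_cong[OF H(1)[of t], of "\<lambda>T. blinfun_apply T y"] arg_cong[OF H(2)[of t], of "\<lambda>T. blinfun_apply T y"]
    by simp_all
  define A where "A t = fst_blinfun o\<^sub>L (Z t o\<^sub>L H t)" for t
  have "continuous_on S A"
    unfolding A_def by (intro bounded_bilinear.continuous_on[OF bounded_bilinear_blinfun_compose] continuous_on_const cont Hc)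
  moreover have "\<forall>t\<in>S. symmetric_op (A t) \<and> range (Z t) = sym_graph \<beta> (A t)"
  proof
    fix t assume t: "t \<in> S"
    have pt: "Z t (H t y) = (A t y, y + \<beta> *\<^sub>R A t y)" for y
      using YH(1)[of t y] unfolding Yapp[OF t] by (simp add: A_def prod_eq_iff algebra_simps)
    have "range (Z t) = sym_graph \<beta> (A t)"
    proof
      show "range (Z t) \<subseteq> sym_graph \<beta> (A t)"
      proof
        fix z assume "z \<in> range (Z t)"
        then obtain k where "z = Z t k" by blast
        then have "z = Z t (H t (Y t k))" by (simp add: YH)
        then show "z \<in> sym_graph \<beta> (A t)" unfolding pt sym_graph_def by blast
      qed
      show "sym_graph \<beta> (A t) \<subseteq> range (Z t)" unfolding sym_graph_def pt[symmetric] by blast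
    qed
    moreover have "symmetric_op (A t)"
      unfolding symmetric_op_def
    proof (intro allI)
      fix x y
      show "A t x \<bullet> y = x \<bullet> A t y"
      proof -
        have "fst (Z t (H t x)) \<bullet> snd (Z t (H t y)) = fst (Z t (H t y)) \<bullet> snd (Z t (H t x))"
          by (rule LagrangiansD(3)[OF Lag[OF t]]) auto
        then show ?thesis unfolding pt by (simp add: inner_add_right) (simp add: inner_commute)
      qed
    qed
    ultimately show "symmetric_op (A t) \<and> range (Z t) = sym_graph \<beta> (A t)" by blast
  qed
  ultimately show thesis by (rule that)
qed

section \<open>The Lagrangian family of the boundary value problem\<close>

text \<open>
  The coefficients \<open>G\<close> and \<open>H\<close> of the boundary value problem matter only on \<open>[0, l']\<close>; \<open>g\<close> and \<open>h\<close> are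
  continuous extensions to the whole line, so that the solutions exist globally.
\<close>

locale corner = hamiltonian_pencil g h for g h +
  fixes l l' :: real and G H :: "real \<Rightarrow> real"
  assumes l: "0 < l" "l < l'"
    and G: "\<And>y. y \<in> {0..l'} \<Longrightarrow> G y = g y" and H: "\<And>y. y \<in> {0..l'} \<Longrightarrow> H y = h y"
begin

definition e1 :: cauchy_data where "e1 = ((1, 0), (0, 0))"
definition e2 :: cauchy_data where "e2 = ((0, 0), (1, 0))"

text \<open>
  The components and derivatives of the solution of \<open>u'' = - g u - \<mu> v\<close>, \<open>v'' = - h v + \<mu> u\<close> with
  Cauchy data \<open>u(0), v(0), u'(0), v'(0)\<close> listed in \<open>k\<close>.
\<close>

definition gu where "gu k \<mu> y = k $ 1 * usol e1 \<mu> y + k $ 2 * usol e2 \<mu> y + k $ 3 * usol eu \<mu> y + k $ 4 * usol ev \<mu> y" for k :: "real^4"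
definition gu' where "gu' k \<mu> y = k $ 1 * usol' e1 \<mu> y + k $ 2 * usol' e2 \<mu> y + k $ 3 * usol' eu \<mu> y + k $ 4 * usol' ev \<mu> y" for k :: "real^4"
definition gv where "gv k \<mu> y = k $ 1 * vsol e1 \<mu> y + k $ 2 * vsol e2 \<mu> y + k $ 3 * vsol eu \<mu> y + k $ 4 * vsol ev \<mu> y" for k :: "real^4"
definition gv' where "gv' k \<mu> y = k $ 1 * vsol' e1 \<mu> y + k $ 2 * vsol' e2 \<mu> y + k $ 3 * vsol' eu \<mu> y + k $ 4 * vsol' ev \<mu> y" for k :: "real^4"

lemma gen_deriv:
  "(gu k \<mu> has_real_derivative gu' k \<mu> y) (at y)" "(gv k \<mu> has_real_derivative gv' k \<mu> y) (at y)"
  "(gu' k \<mu> has_real_derivative - g y * gu k \<mu> y - \<mu> * gv k \<mu> y) (at y)"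
  "(gv' k \<mu> has_real_derivative - h y * gv k \<mu> y + \<mu> * gu k \<mu> y) (at y)"
  unfolding gu_def[abs_def] gu'_def[abs_def] gv_def[abs_def] gv'_def[abs_def]
  by (rule DERIV_cong, (rule derivative_intros sol_deriv)+, simp add: algebra_simps)+

lemma gen_init [simp]: "gu k \<mu> 0 = k $ 1" "gv k \<mu> 0 = k $ 2" "gu' k \<mu> 0 = k $ 3" "gv' k \<mu> 0 = k $ 4"
  by (simp_all add: gu_def gu'_def gv_def gv'_def e1_def e2_def eu_def ev_def)

lemma gen_cont:
  "continuous_on UNIV (\<lambda>p. gu k (fst p) (snd p))" "continuous_on UNIV (\<lambda>p. gu' k (fst p) (snd p))"
  "continuous_on UNIV (\<lambda>p. gv k (fst p) (snd p))" "continuous_on UNIV (\<lambda>p. gv' k (fst p) (snd p))"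
  unfolding gu_def gu'_def gv_def gv'_def
  by (intro continuous_on_add continuous_on_mult continuous_on_const sol_cont)+

text \<open>
  Rescaling \<open>y = s x\<close> turns the equation on \<open>[0, l]\<close> with parameter \<open>s\<close> into the unscaled equation on
  \<open>[0, s l]\<close>, so one family of solutions serves all \<open>s\<close>.
\<close>

definition sol :: "real \<Rightarrow> real \<Rightarrow> real^4 \<Rightarrow> real \<Rightarrow> real \<times> real"
  where "sol \<mu> s k x = (if x \<in> {0..l} then (gu k \<mu> (s * x), gv k \<mu> (s * x)) else 0)"

lemma scaled_coefficients:
  assumes s: "0 < s" "s * l \<le> l'" and x: "x \<in> {0..l}"
  shows "G (s * x) = g (s * x)" "H (s * x) = h (s * x)"
proof -
  have "s * x \<le> s * l" using s x by (intro mult_left_mono) auto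
  then have "s * x \<in> {0..l'}" using s x order_trans[of "s * x" "s * l" l'] by simp
  then show "G (s * x) = g (s * x)" "H (s * x) = h (s * x)" using G H by auto
qed

lemma scaled_continuous:
  assumes s: "0 < s" "s * l \<le> l'"
  shows "continuous_on {0..l} (\<lambda>x. G (s * x))" "continuous_on {0..l} (\<lambda>x. H (s * x))"
proof -
  have "continuous_on {0..l} (\<lambda>x. g (s * x))" "continuous_on {0..l} (\<lambda>x. h (s * x))"
    by (intro continuous_on_compose2[OF g_cont] continuous_on_compose2[OF h_cont] continuous_intros; simp)+
  from continuous_on_eq[OF this(1)] continuous_on_eq[OF this(2)]
  show "continuous_on {0..l} (\<lambda>x. G (s * x))" "continuous_on {0..l} (\<lambda>x. H (s * x))"
    by (simp_all only: scaled_coefficients[OF s])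
qed

lemma sol_classical:
  assumes s: "0 < s" "s * l \<le> l'"
  shows "classical l (\<lambda>x. fst (sol \<mu> s k x)) (\<lambda>x. - s\<^sup>2 * G (s * x) * fst (sol \<mu> s k x) - s\<^sup>2 * \<mu> * snd (sol \<mu> s k x))"
    "classical l (\<lambda>x. snd (sol \<mu> s k x)) (\<lambda>x. - s\<^sup>2 * H (s * x) * snd (sol \<mu> s k x) + s\<^sup>2 * \<mu> * fst (sol \<mu> s k x))"
    "\<And>x. x \<in> {0..l} \<Longrightarrow> D1 l (\<lambda>x. fst (sol \<mu> s k x)) x = s * gu' k \<mu> (s * x)"
    "\<And>x. x \<in> {0..l} \<Longrightarrow> D1 l (\<lambda>x. snd (sol \<mu> s k x)) x = s * gv' k \<mu> (s * x)"
proof -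
  have ch: "((\<lambda>x. f (s * x)) has_real_derivative s * f') (at x within {0..l})"
    if "(f has_real_derivative f') (at (s * x))" for f f' x
  proof -
    have "((\<lambda>x. s * x) has_real_derivative s) (at x)" by (rule derivative_eq_intros | simp)+
    from DERIV_chain2[OF that this] have "((\<lambda>x. f (s * x)) has_real_derivative s * f') (at x)" by (simp add: mult.commute)
    then show ?thesis by (rule has_field_derivative_at_within)
  qed
  have eq: "fst (sol \<mu> s k x) = gu k \<mu> (s * x)" "snd (sol \<mu> s k x) = gv k \<mu> (s * x)" if "x \<in> {0..l}" for x
    using that by (simp_all add: sol_def)
  have d1: "((\<lambda>x. fst (sol \<mu> s k x)) has_real_derivative s * gu' k \<mu> (s * x)) (at x within {0..l})" if x: "x \<in> {0..l}" for x
    by (rule has_field_derivative_transform_within[OF ch[OF gen_deriv(1)] zero_less_one x]) (simp add: eq)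
  have d2: "((\<lambda>x. snd (sol \<mu> s k x)) has_real_derivative s * gv' k \<mu> (s * x)) (at x within {0..l})" if x: "x \<in> {0..l}" for x
    by (rule has_field_derivative_transform_within[OF ch[OF gen_deriv(2)] zero_less_one x]) (simp add: eq)
  have d3: "((\<lambda>x. s * gu' k \<mu> (s * x)) has_real_derivative
      - s\<^sup>2 * G (s * x) * fst (sol \<mu> s k x) - s\<^sup>2 * \<mu> * snd (sol \<mu> s k x)) (at x within {0..l})" if x: "x \<in> {0..l}" for x
    using DERIV_cmult[OF ch[OF gen_deriv(3)], of s]
    by (rule DERIV_cong) (simp add: eq[OF x] scaled_coefficients[OF s x] power2_eq_square algebra_simps)
  have d4: "((\<lambda>x. s * gv' k \<mu> (s * x)) has_real_derivative
      - s\<^sup>2 * H (s * x) * snd (sol \<mu> s k x) + s\<^sup>2 * \<mu> * fst (sol \<mu> s k x)) (at x within {0..l})" if x: "x \<in> {0..l}" for x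
    using DERIV_cmult[OF ch[OF gen_deriv(4)], of s]
    by (rule DERIV_cong) (simp add: eq[OF x] scaled_coefficients[OF s x] power2_eq_square algebra_simps)
  show "classical l (\<lambda>x. fst (sol \<mu> s k x)) (\<lambda>x. - s\<^sup>2 * G (s * x) * fst (sol \<mu> s k x) - s\<^sup>2 * \<mu> * snd (sol \<mu> s k x))"
    "\<And>x. x \<in> {0..l} \<Longrightarrow> D1 l (\<lambda>x. fst (sol \<mu> s k x)) x = s * gu' k \<mu> (s * x)"
    by (rule classicalI[OF l(1) d1 d3]; assumption)+
  show "classical l (\<lambda>x. snd (sol \<mu> s k x)) (\<lambda>x. - s\<^sup>2 * H (s * x) * snd (sol \<mu> s k x) + s\<^sup>2 * \<mu> * fst (sol \<mu> s k x))"
    "\<And>x. x \<in> {0..l} \<Longrightarrow> D1 l (\<lambda>x. snd (sol \<mu> s k x)) x = s * gv' k \<mu> (s * x)"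
    by (rule classicalI[OF l(1) d2 d4]; assumption)+
qed

lemma solution_space_eq:
  assumes s: "0 < s" "s * l \<le> l'"
  shows "solution_space l G H \<mu> s = range (sol \<mu> s)"
proof
  note iff = solution_space_iff[OF l(1) scaled_continuous[OF s], of _ \<mu>]
  show "range (sol \<mu> s) \<subseteq> solution_space l G H \<mu> s"
    unfolding iff image_subset_iff using sol_classical(1,2)[OF s] by (auto simp: sol_def)
  show "solution_space l G H \<mu> s \<subseteq> range (sol \<mu> s)"
  proof
    fix U assume U: "U \<in> solution_space l G H \<mu> s"
    let ?u = "\<lambda>x. fst (U x)" and ?v = "\<lambda>x. snd (U x)"
    define k where "k = vec4 (?u 0) (?v 0) (D1 l ?u 0 / s) (D1 l ?v 0 / s)"
    have cU: "classical l ?u (\<lambda>x. - s\<^sup>2 * G (s * x) * ?u x - s\<^sup>2 * \<mu> * ?v x)"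
      "classical l ?v (\<lambda>x. - s\<^sup>2 * H (s * x) * ?v x + s\<^sup>2 * \<mu> * ?u x)" and out: "\<And>x. x \<notin> {0..l} \<Longrightarrow> U x = 0"
      using U unfolding iff by blast+
    let ?a = "\<lambda>x. fst (sol \<mu> s k x)" and ?b = "\<lambda>x. snd (sol \<mu> s k x)"
    note cS = sol_classical[OF s, where \<mu> = \<mu> and k = k]
    have "?u x - ?a x = 0 \<and> D1 l ?u x - D1 l ?a x = 0 \<and> ?v x - ?b x = 0 \<and> D1 l ?v x - D1 l ?b x = 0" if x: "x \<in> {0..l}" for x
    proof (rule linear_system_unique[where p = "\<lambda>x. s\<^sup>2 * G (s * x)" and q = "\<lambda>x. s\<^sup>2 * H (s * x)" and m = "s\<^sup>2 * \<mu>", OF _ _ _ _ _ _ _ _ _ _ x])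
      fix x assume x: "x \<in> {0..l}"
      show "((\<lambda>x. ?u x - ?a x) has_real_derivative D1 l ?u x - D1 l ?a x) (at x within {0..l})"
        "((\<lambda>x. ?v x - ?b x) has_real_derivative D1 l ?v x - D1 l ?b x) (at x within {0..l})"
        using cU cS(1,2) x by (auto simp: classical_def intro!: DERIV_diff)
      have "((\<lambda>x. D1 l ?u x - D1 l ?a x) has_real_derivative
          (- s\<^sup>2 * G (s * x) * ?u x - s\<^sup>2 * \<mu> * ?v x) - (- s\<^sup>2 * G (s * x) * ?a x - s\<^sup>2 * \<mu> * ?b x)) (at x within {0..l})"
        using cU cS(1,2) x by (auto simp: classical_def intro!: DERIV_diff)
      then show "((\<lambda>x. D1 l ?u x - D1 l ?a x) has_real_derivative
          - (s\<^sup>2 * G (s * x)) * (?u x - ?a x) - s\<^sup>2 * \<mu> * (?v x - ?b x)) (at x within {0..l})"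
        by (rule DERIV_cong) (simp add: algebra_simps)
      have "((\<lambda>x. D1 l ?v x - D1 l ?b x) has_real_derivative
          (- s\<^sup>2 * H (s * x) * ?v x + s\<^sup>2 * \<mu> * ?u x) - (- s\<^sup>2 * H (s * x) * ?b x + s\<^sup>2 * \<mu> * ?a x)) (at x within {0..l})"
        using cU cS(1,2) x by (auto simp: classical_def intro!: DERIV_diff)
      then show "((\<lambda>x. D1 l ?v x - D1 l ?b x) has_real_derivative
          - (s\<^sup>2 * H (s * x)) * (?v x - ?b x) + s\<^sup>2 * \<mu> * (?u x - ?a x)) (at x within {0..l})"
        by (rule DERIV_cong) (simp add: algebra_simps)
    next
      show "continuous_on {0..l} (\<lambda>x. s\<^sup>2 * G (s * x))" "continuous_on {0..l} (\<lambda>x. s\<^sup>2 * H (s * x))"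
        by (intro continuous_on_mult continuous_on_const scaled_continuous[OF s])+
      have z: "0 \<in> {0..l}" using l by simp
      show "?u 0 - ?a 0 = 0" "?v 0 - ?b 0 = 0" using l by (simp_all add: sol_def k_def)
      show "D1 l ?u 0 - D1 l ?a 0 = 0" "D1 l ?v 0 - D1 l ?b 0 = 0"
        using cS(3,4)[OF z] s by (simp_all add: k_def)
    qed
    then have "U x = sol \<mu> s k x" for x
      using out[of x] by (cases "x \<in> {0..l}") (auto simp: prod_eq_iff sol_def)
    then show "U \<in> range (sol \<mu> s)" by blast
  qed
qed

text \<open>
  The trace of \<open>sol \<mu> s k\<close>; the factor \<open>1/s\<close> in the definition of \<open>Tr\<close> cancels the scaling of the
  derivatives.
\<close>

definition frame_map :: "real \<Rightarrow> real \<Rightarrow> real^4 \<Rightarrow> (real^4) \<times> (real^4)"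
  where "frame_map \<mu> s k = (vec4 (k $ 1) (k $ 2) (gu k \<mu> (s * l)) (gv k \<mu> (s * l)),
    vec4 (- k $ 3) (k $ 4) (gu' k \<mu> (s * l)) (- gv' k \<mu> (s * l)))"

definition frame :: "real \<Rightarrow> real \<Rightarrow> (real^4) \<Rightarrow>\<^sub>L ((real^4) \<times> (real^4))"
  where "frame \<mu> s = Blinfun (frame_map \<mu> s)"

lemma frame_apply: "blinfun_apply (frame \<mu> s) = frame_map \<mu> s"
  unfolding frame_def
proof (rule bounded_linear_Blinfun_apply)
  have "linear (frame_map \<mu> s)"
    by (rule linearI) (simp_all add: frame_map_def vec4_eq_iff gu_def gu'_def gv_def gv'_def algebra_simps)
  then show "bounded_linear (frame_map \<mu> s)" by (simp add: linear_linear)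
qed

lemma Tr_sol:
  assumes s: "0 < s" "s * l \<le> l'"
  shows "Tr l s (sol \<mu> s k) = frame_map \<mu> s k"
proof -
  have z: "0 \<in> {0..l}" "l \<in> {0..l}" using l by auto
  show ?thesis
    using sol_classical(3,4)[OF s z(1), where \<mu> = \<mu> and k = k] sol_classical(3,4)[OF s z(2), where \<mu> = \<mu> and k = k] s z
    by (simp add: Tr_def Let_def frame_map_def vec4_def[symmetric]) (simp add: sol_def)
qed

lemma Lambda_eq: "0 < s \<Longrightarrow> s * l \<le> l' \<Longrightarrow> Lambda l G H \<mu> s = range (frame \<mu> s)"
  unfolding Lambda_def solution_space_eq image_image frame_apply by (simp add: Tr_sol)

lemma frame_inj: "inj (blinfun_apply (frame \<mu> s))"
proof (rule injI)
  fix k k' assume eq: "frame \<mu> s k = frame \<mu> s k'"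
  have "fst (frame \<mu> s k) $ i = fst (frame \<mu> s k') $ i" "snd (frame \<mu> s k) $ i = snd (frame \<mu> s k') $ i" for i
    using eq by simp_all
  from this(1)[of 1] this(1)[of 2] this(2)[of 1] this(2)[of 2] show "k = k'"
    by (simp add: frame_apply frame_map_def vec4_eq_iff)
qed

text \<open>
  The symplectic form of two traces is the difference of the values at \<open>s l\<close> and at \<open>0\<close> of a Wronskian
  that is constant in \<open>y\<close>.
\<close>

lemma frame_Lagrangian: "range (frame \<mu> s) \<in> Lagrangians"
proof -
  have lin: "linear (blinfun_apply (frame \<mu> s))" by (simp add: blinfun.bounded_linear_right bounded_linear.linear)
  have "dim (range (frame \<mu> s)) = dim (UNIV :: (real^4) set)"
    by (rule dim_image_eq[OF lin]) (use frame_inj in auto)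
  moreover have "subspace (range (frame \<mu> s))" by (rule linear_subspace_image[OF lin subspace_UNIV])
  moreover have "symp (frame \<mu> s k) (frame \<mu> s k') = 0" for k k'
  proof -
    define F where "F y = gu k \<mu> y * gu' k' \<mu> y - gu' k \<mu> y * gu k' \<mu> y - gv k \<mu> y * gv' k' \<mu> y + gv' k \<mu> y * gv k' \<mu> y" for y
    have "(F has_real_derivative 0) (at y)" for y
      unfolding F_def[abs_def] by (rule DERIV_cong, (rule derivative_intros gen_deriv)+) (simp add: algebra_simps)
    then have "F (s * l) = F 0" using DERIV_isconst_all by blast
    then show ?thesis
      by (simp add: symp_eq inner_vec4 frame_apply frame_map_def F_def algebra_simps)
  qed
  ultimately show ?thesis by (auto simp: Lagrangians_def)
qed

lemma frame_continuous: "continuous_on UNIV (\<lambda>p. frame (fst p) (snd p))"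
proof -
  have "continuous (at p) (\<lambda>p. frame (fst p) (snd p))" for p
  proof (rule continuous_blinfun_componentwiseI1)
    fix k :: "real^4"
    have c: "continuous_on UNIV (\<lambda>p. f (fst p) (snd p * l))"
      if "continuous_on UNIV (\<lambda>p. f (fst p) (snd p))" for f :: "real \<Rightarrow> real \<Rightarrow> real"
    proof -
      have "continuous_on UNIV (\<lambda>p::real \<times> real. (fst p, snd p * l))" by (intro continuous_intros)
      from continuous_on_compose2[OF that this] show ?thesis by simp
    qed
    have "continuous_on UNIV (\<lambda>p. frame (fst p) (snd p) k)"
      unfolding frame_apply frame_map_def
      by (intro continuous_on_Pair continuous_vec4 continuous_on_const continuous_on_minus c gen_cont)
    then show "continuous (at p) (\<lambda>p. frame (fst p) (snd p) k)"
      unfolding continuous_on_eq_continuous_at[OF open_UNIV] by (rule bspec) simp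
  qed
  then show ?thesis by (simp add: continuous_at_imp_continuous_on)
qed

definition corner_box :: "real \<Rightarrow> (real \<times> real) set" where "corner_box \<delta> = {-\<delta>..\<delta>} \<times> {1-\<delta>..1+\<delta>}"

text \<open>
  Transversality to a fixed slope is an open condition, so one chart covers a neighbourhood of the corner.
\<close>

lemma chart_exists:
  obtains \<beta> \<delta> A where "0 < \<delta>" "\<delta> < 1" "(1 + \<delta>) * l \<le> l'" "continuous_on (corner_box \<delta>) A"
    "\<forall>p\<in>corner_box \<delta>. symmetric_op (A p) \<and> range (frame (fst p) (snd p)) = sym_graph \<beta> (A p)"
proof -
  obtain \<beta> where \<beta>: "transverse \<beta> (range (frame 0 1))" using transverse_exists[OF frame_Lagrangian] .
  define Y where "Y p = (snd_blinfun o\<^sub>L frame (fst p) (snd p)) - \<beta> *\<^sub>R (fst_blinfun o\<^sub>L frame (fst p) (snd p))" for p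
  have Yapp: "Y p k = snd (frame (fst p) (snd p) k) - \<beta> *\<^sub>R fst (frame (fst p) (snd p) k)" for p k
    by (simp add: Y_def blinfun.bilinear_simps)
  have "continuous_on UNIV Y"
    unfolding Y_def
    by (intro continuous_on_diff continuous_on_scaleR continuous_on_const frame_continuous
        bounded_bilinear.continuous_on[OF bounded_bilinear_blinfun_compose])
  then have Yc: "isCont Y (0, 1)" by (simp add: continuous_on_eq_continuous_at)
  have "linear (blinfun_apply (Y (0, 1)))" by (simp add: blinfun.bounded_linear_right bounded_linear.linear)
  moreover have "inj (blinfun_apply (Y (0, 1)))"
    using \<beta> unfolding frame_transverse_inj[OF frame_inj] Yapp[of "(0, 1)", symmetric, unfolded fst_conv snd_conv] .
  ultimately obtain B where B: "B > 0" "\<And>k. B * norm k \<le> norm (Y (0, 1) k)"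
    using linear_inj_bounded_below_pos by metis
  obtain r where r: "r > 0" "\<And>p. dist p (0, 1) < r \<Longrightarrow> dist (Y p) (Y (0, 1)) < B"
    using Yc B(1) unfolding continuous_at_eps_delta by metis
  define \<delta> where "\<delta> = min (r / 3) (min (1/2) ((l' - l) / l))"
  have \<delta>: "0 < \<delta>" "\<delta> < 1" "3 * \<delta> \<le> r" "\<delta> \<le> (l' - l) / l" using r(1) l by (auto simp: \<delta>_def)
  have "(1 + \<delta>) * l \<le> l'" using \<delta>(4) l by (simp add: field_simps)
  have tr: "transverse \<beta> (range (frame (fst p) (snd p)))" if p: "p \<in> corner_box \<delta>" for p
  proof -
    have "dist p (0, 1) \<le> \<bar>fst p\<bar> + \<bar>snd p - 1\<bar>"
      using sqrt_sum_squares_le_sum_abs[of "fst p" "snd p - 1"] by (cases p) (simp add: dist_prod_def dist_real_def)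
    also have "\<dots> < r" using p \<delta> by (auto simp: corner_box_def)
    finally have d: "norm (Y p - Y (0, 1)) < B" using r(2) by (simp add: dist_norm)
    have lin: "linear (\<lambda>k. snd (frame (fst p) (snd p) k) - \<beta> *\<^sub>R fst (frame (fst p) (snd p) k))"
      unfolding Yapp[symmetric] by (simp add: blinfun.bounded_linear_right bounded_linear.linear)
    show ?thesis
      unfolding frame_transverse_inj[OF frame_inj] linear_injective_0[OF lin]
    proof (intro allI impI)
      fix k assume "snd (frame (fst p) (snd p) k) - \<beta> *\<^sub>R fst (frame (fst p) (snd p) k) = 0"
      then have "Y p k = 0" by (simp add: Yapp)
      then have "B * norm k \<le> norm ((Y p - Y (0, 1)) k)" using B(2)[of k] by (simp add: blinfun.diff_left)
      also have "\<dots> \<le> norm (Y p - Y (0, 1)) * norm k" by (rule norm_blinfun)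
      finally have "(B - norm (Y p - Y (0, 1))) * norm k \<le> 0" by (simp add: left_diff_distrib)
      then have "norm k \<le> 0" using d by (simp add: mult_le_0_iff)
      then show "k = 0" by simp
    qed
  qed
  obtain A where A: "continuous_on (corner_box \<delta>) A" "\<forall>p\<in>corner_box \<delta>. symmetric_op (A p) \<and> range (frame (fst p) (snd p)) = sym_graph \<beta> (A p)"
    by (rule chart_of_frame[of "corner_box \<delta>" "\<lambda>p. frame (fst p) (snd p)" \<beta>])
       (use tr frame_Lagrangian frame_inj continuous_on_subset[OF frame_continuous] in auto)
  show thesis by (rule that[OF \<delta>(1,2) \<open>(1 + \<delta>) * l \<le> l'\<close> A])
qed

end

section \<open>The index in a chart around the corner\<close>

lemma Dirichlet_vertical: "Dirichlet = vertical"
  by (simp add: Dirichlet_def vertical_def)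

locale corner_chart = corner g h l l' G H for g h l l' G H +
  fixes \<beta> \<delta> :: real and A :: "real \<times> real \<Rightarrow> (real^4) \<Rightarrow>\<^sub>L (real^4)"
  assumes \<delta>: "0 < \<delta>" "\<delta> < 1" "(1 + \<delta>) * l \<le> l'"
    and A_cont: "continuous_on (corner_box \<delta>) A"
    and A_sym: "\<And>p. p \<in> corner_box \<delta> \<Longrightarrow> symmetric_op (A p)"
    and A_graph: "\<And>p. p \<in> corner_box \<delta> \<Longrightarrow> range (frame (fst p) (snd p)) = sym_graph \<beta> (A p)"
begin

lemma box_Lambda: "(\<mu>, s) \<in> corner_box \<delta> \<Longrightarrow> Lambda l G H \<mu> s = range (frame \<mu> s)"
proof (rule Lambda_eq)
  assume p: "(\<mu>, s) \<in> corner_box \<delta>"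
  then show "0 < s" using \<delta> by (auto simp: corner_box_def)
  have "s * l \<le> (1 + \<delta>) * l" using p l by (intro mult_right_mono) (auto simp: corner_box_def)
  then show "s * l \<le> l'" using \<delta>(3) by linarith
qed

definition N :: "real \<Rightarrow> real \<Rightarrow> nat" where "N \<mu> s = neg_index \<beta> (range (frame \<mu> s))"

definition no_crossing :: "real \<Rightarrow> real \<Rightarrow> bool"
  where "no_crossing \<mu> s \<longleftrightarrow> (\<forall>k. fst (frame \<mu> s k) = 0 \<longrightarrow> k = 0)"

lemma no_crossing_iff: "no_crossing \<mu> s \<longleftrightarrow> (\<forall>z\<in>range (frame \<mu> s). fst z = 0 \<longrightarrow> z = 0)"
proof
  assume "no_crossing \<mu> s" then show "\<forall>z\<in>range (frame \<mu> s). fst z = 0 \<longrightarrow> z = 0"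
    by (auto simp: no_crossing_def blinfun.zero_right)
next
  assume r: "\<forall>z\<in>range (frame \<mu> s). fst z = 0 \<longrightarrow> z = 0"
  show "no_crossing \<mu> s"
    unfolding no_crossing_def
  proof (intro allI impI)
    fix k assume "fst (frame \<mu> s k) = 0"
    then have "frame \<mu> s k = frame \<mu> s 0" using r by (simp add: blinfun.zero_right)
    then show "k = 0" by (rule injD[OF frame_inj])
  qed
qed

lemma transverse_box: "(\<mu>, s) \<in> corner_box \<delta> \<Longrightarrow> transverse \<beta> (range (frame \<mu> s))"
  using A_graph[of "(\<mu>, s)"] sym_graph_Lagrangian(2)[OF A_sym[of "(\<mu>, s)"]] by simp

text \<open>
  Both paths stay in the chart; the contributions at the corner cancel.
\<close>

lemma corner_index_eq:
  assumes "0 < \<epsilon>" "\<epsilon> \<le> \<delta>"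
  shows "corner_index l G H \<epsilon> = int (N 0 (1 - \<epsilon>)) - int (N \<epsilon> 1)"
proof -
  have c: "continuous_on S (\<lambda>t. A (\<phi> t))" if "continuous_on S \<phi>" "\<phi> ` S \<subseteq> corner_box \<delta>" for S and \<phi> :: "real \<Rightarrow> real \<times> real"
    by (rule continuous_on_compose2[OF A_cont that])
  have 1: "Mas (\<lambda>s. Lambda l G H 0 s) vertical (1 - \<epsilon>) 1 =
      int (neg_index \<beta> (Lambda l G H 0 (1 - \<epsilon>))) - int (neg_index \<beta> (Lambda l G H 0 1))"
  proof (rule Maslov_index_in_chart)
    show "continuous_on {1 - \<epsilon>..1} (\<lambda>s. A (0, s))"
      by (rule c) (use assms in \<open>auto simp: corner_box_def intro!: continuous_intros\<close>)
    fix s assume "s \<in> {1 - \<epsilon>..1}"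
    then have b: "(0, s) \<in> corner_box \<delta>" using assms by (auto simp: corner_box_def)
    show "symmetric_op (A (0, s))" by (rule A_sym[OF b])
    show "Lambda l G H 0 s = sym_graph \<beta> (A (0, s))" using box_Lambda[OF b] A_graph[OF b] by simp
  qed (use assms in simp)
  have 2: "Mas (\<lambda>\<mu>. Lambda l G H \<mu> 1) vertical 0 \<epsilon> =
      int (neg_index \<beta> (Lambda l G H 0 1)) - int (neg_index \<beta> (Lambda l G H \<epsilon> 1))"
  proof (rule Maslov_index_in_chart)
    show "continuous_on {0..\<epsilon>} (\<lambda>\<mu>. A (\<mu>, 1))"
      by (rule c) (use assms in \<open>auto simp: corner_box_def intro!: continuous_intros\<close>)
    fix \<mu> assume "\<mu> \<in> {0..\<epsilon>}"
    then have b: "(\<mu>, 1) \<in> corner_box \<delta>" using assms by (auto simp: corner_box_def)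
    show "symmetric_op (A (\<mu>, 1))" by (rule A_sym[OF b])
    show "Lambda l G H \<mu> 1 = sym_graph \<beta> (A (\<mu>, 1))" using box_Lambda[OF b] A_graph[OF b] by simp
  qed (use assms in simp)
  have "(0, 1 - \<epsilon>) \<in> corner_box \<delta>" "(\<epsilon>, 1) \<in> corner_box \<delta>" using assms by (auto simp: corner_box_def)
  then show ?thesis unfolding corner_index_def Dirichlet_vertical 1 2 by (simp add: box_Lambda N_def)
qed

text \<open>
  Without crossings the form \<open>slope_form\<close> is nondegenerate, so its negative index is locally constant.
\<close>

lemma N_vertical_segment:
  assumes seg: "\<And>s. s \<in> {a..b} \<Longrightarrow> (\<mu>, s) \<in> corner_box \<delta>" "\<And>s. s \<in> {a..b} \<Longrightarrow> no_crossing \<mu> s" and "a \<le> b"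
  shows "N \<mu> a = N \<mu> b"
proof (rule connected_local_const[of "{a..b}"])
  show "\<forall>s\<in>{a..b}. \<forall>\<^sub>F t in at s within {a..b}. N \<mu> s = N \<mu> t"
  proof
    fix s assume s: "s \<in> {a..b}"
    let ?V = "\<lambda>t. sym_graph \<beta> (A (\<mu>, t))"
    have Veq: "?V t = range (frame \<mu> t)" if "t \<in> {a..b}" for t using A_graph[OF seg(1)[OF that]] by simp
    have "continuous_on {a..b} (\<lambda>t. ortho_proj (?V t))"
    proof (rule continuous_on_ortho_proj_sym_graph)
      show "continuous_on {a..b} (\<lambda>t. A (\<mu>, t))"
        by (rule continuous_on_compose2[OF A_cont]) (use seg in \<open>auto intro!: continuous_intros\<close>)
    qed (use A_sym seg in auto)
    then have P: "((\<lambda>t. ortho_proj (?V t)) \<longlongrightarrow> ortho_proj (?V s)) (at s within {a..b})"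
      using s by (simp add: continuous_on_def)
    have inS: "\<forall>\<^sub>F t in at s within {a..b}. t \<in> {a..b}" unfolding eventually_at_filter by simp
    have Lag: "\<forall>\<^sub>F t in at s within {a..b}. ?V t \<in> Lagrangians"
      using inS by eventually_elim (rule sym_graph_Lagrangian(1)[OF A_sym[OF seg(1)]])
    have VL: "?V s \<in> Lagrangians" and Vt: "transverse \<beta> (?V s)"
      using sym_graph_Lagrangian[OF A_sym[OF seg(1)[OF s]]] by blast+
    have nd: "z = 0" if "z \<in> ?V s" "\<forall>w\<in>?V s. slope_form \<beta> z w = 0" for z
    proof -
      have "fst z = 0" using slope_form_kernel[OF VL Vt that(1)] that(2) by blast
      then show ?thesis using seg(2)[OF s] that(1) unfolding no_crossing_iff Veq[OF s] by blast
    qed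
    have "\<forall>\<^sub>F t in at s within {a..b}. n_minus (?V t) (\<lambda>z. slope_form \<beta> z z) = n_minus (?V s) (\<lambda>z. slope_form \<beta> z z) \<and>
      (\<forall>z\<in>?V t. (\<forall>w\<in>?V t. slope_form \<beta> z w = 0) \<longrightarrow> z = 0)"
      by (rule nondegenerate_inertia_stable[OF VL Lag P bilinear_slope_form slope_form_sym nd])
    with inS show "\<forall>\<^sub>F t in at s within {a..b}. N \<mu> s = N \<mu> t"
      by eventually_elim (use Veq s in \<open>simp add: N_def neg_index_def\<close>)
  qed
qed (use \<open>a \<le> b\<close> in auto)

text \<open>
  The kernel is described by the Cauchy data \<open>k\<close> that give a Dirichlet solution at the corner, and the
  frame itself transports it to nearby points.
\<close>

lemma near_corner:
  fixes \<mu> s \<tau> :: "'t \<Rightarrow> real" and K :: "(real^4) set"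
  assumes lim: "(\<mu> \<longlongrightarrow> 0) F" "(s \<longlongrightarrow> 1) F" and \<tau>: "\<forall>\<^sub>F t in F. \<tau> t > 0" "(\<tau> \<longlongrightarrow> 0) F"
    and K: "independent K" "span K = {k. fst (frame 0 1 k) = 0}"
    and \<xi>: "\<And>k. k \<in> K \<Longrightarrow> ((\<lambda>t. fst (frame (\<mu> t) (s t) k) /\<^sub>R \<tau> t) \<longlongrightarrow> \<xi> k) F"
    and d: "\<And>k k'. k \<in> K \<Longrightarrow> k' \<in> K \<Longrightarrow> \<xi> k' \<bullet> snd (frame 0 1 k) = (if k = k' then - d k else 0)"
      "\<And>k. k \<in> K \<Longrightarrow> d k \<noteq> 0"
  shows "\<forall>\<^sub>F t in F. N (\<mu> t) (s t) = N 0 1 + card {k\<in>K. d k < 0} \<and> no_crossing (\<mu> t) (s t)"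
proof -
  let ?Z = "frame 0 1"
  define inv where "inv = inv_into UNIV (blinfun_apply ?Z)"
  have inv: "inv (?Z k) = k" for k unfolding inv_def by (rule inv_f_f[OF frame_inj])
  have lz: "linear (blinfun_apply ?Z)" by (simp add: blinfun.bounded_linear_right bounded_linear.linear)
  have Zlim: "((\<lambda>t. frame (\<mu> t) (s t)) \<longlongrightarrow> ?Z) F"
  proof -
    have "isCont (\<lambda>p. frame (fst p) (snd p)) (0, 1)"
      using frame_continuous unfolding continuous_on_eq_continuous_at[OF open_UNIV] by (rule bspec) simp
    from isCont_tendsto_compose[OF this tendsto_Pair[OF lim]] show ?thesis by simp
  qed
  have b01: "(0, 1) \<in> corner_box \<delta>" using \<delta> by (auto simp: corner_box_def)
  have "\<forall>\<^sub>F t in F. neg_index \<beta> (range (frame (\<mu> t) (s t))) = neg_index \<beta> (range ?Z) + card {z\<in>?Z ` K. d (inv z) < 0} \<and>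
    (\<forall>z\<in>range (frame (\<mu> t) (s t)). fst z = 0 \<longrightarrow> z = 0)"
  proof (rule negative_index_near_crossing[where L = "\<lambda>t z. frame (\<mu> t) (s t) (inv z)" and \<xi> = "\<lambda>z. \<xi> (inv z)" and \<tau> = \<tau>])
    show "range ?Z \<in> Lagrangians" by (rule frame_Lagrangian)
    show "transverse \<beta> (range ?Z)" by (rule transverse_box[OF b01])
    show "\<forall>\<^sub>F t in F. range (frame (\<mu> t) (s t)) \<in> Lagrangians" by (simp add: frame_Lagrangian)
    show "\<forall>\<^sub>F t in F. frame (\<mu> t) (s t) (inv z) \<in> range (frame (\<mu> t) (s t))" for z by simp
    show "((\<lambda>t. frame (\<mu> t) (s t) (inv z)) \<longlongrightarrow> z) F" if "z \<in> range ?Z" for z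
    proof -
      obtain k where k: "z = ?Z k" using \<open>z \<in> range ?Z\<close> by blast
      show ?thesis unfolding k inv by (rule blinfun.tendsto[OF Zlim tendsto_const])
    qed
    show "independent (?Z ` K)"
      by (rule linear_independent_injective_image[OF lz K(1)]) (use frame_inj in \<open>auto intro: inj_on_subset\<close>)
    show "span (?Z ` K) = {z \<in> range ?Z. fst z = 0}"
      unfolding linear_span_image[OF lz] K(2) by auto
    show "((\<lambda>t. fst (frame (\<mu> t) (s t) (inv z)) /\<^sub>R \<tau> t) \<longlongrightarrow> \<xi> (inv z)) F" if "z \<in> ?Z ` K" for z
      using that \<xi> by (auto simp: inv)
    show "\<xi> (inv z') \<bullet> snd z = (if z = z' then - d (inv z) else 0)" if "z \<in> ?Z ` K" "z' \<in> ?Z ` K" for z z'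
    proof -
      obtain k k' where k: "k \<in> K" "k' \<in> K" "z = ?Z k" "z' = ?Z k'" using \<open>z \<in> ?Z ` K\<close> \<open>z' \<in> ?Z ` K\<close> by blast
      have "?Z k = ?Z k' \<longleftrightarrow> k = k'" using frame_inj by (simp add: inj_eq)
      then show ?thesis using d(1)[OF k(1,2)] by (simp add: k(3,4) inv)
    qed
    show "d (inv z) \<noteq> 0" if "z \<in> ?Z ` K" for z using that d(2) by (auto simp: inv)
  qed (use \<tau> in auto)
  moreover have "card {z\<in>?Z ` K. d (inv z) < 0} = card {k\<in>K. d k < 0}"
  proof -
    have "{z\<in>?Z ` K. d (inv z) < 0} = ?Z ` {k\<in>K. d k < 0}" by (auto simp: inv)
    then show ?thesis using card_image[OF inj_on_subset[OF frame_inj subset_UNIV]] by simp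
  qed
  ultimately show ?thesis unfolding no_crossing_iff N_def by simp
qed

text \<open>
  The Cauchy data of the two possible kernel functions at the corner: \<open>ku\<close> gives \<open>(sg, 0)\<close> and \<open>kv\<close> gives \<open>(0, sh)\<close>.
\<close>

definition ku :: "real^4" where "ku = vec4 0 0 1 0"
definition kv :: "real^4" where "kv = vec4 0 0 0 1"

lemma fst_frame:
  "fst (frame \<mu> s ku) = vec4 0 0 (usol eu \<mu> (s * l)) (vsol eu \<mu> (s * l))"
  "fst (frame \<mu> s kv) = vec4 0 0 (usol ev \<mu> (s * l)) (vsol ev \<mu> (s * l))"
  by (simp_all add: frame_apply frame_map_def gu_def gv_def ku_def kv_def)

lemma snd_frame:
  "snd (frame 0 1 ku) = vec4 (-1) 0 (sg' l) 0" "snd (frame 0 1 kv) = vec4 0 1 0 (- sh' l)"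
  by (simp_all add: frame_apply frame_map_def gu'_def gv'_def ku_def kv_def sol_zero uc'_def vc'_def eu_def ev_def)

lemma fst_frame_zero: "fst (frame 0 1 k) = 0 \<longleftrightarrow> k $ 1 = 0 \<and> k $ 2 = 0 \<and> k $ 3 * sg l = 0 \<and> k $ 4 * sh l = 0"
  by (auto simp: frame_apply frame_map_def vec4_eq_iff gu_def gv_def sol_zero uc_def vc_def e1_def e2_def eu_def ev_def)

lemma no_crossing_det:
  assumes "dirichlet_det \<mu> (s * l) \<noteq> 0"
  shows "no_crossing \<mu> s"
  unfolding no_crossing_def
proof (intro allI impI)
  fix k assume "fst (frame \<mu> s k) = 0"
  then have z: "k $ 1 = 0" "k $ 2 = 0" "gu k \<mu> (s * l) = 0" "gv k \<mu> (s * l) = 0"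
    by (auto simp: frame_apply frame_map_def vec4_eq_iff)
  then have "(k $ 3, k $ 4) = (0, 0)"
    using dirichlet_det_kernel[of "k $ 3" \<mu> "s * l" "k $ 4"] assms by (auto simp: gu_def gv_def)
  then show "k = 0" using z by (simp add: vec4_eq_iff)
qed

lemma crossing_in_Spec:
  assumes "(\<mu>, s) \<in> corner_box \<delta>" "\<not> no_crossing \<mu> s"
  shows "s\<^sup>2 * \<mu> \<in> Spec l (N_op l G H s)"
proof (rule ccontr)
  assume n: "s\<^sup>2 * \<mu> \<notin> Spec l (N_op l G H s)"
  have s: "0 < s" "s * l \<le> l'"
  proof -
    show "0 < s" using assms \<delta> by (auto simp: corner_box_def)
    have "s * l \<le> (1 + \<delta>) * l" using assms l by (intro mult_right_mono) (auto simp: corner_box_def)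
    then show "s * l \<le> l'" using \<delta>(3) by linarith
  qed
  obtain k where k: "fst (frame \<mu> s k) = 0" "k \<noteq> 0" using assms(2) by (auto simp: no_crossing_def)
  have el: "sol \<mu> s k \<in> H2_H10 l \<and> eq_ae l (\<lambda>x. N_op l G H s (sol \<mu> s k) x - (s\<^sup>2 * \<mu>) *\<^sub>R sol \<mu> s k x) (\<lambda>x. 0)"
    if z: "fst (frame \<mu> s k) = 0" for k
  proof -
    have "sol \<mu> s k \<in> solution_space l G H \<mu> s" unfolding solution_space_eq[OF s] by simp
    then have "sol \<mu> s k \<in> H2 l" "eq_ae l (N_op l G H s (sol \<mu> s k)) (\<lambda>x. (s\<^sup>2 * \<mu>) *\<^sub>R sol \<mu> s k x)"
      by (auto simp: solution_space_def)
    moreover have "sol \<mu> s k 0 = 0" "sol \<mu> s k l = 0"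
      using z l by (auto simp: sol_def frame_apply frame_map_def vec4_eq_iff zero_prod_def)
    ultimately show ?thesis by (auto simp: H2_H10_def eq_ae_def elim: eventually_mono)
  qed
  have "sol \<mu> s k = sol \<mu> s 0"
    using not_in_Spec_ker_trivial[OF n] el[OF k(1)] el[of 0] by (simp add: blinfun.zero_right)
  then have "Tr l s (sol \<mu> s k) = Tr l s (sol \<mu> s 0)" by simp
  then have "frame \<mu> s k = frame \<mu> s 0" unfolding Tr_sol[OF s] frame_apply .
  then have "k = 0" by (rule injD[OF frame_inj])
  then show False using k(2) by simp
qed

text \<open>
  In the \<open>u\<close>-direction the limiting form is \<open>- m (sg' l)\<close>; in the \<open>v\<close>-direction, in the next lemma,
  the opposite sign appears because the trace contains \<open>- v'(l)\<close> in place of \<open>u'(l)\<close>. This is why the two cases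
  of a one-dimensional kernel have opposite values.
\<close>

lemma near_corner_u:
  fixes \<mu> s \<tau> :: "'t \<Rightarrow> real"
  assumes lim: "(\<mu> \<longlongrightarrow> 0) F" "(s \<longlongrightarrow> 1) F" and \<tau>: "\<forall>\<^sub>F t in F. \<tau> t > 0" "(\<tau> \<longlongrightarrow> 0) F"
    and z: "sg l = 0" "sh l \<noteq> 0"
    and m: "((\<lambda>t. usol eu (\<mu> t) (s t * l) / \<tau> t) \<longlongrightarrow> m) F" "((\<lambda>t. vsol eu (\<mu> t) (s t * l) / \<tau> t) \<longlongrightarrow> m') F" "m * sg' l \<noteq> 0"
  shows "\<forall>\<^sub>F t in F. N (\<mu> t) (s t) = N 0 1 + (if m * sg' l > 0 then 1 else 0) \<and> no_crossing (\<mu> t) (s t)"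
proof -
  have "\<forall>\<^sub>F t in F. N (\<mu> t) (s t) = N 0 1 + card {k\<in>{ku}. - (m * sg' l) < 0} \<and> no_crossing (\<mu> t) (s t)"
  proof (rule near_corner[OF lim \<tau>, where \<xi> = "\<lambda>_. vec4 0 0 m m'"])
    have "ku \<noteq> 0" by (simp add: ku_def vec4_eq_iff)
    then show "independent {ku}" by simp
    show "span {ku} = {k. fst (frame 0 1 k) = 0}"
      unfolding fst_frame_zero span_singleton using z by (force simp: ku_def vec4_eq_iff)
    fix k assume "k \<in> {ku}"
    then have k: "k = ku" by simp
    have "((\<lambda>t. vec4 0 0 (usol eu (\<mu> t) (s t * l) / \<tau> t) (vsol eu (\<mu> t) (s t * l) / \<tau> t)) \<longlongrightarrow> vec4 0 0 m m') F"
      by (intro tendsto_vec4 tendsto_const m)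
    moreover have "vec4 0 0 (usol eu (\<mu> t) (s t * l) / \<tau> t) (vsol eu (\<mu> t) (s t * l) / \<tau> t) = fst (frame (\<mu> t) (s t) k) /\<^sub>R \<tau> t" for t
      unfolding k fst_frame by (simp add: vec4_eq_iff divide_inverse mult.commute)
    ultimately show "((\<lambda>t. fst (frame (\<mu> t) (s t) k) /\<^sub>R \<tau> t) \<longlongrightarrow> vec4 0 0 m m') F" by simp
  qed (use m in \<open>auto simp: snd_frame inner_vec4\<close>)
  moreover have "card {k\<in>{ku}. - (m * sg' l) < 0} = (if m * sg' l > 0 then 1 else 0)" by simp
  ultimately show ?thesis by (simp only:)
qed

lemma near_corner_v:
  fixes \<mu> s \<tau> :: "'t \<Rightarrow> real"
  assumes lim: "(\<mu> \<longlongrightarrow> 0) F" "(s \<longlongrightarrow> 1) F" and \<tau>: "\<forall>\<^sub>F t in F. \<tau> t > 0" "(\<tau> \<longlongrightarrow> 0) F"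
    and z: "sg l \<noteq> 0" "sh l = 0"
    and m: "((\<lambda>t. vsol ev (\<mu> t) (s t * l) / \<tau> t) \<longlongrightarrow> m) F" "((\<lambda>t. usol ev (\<mu> t) (s t * l) / \<tau> t) \<longlongrightarrow> m') F" "m * sh' l \<noteq> 0"
  shows "\<forall>\<^sub>F t in F. N (\<mu> t) (s t) = N 0 1 + (if m * sh' l < 0 then 1 else 0) \<and> no_crossing (\<mu> t) (s t)"
proof -
  have "\<forall>\<^sub>F t in F. N (\<mu> t) (s t) = N 0 1 + card {k\<in>{kv}. m * sh' l < 0} \<and> no_crossing (\<mu> t) (s t)"
  proof (rule near_corner[OF lim \<tau>, where \<xi> = "\<lambda>_. vec4 0 0 m' m"])
    have "kv \<noteq> 0" by (simp add: kv_def vec4_eq_iff)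
    then show "independent {kv}" by simp
    show "span {kv} = {k. fst (frame 0 1 k) = 0}"
      unfolding fst_frame_zero span_singleton using z by (force simp: kv_def vec4_eq_iff)
    fix k assume "k \<in> {kv}"
    then have k: "k = kv" by simp
    have "((\<lambda>t. vec4 0 0 (usol ev (\<mu> t) (s t * l) / \<tau> t) (vsol ev (\<mu> t) (s t * l) / \<tau> t)) \<longlongrightarrow> vec4 0 0 m' m) F"
      by (intro tendsto_vec4 tendsto_const m)
    moreover have "vec4 0 0 (usol ev (\<mu> t) (s t * l) / \<tau> t) (vsol ev (\<mu> t) (s t * l) / \<tau> t) = fst (frame (\<mu> t) (s t) k) /\<^sub>R \<tau> t" for t
      unfolding k fst_frame by (simp add: vec4_eq_iff divide_inverse mult.commute)
    ultimately show "((\<lambda>t. fst (frame (\<mu> t) (s t) k) /\<^sub>R \<tau> t) \<longlongrightarrow> vec4 0 0 m' m) F" by simp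
  qed (use m in \<open>auto simp: snd_frame inner_vec4\<close>)
  moreover have "card {k\<in>{kv}. m * sh' l < 0} = (if m * sh' l < 0 then 1 else 0)" by simp
  ultimately show ?thesis by (simp only:)
qed

text \<open>
  \<open>Q\<close> is the negative of the limiting form on the two-dimensional kernel, in the coordinates \<open>(x, y)\<close> given by
  \<open>x ku + y kv\<close>, and \<open>(a1, a2)\<close>, \<open>(b1, b2)\<close> is a basis that diagonalises it.
\<close>

lemma near_corner_uv:
  fixes \<mu> s \<tau> :: "'t \<Rightarrow> real"
  assumes lim: "(\<mu> \<longlongrightarrow> 0) F" "(s \<longlongrightarrow> 1) F" and \<tau>: "\<forall>\<^sub>F t in F. \<tau> t > 0" "(\<tau> \<longlongrightarrow> 0) F"
    and z: "sg l = 0" "sh l = 0"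
    and m: "((\<lambda>t. usol eu (\<mu> t) (s t * l) / \<tau> t) \<longlongrightarrow> m11) F" "((\<lambda>t. usol ev (\<mu> t) (s t * l) / \<tau> t) \<longlongrightarrow> m12) F"
      "((\<lambda>t. vsol eu (\<mu> t) (s t * l) / \<tau> t) \<longlongrightarrow> m21) F" "((\<lambda>t. vsol ev (\<mu> t) (s t * l) / \<tau> t) \<longlongrightarrow> m22) F"
    and ab: "a1 * b2 \<noteq> a2 * b1"
    and q: "\<And>x y x' y'. Q x y x' y' = (x * m11 + y * m12) * (x' * sg' l) - (x * m21 + y * m22) * (y' * sh' l)"
    and orth: "Q a1 a2 b1 b2 = 0" "Q b1 b2 a1 a2 = 0" and nz: "Q a1 a2 a1 a2 \<noteq> 0" "Q b1 b2 b1 b2 \<noteq> 0"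
  shows "\<forall>\<^sub>F t in F. N (\<mu> t) (s t) = N 0 1 + (if Q a1 a2 a1 a2 > 0 then 1 else 0) + (if Q b1 b2 b1 b2 > 0 then 1 else 0)
    \<and> no_crossing (\<mu> t) (s t)"
proof -
  define ka where "ka = vec4 0 0 a1 a2"
  define kb where "kb = vec4 0 0 b1 b2"
  have ab_ne: "ka \<noteq> kb" using ab by (auto simp: ka_def kb_def vec4_eq_iff)
  define \<xi> where "\<xi> k = vec4 0 0 (k $ 3 * m11 + k $ 4 * m12) (k $ 3 * m21 + k $ 4 * m22)" for k :: "real^4"
  have lin: "frame \<mu> s (vec4 0 0 x y) = x *\<^sub>R frame \<mu> s ku + y *\<^sub>R frame \<mu> s kv" for \<mu> s x y
  proof -
    have "vec4 0 0 x y = x *\<^sub>R ku + y *\<^sub>R kv" by (simp add: vec4_eq_iff ku_def kv_def)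
    then show ?thesis by (simp add: blinfun.bilinear_simps)
  qed
  have Qeq: "\<xi> (vec4 0 0 x y) \<bullet> snd (frame 0 1 (vec4 0 0 x' y')) = Q x y x' y'" for x y x' y'
    by (simp add: lin snd_frame inner_vec4 \<xi>_def q)
  define d where "d k = - (\<xi> k \<bullet> snd (frame 0 1 k))" for k
  have "\<forall>\<^sub>F t in F. N (\<mu> t) (s t) = N 0 1 + card {k\<in>{ka, kb}. d k < 0} \<and> no_crossing (\<mu> t) (s t)"
  proof (rule near_corner[OF lim \<tau>, where \<xi> = \<xi>])
    have "ka \<noteq> 0" using ab by (auto simp: ka_def vec4_eq_iff)
    moreover have "kb \<notin> span {ka}"
    proof
      assume "kb \<in> span {ka}"
      then obtain c where "kb = c *\<^sub>R ka" by (auto simp: span_singleton)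
      then have "b1 = c * a1" "b2 = c * a2" by (simp_all add: ka_def kb_def vec4_eq_iff)
      then show False using ab by simp
    qed
    ultimately show ind: "independent {ka, kb}" using ab_ne by (simp add: independent_insert insert_commute[of ka])
    show "span {ka, kb} = {k. fst (frame 0 1 k) = 0}"
    proof
      show "span {ka, kb} \<subseteq> {k. fst (frame 0 1 k) = 0}"
      proof (rule span_minimal)
        show "subspace {k. fst (frame 0 1 k) = 0}" by (auto simp: subspace_def blinfun.bilinear_simps)
        show "{ka, kb} \<subseteq> {k. fst (frame 0 1 k) = 0}" using z by (auto simp: fst_frame_zero ka_def kb_def)
      qed
      show "{k. fst (frame 0 1 k) = 0} \<subseteq> span {ka, kb}"
      proof
        fix k :: "real^4" assume "k \<in> {k. fst (frame 0 1 k) = 0}"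
        then have k: "k $ 1 = 0" "k $ 2 = 0" by (auto simp: fst_frame_zero)
        define D where "D = a1 * b2 - a2 * b1"
        have D: "D \<noteq> 0" using ab by (simp add: D_def)
        have "k = ((k $ 3 * b2 - k $ 4 * b1) / D) *\<^sub>R ka + ((a1 * k $ 4 - a2 * k $ 3) / D) *\<^sub>R kb"
        proof -
          have "k $ 3 * D = (k $ 3 * b2 - k $ 4 * b1) * a1 + (a1 * k $ 4 - a2 * k $ 3) * b1"
            "k $ 4 * D = (k $ 3 * b2 - k $ 4 * b1) * a2 + (a1 * k $ 4 - a2 * k $ 3) * b2"
            by (simp_all add: D_def algebra_simps)
          then show ?thesis using D k by (simp add: vec4_eq_iff ka_def kb_def add_divide_distrib[symmetric] eq_divide_eq)
        qed
        then show "k \<in> span {ka, kb}"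
          by (metis insertI1 insertI2 span_add span_base span_scale)
      qed
    qed
    fix k assume k: "k \<in> {ka, kb}"
    have "((\<lambda>t. vec4 0 0 (k $ 3 * (usol eu (\<mu> t) (s t * l) / \<tau> t) + k $ 4 * (usol ev (\<mu> t) (s t * l) / \<tau> t))
        (k $ 3 * (vsol eu (\<mu> t) (s t * l) / \<tau> t) + k $ 4 * (vsol ev (\<mu> t) (s t * l) / \<tau> t))) \<longlongrightarrow> \<xi> k) F"
      unfolding \<xi>_def by (intro tendsto_vec4 tendsto_const tendsto_add tendsto_mult m)
    moreover have "vec4 0 0 (k $ 3 * (usol eu (\<mu> t) (s t * l) / \<tau> t) + k $ 4 * (usol ev (\<mu> t) (s t * l) / \<tau> t))
        (k $ 3 * (vsol eu (\<mu> t) (s t * l) / \<tau> t) + k $ 4 * (vsol ev (\<mu> t) (s t * l) / \<tau> t)) = fst (frame (\<mu> t) (s t) k) /\<^sub>R \<tau> t" for t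
    proof -
      have "frame (\<mu> t) (s t) k = k $ 3 *\<^sub>R frame (\<mu> t) (s t) ku + k $ 4 *\<^sub>R frame (\<mu> t) (s t) kv"
        using k lin[of "\<mu> t" "s t"] by (auto simp: ka_def kb_def)
      then show ?thesis by (simp add: fst_frame vec4_eq_iff divide_inverse algebra_simps)
    qed
    ultimately show "((\<lambda>t. fst (frame (\<mu> t) (s t) k) /\<^sub>R \<tau> t) \<longlongrightarrow> \<xi> k) F" by simp
    show "d k \<noteq> 0" using k nz unfolding d_def ka_def kb_def by (auto simp: Qeq)
  next
    fix k k' assume "k \<in> {ka, kb}" "k' \<in> {ka, kb}"
    then show "\<xi> k' \<bullet> snd (frame 0 1 k) = (if k = k' then - d k else 0)"
      using orth ab_ne by (auto simp: d_def ka_def kb_def Qeq)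
  qed
  moreover have "card {k\<in>{ka, kb}. d k < 0} = (if Q a1 a2 a1 a2 > 0 then 1 else 0) + (if Q b1 b2 b1 b2 > 0 then 1 else 0)"
  proof -
    have da: "d ka = - Q a1 a2 a1 a2" and db: "d kb = - Q b1 b2 b1 b2" by (simp_all add: d_def ka_def kb_def Qeq)
    have "{k\<in>{ka, kb}. d k < 0} = (if Q a1 a2 a1 a2 > 0 then {ka} else {}) \<union> (if Q b1 b2 b1 b2 > 0 then {kb} else {})"
      using da db by auto
    then show ?thesis using ab_ne by auto
  qed
  ultimately show ?thesis by (simp only: add.assoc)
qed

end

section \<open>Asymptotics near the corner\<close>

lemma right_limits:
  fixes f :: "real \<Rightarrow> real"
  assumes f: "(f has_real_derivative f') (at l)" "f l = 0"
  shows "((\<lambda>t. f ((1 + \<kappa> * t) * l) / t) \<longlongrightarrow> \<kappa> * l * f') (at_right 0)"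
    "((\<lambda>t. f ((1 + \<rho> * t\<^sup>2) * l) / t\<^sup>2) \<longlongrightarrow> \<rho> * l * f') (at_right 0)"
    "((\<lambda>t. f ((1 + \<rho> * t\<^sup>2) * l) / t) \<longlongrightarrow> 0) (at_right 0)"
proof -
  have 1: "((\<lambda>t. f ((1 + \<kappa> * t) * l) / t) \<longlongrightarrow> \<kappa> * l * f') (at_right 0)" for \<kappa>
  proof -
    have "((\<lambda>t. (1 + \<kappa> * t) * l) has_real_derivative \<kappa> * l) (at 0)"
      by (auto intro!: derivative_eq_intros)
    moreover have "(f has_real_derivative f') (at ((1 + \<kappa> * 0) * l))" using f(1) by simp
    ultimately have "((\<lambda>t. f ((1 + \<kappa> * t) * l)) has_real_derivative f' * (\<kappa> * l)) (at 0)"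
      by (rule DERIV_chain2[rotated])
    then have "((\<lambda>t. f ((1 + \<kappa> * t) * l) / t) \<longlongrightarrow> f' * (\<kappa> * l)) (at 0)"
      using f(2) by (simp add: DERIV_def)
    then have "((\<lambda>t. f ((1 + \<kappa> * t) * l) / t) \<longlongrightarrow> f' * (\<kappa> * l)) (at_right 0)"
      by (rule tendsto_mono[rotated]) (simp add: at_le)
    then show ?thesis by (simp add: mult_ac)
  qed
  show "((\<lambda>t. f ((1 + \<kappa> * t) * l) / t) \<longlongrightarrow> \<kappa> * l * f') (at_right 0)" by (rule 1)
  have sq: "filterlim (\<lambda>t::real. t\<^sup>2) (at_right 0) (at_right 0)"
    unfolding filterlim_at
  proof
    have "((\<lambda>t::real. t\<^sup>2) \<longlongrightarrow> 0\<^sup>2) (at_right 0)" by (intro tendsto_intros)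
    then show "((\<lambda>t::real. t\<^sup>2) \<longlongrightarrow> 0) (at_right 0)" by simp
    show "\<forall>\<^sub>F t::real in at_right 0. t\<^sup>2 \<in> {0<..} \<and> t\<^sup>2 \<noteq> 0"
      using eventually_at_right_less[of "0::real"] by eventually_elim simp
  qed
  show 2: "((\<lambda>t. f ((1 + \<rho> * t\<^sup>2) * l) / t\<^sup>2) \<longlongrightarrow> \<rho> * l * f') (at_right 0)"
    by (rule filterlim_compose[OF 1 sq])
  have "((\<lambda>t. f ((1 + \<rho> * t\<^sup>2) * l) / t\<^sup>2 * t) \<longlongrightarrow> \<rho> * l * f' * 0) (at_right 0)"
    by (intro tendsto_mult 2 tendsto_ident_at)
  then have "((\<lambda>t. f ((1 + \<rho> * t\<^sup>2) * l) / t\<^sup>2 * t) \<longlongrightarrow> 0) (at_right 0)" by simp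
  moreover have "\<forall>\<^sub>F t::real in at_right 0. f ((1 + \<rho> * t\<^sup>2) * l) / t\<^sup>2 * t = f ((1 + \<rho> * t\<^sup>2) * l) / t"
    using eventually_at_right_less[of "0::real"] by eventually_elim (simp add: power2_eq_square)
  ultimately show "((\<lambda>t. f ((1 + \<rho> * t\<^sup>2) * l) / t) \<longlongrightarrow> 0) (at_right 0)"
    by (rule Lim_transform_eventually)
qed

lemma remainder_tendsto:
  fixes S :: "real \<Rightarrow> real \<Rightarrow> real"
  assumes rem: "\<forall>\<mu> y. \<bar>\<mu>\<bar> \<le> 1 \<longrightarrow> \<bar>y\<bar> \<le> \<bar>l\<bar> + 1 \<longrightarrow> \<bar>S \<mu> y - T \<mu> y\<bar> \<le> K * \<bar>\<mu>\<bar> ^ Suc n"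
    and y: "(y \<longlongrightarrow> l) (at_right 0)" and T: "((\<lambda>t. T t (y t) / t ^ n) \<longlongrightarrow> a) (at_right 0)"
  shows "((\<lambda>t. S t (y t) / t ^ n) \<longlongrightarrow> a) (at_right 0)"
proof -
  have pos: "\<forall>\<^sub>F t::real in at_right 0. 0 < t" by (rule eventually_at_right_less)
  have lt1: "\<forall>\<^sub>F t::real in at_right 0. t < 1" by (rule order_tendstoD(2)[OF tendsto_ident_at]) simp
  have "\<forall>\<^sub>F t in at_right 0. dist (y t) l < 1" by (rule tendstoD[OF y]) simp
  then have "\<forall>\<^sub>F t in at_right 0. \<bar>S t (y t) / t ^ n - T t (y t) / t ^ n\<bar> \<le> K * t"
    using pos lt1
  proof eventually_elim
    case (elim t)
    have "\<bar>y t\<bar> \<le> \<bar>l\<bar> + 1" using elim(1) by (simp add: dist_real_def)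
    then have "\<bar>S t (y t) - T t (y t)\<bar> \<le> K * \<bar>t\<bar> ^ Suc n"
      using rem[rule_format, of t "y t"] elim by simp
    then have "\<bar>S t (y t) - T t (y t)\<bar> / t ^ n \<le> K * t ^ Suc n / t ^ n"
      using elim by (intro divide_right_mono) auto
    moreover have "K * t ^ Suc n / t ^ n = K * t" using elim by simp
    moreover have "\<bar>S t (y t) / t ^ n - T t (y t) / t ^ n\<bar> = \<bar>S t (y t) - T t (y t)\<bar> / t ^ n"
      using elim(2) by (subst diff_divide_distrib[symmetric], subst abs_divide) simp
    ultimately show ?case by linarith
  qed
  then have le: "\<forall>\<^sub>F t in at_right 0. norm (S t (y t) / t ^ n - T t (y t) / t ^ n) \<le> K * t"
    unfolding real_norm_def .
  have "((\<lambda>t. K * t) \<longlongrightarrow> K * 0) (at_right 0)" by (intro tendsto_mult tendsto_const tendsto_ident_at)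
  then have "((\<lambda>t. K * t) \<longlongrightarrow> 0) (at_right 0)" by simp
  from Lim_null_comparison[OF le this]
  have "((\<lambda>t. S t (y t) / t ^ n - T t (y t) / t ^ n) \<longlongrightarrow> 0) (at_right 0)" .
  from tendsto_add[OF this T] show ?thesis by simp
qed

text \<open>
  First and second order expansions along a curve that approaches the corner. The term of order zero,
  divided by the scale, contributes the slope of the curve.
\<close>

lemma quadratic_asymptotics:
  fixes S :: "real \<Rightarrow> real \<Rightarrow> real" and f :: "nat \<Rightarrow> real \<Rightarrow> real"
  assumes y: "(y \<longlongrightarrow> l) (at_right 0)"
  shows "\<forall>\<mu> y. \<bar>\<mu>\<bar> \<le> 1 \<longrightarrow> \<bar>y\<bar> \<le> \<bar>l\<bar> + 1 \<longrightarrow> \<bar>S \<mu> y - (\<Sum>n<2. \<mu> ^ n * f n y)\<bar> \<le> K * \<bar>\<mu>\<bar> ^ 2 \<Longrightarrow>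
      ((\<lambda>t. f 0 (y t) / t) \<longlongrightarrow> a0) (at_right 0) \<Longrightarrow> isCont (f 1) l \<Longrightarrow>
      ((\<lambda>t. S t (y t) / t) \<longlongrightarrow> a0 + f 1 l) (at_right 0)"
    "\<forall>\<mu> y. \<bar>\<mu>\<bar> \<le> 1 \<longrightarrow> \<bar>y\<bar> \<le> \<bar>l\<bar> + 1 \<longrightarrow> \<bar>S \<mu> y - (\<Sum>n<3. \<mu> ^ n * f n y)\<bar> \<le> K * \<bar>\<mu>\<bar> ^ 3 \<Longrightarrow>
      ((\<lambda>t. f 0 (y t) / t\<^sup>2) \<longlongrightarrow> a0) (at_right 0) \<Longrightarrow> ((\<lambda>t. f 1 (y t) / t) \<longlongrightarrow> a1) (at_right 0) \<Longrightarrow> isCont (f 2) l \<Longrightarrow>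
      ((\<lambda>t. S t (y t) / t\<^sup>2) \<longlongrightarrow> a0 + a1 + f 2 l) (at_right 0)"
proof -
  have pos: "\<forall>\<^sub>F t::real in at_right 0. 0 < t" by (rule eventually_at_right_less)
  {
    assume rem: "\<forall>\<mu> y. \<bar>\<mu>\<bar> \<le> 1 \<longrightarrow> \<bar>y\<bar> \<le> \<bar>l\<bar> + 1 \<longrightarrow> \<bar>S \<mu> y - (\<Sum>n<2. \<mu> ^ n * f n y)\<bar> \<le> K * \<bar>\<mu>\<bar> ^ 2"
      and f0: "((\<lambda>t. f 0 (y t) / t) \<longlongrightarrow> a0) (at_right 0)" and f1: "isCont (f 1) l"
    have "((\<lambda>t. f 0 (y t) / t + f 1 (y t)) \<longlongrightarrow> a0 + f 1 l) (at_right 0)"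
      by (intro tendsto_add f0 isCont_tendsto_compose[OF f1 y])
    moreover have "\<forall>\<^sub>F t in at_right 0. f 0 (y t) / t + f 1 (y t) = (\<Sum>n<2. t ^ n * f n (y t)) / t ^ 1"
      using pos by eventually_elim (simp add: numeral_2_eq_2 field_simps)
    ultimately have "((\<lambda>t. (\<Sum>n<2. t ^ n * f n (y t)) / t ^ 1) \<longlongrightarrow> a0 + f 1 l) (at_right 0)"
      by (rule Lim_transform_eventually)
    from remainder_tendsto[where S = S and T = "\<lambda>\<mu> y. \<Sum>n<2. \<mu> ^ n * f n y" and n = 1 and K = K, OF _ y this] rem
    show "((\<lambda>t. S t (y t) / t) \<longlongrightarrow> a0 + f 1 l) (at_right 0)" by (simp add: numeral_2_eq_2)
  next
    assume rem: "\<forall>\<mu> y. \<bar>\<mu>\<bar> \<le> 1 \<longrightarrow> \<bar>y\<bar> \<le> \<bar>l\<bar> + 1 \<longrightarrow> \<bar>S \<mu> y - (\<Sum>n<3. \<mu> ^ n * f n y)\<bar> \<le> K * \<bar>\<mu>\<bar> ^ 3"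
      and f0: "((\<lambda>t. f 0 (y t) / t\<^sup>2) \<longlongrightarrow> a0) (at_right 0)" and f1: "((\<lambda>t. f 1 (y t) / t) \<longlongrightarrow> a1) (at_right 0)"
      and f2: "isCont (f 2) l"
    have "((\<lambda>t. f 0 (y t) / t\<^sup>2 + f 1 (y t) / t + f 2 (y t)) \<longlongrightarrow> a0 + a1 + f 2 l) (at_right 0)"
      by (intro tendsto_add f0 f1 isCont_tendsto_compose[OF f2 y])
    moreover have "\<forall>\<^sub>F t in at_right 0. f 0 (y t) / t\<^sup>2 + f 1 (y t) / t + f 2 (y t) = (\<Sum>n<3. t ^ n * f n (y t)) / t ^ 2"
      using pos by eventually_elim (simp add: eval_nat_numeral field_simps)
    ultimately have "((\<lambda>t. (\<Sum>n<3. t ^ n * f n (y t)) / t ^ 2) \<longlongrightarrow> a0 + a1 + f 2 l) (at_right 0)"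
      by (rule Lim_transform_eventually)
    from remainder_tendsto[where S = S and T = "\<lambda>\<mu> y. \<Sum>n<3. \<mu> ^ n * f n y" and n = 2 and K = K, OF _ y this] rem
    show "((\<lambda>t. S t (y t) / t\<^sup>2) \<longlongrightarrow> a0 + a1 + f 2 l) (at_right 0)" by (simp add: eval_nat_numeral)
  }
qed

context hamiltonian_pencil
begin

lemma un_isCont: "isCont (un c 1) y" "isCont (vn c 1) y" "isCont (un c 2) y" "isCont (vn c 2) y"
  using un_deriv[of c 0 y] un_deriv[of c 1 y] DERIV_isCont by (auto simp: numeral_2_eq_2)

lemma line_tendsto:
  fixes l \<kappa> \<rho> :: real
  shows "((\<lambda>t. (1 + \<kappa> * t) * l) \<longlongrightarrow> l) (at_right 0)" "((\<lambda>t. (1 + \<rho> * t\<^sup>2) * l) \<longlongrightarrow> l) (at_right 0)"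
proof -
  have "((\<lambda>t. (1 + \<kappa> * t) * l) \<longlongrightarrow> (1 + \<kappa> * 0) * l) (at_right 0)"
    by (intro tendsto_mult tendsto_add tendsto_const tendsto_ident_at)
  then show "((\<lambda>t. (1 + \<kappa> * t) * l) \<longlongrightarrow> l) (at_right 0)" by simp
  have "((\<lambda>t. (1 + \<rho> * t\<^sup>2) * l) \<longlongrightarrow> (1 + \<rho> * 0\<^sup>2) * l) (at_right 0)"
    by (intro tendsto_mult tendsto_add tendsto_const tendsto_power tendsto_ident_at)
  then show "((\<lambda>t. (1 + \<rho> * t\<^sup>2) * l) \<longlongrightarrow> l) (at_right 0)" by simp
qed

text \<open>
  Along \<open>s = 1 + \<kappa> \<mu>\<close> the moving endpoint contributes the slope of the kernel function and the
  coupling enters to first order, in the other component only, by parity.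
\<close>

lemma linear_path_u:
  assumes "sg l = 0"
  shows "((\<lambda>t. usol eu t ((1 + \<kappa> * t) * l) / t) \<longlongrightarrow> \<kappa> * l * sg' l) (at_right 0)"
    "((\<lambda>t. vsol eu t ((1 + \<kappa> * t) * l) / t) \<longlongrightarrow> vn eu 1 l) (at_right 0)"
proof -
  obtain K where K: "K \<ge> 0" "\<forall>\<mu> y. \<bar>\<mu>\<bar> \<le> 1 \<longrightarrow> \<bar>y\<bar> \<le> \<bar>l\<bar> + 1 \<longrightarrow> \<bar>usol eu \<mu> y - (\<Sum>n<2. \<mu> ^ n * un eu n y)\<bar> \<le> K * \<bar>\<mu>\<bar> ^ 2"
    "\<forall>\<mu> y. \<bar>\<mu>\<bar> \<le> 1 \<longrightarrow> \<bar>y\<bar> \<le> \<bar>l\<bar> + 1 \<longrightarrow> \<bar>vsol eu \<mu> y - (\<Sum>n<2. \<mu> ^ n * vn eu n y)\<bar> \<le> K * \<bar>\<mu>\<bar> ^ 2"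
    by (rule sol_remainder)
  from quadratic_asymptotics(1)[OF line_tendsto(1) K(2) _ un_isCont(1), where ?a0.0 = "\<kappa> * l * sg' l"]
    right_limits(1)[OF fund_deriv(3) assms]
  show "((\<lambda>t. usol eu t ((1 + \<kappa> * t) * l) / t) \<longlongrightarrow> \<kappa> * l * sg' l) (at_right 0)"
    by (simp add: u_zero parity parity[unfolded One_nat_def])
  from quadratic_asymptotics(1)[OF line_tendsto(1) K(3) _ un_isCont(2), where ?a0.0 = 0]
  show "((\<lambda>t. vsol eu t ((1 + \<kappa> * t) * l) / t) \<longlongrightarrow> vn eu 1 l) (at_right 0)"
    by (simp add: u_zero)
qed

lemma linear_path_v:
  assumes "sh l = 0"
  shows "((\<lambda>t. vsol ev t ((1 + \<kappa> * t) * l) / t) \<longlongrightarrow> \<kappa> * l * sh' l) (at_right 0)"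
    "((\<lambda>t. usol ev t ((1 + \<kappa> * t) * l) / t) \<longlongrightarrow> un ev 1 l) (at_right 0)"
proof -
  obtain K where K: "K \<ge> 0" "\<forall>\<mu> y. \<bar>\<mu>\<bar> \<le> 1 \<longrightarrow> \<bar>y\<bar> \<le> \<bar>l\<bar> + 1 \<longrightarrow> \<bar>usol ev \<mu> y - (\<Sum>n<2. \<mu> ^ n * un ev n y)\<bar> \<le> K * \<bar>\<mu>\<bar> ^ 2"
    "\<forall>\<mu> y. \<bar>\<mu>\<bar> \<le> 1 \<longrightarrow> \<bar>y\<bar> \<le> \<bar>l\<bar> + 1 \<longrightarrow> \<bar>vsol ev \<mu> y - (\<Sum>n<2. \<mu> ^ n * vn ev n y)\<bar> \<le> K * \<bar>\<mu>\<bar> ^ 2"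
    by (rule sol_remainder)
  from quadratic_asymptotics(1)[OF line_tendsto(1) K(3) _ un_isCont(2), where ?a0.0 = "\<kappa> * l * sh' l"]
    right_limits(1)[OF fund_deriv(7) assms]
  show "((\<lambda>t. vsol ev t ((1 + \<kappa> * t) * l) / t) \<longlongrightarrow> \<kappa> * l * sh' l) (at_right 0)"
    by (simp add: u_zero parity parity[unfolded One_nat_def])
  from quadratic_asymptotics(1)[OF line_tendsto(1) K(2) _ un_isCont(1), where ?a0.0 = 0]
  show "((\<lambda>t. usol ev t ((1 + \<kappa> * t) * l) / t) \<longlongrightarrow> un ev 1 l) (at_right 0)"
    by (simp add: u_zero)
qed

text \<open>
  If the first-order coupling vanishes, both the displacement of the endpoint and the second-order
  coupling have size \<open>\<mu>\<^sup>2\<close> along \<open>s = 1 + \<rho> \<mu>\<^sup>2\<close>, and the off-diagonal terms are of higher order.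
\<close>

lemma quadratic_path:
  assumes z: "sg l = 0" "sh l = 0" and o: "vn eu 1 l = 0" "un ev 1 l = 0"
  shows "((\<lambda>t. usol eu t ((1 + \<rho> * t\<^sup>2) * l) / t\<^sup>2) \<longlongrightarrow> \<rho> * l * sg' l + un eu 2 l) (at_right 0)"
    "((\<lambda>t. vsol eu t ((1 + \<rho> * t\<^sup>2) * l) / t\<^sup>2) \<longlongrightarrow> 0) (at_right 0)"
    "((\<lambda>t. usol ev t ((1 + \<rho> * t\<^sup>2) * l) / t\<^sup>2) \<longlongrightarrow> 0) (at_right 0)"
    "((\<lambda>t. vsol ev t ((1 + \<rho> * t\<^sup>2) * l) / t\<^sup>2) \<longlongrightarrow> \<rho> * l * sh' l + vn ev 2 l) (at_right 0)"
proof -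
  obtain K where K: "K \<ge> 0" "\<forall>\<mu> y. \<bar>\<mu>\<bar> \<le> 1 \<longrightarrow> \<bar>y\<bar> \<le> \<bar>l\<bar> + 1 \<longrightarrow> \<bar>usol eu \<mu> y - (\<Sum>n<3. \<mu> ^ n * un eu n y)\<bar> \<le> K * \<bar>\<mu>\<bar> ^ 3"
    "\<forall>\<mu> y. \<bar>\<mu>\<bar> \<le> 1 \<longrightarrow> \<bar>y\<bar> \<le> \<bar>l\<bar> + 1 \<longrightarrow> \<bar>vsol eu \<mu> y - (\<Sum>n<3. \<mu> ^ n * vn eu n y)\<bar> \<le> K * \<bar>\<mu>\<bar> ^ 3"
    by (rule sol_remainder)
  obtain M where M: "M \<ge> 0" "\<forall>\<mu> y. \<bar>\<mu>\<bar> \<le> 1 \<longrightarrow> \<bar>y\<bar> \<le> \<bar>l\<bar> + 1 \<longrightarrow> \<bar>usol ev \<mu> y - (\<Sum>n<3. \<mu> ^ n * un ev n y)\<bar> \<le> M * \<bar>\<mu>\<bar> ^ 3"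
    "\<forall>\<mu> y. \<bar>\<mu>\<bar> \<le> 1 \<longrightarrow> \<bar>y\<bar> \<le> \<bar>l\<bar> + 1 \<longrightarrow> \<bar>vsol ev \<mu> y - (\<Sum>n<3. \<mu> ^ n * vn ev n y)\<bar> \<le> M * \<bar>\<mu>\<bar> ^ 3"
    by (rule sol_remainder)
  have d1: "(vn eu 1 has_real_derivative vn' eu 1 l) (at l)" "(un ev 1 has_real_derivative un' ev 1 l) (at l)"
    using un_deriv[of eu 0 l] un_deriv[of ev 0 l] by simp_all
  from quadratic_asymptotics(2)[OF line_tendsto(2) K(2) _ _ un_isCont(3), where ?a0.0 = "\<rho> * l * sg' l" and ?a1.0 = 0]
    right_limits(2)[OF fund_deriv(3) z(1)]
  show "((\<lambda>t. usol eu t ((1 + \<rho> * t\<^sup>2) * l) / t\<^sup>2) \<longlongrightarrow> \<rho> * l * sg' l + un eu 2 l) (at_right 0)"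
    by (simp add: u_zero parity parity[unfolded One_nat_def])
  from quadratic_asymptotics(2)[OF line_tendsto(2) M(3) _ _ un_isCont(4), where ?a0.0 = "\<rho> * l * sh' l" and ?a1.0 = 0]
    right_limits(2)[OF fund_deriv(7) z(2)]
  show "((\<lambda>t. vsol ev t ((1 + \<rho> * t\<^sup>2) * l) / t\<^sup>2) \<longlongrightarrow> \<rho> * l * sh' l + vn ev 2 l) (at_right 0)"
    by (simp add: u_zero parity parity[unfolded One_nat_def])
  from quadratic_asymptotics(2)[OF line_tendsto(2) K(3) _ _ un_isCont(4), where ?a0.0 = 0 and ?a1.0 = 0]
    right_limits(3)[OF d1(1) o(1)]
  show "((\<lambda>t. vsol eu t ((1 + \<rho> * t\<^sup>2) * l) / t\<^sup>2) \<longlongrightarrow> 0) (at_right 0)"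
    by (simp add: u_zero parity parity[unfolded One_nat_def])
  from quadratic_asymptotics(2)[OF line_tendsto(2) M(2) _ _ un_isCont(3), where ?a0.0 = 0 and ?a1.0 = 0]
    right_limits(3)[OF d1(2) o(2)]
  show "((\<lambda>t. usol ev t ((1 + \<rho> * t\<^sup>2) * l) / t\<^sup>2) \<longlongrightarrow> 0) (at_right 0)"
    by (simp add: u_zero parity parity[unfolded One_nat_def])
qed

lemma unperturbed_path:
  "sg l = 0 \<Longrightarrow> ((\<lambda>t. usol eu 0 ((1 + \<kappa> * t) * l) / t) \<longlongrightarrow> \<kappa> * l * sg' l) (at_right 0)"
  "((\<lambda>t. vsol eu 0 ((1 + \<kappa> * t) * l) / t) \<longlongrightarrow> 0) (at_right 0)"
  "((\<lambda>t. usol ev 0 ((1 + \<kappa> * t) * l) / t) \<longlongrightarrow> 0) (at_right 0)"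
  "sh l = 0 \<Longrightarrow> ((\<lambda>t. vsol ev 0 ((1 + \<kappa> * t) * l) / t) \<longlongrightarrow> \<kappa> * l * sh' l) (at_right 0)"
  using right_limits(1)[OF fund_deriv(3)] right_limits(1)[OF fund_deriv(7)]
  by (simp_all add: sol_zero uc_def vc_def eu_def ev_def)

lemma cf_components:
  "((\<lambda>y. fst (fst (cf c (Suc n) y))) has_real_derivative sg y * vn c n y) (at y)"
  "((\<lambda>y. fst (snd (cf c (Suc n) y))) has_real_derivative - sh y * un c n y) (at y)"
proof -
  note bl = bounded_linear.has_vector_derivative
  from bl[OF bounded_linear_fst bl[OF bounded_linear_fst cf_deriv[of c n y]]]
  show "((\<lambda>y. fst (fst (cf c (Suc n) y))) has_real_derivative sg y * vn c n y) (at y)"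
    by (simp add: has_real_derivative_iff_has_vector_derivative vn_def)
  from bl[OF bounded_linear_fst bl[OF bounded_linear_snd cf_deriv[of c n y]]]
  show "((\<lambda>y. fst (snd (cf c (Suc n) y))) has_real_derivative - sh y * un c n y) (at y)"
    by (simp add: has_real_derivative_iff_has_vector_derivative un_def)
qed

text \<open>
  \<open>I1 l\<close> is \<open>\<langle>sg, sh\<rangle>\<close>, and if it vanishes \<open>A2 l\<close> and \<open>B2 l\<close> are \<open>\<langle>sg, v\<rangle>\<close> and \<open>\<langle>sh, u\<rangle>\<close> for solutions of
  \<open>- L\<^sub>- v = sg\<close> and \<open>L\<^sub>+ u = sh\<close>: these are the quantities in the theorem for kernel functions normalised
  by slope one at \<open>0\<close>.
\<close>

definition I1 where "I1 y = fst (fst (cf ev 1 y))"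
definition A2 where "A2 y = fst (fst (cf eu 2 y))"
definition B2 where "B2 y = - fst (snd (cf ev 2 y))"

lemma integrals_deriv:
  "(I1 has_real_derivative sg y * sh y) (at y)"
  "(A2 has_real_derivative sg y * vn eu 1 y) (at y)"
  "(B2 has_real_derivative sh y * un ev 1 y) (at y)"
  "I1 0 = 0" "A2 0 = 0" "B2 0 = 0"
proof -
  show "(I1 has_real_derivative sg y * sh y) (at y)"
    using cf_components(1)[of ev 0 y] by (simp add: I1_def[abs_def] u_zero)
  show "(A2 has_real_derivative sg y * vn eu 1 y) (at y)"
    using cf_components(1)[of eu 1 y] by (simp add: A2_def[abs_def] numeral_2_eq_2)
  show "(B2 has_real_derivative sh y * un ev 1 y) (at y)"
    using DERIV_minus[OF cf_components(2)[of ev 1 y]] by (simp add: B2_def[abs_def] numeral_2_eq_2)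
  show "I1 0 = 0" "A2 0 = 0" "B2 0 = 0"
    using cf_simps(2)[of ev 0] cf_simps(2)[of eu 1] cf_simps(2)[of ev 1]
    by (simp_all add: I1_def A2_def B2_def numeral_2_eq_2)
qed

text \<open>
  By variation of constants the coefficients at \<open>l\<close> are multiples of \<open>cg l\<close> and \<open>ch l\<close>, as \<open>sg\<close> and \<open>sh\<close>
  vanish there, and the multiples are integrals against the kernel functions.
\<close>

lemma coefficient_values:
  assumes z: "sg l = 0" "sh l = 0"
  shows "un ev 1 l = I1 l * cg l" "vn eu 1 l = - I1 l * ch l" "un eu 2 l = A2 l * cg l" "vn ev 2 l = - B2 l * ch l"
    "cg l * sg' l = 1" "ch l * sh' l = 1"
proof -
  have "((\<lambda>y. I1 y + fst (snd (cf eu 1 y))) has_real_derivative 0) (at y)" for y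
    using DERIV_add[OF integrals_deriv(1)[of y] cf_components(2)[of eu 0 y]] by (simp add: u_zero)
  then have "I1 l + fst (snd (cf eu 1 l)) = I1 0 + fst (snd (cf eu 1 0))"
    using DERIV_isconst_all[of "\<lambda>y. I1 y + fst (snd (cf eu 1 y))" l 0] by simp
  then have b: "fst (snd (cf eu 1 l)) = - I1 l" using integrals_deriv(4) cf_simps(2)[of eu 0] by simp
  show "un ev 1 l = I1 l * cg l" "vn eu 1 l = - I1 l * ch l" "un eu 2 l = A2 l * cg l" "vn ev 2 l = - B2 l * ch l"
    using z b by (simp_all add: un_def vn_def uc_def vc_def I1_def A2_def B2_def)
  show "cg l * sg' l = 1" "ch l * sh' l = 1" using wronskian[of l] z by simp_all
qed

end

section \<open>Germs of eigenvalue curves\<close>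

lemma curve_germ_props:
  assumes "curve_germ \<sigma>"
  obtains \<eta> where "\<eta> > 0" "continuous_on {0<..<\<eta>} \<sigma>"
    "((\<lambda>t. (\<sigma> t - 1) / t) \<longlongrightarrow> 0) (at_right 0)"
    "((\<lambda>t. (\<sigma> t - 1) / t\<^sup>2) \<longlongrightarrow> deriv (deriv \<sigma>) 0 / 2) (at_right 0)"
proof -
  obtain \<eta> where \<eta>: "\<eta> > 0" "C2_on \<sigma> {-\<eta><..<\<eta>}" and s0: "\<sigma> 0 = 1" "deriv \<sigma> 0 = 0"
    using assms by (auto simp: curve_germ_def)
  let ?S = "{-\<eta><..<\<eta>}"
  obtain f' f'' where f': "\<And>x. x \<in> ?S \<Longrightarrow> (\<sigma> has_real_derivative f' x) (at x within ?S)"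
    and f'': "\<And>x. x \<in> ?S \<Longrightarrow> (f' has_real_derivative f'' x) (at x within ?S)"
    using \<eta>(2) unfolding C2_on_def by blast
  have d: "(\<sigma> has_real_derivative f' x) (at x)" "(f' has_real_derivative f'' x) (at x)" if "x \<in> ?S" for x
    using f'[OF that] f''[OF that] at_within_open[OF that open_greaterThanLessThan] by simp_all
  have z: "0 \<in> ?S" using \<eta>(1) by simp
  have f0: "f' 0 = 0" using DERIV_imp_deriv[OF d(1)[OF z]] s0 by simp
  have "(deriv \<sigma> has_real_derivative f'' 0) (at 0)"
    by (rule has_field_derivative_transform_within_open[OF d(2)[OF z] open_greaterThanLessThan z])
       (use DERIV_imp_deriv[OF d(1)] in simp)
  then have dd: "deriv (deriv \<sigma>) 0 = f'' 0" by (rule DERIV_imp_deriv)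
  have lim1: "((\<lambda>t. (\<sigma> t - 1) / t) \<longlongrightarrow> 0) (at_right 0)"
  proof -
    have "((\<lambda>t. (\<sigma> t - 1) / t) \<longlongrightarrow> 0) (at 0)" using d(1)[OF z] f0 s0 by (simp add: DERIV_def)
    then show ?thesis by (rule tendsto_mono[rotated]) (simp add: at_le)
  qed
  have lim2: "((\<lambda>t. f' t / (2 * t)) \<longlongrightarrow> f'' 0 / 2) (at_right 0)"
  proof -
    have "((\<lambda>t. f' t / t) \<longlongrightarrow> f'' 0) (at 0)" using d(2)[OF z] f0 by (simp add: DERIV_def)
    then have "((\<lambda>t. f' t / t) \<longlongrightarrow> f'' 0) (at_right 0)" by (rule tendsto_mono[rotated]) (simp add: at_le)
    from tendsto_divide[OF this tendsto_const[of 2]] show ?thesis by (simp add: mult.commute)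
  qed
  have inS: "\<forall>\<^sub>F t in at_right 0. t \<in> ?S"
    using eventually_at_right_real[OF \<eta>(1)] by eventually_elim (use \<eta>(1) in auto)
  have pos: "\<forall>\<^sub>F t::real in at_right 0. 0 < t" by (rule eventually_at_right_less)
  have "((\<lambda>t. (\<sigma> t - 1) / t\<^sup>2) \<longlongrightarrow> f'' 0 / 2) (at_right 0)"
  proof (rule lhopital_right_0[where f' = f' and g' = "\<lambda>t. 2 * t"])
    have "isCont \<sigma> 0" using d(1)[OF z] by (rule DERIV_isCont)
    then have "(\<sigma> \<longlongrightarrow> 1) (at 0)" using s0 by (simp add: isCont_def)
    then have "(\<sigma> \<longlongrightarrow> 1) (at_right 0)" by (rule tendsto_mono[rotated]) (simp add: at_le)
    from tendsto_diff[OF this tendsto_const[of 1]] show "((\<lambda>t. \<sigma> t - 1) \<longlongrightarrow> 0) (at_right 0)" by simp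
    have "((\<lambda>t::real. t\<^sup>2) \<longlongrightarrow> 0\<^sup>2) (at_right 0)" by (intro tendsto_intros)
    then show "((\<lambda>t::real. t\<^sup>2) \<longlongrightarrow> 0) (at_right 0)" by simp
    show "\<forall>\<^sub>F x::real in at_right 0. x\<^sup>2 \<noteq> 0" "\<forall>\<^sub>F x::real in at_right 0. 2 * x \<noteq> 0"
      using pos by (auto elim: eventually_mono)
    show "\<forall>\<^sub>F x in at_right 0. ((\<lambda>t. \<sigma> t - 1) has_real_derivative f' x) (at x)"
      using inS
    proof eventually_elim
      case (elim x)
      show ?case using DERIV_diff[OF d(1)[OF elim] DERIV_const[of 1]] by simp
    qed
    show "\<forall>\<^sub>F x in at_right 0. ((\<lambda>t::real. t\<^sup>2) has_real_derivative 2 * x) (at x)"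
      by (intro always_eventually allI) (auto intro!: derivative_eq_intros)
  qed (rule lim2)
  moreover have "continuous_on {0<..<\<eta>} \<sigma>"
    by (intro continuous_at_imp_continuous_on ballI DERIV_isCont[OF d(1)]) (use \<eta>(1) in auto)
  ultimately show thesis using that[of \<eta>] \<eta>(1) lim1 dd by simp
qed

text \<open>
  A continuous function without zeros has a constant sign.
\<close>

lemma s_sharp_dichotomy:
  assumes \<sigma>: "curve_germ \<sigma>" and ne: "\<forall>\<^sub>F t in at_right 0. \<sigma> t \<noteq> 1"
  shows "s_sharp \<sigma> = 1 \<and> (\<forall>\<^sub>F t in at_right 0. \<sigma> t > 1) \<or> s_sharp \<sigma> = - 1 \<and> (\<forall>\<^sub>F t in at_right 0. \<sigma> t < 1)"
proof -
  obtain \<eta> where \<eta>: "\<eta> > 0" "continuous_on {0<..<\<eta>} \<sigma>" using curve_germ_props[OF \<sigma>] by metis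
  obtain b where b: "b > 0" "\<And>t. 0 < t \<Longrightarrow> t < b \<Longrightarrow> \<sigma> t \<noteq> 1"
    using ne unfolding eventually_at_right_field by metis
  define c where "c = min \<eta> b"
  have c: "c > 0" using \<eta>(1) b(1) by (simp add: c_def)
  have con: "connected (\<sigma> ` {0<..<c})"
    by (intro connected_continuous_image continuous_on_subset[OF \<eta>(2)]) (auto simp: c_def)
  have ne1: "1 \<notin> \<sigma> ` {0<..<c}" using b(2) by (force simp: c_def)
  have lim: "s_sharp \<sigma> = x" if "\<forall>\<^sub>F t in at_right 0. sgn (\<sigma> t - 1) = x" for x
    unfolding s_sharp_def by (rule tendsto_Lim) (use tendsto_eventually[OF that] in auto)
  have m: "\<sigma> (c / 2) \<in> \<sigma> ` {0<..<c}" using c by auto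
  have ev: "\<forall>\<^sub>F t in at_right 0. t \<in> {0<..<c}" by (rule eventually_at_right_real[OF c])
  show ?thesis
  proof (cases "\<sigma> (c / 2) > 1")
    case True
    have "\<sigma> t > 1" if t: "t \<in> {0<..<c}" for t
    proof (rule ccontr)
      assume "\<not> \<sigma> t > 1"
      then have "1 \<in> \<sigma> ` {0<..<c}" using connectedD_interval[OF con imageI[OF t] m, of 1] True by simp
      then show False using ne1 by blast
    qed
    then have g: "\<forall>\<^sub>F t in at_right 0. \<sigma> t > 1" using ev by (auto elim: eventually_mono)
    then have "\<forall>\<^sub>F t in at_right 0. sgn (\<sigma> t - 1) = 1" by eventually_elim simp
    then show ?thesis using lim g by blast
  next
    case False
    have lt: "\<sigma> (c / 2) < 1" using False ne1 m by (metis linorder_neqE)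
    have "\<sigma> t < 1" if t: "t \<in> {0<..<c}" for t
    proof (rule ccontr)
      assume "\<not> \<sigma> t < 1"
      then have "1 \<in> \<sigma> ` {0<..<c}" using connectedD_interval[OF con m imageI[OF t], of 1] lt by simp
      then show False using ne1 by blast
    qed
    then have g: "\<forall>\<^sub>F t in at_right 0. \<sigma> t < 1" using ev by (auto elim: eventually_mono)
    then have "\<forall>\<^sub>F t in at_right 0. sgn (\<sigma> t - 1) = - 1" by eventually_elim simp
    then show ?thesis using lim g by blast
  qed
qed

section \<open>Counting crossings at the corner\<close>

lemma mult_pos_right_sign:
  fixes c \<kappa> :: real
  assumes "0 < c"
  shows "(\<kappa> * c > 0) = (\<kappa> > 0)" "(\<kappa> * c < 0) = (\<kappa> < 0)" "(\<kappa> * c = 0) = (\<kappa> = 0)"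
  using assms by (auto simp: zero_less_mult_iff mult_less_0_iff)

context corner_chart
begin

lemma N_vertical_between:
  assumes "\<bar>t\<bar> \<le> \<delta>" "\<bar>a - 1\<bar> \<le> \<delta>" "\<bar>b - 1\<bar> \<le> \<delta>"
    and nc: "\<And>s. min a b \<le> s \<Longrightarrow> s \<le> max a b \<Longrightarrow> no_crossing t s"
  shows "N t a = N t b"
proof -
  have box: "(t, s) \<in> corner_box \<delta>" if "min a b \<le> s" "s \<le> max a b" for s
    using assms(1-3) that by (auto simp: corner_box_def min_def max_def abs_le_iff split: if_splits)
  show ?thesis
  proof (cases "a \<le> b")
    case True
    show ?thesis by (rule N_vertical_segment) (use True box nc in auto)
  next
    case False
    have "N t b = N t a" by (rule N_vertical_segment) (use False box nc in auto)
    then show ?thesis by simp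
  qed
qed

lemma eventually_small:
  assumes "0 < c" shows "\<forall>\<^sub>F t in at_right 0. \<bar>\<rho> * t ^ Suc n\<bar> < (c::real)"
proof -
  have "((\<lambda>t. \<rho> * t ^ Suc n) \<longlongrightarrow> \<rho> * 0 ^ Suc n) (at_right (0::real))"
    by (intro tendsto_mult tendsto_const tendsto_power tendsto_ident_at)
  from tendstoD[OF this assms] show ?thesis by (simp add: dist_real_def)
qed

text \<open>
  For small \<open>t > 0\<close> the curve passes between \<open>(t, 1 - t)\<close> and \<open>(t, 1 + t)\<close> because its slope at \<open>0\<close> is zero.
  On either side of the curve \<open>N\<close> is constant along the vertical segment, with value \<open>n1\<close> below and \<open>n2\<close>
  above, and \<open>(t, 1)\<close> is on the side given by \<open>s_sharp\<close>. The curve cannot pass through \<open>(t, 1)\<close>, which is no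
  crossing: otherwise \<open>n1 = n2\<close>.
\<close>

lemma simple_corner:
  assumes \<sigma>: "curve_germ \<sigma>"
    and cross: "\<eta> > 0" "\<forall>\<mu> s. \<bar>\<mu>\<bar> < \<eta> \<longrightarrow> \<bar>s - 1\<bar> < \<eta> \<longrightarrow> \<not> no_crossing \<mu> s \<longrightarrow> s = \<sigma> \<mu>"
    and below: "\<forall>\<^sub>F t in at_right 0. N t (1 - t) = n1" and above: "\<forall>\<^sub>F t in at_right 0. N t (1 + t) = n2"
    and left: "\<forall>\<^sub>F t in at_right 0. N 0 (1 - t) = n1" and ne: "n1 \<noteq> n2"
    and nc: "\<forall>\<^sub>F t in at_right 0. no_crossing t 1"
  shows "s_sharp \<sigma> = 1 \<and> (\<forall>\<^sub>F \<epsilon> in at_right 0. corner_index l G H \<epsilon> = 0) \<or>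
    s_sharp \<sigma> = - 1 \<and> (\<forall>\<^sub>F \<epsilon> in at_right 0. corner_index l G H \<epsilon> = int n1 - int n2)"
proof -
  have pos: "\<forall>\<^sub>F t::real in at_right 0. 0 < t" by (rule eventually_at_right_less)
  have small: "\<forall>\<^sub>F t in at_right 0. \<bar>t\<bar> < min \<delta> \<eta>"
    using eventually_small[of "min \<delta> \<eta>" 1 0] \<delta>(1) cross(1) by simp
  have "((\<lambda>t. (\<sigma> t - 1) / t) \<longlongrightarrow> 0) (at_right 0)" using curve_germ_props[OF \<sigma>] by metis
  then have "\<forall>\<^sub>F t in at_right 0. dist ((\<sigma> t - 1) / t) 0 < 1" by (rule tendstoD) simp
  then have near: "\<forall>\<^sub>F t in at_right 0. \<bar>\<sigma> t - 1\<bar> < t"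
    using pos by eventually_elim (simp add: dist_real_def abs_divide)
  have off: "no_crossing t s" if "0 < t" "\<bar>t\<bar> < min \<delta> \<eta>" "\<bar>s - 1\<bar> \<le> t" "s \<noteq> \<sigma> t" for t s
    using cross(2)[rule_format, of t s] that by auto
  have ne1: "\<forall>\<^sub>F t in at_right 0. \<sigma> t \<noteq> 1"
    using pos small nc below above
  proof eventually_elim
    case (elim t)
    show ?case
    proof
      assume one: "\<sigma> t = 1"
      have "N t (1 - t) = N t (1 + t)"
      proof (rule N_vertical_between)
        fix s assume s: "min (1 - t) (1 + t) \<le> s" "s \<le> max (1 - t) (1 + t)"
        show "no_crossing t s"
        proof (cases "s = 1")
          case True then show ?thesis using elim by simp
        next
          case False
          show ?thesis by (rule off) (use elim s False one in \<open>auto simp: abs_le_iff\<close>)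
        qed
      qed (use elim in auto)
      then show False using elim ne by simp
    qed
  qed
  from s_sharp_dichotomy[OF \<sigma> ne1] show ?thesis
  proof
    assume 1: "s_sharp \<sigma> = 1 \<and> (\<forall>\<^sub>F t in at_right 0. \<sigma> t > 1)"
    then have "\<forall>\<^sub>F t in at_right 0. \<sigma> t > 1" by simp
    then have "\<forall>\<^sub>F \<epsilon> in at_right 0. corner_index l G H \<epsilon> = 0"
      using pos small below left
    proof eventually_elim
      case (elim t)
      have "N t (1 - t) = N t 1"
        by (rule N_vertical_between) (use elim in \<open>auto intro!: off simp: abs_le_iff\<close>)
      then show ?case using corner_index_eq[of t] elim by simp
    qed
    with 1 show ?thesis by simp
  next
    assume 1: "s_sharp \<sigma> = - 1 \<and> (\<forall>\<^sub>F t in at_right 0. \<sigma> t < 1)"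
    then have "\<forall>\<^sub>F t in at_right 0. \<sigma> t < 1" by simp
    then have "\<forall>\<^sub>F \<epsilon> in at_right 0. corner_index l G H \<epsilon> = int n1 - int n2"
      using pos small above left
    proof eventually_elim
      case (elim t)
      have "N t (1 + t) = N t 1"
        by (rule N_vertical_between) (use elim in \<open>auto intro!: off simp: abs_le_iff\<close>)
      then show ?case using corner_index_eq[of t] elim by simp
    qed
    with 1 show ?thesis by simp
  qed
qed

text \<open>
  The same for two curves with different second derivatives, separated by three parabolas. Here \<open>p\<close> is the
  lower curve, and \<open>n0\<close>, \<open>n1\<close>, \<open>n2\<close> are the values below, between and above.
\<close>

lemma double_corner:
  assumes lim: "((\<lambda>t. (p t - 1) / t\<^sup>2) \<longlongrightarrow> a) (at_right 0)" "((\<lambda>t. (q t - 1) / t\<^sup>2) \<longlongrightarrow> b) (at_right 0)" "a < b"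
    and cross: "\<eta> > 0" "\<forall>\<mu> s. \<bar>\<mu>\<bar> < \<eta> \<longrightarrow> \<bar>s - 1\<bar> < \<eta> \<longrightarrow> \<not> no_crossing \<mu> s \<longrightarrow> s = p \<mu> \<or> s = q \<mu>"
    and n0: "\<forall>\<^sub>F t in at_right 0. N t (1 + (a - 1) * t\<^sup>2) = n0"
    and n1: "\<forall>\<^sub>F t in at_right 0. N t (1 + (a + b) / 2 * t\<^sup>2) = n1"
    and n2: "\<forall>\<^sub>F t in at_right 0. N t (1 + (b + 1) * t\<^sup>2) = n2" and ne: "n0 \<noteq> n1" "n1 \<noteq> n2"
    and nc: "\<forall>\<^sub>F t in at_right 0. no_crossing t 1"
  shows "\<forall>\<^sub>F t in at_right 0. p t \<noteq> 1 \<and> q t \<noteq> 1 \<and> p t < q t \<and>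
    N t 1 = (if p t > 1 then n0 else if q t > 1 then n1 else n2)"
proof -
  have pos: "\<forall>\<^sub>F t::real in at_right 0. 0 < t" by (rule eventually_at_right_less)
  have small: "\<forall>\<^sub>F t in at_right 0. \<bar>\<rho> * t\<^sup>2\<bar> < min \<delta> \<eta>" for \<rho>
    using eventually_small[of "min \<delta> \<eta>" \<rho> 1] \<delta>(1) cross(1) by (simp add: numeral_2_eq_2)
  have small1: "\<forall>\<^sub>F t in at_right 0. \<bar>t\<bar> < min \<delta> \<eta>"
    using eventually_small[of "min \<delta> \<eta>" 1 0] \<delta>(1) cross(1) by simp
  have P: "\<forall>\<^sub>F t in at_right 0. a - 1 < (p t - 1) / t\<^sup>2" "\<forall>\<^sub>F t in at_right 0. (p t - 1) / t\<^sup>2 < (a + b) / 2"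
    using order_tendstoD(1)[OF lim(1), of "a - 1"] order_tendstoD(2)[OF lim(1), of "(a + b) / 2"] lim(3) by simp_all
  have Q: "\<forall>\<^sub>F t in at_right 0. (a + b) / 2 < (q t - 1) / t\<^sup>2" "\<forall>\<^sub>F t in at_right 0. (q t - 1) / t\<^sup>2 < b + 1"
    using order_tendstoD(1)[OF lim(2), of "(a + b) / 2"] order_tendstoD(2)[OF lim(2), of "b + 1"] lim(3) by simp_all
  show ?thesis
    using P Q pos small1 small[of "a - 1"] small[of "(a + b) / 2"] small[of "b + 1"] n0 n1 n2 nc
  proof eventually_elim
    case (elim t)
    \<comment> \<open>points on the separating parabolas, ordered with the curves as \<open>x < p t < y < q t < z\<close>\<close>
    define x y z where "x = 1 + (a - 1) * t\<^sup>2" and "y = 1 + (a + b) / 2 * t\<^sup>2" and "z = 1 + (b + 1) * t\<^sup>2"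
    have w: "0 < t\<^sup>2" using elim by simp
    have ord: "x < p t" "p t < y" "y < q t" "q t < z"
      using elim(1-4) w by (simp_all add: x_def y_def z_def field_simps)
    have near: "\<bar>x - 1\<bar> < min \<delta> \<eta>" "\<bar>y - 1\<bar> < min \<delta> \<eta>" "\<bar>z - 1\<bar> < min \<delta> \<eta>"
      using elim by (simp_all add: x_def y_def z_def)
    have val: "N t x = n0" "N t y = n1" "N t z = n2" "no_crossing t 1" using elim by (simp_all add: x_def y_def z_def)
    have move: "N t c = N t d"
      if cd: "\<bar>c - 1\<bar> < min \<delta> \<eta>" "\<bar>d - 1\<bar> < min \<delta> \<eta>"
        and s: "\<And>s. min c d \<le> s \<Longrightarrow> s \<le> max c d \<Longrightarrow> s \<noteq> 1 \<Longrightarrow> s \<noteq> p t \<and> s \<noteq> q t" for c d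
    proof (rule N_vertical_between)
      fix r assume r: "min c d \<le> r" "r \<le> max c d"
      show "no_crossing t r"
      proof (rule ccontr)
        assume n: "\<not> no_crossing t r"
        have "\<bar>r - 1\<bar> < \<eta>" using r cd by (auto simp: min_def max_def split: if_splits)
        then have "r = p t \<or> r = q t" using cross(2)[rule_format, of t r] n elim by auto
        moreover have "r \<noteq> 1" using n val(4) by blast
        ultimately show False using s[OF r] by simp
      qed
    qed (use elim cd in auto)
    have one: "\<bar>1 - 1 :: real\<bar> < min \<delta> \<eta>" using \<delta>(1) cross(1) by simp
    have p1: "p t \<noteq> 1"
    proof
      assume "p t = 1"
      then have "N t x = N t y" by (intro move near) (use ord in auto)
      then show False using val ne by simp
    qed
    have q1: "q t \<noteq> 1"
    proof
      assume "q t = 1"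
      then have "N t y = N t z" by (intro move near) (use ord in auto)
      then show False using val ne by simp
    qed
    have "N t 1 = n0" if "p t > 1"
    proof -
      have "N t 1 = N t x" by (intro move near one) (use ord that in auto)
      then show ?thesis using val by simp
    qed
    moreover have "N t 1 = n1" if "p t < 1" "q t > 1"
    proof -
      have "N t 1 = N t y" by (intro move near one) (use ord that in auto)
      then show ?thesis using val by simp
    qed
    moreover have "N t 1 = n2" if "q t < 1"
    proof -
      have "N t 1 = N t z" by (intro move near one) (use ord that in auto)
      then show ?thesis using val by simp
    qed
    ultimately show ?case using p1 q1 ord by auto
  qed
qed

lemma end_slopes: "sg l = 0 \<Longrightarrow> sg' l \<noteq> 0" "sh l = 0 \<Longrightarrow> sh' l \<noteq> 0"
  using wronskian[of l] by auto

lemma paths_to_corner: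
  "((\<lambda>t. t) \<longlongrightarrow> 0) (at_right (0::real))" "((\<lambda>t. t\<^sup>2) \<longlongrightarrow> 0) (at_right (0::real))"
  "((\<lambda>t. 1 + \<kappa> * t) \<longlongrightarrow> 1) (at_right (0::real))" "((\<lambda>t. 1 + \<kappa> * t\<^sup>2) \<longlongrightarrow> 1) (at_right (0::real))"
  "\<forall>\<^sub>F t in at_right (0::real). t > 0" "\<forall>\<^sub>F t in at_right (0::real). t\<^sup>2 > 0"
proof -
  show 1: "((\<lambda>t. t) \<longlongrightarrow> 0) (at_right (0::real))" by (rule tendsto_ident_at)
  have "((\<lambda>t. t\<^sup>2) \<longlongrightarrow> 0\<^sup>2) (at_right (0::real))" by (intro tendsto_power 1)
  then show 2: "((\<lambda>t. t\<^sup>2) \<longlongrightarrow> 0) (at_right (0::real))" by simp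
  have "((\<lambda>t. 1 + \<kappa> * t) \<longlongrightarrow> 1 + \<kappa> * 0) (at_right (0::real))" by (intro tendsto_add tendsto_mult tendsto_const 1)
  then show "((\<lambda>t. 1 + \<kappa> * t) \<longlongrightarrow> 1) (at_right (0::real))" by simp
  have "((\<lambda>t. 1 + \<kappa> * t\<^sup>2) \<longlongrightarrow> 1 + \<kappa> * 0) (at_right (0::real))" by (intro tendsto_add tendsto_mult tendsto_const 2)
  then show "((\<lambda>t. 1 + \<kappa> * t\<^sup>2) \<longlongrightarrow> 1) (at_right (0::real))" by simp
  show 3: "\<forall>\<^sub>F t in at_right (0::real). t > 0" by (rule eventually_at_right_less)
  then show "\<forall>\<^sub>F t in at_right (0::real). t\<^sup>2 > 0" by eventually_elim simp
qed

lemma simple_kernel_u: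
  assumes z: "sg l = 0" "sh l \<noteq> 0" and \<kappa>: "\<kappa> \<noteq> 0"
  shows "\<forall>\<^sub>F t in at_right 0. N t (1 + \<kappa> * t) = N 0 1 + (if \<kappa> > 0 then 1 else 0)"
    "\<forall>\<^sub>F t in at_right 0. N 0 (1 + \<kappa> * t) = N 0 1 + (if \<kappa> > 0 then 1 else 0)"
proof -
  have m: "\<kappa> * l * sg' l * sg' l = \<kappa> * (l * (sg' l)\<^sup>2)" by (simp add: power2_eq_square)
  have lp: "0 < l * (sg' l)\<^sup>2" using end_slopes(1)[OF z(1)] l(1) by simp
  have nz: "\<kappa> * l * sg' l * sg' l \<noteq> 0" and sgn: "(\<kappa> * l * sg' l * sg' l > 0) = (\<kappa> > 0)"
    unfolding m mult_pos_right_sign[OF lp] using \<kappa> by simp_all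
  show "\<forall>\<^sub>F t in at_right 0. N t (1 + \<kappa> * t) = N 0 1 + (if \<kappa> > 0 then 1 else 0)"
    using near_corner_u[OF paths_to_corner(1,3,5,1) z linear_path_u[OF z(1)] nz]
    unfolding sgn by (rule eventually_mono) simp
  show "\<forall>\<^sub>F t in at_right 0. N 0 (1 + \<kappa> * t) = N 0 1 + (if \<kappa> > 0 then 1 else 0)"
    using near_corner_u[OF tendsto_const paths_to_corner(3,5,1) z unperturbed_path(1)[OF z(1)] unperturbed_path(2) nz]
    unfolding sgn by (rule eventually_mono) simp
qed

lemma simple_kernel_v:
  assumes z: "sg l \<noteq> 0" "sh l = 0" and \<kappa>: "\<kappa> \<noteq> 0"
  shows "\<forall>\<^sub>F t in at_right 0. N t (1 + \<kappa> * t) = N 0 1 + (if \<kappa> < 0 then 1 else 0)"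
    "\<forall>\<^sub>F t in at_right 0. N 0 (1 + \<kappa> * t) = N 0 1 + (if \<kappa> < 0 then 1 else 0)"
proof -
  have m: "\<kappa> * l * sh' l * sh' l = \<kappa> * (l * (sh' l)\<^sup>2)" by (simp add: power2_eq_square)
  have lp: "0 < l * (sh' l)\<^sup>2" using end_slopes(2)[OF z(2)] l(1) by simp
  have nz: "\<kappa> * l * sh' l * sh' l \<noteq> 0" and sgn: "(\<kappa> * l * sh' l * sh' l < 0) = (\<kappa> < 0)"
    unfolding m mult_pos_right_sign[OF lp] using \<kappa> by simp_all
  show "\<forall>\<^sub>F t in at_right 0. N t (1 + \<kappa> * t) = N 0 1 + (if \<kappa> < 0 then 1 else 0)"
    using near_corner_v[OF paths_to_corner(1,3,5,1) z linear_path_v[OF z(2)] nz]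
    unfolding sgn by (rule eventually_mono) simp
  show "\<forall>\<^sub>F t in at_right 0. N 0 (1 + \<kappa> * t) = N 0 1 + (if \<kappa> < 0 then 1 else 0)"
    using near_corner_v[OF tendsto_const paths_to_corner(3,5,1) z unperturbed_path(4)[OF z(2)] unperturbed_path(3) nz]
    unfolding sgn by (rule eventually_mono) simp
qed

lemma double_kernel_unperturbed:
  assumes z: "sg l = 0" "sh l = 0"
  shows "\<forall>\<^sub>F t in at_right 0. N 0 (1 - t) = N 0 1 + 1"
proof -
  define Q where "Q x y x' y' = (x * (- 1 * l * sg' l) + y * 0) * (x' * sg' l) - (x * 0 + y * (- 1 * l * sh' l)) * (y' * sh' l)"
    for x y x' y' :: real
  have s: "Q 1 0 1 0 = - (l * (sg' l)\<^sup>2)" "Q 0 1 0 1 = l * (sh' l)\<^sup>2" "Q 1 0 0 1 = 0" "Q 0 1 1 0 = 0"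
    by (simp_all add: Q_def power2_eq_square)
  have p: "0 < l * (sg' l)\<^sup>2" "0 < l * (sh' l)\<^sup>2" using end_slopes z l(1) by simp_all
  have "\<forall>\<^sub>F t in at_right 0. N 0 (1 + - 1 * t) = N 0 1 + (if Q 1 0 1 0 > 0 then 1 else 0) + (if Q 0 1 0 1 > 0 then 1 else 0)
    \<and> no_crossing 0 (1 + - 1 * t)"
    by (rule near_corner_uv[OF tendsto_const paths_to_corner(3,5,1) z
        unperturbed_path(1)[OF z(1)] unperturbed_path(3) unperturbed_path(2) unperturbed_path(4)[OF z(2)] _ Q_def])
       (use s p in auto)
  then show ?thesis by (rule eventually_mono) (use s p in auto)
qed

text \<open>
  The limiting form is a hyperbolic plane: \<open>Q\<close> is \<open>2 (I1 l) x y\<close>, diagonalised by \<open>(1, 1)\<close> and \<open>(1, -1)\<close>.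
\<close>

lemma double_kernel_coupled:
  assumes z: "sg l = 0" "sh l = 0" and I: "I1 l \<noteq> 0"
  shows "\<forall>\<^sub>F t in at_right 0. N t 1 = N 0 1 + 1"
proof -
  note cv = coefficient_values[OF z]
  define Q where "Q x y x' y' = (x * (0 * l * sg' l) + y * un ev 1 l) * (x' * sg' l) - (x * vn eu 1 l + y * (0 * l * sh' l)) * (y' * sh' l)"
    for x y x' y' :: real
  have q: "Q x y x' y' = I1 l * (y * x' + x * y')" for x y x' y'
  proof -
    have "Q x y x' y' = I1 l * (y * x' * (cg l * sg' l) + x * y' * (ch l * sh' l))"
      unfolding Q_def cv(1,2) by (simp add: algebra_simps)
    then show ?thesis by (simp add: cv(5,6))
  qed
  have "\<forall>\<^sub>F t in at_right 0. N t (1 + 0 * t) = N 0 1 + (if Q 1 1 1 1 > 0 then 1 else 0) + (if Q 1 (-1) 1 (-1) > 0 then 1 else 0)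
    \<and> no_crossing t (1 + 0 * t)"
    by (rule near_corner_uv[OF paths_to_corner(1,3,5,1) z
        linear_path_u(1)[OF z(1)] linear_path_v(2)[OF z(2)] linear_path_u(2)[OF z(1)] linear_path_v(1)[OF z(2)] _ Q_def])
       (use I in \<open>auto simp: q\<close>)
  then show ?thesis by (rule eventually_mono) (use I in \<open>auto simp: q\<close>)
qed

text \<open>
  \<open>r1\<close> and \<open>r2\<close> are half the second derivatives of the two eigenvalue curves. On \<open>s = 1 + \<rho> \<mu>\<^sup>2\<close> the limiting form
  is diagonal, with entries of the sign of \<open>r1 - \<rho>\<close> and \<open>\<rho> - r2\<close>.
\<close>

lemma double_kernel_decoupled:
  assumes z: "sg l = 0" "sh l = 0" and I: "I1 l = 0"
    and r: "A2 l = - r1 * (l * (sg' l)\<^sup>2)" "B2 l = r2 * (l * (sh' l)\<^sup>2)" and \<rho>: "\<rho> \<noteq> r1" "\<rho> \<noteq> r2"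
  shows "\<forall>\<^sub>F t in at_right 0. N t (1 + \<rho> * t\<^sup>2) = N 0 1 + (if \<rho> > r1 then 1 else 0) + (if \<rho> < r2 then 1 else 0)"
proof -
  note cv = coefficient_values[OF z]
  have o: "vn eu 1 l = 0" "un ev 1 l = 0" using cv I by simp_all
  define Q where "Q x y x' y' = (x * (\<rho> * l * sg' l + un eu 2 l) + y * 0) * (x' * sg' l) - (x * 0 + y * (\<rho> * l * sh' l + vn ev 2 l)) * (y' * sh' l)"
    for x y x' y' :: real
  have p: "0 < l * (sg' l)\<^sup>2" "0 < l * (sh' l)\<^sup>2" using end_slopes z l(1) by simp_all
  have "Q 1 0 1 0 = \<rho> * (l * (sg' l)\<^sup>2) + A2 l * (cg l * sg' l)"
    by (simp add: Q_def cv(3) algebra_simps power2_eq_square)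
  then have q1: "Q 1 0 1 0 = (\<rho> - r1) * (l * (sg' l)\<^sup>2)" by (simp add: cv(5) r(1) algebra_simps)
  have "Q 0 1 0 1 = - \<rho> * (l * (sh' l)\<^sup>2) + B2 l * (ch l * sh' l)"
    by (simp add: Q_def cv(4) algebra_simps power2_eq_square)
  then have q2: "Q 0 1 0 1 = (r2 - \<rho>) * (l * (sh' l)\<^sup>2)" by (simp add: cv(6) r(2) algebra_simps)
  have q3: "Q 1 0 0 1 = 0" "Q 0 1 1 0 = 0" by (simp_all add: Q_def)
  have s: "(Q 1 0 1 0 > 0) = (\<rho> > r1)" "(Q 0 1 0 1 > 0) = (\<rho> < r2)" "Q 1 0 1 0 \<noteq> 0" "Q 0 1 0 1 \<noteq> 0"
    unfolding q1 q2 mult_pos_right_sign[OF p(1)] mult_pos_right_sign[OF p(2)] using \<rho> by simp_all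
  have "\<forall>\<^sub>F t in at_right 0. N t (1 + \<rho> * t\<^sup>2) = N 0 1 + (if Q 1 0 1 0 > 0 then 1 else 0) + (if Q 0 1 0 1 > 0 then 1 else 0)
    \<and> no_crossing t (1 + \<rho> * t\<^sup>2)"
    by (rule near_corner_uv[OF paths_to_corner(1,4,6,2) z
        quadratic_path(1)[OF z o] quadratic_path(3)[OF z o] quadratic_path(2)[OF z o] quadratic_path(4)[OF z o] _ Q_def])
       (use s q3 in auto)
  then show ?thesis unfolding s by (rule eventually_mono) simp
qed

text \<open>
  This is where the discreteness of the spectrum at the corner enters.
\<close>

lemma no_crossing_horizontal: "\<forall>\<^sub>F t in at_right 0. no_crossing t 1"
  using dirichlet_det_isolated[OF l(1)] by (rule eventually_mono) (simp add: no_crossing_det)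

lemma eventually_corner_index:
  assumes "\<forall>\<^sub>F t in at_right 0. int (N 0 (1 - t)) - int (N t 1) = c"
  shows "\<forall>\<^sub>F \<epsilon> in at_right 0. corner_index l G H \<epsilon> = c"
proof -
  have "\<forall>\<^sub>F t in at_right 0. \<bar>1 * t ^ Suc 0\<bar> < \<delta>" by (rule eventually_small[OF \<delta>(1)])
  then show ?thesis using assms paths_to_corner(5)
  proof eventually_elim
    case (elim t)
    then show ?case using corner_index_eq[of t] by simp
  qed
qed

lemma corner_index_simple_u:
  assumes "sg l = 0" "sh l \<noteq> 0" "curve_germ \<sigma>"
    and "\<eta> > 0" "\<forall>\<mu> s. \<bar>\<mu>\<bar> < \<eta> \<longrightarrow> \<bar>s - 1\<bar> < \<eta> \<longrightarrow> \<not> no_crossing \<mu> s \<longrightarrow> s = \<sigma> \<mu>"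
  shows "s_sharp \<sigma> = 1 \<and> (\<forall>\<^sub>F \<epsilon> in at_right 0. corner_index l G H \<epsilon> = 0) \<or>
    s_sharp \<sigma> = - 1 \<and> (\<forall>\<^sub>F \<epsilon> in at_right 0. corner_index l G H \<epsilon> = - 1)"
  using simple_corner[OF assms(3-5), of "N 0 1" "N 0 1 + 1"] simple_kernel_u[OF assms(1,2), of "-1"]
    simple_kernel_u[OF assms(1,2), of 1] no_crossing_horizontal by simp

lemma corner_index_simple_v:
  assumes "sg l \<noteq> 0" "sh l = 0" "curve_germ \<sigma>"
    and "\<eta> > 0" "\<forall>\<mu> s. \<bar>\<mu>\<bar> < \<eta> \<longrightarrow> \<bar>s - 1\<bar> < \<eta> \<longrightarrow> \<not> no_crossing \<mu> s \<longrightarrow> s = \<sigma> \<mu>"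
  shows "s_sharp \<sigma> = 1 \<and> (\<forall>\<^sub>F \<epsilon> in at_right 0. corner_index l G H \<epsilon> = 0) \<or>
    s_sharp \<sigma> = - 1 \<and> (\<forall>\<^sub>F \<epsilon> in at_right 0. corner_index l G H \<epsilon> = 1)"
  using simple_corner[OF assms(3-5), of "N 0 1 + 1" "N 0 1"] simple_kernel_v[OF assms(1,2), of "-1"]
    simple_kernel_v[OF assms(1,2), of 1] no_crossing_horizontal by simp

lemma corner_index_coupled:
  assumes z: "sg l = 0" "sh l = 0" and I: "I1 l \<noteq> 0"
  shows "\<forall>\<^sub>F \<epsilon> in at_right 0. corner_index l G H \<epsilon> = 0"
proof (rule eventually_corner_index)
  show "\<forall>\<^sub>F t in at_right 0. int (N 0 (1 - t)) - int (N t 1) = 0"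
    using double_kernel_unperturbed[OF z] double_kernel_coupled[OF z I] by eventually_elim simp
qed

text \<open>
  If the first curve is the lower one, \<open>N - N(0, 1)\<close> is \<open>1, 2, 1\<close> in the three regions from below; if it is the
  upper one, it is \<open>1, 0, 1\<close>. At \<open>(0, 1 - \<epsilon>)\<close> it is \<open>1\<close>. In both orders the difference is half the difference of the
  signs.
\<close>

lemma corner_index_decoupled:
  assumes z: "sg l = 0" "sh l = 0" and I: "I1 l = 0"
    and r: "A2 l = - r1 * (l * (sg' l)\<^sup>2)" "B2 l = r2 * (l * (sh' l)\<^sup>2)" and ne: "r1 \<noteq> r2"
    and \<sigma>: "curve_germ \<sigma>1" "curve_germ \<sigma>2" "deriv (deriv \<sigma>1) 0 = 2 * r1" "deriv (deriv \<sigma>2) 0 = 2 * r2"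
    and cross: "\<eta> > 0" "\<forall>\<mu> s. \<bar>\<mu>\<bar> < \<eta> \<longrightarrow> \<bar>s - 1\<bar> < \<eta> \<longrightarrow> \<not> no_crossing \<mu> s \<longrightarrow> s = \<sigma>1 \<mu> \<or> s = \<sigma>2 \<mu>"
  shows "\<forall>\<^sub>F \<epsilon> in at_right 0. real_of_int (corner_index l G H \<epsilon>) = 1 / 2 * (s_sharp \<sigma>1 - s_sharp \<sigma>2)"
proof -
  have lim1: "((\<lambda>t. (\<sigma>1 t - 1) / t\<^sup>2) \<longlongrightarrow> r1) (at_right 0)" using curve_germ_props[OF \<sigma>(1)] \<sigma>(3) by simp
  have lim2: "((\<lambda>t. (\<sigma>2 t - 1) / t\<^sup>2) \<longlongrightarrow> r2) (at_right 0)" using curve_germ_props[OF \<sigma>(2)] \<sigma>(4) by simp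
  note dec = double_kernel_decoupled[OF z I r]
  have main: "\<forall>\<^sub>F t in at_right 0. \<sigma>1 t \<noteq> 1 \<and> \<sigma>2 t \<noteq> 1 \<and>
    real_of_int (int (N 0 (1 - t)) - int (N t 1)) = 1 / 2 * (sgn (\<sigma>1 t - 1) - sgn (\<sigma>2 t - 1))"
  proof (cases "r1 < r2")
    case True
    have "\<forall>\<^sub>F t in at_right 0. \<sigma>1 t \<noteq> 1 \<and> \<sigma>2 t \<noteq> 1 \<and> \<sigma>1 t < \<sigma>2 t \<and>
      N t 1 = (if \<sigma>1 t > 1 then N 0 1 + 1 else if \<sigma>2 t > 1 then N 0 1 + 2 else N 0 1 + 1)"
      using dec[of "r1 - 1"] dec[of "(r1 + r2) / 2"] dec[of "r2 + 1"] True no_crossing_horizontal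
      by (intro double_corner[OF lim1 lim2 True cross]) simp_all
    then show ?thesis using double_kernel_unperturbed[OF z]
    proof eventually_elim
      case (elim t)
      then show ?case by (cases "\<sigma>1 t > 1"; cases "\<sigma>2 t > 1") (auto simp: sgn_if)
    qed
  next
    case False
    then have lt: "r2 < r1" using ne by simp
    have cross': "\<forall>\<mu> s. \<bar>\<mu>\<bar> < \<eta> \<longrightarrow> \<bar>s - 1\<bar> < \<eta> \<longrightarrow> \<not> no_crossing \<mu> s \<longrightarrow> s = \<sigma>2 \<mu> \<or> s = \<sigma>1 \<mu>"
      using cross(2) by blast
    have "\<forall>\<^sub>F t in at_right 0. \<sigma>2 t \<noteq> 1 \<and> \<sigma>1 t \<noteq> 1 \<and> \<sigma>2 t < \<sigma>1 t \<and>
      N t 1 = (if \<sigma>2 t > 1 then N 0 1 + 1 else if \<sigma>1 t > 1 then N 0 1 else N 0 1 + 1)"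
      using dec[of "r2 - 1"] dec[of "(r2 + r1) / 2"] dec[of "r1 + 1"] lt no_crossing_horizontal
      by (intro double_corner[OF lim2 lim1 lt cross(1) cross']) simp_all
    then show ?thesis using double_kernel_unperturbed[OF z]
    proof eventually_elim
      case (elim t)
      then show ?case by (cases "\<sigma>1 t > 1"; cases "\<sigma>2 t > 1") (auto simp: sgn_if)
    qed
  qed
  have sharp: "\<forall>\<^sub>F t in at_right 0. sgn (\<sigma> t - 1) = s_sharp \<sigma>"
    if "curve_germ \<sigma>" "\<forall>\<^sub>F t in at_right 0. \<sigma> t \<noteq> 1" for \<sigma>
    using s_sharp_dichotomy[OF that]
  proof (elim disjE conjE)
    assume s: "s_sharp \<sigma> = 1" and "\<forall>\<^sub>F t in at_right 0. \<sigma> t > 1"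
    from this(2) show ?thesis by (rule eventually_mono) (simp add: s)
  next
    assume s: "s_sharp \<sigma> = - 1" and "\<forall>\<^sub>F t in at_right 0. \<sigma> t < 1"
    from this(2) show ?thesis by (rule eventually_mono) (simp add: s)
  qed
  have "\<forall>\<^sub>F t in at_right 0. \<sigma>1 t \<noteq> 1" "\<forall>\<^sub>F t in at_right 0. \<sigma>2 t \<noteq> 1"
    using main by (rule eventually_mono, simp)+
  from main sharp[OF \<sigma>(1) this(1)] sharp[OF \<sigma>(2) this(2)]
  have "\<forall>\<^sub>F t in at_right 0. real_of_int (int (N 0 (1 - t)) - int (N t 1)) = 1 / 2 * (s_sharp \<sigma>1 - s_sharp \<sigma>2)"
    by eventually_elim simp
  moreover have "\<forall>\<^sub>F t in at_right 0. \<bar>1 * t ^ Suc 0\<bar> < \<delta>" by (rule eventually_small[OF \<delta>(1)])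
  ultimately show ?thesis using paths_to_corner(5)
  proof eventually_elim
    case (elim t)
    then show ?case using corner_index_eq[of t] by simp
  qed
qed

end

section \<open>Kernels and their correctors\<close>

text \<open>
  The difference of two solutions vanishing at \<open>0\<close> is a multiple of the fundamental solution \<open>w\<close>.
\<close>

lemma dirichlet_solution_form:
  fixes w w' p p' q k :: "real \<Rightarrow> real"
  assumes l: "0 < l" and q: "continuous_on {0..l} q"
    and w: "\<And>x. x \<in> {0..l} \<Longrightarrow> (w has_real_derivative w' x) (at x)"
      "\<And>x. x \<in> {0..l} \<Longrightarrow> (w' has_real_derivative - q x * w x) (at x)" "w 0 = 0" "w' 0 = 1"
    and p: "\<And>x. x \<in> {0..l} \<Longrightarrow> (p has_real_derivative p' x) (at x)"
      "\<And>x. x \<in> {0..l} \<Longrightarrow> (p' has_real_derivative - q x * p x - k x) (at x)" "p 0 = 0"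
    and u: "classical l u (\<lambda>x. - q x * u x - k x)" "u 0 = 0"
  obtains \<kappa> where "\<forall>x\<in>{0..l}. u x = p x + \<kappa> * w x \<and> D1 l u x = p' x + \<kappa> * w' x"
proof -
  define \<kappa> where "\<kappa> = D1 l u 0 - p' 0"
  have du: "(u has_real_derivative D1 l u x) (at x within {0..l})"
    "(D1 l u has_real_derivative - q x * u x - k x) (at x within {0..l})" if "x \<in> {0..l}" for x
    using u(1) that by (simp_all add: classical_def)
  have "u x - (p x + \<kappa> * w x) = 0 \<and> D1 l u x - (p' x + \<kappa> * w' x) = 0 \<and> (0::real) = 0 \<and> (0::real) = 0"
    if x: "x \<in> {0..l}" for x
  proof (rule linear_system_unique[where p = q and q = q and m = 0 and L = l
        and u = "\<lambda>x. u x - (p x + \<kappa> * w x)" and ?u1.0 = "\<lambda>x. D1 l u x - (p' x + \<kappa> * w' x)"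
        and v = "\<lambda>x. 0" and ?v1.0 = "\<lambda>x. 0"])
    fix x assume x: "x \<in> {0..l}"
    show "((\<lambda>x. u x - (p x + \<kappa> * w x)) has_real_derivative D1 l u x - (p' x + \<kappa> * w' x)) (at x within {0..l})"
      by (intro DERIV_diff DERIV_add DERIV_cmult du(1)[OF x]
          has_field_derivative_at_within[OF p(1)[OF x]] has_field_derivative_at_within[OF w(1)[OF x]])
    have "((\<lambda>x. D1 l u x - (p' x + \<kappa> * w' x)) has_real_derivative
      (- q x * u x - k x) - ((- q x * p x - k x) + \<kappa> * (- q x * w x))) (at x within {0..l})"
      by (intro DERIV_diff DERIV_add DERIV_cmult du(2)[OF x]
          has_field_derivative_at_within[OF p(2)[OF x]] has_field_derivative_at_within[OF w(2)[OF x]])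
    then show "((\<lambda>x. D1 l u x - (p' x + \<kappa> * w' x)) has_real_derivative
      - q x * (u x - (p x + \<kappa> * w x)) - 0 * 0) (at x within {0..l})"
      by (rule DERIV_cong) (simp add: algebra_simps)
  qed (use q x l u(2) p(3) w(3,4) in \<open>simp_all add: \<kappa>_def\<close>)
  then show thesis by (intro that[of \<kappa>]) auto
qed

lemma dirichlet_kernel_member:
  fixes w w' q :: "real \<Rightarrow> real"
  assumes l: "0 < l" and q: "continuous_on {0..l} q"
    and w: "\<And>x. x \<in> {0..l} \<Longrightarrow> (w has_real_derivative w' x) (at x)"
      "\<And>x. x \<in> {0..l} \<Longrightarrow> (w' has_real_derivative - q x * w x) (at x)" "w 0 = 0" "w' 0 = 1" "w l = 0"
  obtains z where "z \<in> ker_op l (L_op l q 1)" "\<forall>x. x \<notin> {0..l} \<longrightarrow> z x = 0" "D1 l z 0 = 1"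
proof -
  define z where "z x = (if x \<in> {0..l} then w x else 0)" for x
  have d: "(z has_real_derivative w' x) (at x within {0..l})" "(w' has_real_derivative - q x * z x - 0) (at x within {0..l})"
    if "x \<in> {0..l}" for x
  proof -
    show "(z has_real_derivative w' x) (at x within {0..l})"
      by (rule has_field_derivative_transform_within[OF has_field_derivative_at_within[OF w(1)[OF that]] zero_less_one that])
         (simp add: z_def)
    show "(w' has_real_derivative - q x * z x - 0) (at x within {0..l})"
      using has_field_derivative_at_within[OF w(2)[OF that]] that by (simp add: z_def)
  qed
  have c: "classical l z (\<lambda>x. - q x * z x - 0)" and D: "D1 l z 0 = w' 0"
    using classicalI[OF l d] l by simp_all
  have "z \<in> H2_H10 l \<and> eq_ae l (L_op l q 1 z) (\<lambda>x. 0)"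
    by (subst scalar_H2_iff[OF l q]) (use c w(3,5) in \<open>auto simp: z_def\<close>)
  then have "z \<in> ker_op l (L_op l q 1)" by (simp add: ker_op_def)
  then show thesis by (rule that) (simp_all add: z_def D w(4))
qed

text \<open>
  Used to tell a kernel function from zero: the normalised one has slope one at \<open>0\<close>.
\<close>

lemma D1_vanishing:
  fixes z :: "real \<Rightarrow> real"
  assumes "0 < l" "\<forall>x\<in>{0..l}. z x = 0" shows "D1 l z 0 = 0"
proof (rule D1_eq[OF assms(1)])
  show "(z has_vector_derivative 0) (at 0 within {0..l})"
    by (rule has_vector_derivative_transform_within[OF has_vector_derivative_const[of 0] zero_less_one])
       (use assms in auto)
qed (use assms in auto)

lemma zero_in_H2_H10: "0 < l \<Longrightarrow> (\<lambda>x. 0 :: real) \<in> H2_H10 l \<and> eq_ae l (L_op l q 1 (\<lambda>x. 0)) (\<lambda>x. 0)"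
proof -
  assume l: "0 < l"
  have c: "classical l (\<lambda>x. 0) (\<lambda>x. 0)" by (rule classicalI[OF l, of _ "\<lambda>x. 0"]) simp_all
  have "(\<exists>w. has_D2 l (\<lambda>x. 0 :: real) w) \<and> eq_ae l (D2 l (\<lambda>x. 0)) (\<lambda>x. 0 :: real)"
    by (subst classical_iff[OF l]) (simp_all add: c)
  then show ?thesis
    by (auto simp: H2_H10_def H2_def L_op_def elim: eq_ae_mono)
qed

lemma not_in_Spec_dirichlet:
  fixes w w' q :: "real \<Rightarrow> real"
  assumes l: "0 < l" and q: "continuous_on {0..l} q"
    and w: "\<And>x. x \<in> {0..l} \<Longrightarrow> (w has_real_derivative w' x) (at x)"
      "\<And>x. x \<in> {0..l} \<Longrightarrow> (w' has_real_derivative - q x * w x) (at x)" "w 0 = 0" "w' 0 = 1"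
    and S: "0 \<notin> Spec l (L_op l q 1)"
  shows "w l \<noteq> 0"
proof
  assume wl: "w l = 0"
  obtain z where z: "z \<in> ker_op l (L_op l q 1)" "\<forall>x. x \<notin> {0..l} \<longrightarrow> z x = 0" "D1 l z 0 = 1"
    by (rule dirichlet_kernel_member[OF l q w wl])
  have "z = (\<lambda>x. 0)"
    by (rule not_in_Spec_ker_trivial[OF S]) (use z(1) zero_in_H2_H10[OF l] in \<open>simp_all add: ker_op_def\<close>)
  then show False using z(3) D1_vanishing[OF l, of z] by simp
qed

lemma spanning_kernel_function:
  fixes w w' q :: "real \<Rightarrow> real"
  assumes l: "0 < l" and q: "continuous_on {0..l} q"
    and w: "\<And>x. x \<in> {0..l} \<Longrightarrow> (w has_real_derivative w' x) (at x)"
      "\<And>x. x \<in> {0..l} \<Longrightarrow> (w' has_real_derivative - q x * w x) (at x)" "w 0 = 0" "w' 0 = 1" "w l = 0"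
    and span: "ker_op l (L_op l q 1) = span {u}"
  obtains a where "a \<noteq> 0" "\<forall>x\<in>{0..l}. u x = a * w x" "D1 l u l = a * w' l"
proof -
  have "u \<in> ker_op l (L_op l q 1)" using span by (simp add: real_vector.span_base)
  then have "u \<in> H2_H10 l \<and> eq_ae l (L_op l q 1 u) (\<lambda>x. 0)" by (simp add: ker_op_def)
  then have u: "u 0 = 0" "classical l u (\<lambda>x. - q x * u x - 0)"
    using scalar_H2_iff[OF l q, of "\<lambda>x. 0" u] by simp_all
  have p: "((\<lambda>x. 0) has_real_derivative 0) (at x)" "((\<lambda>x. 0) has_real_derivative - q x * 0 - 0) (at x)" for x
    by simp_all
  obtain \<kappa> where \<kappa>: "\<forall>x\<in>{0..l}. u x = 0 + \<kappa> * w x \<and> D1 l u x = 0 + \<kappa> * w' x"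
    by (rule dirichlet_solution_form[OF l q w(1-4) p refl u(2,1)])
  obtain z where z: "z \<in> ker_op l (L_op l q 1)" "\<forall>x. x \<notin> {0..l} \<longrightarrow> z x = 0" "D1 l z 0 = 1"
    by (rule dirichlet_kernel_member[OF l q w])
  then obtain c where c: "z = c *\<^sub>R u" using span by (auto simp: real_vector.span_singleton)
  have "\<kappa> \<noteq> 0"
  proof
    assume "\<kappa> = 0"
    then have "\<forall>x\<in>{0..l}. z x = 0" using \<kappa> by (simp add: c scaleR_fun_def)
    then show False using z(3) D1_vanishing[OF l, of z] by simp
  qed
  then show thesis by (rule that) (use \<kappa> l in auto)
qed

lemma l2_inner_antiderivative:
  fixes u v k F :: "real \<Rightarrow> real"
  assumes l: "0 < l" and uv: "\<forall>x\<in>{0..l}. u x * v x = k x" and k: "continuous_on {0..l} k"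
    and F: "\<And>x. (F has_real_derivative k x) (at x)" "F 0 = 0"
  shows "l2_inner l u v = F l"
proof -
  have "continuous_on {0..l} (\<lambda>x. u x * v x)" by (rule continuous_on_eq[OF k]) (use uv in simp)
  moreover have "(F has_real_derivative u x * v x) (at x within {0..l})" if "x \<in> {0..l}" for x
    using has_field_derivative_at_within[OF F(1)] uv that by simp
  ultimately show ?thesis using l2_inner_FTC[OF l, of u v F] F(2) by simp
qed

lemma eventually_nhds_corner:
  assumes "\<forall>\<^sub>F (\<mu>, \<sigma>) in nhds (0, 1 :: real). P \<mu> \<sigma>"
  obtains \<eta> :: real where "\<eta> > 0" "\<forall>\<mu> s. \<bar>\<mu>\<bar> < \<eta> \<longrightarrow> \<bar>s - 1\<bar> < \<eta> \<longrightarrow> P \<mu> s"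
proof -
  obtain d where d: "d > 0" "\<forall>x. dist x (0 :: real, 1 :: real) < d \<longrightarrow> (case x of (\<mu>, \<sigma>) \<Rightarrow> P \<mu> \<sigma>)"
    using assms unfolding eventually_nhds_metric by blast
  have "P \<mu> s" if "\<bar>\<mu>\<bar> < d / 2" "\<bar>s - 1\<bar> < d / 2" for \<mu> s
  proof -
    have "dist (\<mu>, s) (0, 1) \<le> \<bar>\<mu>\<bar> + \<bar>s - 1\<bar>"
      by (simp add: dist_Pair_Pair dist_real_def sqrt_sum_squares_le_sum_abs)
    then have "dist (\<mu>, s) (0, 1) < d" using that by simp
    then show ?thesis using d(2)[rule_format, of "(\<mu>, s)"] by simp
  qed
  then show thesis using that[of "d / 2"] d(1) by simp
qed

context corner_chart
begin

lemma one_scale: "0 < (1::real)" "1 * l \<le> l'" using l by simp_all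

lemma unit_coefficients: "x \<in> {0..l} \<Longrightarrow> G x = g x" "x \<in> {0..l} \<Longrightarrow> H x = h x"
  "continuous_on {0..l} G" "continuous_on {0..l} H"
  using scaled_coefficients[OF one_scale] scaled_continuous[OF one_scale] by simp_all

lemma sg_facts:
  "\<And>x. x \<in> {0..l} \<Longrightarrow> (sg has_real_derivative sg' x) (at x)"
  "\<And>x. x \<in> {0..l} \<Longrightarrow> (sg' has_real_derivative - G x * sg x) (at x)" "sg 0 = 0" "sg' 0 = 1"
  using fund_deriv(3,4) unit_coefficients(1) by simp_all

lemma sh_facts:
  "\<And>x. x \<in> {0..l} \<Longrightarrow> (sh has_real_derivative sh' x) (at x)"
  "\<And>x. x \<in> {0..l} \<Longrightarrow> (sh' has_real_derivative - H x * sh x) (at x)" "sh 0 = 0" "sh' 0 = 1"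
  using fund_deriv(7,8) unit_coefficients(2) by simp_all

lemma ker_N_form:
  assumes "U \<in> ker_op l (N_op l G H 1)"
  obtains k where "U = sol 0 1 k" "k $ 1 = 0" "k $ 2 = 0" "k $ 3 * sg l = 0" "k $ 4 * sh l = 0"
proof -
  have "U \<in> solution_space l G H 0 1" and z: "U 0 = 0" "U l = 0"
    using assms by (simp_all add: ker_op_def H2_H10_def solution_space_def)
  then obtain k where k: "U = sol 0 1 k" using solution_space_eq[OF one_scale] by auto
  have "fst (frame 0 1 k) = 0"
    using z l(1) by (simp add: k sol_def frame_apply frame_map_def vec4_eq_iff zero_prod_def)
  then show thesis using that k fst_frame_zero by simp
qed

lemma sol_span:
  assumes "k $ 1 = 0" "k $ 2 = 0"
  shows "sol 0 1 k = k $ 3 *\<^sub>R sol 0 1 ku + k $ 4 *\<^sub>R sol 0 1 kv"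
  using assms by (auto simp: fun_eq_iff sol_def scaleR_fun_def gu_def gv_def ku_def kv_def plus_fun_def zero_prod_def)

text \<open>
  The kernel of \<open>N\<close> consists of the \<open>sol 0 1 k\<close> with \<open>k\<close> supported in the coordinates for which \<open>sg\<close>, resp.
  \<open>sh\<close>, vanishes at \<open>l\<close>.
\<close>

lemma dim_ker_N:
  assumes "dim (ker_op l (N_op l G H 1)) = n" "n \<noteq> 0"
  shows "sg l = 0 \<or> sh l = 0" "n \<noteq> 1 \<Longrightarrow> sg l = 0 \<and> sh l = 0"
proof -
  show "sg l = 0 \<or> sh l = 0"
  proof (rule ccontr)
    assume n: "\<not> (sg l = 0 \<or> sh l = 0)"
    have "ker_op l (N_op l G H 1) \<subseteq> span {}"
    proof
      fix U assume "U \<in> ker_op l (N_op l G H 1)"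
      then obtain k where "U = sol 0 1 k" "k $ 1 = 0" "k $ 2 = 0" "k $ 3 * sg l = 0" "k $ 4 * sh l = 0"
        by (rule ker_N_form)
      then show "U \<in> span {}" using sol_span[of k] n by simp
    qed
    from real_vector.dim_le_card[OF this] assms show False by simp
  qed
  show "sg l = 0 \<and> sh l = 0" if "n \<noteq> 1"
  proof (rule ccontr)
    assume n: "\<not> (sg l = 0 \<and> sh l = 0)"
    \<comment> \<open>at most one of the two coordinates is free\<close>
    define k0 where "k0 = (if sg l = 0 then sol 0 1 ku else sol 0 1 kv)"
    have "ker_op l (N_op l G H 1) \<subseteq> span {k0}"
    proof
      fix U assume "U \<in> ker_op l (N_op l G H 1)"
      then obtain k where k: "U = sol 0 1 k" "k $ 1 = 0" "k $ 2 = 0" "k $ 3 * sg l = 0" "k $ 4 * sh l = 0"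
        by (rule ker_N_form)
      show "U \<in> span {k0}"
      proof (cases "sg l = 0")
        case True
        then have "k $ 4 = 0" using n k by simp
        then have "U = k $ 3 *\<^sub>R k0" using sol_span[of k] k True by (simp add: k0_def)
        then show ?thesis by (simp add: real_vector.span_base real_vector.span_scale)
      next
        case False
        then have "k $ 3 = 0" using k by simp
        then have "U = k $ 4 *\<^sub>R k0" using sol_span[of k] k False by (simp add: k0_def)
        then show ?thesis by (simp add: real_vector.span_base real_vector.span_scale)
      qed
    qed
    from real_vector.dim_le_card[OF this] assms that show False by simp
  qed
qed

text \<open>
  A crossing is an eigenvalue, and the eigenvalues near the corner lie on the given curves.
\<close>

lemma crossings_on_curves:
  assumes "\<forall>\<^sub>F (\<mu>, \<sigma>) in nhds (0, 1). \<sigma>\<^sup>2 * \<mu> \<in> Spec l (N_op l G H \<sigma>) \<longleftrightarrow> P \<mu> \<sigma>"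
  obtains \<eta> where "\<eta> > 0" "\<forall>\<mu> s. \<bar>\<mu>\<bar> < \<eta> \<longrightarrow> \<bar>s - 1\<bar> < \<eta> \<longrightarrow> \<not> no_crossing \<mu> s \<longrightarrow> P \<mu> s"
proof -
  obtain \<eta> where \<eta>: "\<eta> > 0"
    "\<forall>\<mu> s. \<bar>\<mu>\<bar> < \<eta> \<longrightarrow> \<bar>s - 1\<bar> < \<eta> \<longrightarrow> (s\<^sup>2 * \<mu> \<in> Spec l (N_op l G H s) \<longleftrightarrow> P \<mu> s)"
    by (rule eventually_nhds_corner[OF assms])
  have "P \<mu> s" if "\<bar>\<mu>\<bar> < min \<eta> \<delta>" "\<bar>s - 1\<bar> < min \<eta> \<delta>" "\<not> no_crossing \<mu> s" for \<mu> s
  proof -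
    have "(\<mu>, s) \<in> corner_box \<delta>" using that by (auto simp: corner_box_def abs_le_iff)
    from crossing_in_Spec[OF this that(3)] \<eta>(2)[rule_format, of \<mu> s] that show ?thesis by simp
  qed
  then show thesis using that[of "min \<eta> \<delta>"] \<eta>(1) \<delta>(1) by simp
qed

lemma inner_kernel_functions:
  assumes u: "\<forall>x\<in>{0..l}. u x = a * sg x" and v: "\<forall>x\<in>{0..l}. v x = b * sh x"
  shows "l2_inner l u v = a * b * I1 l"
  by (rule l2_inner_antiderivative[OF l(1), where k = "\<lambda>x. a * b * (sg x * sh x)" and F = "\<lambda>x. a * b * I1 x"])
     (use u v in \<open>auto intro!: continuous_intros DERIV_cmult integrals_deriv(1) simp: integrals_deriv(4)\<close>)

text \<open>
  The solution of \<open>- L\<^sub>- w = u\<close> is \<open>a\<close> times the first-order coefficient \<open>vn eu 1\<close> up to a multiple of the kernel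
  function \<open>sh\<close>, and this multiple is orthogonal to \<open>u\<close> because \<open>I1 l = 0\<close>.
\<close>

lemma corrector_v:
  assumes z: "I1 l = 0" and u: "\<forall>x\<in>{0..l}. u x = a * sg x"
    and w: "w \<in> H2_H10 l" "eq_ae l (\<lambda>x. - L_op l H 1 w x) u"
  shows "l2_inner l w u = a\<^sup>2 * A2 l"
proof -
  have cu: "continuous_on {0..l} (\<lambda>x. - u x)"
  proof -
    have "continuous_on {0..l} (\<lambda>x. - (a * sg x))" by (intro continuous_intros)
    then show ?thesis by (rule continuous_on_eq) (use u in simp)
  qed
  have "eq_ae l (L_op l H 1 w) (\<lambda>x. - u x)" by (rule eq_ae_mono[OF w(2)]) simp
  then have c: "classical l w (\<lambda>x. - H x * w x - (- u x))" "w 0 = 0"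
    using scalar_H2_iff[OF l(1) unit_coefficients(4) cu, of w] w(1) by simp_all
  have p: "((\<lambda>x. a * vn eu 1 x) has_real_derivative a * vn' eu 1 x) (at x)"
    "((\<lambda>x. a * vn' eu 1 x) has_real_derivative - H x * (a * vn eu 1 x) - (- u x)) (at x)" if "x \<in> {0..l}" for x
  proof -
    show "((\<lambda>x. a * vn eu 1 x) has_real_derivative a * vn' eu 1 x) (at x)"
      using un_deriv(3)[of eu 0 x] by (intro DERIV_cmult) simp
    show "((\<lambda>x. a * vn' eu 1 x) has_real_derivative - H x * (a * vn eu 1 x) - (- u x)) (at x)"
      by (rule DERIV_cong[OF DERIV_cmult[OF un_deriv(4)[of eu 0 x, folded One_nat_def]]])
         (use that u unit_coefficients(2) in \<open>simp add: u_zero algebra_simps\<close>)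
  qed
  have p0: "a * vn eu 1 0 = 0" using un_init(3)[of eu 0] by simp
  obtain \<kappa> where \<kappa>: "\<forall>x\<in>{0..l}. w x = a * vn eu 1 x + \<kappa> * sh x \<and> D1 l w x = a * vn' eu 1 x + \<kappa> * sh' x"
    by (rule dirichlet_solution_form[OF l(1) unit_coefficients(4) sh_facts p p0 c])
  have "l2_inner l w u = a\<^sup>2 * A2 l + \<kappa> * a * I1 l"
  proof (rule l2_inner_antiderivative[OF l(1), where k = "\<lambda>x. a\<^sup>2 * (sg x * vn eu 1 x) + \<kappa> * a * (sg x * sh x)"])
    show "\<forall>x\<in>{0..l}. w x * u x = a\<^sup>2 * (sg x * vn eu 1 x) + \<kappa> * a * (sg x * sh x)"
      using \<kappa> u by (simp add: algebra_simps power2_eq_square)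
    show "continuous_on {0..l} (\<lambda>x. a\<^sup>2 * (sg x * vn eu 1 x) + \<kappa> * a * (sg x * sh x))"
      by (intro continuous_intros continuous_at_imp_continuous_on[of _ "vn eu 1"] ballI un_isCont)
    show "((\<lambda>y. a\<^sup>2 * A2 y + \<kappa> * a * I1 y) has_real_derivative a\<^sup>2 * (sg x * vn eu 1 x) + \<kappa> * a * (sg x * sh x)) (at x)" for x
      by (intro DERIV_add DERIV_cmult integrals_deriv)
  qed (simp add: integrals_deriv)
  then show ?thesis using z by simp
qed

lemma corrector_u:
  assumes z: "I1 l = 0" and u: "\<forall>x\<in>{0..l}. u x = b * sh x"
    and w: "w \<in> H2_H10 l" "eq_ae l (L_op l G 1 w) u"
  shows "l2_inner l w u = b\<^sup>2 * B2 l"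
proof -
  have cu: "continuous_on {0..l} u"
  proof -
    have "continuous_on {0..l} (\<lambda>x. b * sh x)" by (intro continuous_intros)
    then show ?thesis by (rule continuous_on_eq) (use u in simp)
  qed
  have c: "classical l w (\<lambda>x. - G x * w x - u x)" "w 0 = 0"
    using scalar_H2_iff[OF l(1) unit_coefficients(3) cu, of w] w by simp_all
  have p: "((\<lambda>x. b * un ev 1 x) has_real_derivative b * un' ev 1 x) (at x)"
    "((\<lambda>x. b * un' ev 1 x) has_real_derivative - G x * (b * un ev 1 x) - u x) (at x)" if "x \<in> {0..l}" for x
  proof -
    show "((\<lambda>x. b * un ev 1 x) has_real_derivative b * un' ev 1 x) (at x)"
      using un_deriv(1)[of ev 0 x] by (intro DERIV_cmult) simp
    show "((\<lambda>x. b * un' ev 1 x) has_real_derivative - G x * (b * un ev 1 x) - u x) (at x)"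
      by (rule DERIV_cong[OF DERIV_cmult[OF un_deriv(2)[of ev 0 x, folded One_nat_def]]])
         (use that u unit_coefficients(1) in \<open>simp add: u_zero algebra_simps\<close>)
  qed
  have p0: "b * un ev 1 0 = 0" using un_init(1)[of ev 0] by simp
  obtain \<kappa> where \<kappa>: "\<forall>x\<in>{0..l}. w x = b * un ev 1 x + \<kappa> * sg x \<and> D1 l w x = b * un' ev 1 x + \<kappa> * sg' x"
    by (rule dirichlet_solution_form[OF l(1) unit_coefficients(3) sg_facts p p0 c])
  have "l2_inner l w u = b\<^sup>2 * B2 l + \<kappa> * b * I1 l"
  proof (rule l2_inner_antiderivative[OF l(1), where k = "\<lambda>x. b\<^sup>2 * (sh x * un ev 1 x) + \<kappa> * b * (sg x * sh x)"])
    show "\<forall>x\<in>{0..l}. w x * u x = b\<^sup>2 * (sh x * un ev 1 x) + \<kappa> * b * (sg x * sh x)"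
      using \<kappa> u by (simp add: algebra_simps power2_eq_square)
    show "continuous_on {0..l} (\<lambda>x. b\<^sup>2 * (sh x * un ev 1 x) + \<kappa> * b * (sg x * sh x))"
      by (intro continuous_intros continuous_at_imp_continuous_on[of _ "un ev 1"] ballI un_isCont)
    show "((\<lambda>y. b\<^sup>2 * B2 y + \<kappa> * b * I1 y) has_real_derivative b\<^sup>2 * (sh x * un ev 1 x) + \<kappa> * b * (sg x * sh x)) (at x)" for x
      by (intro DERIV_add DERIV_cmult integrals_deriv)
  qed (simp add: integrals_deriv)
  then show ?thesis using z by simp
qed

lemma corner_formula_simple:
  assumes dim: "dim (ker_op l (N_op l G H 1)) = 1" and curve: "eigenvalue_curve l G H s"
  shows "0 \<notin> Spec l (L_op l H 1) \<Longrightarrow>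
      s_sharp s = 1 \<and> (\<forall>\<^sub>F \<epsilon> in at_right 0. corner_index l G H \<epsilon> = 0) \<or>
      s_sharp s = - 1 \<and> (\<forall>\<^sub>F \<epsilon> in at_right 0. corner_index l G H \<epsilon> = - 1)"
    "0 \<notin> Spec l (L_op l G 1) \<Longrightarrow>
      s_sharp s = 1 \<and> (\<forall>\<^sub>F \<epsilon> in at_right 0. corner_index l G H \<epsilon> = 0) \<or>
      s_sharp s = - 1 \<and> (\<forall>\<^sub>F \<epsilon> in at_right 0. corner_index l G H \<epsilon> = 1)"
proof -
  have germ: "curve_germ s"
    and ev: "\<forall>\<^sub>F (\<mu>, \<sigma>) in nhds (0, 1). \<sigma>\<^sup>2 * \<mu> \<in> Spec l (N_op l G H \<sigma>) \<longleftrightarrow> \<sigma> = s \<mu>"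
    using curve by (simp_all add: eigenvalue_curve_def)
  obtain \<eta> where \<eta>: "\<eta> > 0" "\<forall>\<mu> \<sigma>. \<bar>\<mu>\<bar> < \<eta> \<longrightarrow> \<bar>\<sigma> - 1\<bar> < \<eta> \<longrightarrow> \<not> no_crossing \<mu> \<sigma> \<longrightarrow> \<sigma> = s \<mu>"
    by (rule crossings_on_curves[OF ev])
  have or: "sg l = 0 \<or> sh l = 0" using dim_ker_N(1)[OF dim] by simp
  {
    assume S: "0 \<notin> Spec l (L_op l H 1)"
    have sh: "sh l \<noteq> 0" by (rule not_in_Spec_dirichlet[OF l(1) unit_coefficients(4) sh_facts S])
    with or have "sg l = 0" by simp
    from corner_index_simple_u[OF this sh germ \<eta>]
    show "s_sharp s = 1 \<and> (\<forall>\<^sub>F \<epsilon> in at_right 0. corner_index l G H \<epsilon> = 0) \<or>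
      s_sharp s = - 1 \<and> (\<forall>\<^sub>F \<epsilon> in at_right 0. corner_index l G H \<epsilon> = - 1)" .
  next
    assume S: "0 \<notin> Spec l (L_op l G 1)"
    have sg: "sg l \<noteq> 0" by (rule not_in_Spec_dirichlet[OF l(1) unit_coefficients(3) sg_facts S])
    with or have "sh l = 0" by simp
    from corner_index_simple_v[OF sg this germ \<eta>]
    show "s_sharp s = 1 \<and> (\<forall>\<^sub>F \<epsilon> in at_right 0. corner_index l G H \<epsilon> = 0) \<or>
      s_sharp s = - 1 \<and> (\<forall>\<^sub>F \<epsilon> in at_right 0. corner_index l G H \<epsilon> = 1)" .
  }
qed

lemma corner_formula_double:
  assumes dim: "dim (ker_op l (N_op l G H 1)) = 2"
    and ker: "ker_op l (L_op l G 1) = span {u1}" "ker_op l (L_op l H 1) = span {v2}"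
  shows "l2_inner l u1 v2 \<noteq> 0 \<Longrightarrow> \<forall>\<^sub>F \<epsilon> in at_right 0. corner_index l G H \<epsilon> = 0"
    "l2_inner l u1 v2 = 0 \<Longrightarrow> hu2 \<in> H2_H10 l \<Longrightarrow> eq_ae l (L_op l G 1 hu2) v2 \<Longrightarrow>
      hv1 \<in> H2_H10 l \<Longrightarrow> eq_ae l (\<lambda>x. - L_op l H 1 hv1 x) u1 \<Longrightarrow>
      l2_inner l hv1 u1 / (D1 l u1 l)\<^sup>2 + l2_inner l hu2 v2 / (D1 l v2 l)\<^sup>2 \<noteq> 0 \<Longrightarrow>
      eigenvalue_curve_pair l G H u1 v2 hu2 hv1 s1 s2 \<Longrightarrow>
      \<forall>\<^sub>F \<epsilon> in at_right 0. real_of_int (corner_index l G H \<epsilon>) = 1 / 2 * (s_sharp s1 - s_sharp s2)"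
proof -
  have z: "sg l = 0" "sh l = 0" using dim_ker_N(2)[OF dim] by simp_all
  obtain a where a: "a \<noteq> 0" "\<forall>x\<in>{0..l}. u1 x = a * sg x" "D1 l u1 l = a * sg' l"
    by (rule spanning_kernel_function[OF l(1) unit_coefficients(3) sg_facts z(1) ker(1)])
  obtain b where b: "b \<noteq> 0" "\<forall>x\<in>{0..l}. v2 x = b * sh x" "D1 l v2 l = b * sh' l"
    by (rule spanning_kernel_function[OF l(1) unit_coefficients(4) sh_facts z(2) ker(2)])
  have I: "l2_inner l u1 v2 = a * b * I1 l" by (rule inner_kernel_functions[OF a(2) b(2)])
  show "\<forall>\<^sub>F \<epsilon> in at_right 0. corner_index l G H \<epsilon> = 0" if "l2_inner l u1 v2 \<noteq> 0"
    using corner_index_coupled[OF z] that I by simp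
  show "\<forall>\<^sub>F \<epsilon> in at_right 0. real_of_int (corner_index l G H \<epsilon>) = 1 / 2 * (s_sharp s1 - s_sharp s2)"
    if orth: "l2_inner l u1 v2 = 0" and hu2: "hu2 \<in> H2_H10 l" "eq_ae l (L_op l G 1 hu2) v2"
      and hv1: "hv1 \<in> H2_H10 l" "eq_ae l (\<lambda>x. - L_op l H 1 hv1 x) u1"
      and nd: "l2_inner l hv1 u1 / (D1 l u1 l)\<^sup>2 + l2_inner l hu2 v2 / (D1 l v2 l)\<^sup>2 \<noteq> 0"
      and pair: "eigenvalue_curve_pair l G H u1 v2 hu2 hv1 s1 s2"
  proof -
    have I0: "I1 l = 0" using orth I a(1) b(1) by simp
    note slopes = end_slopes(1)[OF z(1)] end_slopes(2)[OF z(2)]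
    define \<alpha> \<gamma> where "\<alpha> = A2 l / (sg' l)\<^sup>2" and "\<gamma> = B2 l / (sh' l)\<^sup>2"
    have q1: "l2_inner l hv1 u1 / (D1 l u1 l)\<^sup>2 = \<alpha>"
      using corrector_v[OF I0 a(2) hv1] a(1,3) by (simp add: \<alpha>_def power_mult_distrib)
    have q2: "l2_inner l hu2 v2 / (D1 l v2 l)\<^sup>2 = \<gamma>"
      using corrector_u[OF I0 b(2) hu2] b(1,3) by (simp add: \<gamma>_def power_mult_distrib)
    have A: "A2 l = - (- \<alpha> / l) * (l * (sg' l)\<^sup>2)" and B: "B2 l = \<gamma> / l * (l * (sh' l)\<^sup>2)"
      using slopes l(1) by (simp_all add: \<alpha>_def \<gamma>_def)
    have ne: "- \<alpha> / l \<noteq> \<gamma> / l" using nd l(1) unfolding q1 q2 by (simp add: field_simps)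
    have germs: "curve_germ s1" "curve_germ s2"
      and d: "deriv (deriv s1) 0 = 2 * (- \<alpha> / l)" "deriv (deriv s2) 0 = 2 * (\<gamma> / l)"
      and ev: "\<forall>\<^sub>F (\<mu>, \<sigma>) in nhds (0, 1). \<sigma>\<^sup>2 * \<mu> \<in> Spec l (N_op l G H \<sigma>) \<longleftrightarrow> \<sigma> = s1 \<mu> \<or> \<sigma> = s2 \<mu>"
      using pair unfolding eigenvalue_curve_pair_def q1 q2 by simp_all
    obtain \<eta> where \<eta>: "\<eta> > 0"
      "\<forall>\<mu> \<sigma>. \<bar>\<mu>\<bar> < \<eta> \<longrightarrow> \<bar>\<sigma> - 1\<bar> < \<eta> \<longrightarrow> \<not> no_crossing \<mu> \<sigma> \<longrightarrow> \<sigma> = s1 \<mu> \<or> \<sigma> = s2 \<mu>"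
      by (rule crossings_on_curves[OF ev])
    show ?thesis by (rule corner_index_decoupled[OF z I0 A B ne germs d \<eta>])
  qed
qed

end

section \<open>The formula for the corner index\<close>

lemma C2_on_imp_continuous_on: "C2_on f S \<Longrightarrow> continuous_on S f"
  unfolding C2_on_def by (blast intro: DERIV_continuous_on)

text \<open>
  Clamping to \<open>[0, b]\<close> extends the coefficients continuously to the whole line.
\<close>

lemma continuous_clamp:
  fixes f :: "real \<Rightarrow> real"
  assumes "0 \<le> b" "continuous_on {0..b} f"
  shows "continuous_on UNIV (\<lambda>y. f (max 0 (min b y)))"
  by (rule continuous_on_compose2[OF assms(2)]) (use assms(1) in \<open>auto intro!: continuous_intros\<close>)

theorem theorem4p14:
  fixes l l' :: real and g h :: "real \<Rightarrow> real"
  assumes "0 < l" and "l < l'"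
    and "C2_on g {0..l'}" and "C2_on h {0..l'}"
  shows
    "(dim (ker_op l (N_op l g h 1)) = 1 \<longrightarrow>
       (\<forall>s. eigenvalue_curve l g h s \<longrightarrow>
         (0 \<in> Spec l (L_op l g 1) - Spec l (L_op l h 1) \<longrightarrow>
           (\<forall>\<^sub>F \<epsilon> in at_right 0.
              real_of_int (corner_index l g h \<epsilon>) = 1 / 2 * (s_sharp s - 1) \<and>
              (s_sharp s = 1 \<longrightarrow> corner_index l g h \<epsilon> = 0) \<and>
              (s_sharp s = -1 \<longrightarrow> corner_index l g h \<epsilon> = -1))) \<and>
         (0 \<in> Spec l (L_op l h 1) - Spec l (L_op l g 1) \<longrightarrow>
           (\<forall>\<^sub>F \<epsilon> in at_right 0.
              real_of_int (corner_index l g h \<epsilon>) = 1 / 2 * (1 - s_sharp s) \<and>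
              (s_sharp s = 1 \<longrightarrow> corner_index l g h \<epsilon> = 0) \<and>
              (s_sharp s = -1 \<longrightarrow> corner_index l g h \<epsilon> = 1))))) \<and>
     (\<forall>u1 v2.
       dim (ker_op l (N_op l g h 1)) = 2 \<and>
       ker_op l (L_op l g 1) = span {u1} \<and> ker_op l (L_op l h 1) = span {v2} \<longrightarrow>
         (l2_inner l u1 v2 \<noteq> 0 \<longrightarrow> (\<forall>\<^sub>F \<epsilon> in at_right 0. corner_index l g h \<epsilon> = 0)) \<and>
         (\<forall>hu2 hv1 s1 s2.
           l2_inner l u1 v2 = 0 \<and>
           hu2 \<in> H2_H10 l \<and> eq_ae l (L_op l g 1 hu2) v2 \<and>
           hv1 \<in> H2_H10 l \<and> eq_ae l (\<lambda>x. - L_op l h 1 hv1 x) u1 \<and>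
           l2_inner l hv1 u1 / (D1 l u1 l)\<^sup>2 + l2_inner l hu2 v2 / (D1 l v2 l)\<^sup>2 \<noteq> 0 \<and>
           eigenvalue_curve_pair l g h u1 v2 hu2 hv1 s1 s2 \<longrightarrow>
             (\<forall>\<^sub>F \<epsilon> in at_right 0.
                real_of_int (corner_index l g h \<epsilon>) = 1 / 2 * (s_sharp s1 - s_sharp s2))))"
proof -
  have l': "0 \<le> l'" using assms(1,2) by simp
  define g0 h0 where "g0 = (\<lambda>y. g (max 0 (min l' y)))" and "h0 = (\<lambda>y. h (max 0 (min l' y)))"
  interpret corner g0 h0 l l' g h
  proof
    show "continuous_on UNIV g0" "continuous_on UNIV h0"
      unfolding g0_def h0_def by (intro continuous_clamp[OF l'] C2_on_imp_continuous_on assms)+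
  qed (use assms in \<open>auto simp: g0_def h0_def\<close>)
  obtain \<beta> \<delta> A where ch: "0 < \<delta>" "\<delta> < 1" "(1 + \<delta>) * l \<le> l'" "continuous_on (corner_box \<delta>) A"
    "\<forall>p\<in>corner_box \<delta>. symmetric_op (A p) \<and> range (frame (fst p) (snd p)) = sym_graph \<beta> (A p)"
    by (rule chart_exists)
  interpret corner_chart g0 h0 l l' g h \<beta> \<delta> A
    by unfold_locales (use ch in simp_all)
  have simple: "\<forall>\<^sub>F \<epsilon> in at_right 0. real_of_int (corner_index l g h \<epsilon>) = 1 / 2 * (s_sharp s - 1) \<and>
      (s_sharp s = 1 \<longrightarrow> corner_index l g h \<epsilon> = 0) \<and> (s_sharp s = -1 \<longrightarrow> corner_index l g h \<epsilon> = -1)"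
    if "dim (ker_op l (N_op l g h 1)) = 1" "eigenvalue_curve l g h s" "0 \<notin> Spec l (L_op l h 1)" for s
    using corner_formula_simple(1)[OF that]
  proof (elim disjE conjE)
    assume s: "s_sharp s = 1" and "\<forall>\<^sub>F \<epsilon> in at_right 0. corner_index l g h \<epsilon> = 0"
    from this(2) show ?thesis by (rule eventually_mono) (simp add: s)
  next
    assume s: "s_sharp s = - 1" and "\<forall>\<^sub>F \<epsilon> in at_right 0. corner_index l g h \<epsilon> = - 1"
    from this(2) show ?thesis by (rule eventually_mono) (simp add: s)
  qed
  have simple': "\<forall>\<^sub>F \<epsilon> in at_right 0. real_of_int (corner_index l g h \<epsilon>) = 1 / 2 * (1 - s_sharp s) \<and>
      (s_sharp s = 1 \<longrightarrow> corner_index l g h \<epsilon> = 0) \<and> (s_sharp s = -1 \<longrightarrow> corner_index l g h \<epsilon> = 1)"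
    if "dim (ker_op l (N_op l g h 1)) = 1" "eigenvalue_curve l g h s" "0 \<notin> Spec l (L_op l g 1)" for s
    using corner_formula_simple(2)[OF that]
  proof (elim disjE conjE)
    assume s: "s_sharp s = 1" and "\<forall>\<^sub>F \<epsilon> in at_right 0. corner_index l g h \<epsilon> = 0"
    from this(2) show ?thesis by (rule eventually_mono) (simp add: s)
  next
    assume s: "s_sharp s = - 1" and "\<forall>\<^sub>F \<epsilon> in at_right 0. corner_index l g h \<epsilon> = 1"
    from this(2) show ?thesis by (rule eventually_mono) (simp add: s)
  qed
  show ?thesis
    apply (intro conjI allI impI)
    subgoal by (rule simple) simp_all
    subgoal by (rule simple') simp_all
    subgoal for u1 v2 by (elim conjE) (rule corner_formula_double(1))
    subgoal for u1 v2 hu2 hv1 s1 s2 by (elim conjE) (rule corner_formula_double(2))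
    done
qed

end
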